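(* Let $\Omega\subset\mathbb{R}^n$ be bounded and open, $m\le n$. Assume $H:\overline\Omega\times\mathbb{R}\times\mathbb{R}^m\to[0,+\infty)$ is continuous, nondecreasing in the second entry, and for all $R>0$ there is $L_R$ such that $$|H^{1/m}(x,r,q+q_1)-H^{1/m}(x,r,q)|\le L_R|q_1|\qquad\forall\,x\in\overline\Omega,\ |r|\le R,\ |q|\le R,\ |q_1|\le 1 .$$ Suppose the vector fields $X_1,\dots,X_m$ in $\mathbb{R}^n$ are of class $C^2$ and have the form $$X_j(x)=\frac{\partial}{\partial x_j}+\sum_{i=m+1}^n\tau_{ij}(x)\frac{\partial}{\partial x_i},\qquad j=1,\dots,m .$$ Let $u:\overline\Omega\to\mathbb{R}$ be a bounded, $\mathcal X$-convex, upper semicontinuous subsolution of $$-\det D^2_{\mathcal X}u+H(x,u,D_{\mathcal X}u)=0\quad\text{in }\Omega$$ and let $v:\overline\Omega\to\mathbb{R}$ be a bounded lower semicontinuous supersolution of the same equation. Then $$\sup_\Omega(u-v)\le\max_{\partial\Omega}(u-v)^+ .$$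
   Context: For vector fields $\mathcal X=\{X_1,\dots,X_m\}$ and smooth $u$: $D_{\mathcal X}u=(X_1u,\dots,X_mu)$ and $(D^2_{\mathcal X}u)_{ij}=\tfrac12(X_iX_ju+X_jX_iu)$. Matrix inequalities are in the usual order of symmetric matrices; $M>0$ means positive definite; $s^+=\max\{s,0\}$. An upper semicontinuous $u$ on $\overline\Omega$ is $\mathcal X$-convex if $D^2_{\mathcal X}\varphi(x)\ge0$ for all $\varphi\in C^2(\Omega)$ and all $x\in\Omega$ at which $u-\varphi$ attains its maximum. Subsolution (viscosity): $u\in USC(\overline\Omega)$ such that for every $\varphi\in C^2(\overline\Omega)$ and every maximum point $x_0\in\Omega$ of $u-\varphi$, $-\det D^2_{\mathcal X}\varphi(x_0)+H(x_0,u(x_0),D_{\mathcal X}\varphi(x_0))\le0$. Supersolution (viscosity, with restricted test functions): $v\in LSC(\overline\Omega)$ such that for every $\varphi\in C^2(\overline\Omega)$ and every minimum point $x_0\in\Omega$ of $v-\varphi$ with $D^2_{\mathcal X}\varphi(x_0)>0$, $-\det D^2_{\mathcal X}\varphi(x_0)+H(x_0,v(x_0),D_{\mathcal X}\varphi(x_0))\ge0$. *)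

theory Defs
  imports "HOL-Analysis.Analysis"
begin

text \<open>\<open>C2_on S\<close> is meant for open \<open>S\<close>.  \<open>C2_closure S\<close> is the class usually written
  $C^2(\overline{S})$ for open \<open>S\<close>: the function is of class $C^2$ on \<open>S\<close>, and the function and
  its derivatives of order one and two extend continuously to the closure of \<open>S\<close> (the values of
  \<open>f\<close> itself on the frontier being those of the extension).\<close>

definition C2_on :: "'a::real_normed_vector set \<Rightarrow> ('a \<Rightarrow> 'b::real_normed_vector) \<Rightarrow> bool" where
  "C2_on S f \<longleftrightarrow>
    (\<exists>(f' :: 'a \<Rightarrow> 'a \<Rightarrow>\<^sub>L 'b) (f'' :: 'a \<Rightarrow> 'a \<Rightarrow>\<^sub>L ('a \<Rightarrow>\<^sub>L 'b)).
      (\<forall>x\<in>S. (f has_derivative blinfun_apply (f' x)) (at x) \<and>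
             (f' has_derivative blinfun_apply (f'' x)) (at x)) \<and>
      continuous_on S f'')"

definition C2_closure :: "'a::real_normed_vector set \<Rightarrow> ('a \<Rightarrow> 'b::real_normed_vector) \<Rightarrow> bool" where
  "C2_closure S f \<longleftrightarrow>
    (\<exists>(f' :: 'a \<Rightarrow> 'a \<Rightarrow>\<^sub>L 'b) (f'' :: 'a \<Rightarrow> 'a \<Rightarrow>\<^sub>L ('a \<Rightarrow>\<^sub>L 'b)).
      (\<forall>x\<in>S. (f has_derivative blinfun_apply (f' x)) (at x) \<and>
             (f' has_derivative blinfun_apply (f'' x)) (at x)) \<and>
      continuous_on (closure S) f \<and> continuous_on (closure S) f' \<and>
      continuous_on (closure S) f'')"

definition usc_on :: "'a::topological_space set \<Rightarrow> ('a \<Rightarrow> real) \<Rightarrow> bool" where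
  "usc_on S f \<longleftrightarrow> (\<forall>x\<in>S. \<forall>a. f x < a \<longrightarrow> (\<forall>\<^sub>F y in at x within S. f y < a))"

definition lsc_on :: "'a::topological_space set \<Rightarrow> ('a \<Rightarrow> real) \<Rightarrow> bool" where
  "lsc_on S f \<longleftrightarrow> (\<forall>x\<in>S. \<forall>a. a < f x \<longrightarrow> (\<forall>\<^sub>F y in at x within S. a < f y))"

definition pos_semidef :: "real ^ 'm ^ 'm \<Rightarrow> bool" where
  "pos_semidef A \<longleftrightarrow> transpose A = A \<and> (\<forall>\<xi>. 0 \<le> \<xi> \<bullet> (A *v \<xi>))"

definition pos_def :: "real ^ 'm ^ 'm \<Rightarrow> bool" where
  "pos_def A \<longleftrightarrow> transpose A = A \<and> (\<forall>\<xi>. \<xi> \<noteq> 0 \<longrightarrow> 0 < \<xi> \<bullet> (A *v \<xi>))"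

text \<open>A vector field acts on functions as a first-order differential operator.\<close>

definition vf_deriv :: "('a \<Rightarrow> 'a) \<Rightarrow> ('a::real_normed_vector \<Rightarrow> real) \<Rightarrow> 'a \<Rightarrow> real" where
  "vf_deriv Y f = (\<lambda>x. frechet_derivative f (at x) (Y x))"

definition D_vf :: "('m::finite \<Rightarrow> 'a \<Rightarrow> 'a) \<Rightarrow> ('a::real_normed_vector \<Rightarrow> real) \<Rightarrow> 'a \<Rightarrow> real ^ 'm" where
  "D_vf X f x = (\<chi> j. vf_deriv (X j) f x)"

definition D2_vf :: "('m::finite \<Rightarrow> 'a \<Rightarrow> 'a) \<Rightarrow> ('a::real_normed_vector \<Rightarrow> real) \<Rightarrow> 'a \<Rightarrow> real ^ 'm ^ 'm" where
  "D2_vf X f x =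
    (\<chi> i j. (1/2) * (vf_deriv (X i) (vf_deriv (X j) f) x + vf_deriv (X j) (vf_deriv (X i) f) x))"

text \<open>The test functions in \<open>vf_convex\<close> are only defined on \<open>\<Omega>\<close>, so there the maximum is taken
  over \<open>\<Omega>\<close>; in the other two definitions the extrema are over the closure of \<open>\<Omega>\<close>, and attained
  at a point of \<open>\<Omega>\<close>.\<close>

definition vf_convex ::
  "('m::finite \<Rightarrow> 'a \<Rightarrow> 'a) \<Rightarrow> 'a::real_normed_vector set \<Rightarrow> ('a \<Rightarrow> real) \<Rightarrow> bool" where
  "vf_convex X \<Omega> u \<longleftrightarrow>
    usc_on (closure \<Omega>) u \<and>
    (\<forall>\<phi> x. C2_on \<Omega> \<phi> \<longrightarrow> x \<in> \<Omega> \<longrightarrow> is_arg_max (\<lambda>y. u y - \<phi> y) (\<lambda>y. y \<in> \<Omega>) x \<longrightarrow>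
      pos_semidef (D2_vf X \<phi> x))"

definition subsolution ::
  "('m::finite \<Rightarrow> 'a \<Rightarrow> 'a) \<Rightarrow> 'a::real_normed_vector set \<Rightarrow> ('a \<Rightarrow> real \<Rightarrow> real ^ 'm \<Rightarrow> real)
    \<Rightarrow> ('a \<Rightarrow> real) \<Rightarrow> bool" where
  "subsolution X \<Omega> H u \<longleftrightarrow>
    usc_on (closure \<Omega>) u \<and>
    (\<forall>\<phi> x. C2_closure \<Omega> \<phi> \<longrightarrow> x \<in> \<Omega> \<longrightarrow>
      is_arg_max (\<lambda>y. u y - \<phi> y) (\<lambda>y. y \<in> closure \<Omega>) x \<longrightarrow>
      - det (D2_vf X \<phi> x) + H x (u x) (D_vf X \<phi> x) \<le> 0)"

definition supersolution ::
  "('m::finite \<Rightarrow> 'a \<Rightarrow> 'a) \<Rightarrow> 'a::real_normed_vector set \<Rightarrow> ('a \<Rightarrow> real \<Rightarrow> real ^ 'm \<Rightarrow> real)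
    \<Rightarrow> ('a \<Rightarrow> real) \<Rightarrow> bool" where
  "supersolution X \<Omega> H v \<longleftrightarrow>
    lsc_on (closure \<Omega>) v \<and>
    (\<forall>\<phi> x. C2_closure \<Omega> \<phi> \<longrightarrow> x \<in> \<Omega> \<longrightarrow>
      is_arg_min (\<lambda>y. v y - \<phi> y) (\<lambda>y. y \<in> closure \<Omega>) x \<longrightarrow>
      pos_def (D2_vf X \<phi> x) \<longrightarrow>
      - det (D2_vf X \<phi> x) + H x (v x) (D_vf X \<phi> x) \<ge> 0)"

text \<open>The coordinates of the ambient space are indexed by \<open>'n\<close> and the vector fields by \<open>'m\<close>.
  An injection \<open>\<iota>\<close> says which coordinate direction belongs to which vector field, so
  \<open>range \<iota>\<close> plays the role of $\{1,\dots,m\}$, \<open>- range \<iota>\<close> that of $\{m+1,\dots,n\}$,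
  and injectivity of \<open>\<iota>\<close> forces $m \le n$ (with $m = n$ allowed).\<close>

definition vf_form ::
  "('m::finite \<Rightarrow> 'n::finite) \<Rightarrow> ('n \<Rightarrow> 'm \<Rightarrow> real ^ 'n \<Rightarrow> real) \<Rightarrow> 'm \<Rightarrow> real ^ 'n \<Rightarrow> real ^ 'n" where
  "vf_form \<iota> \<tau> j x = axis (\<iota> j) 1 + (\<Sum>i\<in>- range \<iota>. \<tau> i j x *\<^sub>R axis i 1)"

end

theory Submission
  imports Defs
begin

text \<open>Suppose that \<open>u - v\<close> exceeds its positive frontier maximum somewhere.  Convexity bounds the
  horizontal gradient of \<open>u\<close> in the interior, by a barrier along the integral curves of the fields.
  Adding a small multiple of \<open>exp (\<mu> |x'|\<^sup>2 / 2)\<close>, where \<open>x'\<close> are the coordinates in \<open>range \<iota>\<close>, makes the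
  subsolution strict and uniformly convex along the fields, because these are the unit vectors plus
  terms in the other directions; the Lipschitz bound on the root of \<open>H\<close> absorbs the change of
  gradient.  The variables are then doubled.

  The special form of the equation replaces the theorem on sums.  The root of the determinant is
  concave: up to the dimension factor it is the infimum of the traces of \<open>C\<^sup>T S C\<close> over
  \<open>|det C| = 1\<close>.  So the subsolution property is a family of linear inequalities for the jets.
  By coupling the two variables through a linear map that carries the fields at \<open>y\<close> to the fields at
  a fixed point, they become inequalities with constant coefficients for the sup-convolution of \<open>u\<close>,
  and such inequalities survive mollification.  The mollified function is smooth, so it can serve as
  a test function for \<open>v\<close>.\<close>

section \<open>Quadratic forms and second-order jets\<close>

text \<open>Two obstacles shape the argument. The Lipschitz constant and the modulus of continuity
  of the root of \<open>H\<close> are available only for bounded gradients, while the penalty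
  gradient \<open>(\<kappa> / 2) *\<^sub>R (yh - zh)\<close> is not controlled as \<kappa> grows;
  the gradient bound supplies one radius before \<kappa> is chosen. And doubling makes only \<kappa>
  |yh - zh|^2 small, so errors from variable fields must be quadratic in the distance, or linear
  with \<kappa> |yh - zh| as a factor; the linear coupling achieves this. The matrix
  \<open>C\<close> that realises the infimum is read off from the Hessian seen by \<open>v\<close>,
  hence known only after the mollified function is fixed. The transferred inequalities are therefore
  quantified over the directions last, and uniform convexity bounds the columns of \<open>C\<close>,
  which multiply the errors. Why mollification preserves the inequalities: a function whose jets are
  bounded below rises under heat flow, the flow commutes with mollification, and the rise of the
  mollified function in a short time measures its Hessian.\<close>

text \<open>Hessians are kept as functions rather than matrices, since they are pulled back along
  linear maps and evaluated at vectors. Different \<open>A\<close> may represent the same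
  \<open>G\<close>.\<close>

definition quad_form :: "('a::euclidean_space \<Rightarrow> real) \<Rightarrow> bool" where
  "quad_form G \<longleftrightarrow> (\<exists>A. linear A \<and> G = (\<lambda>h. h \<bullet> A h))"

text \<open>Membership in the second-order superjet relative to \<open>S\<close>, with the o(|h|^2)
  error spelled out.\<close>

definition upper_jet ::
  "'a::euclidean_space set \<Rightarrow> ('a \<Rightarrow> real) \<Rightarrow> 'a \<Rightarrow> 'a \<Rightarrow> ('a \<Rightarrow> real) \<Rightarrow> bool" where
  "upper_jet S f x p G \<longleftrightarrow>
    (\<forall>e>0. \<forall>\<^sub>F y in at x within S. f y \<le> f x + p \<bullet> (y - x) + G (y - x) / 2 + e * (norm (y - x))\<^sup>2)"

lemma quad_form_scale: "quad_form G \<Longrightarrow> G (c *\<^sub>R h) = c\<^sup>2 * G h"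
  unfolding quad_form_def by (auto simp: linear_cmul power2_eq_square)

lemma quad_form_0 [simp]: "quad_form G \<Longrightarrow> G 0 = 0"
  unfolding quad_form_def by auto

lemma quad_form_minus: "quad_form G \<Longrightarrow> G (- h) = G h"
  using quad_form_scale[of G "-1" h] by simp

lemma quad_form_add:
  assumes "quad_form G" "quad_form G'" shows "quad_form (\<lambda>h. G h + G' h)"
proof -
  from assms obtain A B where "linear A" "G = (\<lambda>h. h \<bullet> A h)" "linear B" "G' = (\<lambda>h. h \<bullet> B h)"
    unfolding quad_form_def by auto
  then show ?thesis unfolding quad_form_def
    by (intro exI[of _ "\<lambda>h. A h + B h"]) (auto simp: inner_add_right linear_compose_add)
qed

lemma quad_form_cmult:
  assumes "quad_form G" shows "quad_form (\<lambda>h. c * G h)"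
proof -
  from assms obtain A where "linear A" "G = (\<lambda>h. h \<bullet> A h)"
    unfolding quad_form_def by auto
  then show ?thesis unfolding quad_form_def
    by (intro exI[of _ "\<lambda>h. c *\<^sub>R A h"]) (auto simp: linear_compose_scale_right)
qed

lemma quad_form_uminus: "quad_form G \<Longrightarrow> quad_form (\<lambda>h. - G h)"
  using quad_form_cmult[of G "-1"] by simp

lemma quad_form_diff: "quad_form G \<Longrightarrow> quad_form G' \<Longrightarrow> quad_form (\<lambda>h. G h - G' h)"
  using quad_form_add[of G "\<lambda>h. - G' h"] quad_form_uminus[of G'] by simp

lemma quad_form_zero: "quad_form (\<lambda>h. 0)"
  unfolding quad_form_def by (intro exI[of _ "\<lambda>h. 0"]) (auto simp: linear_zero)

lemma quad_form_norm: "quad_form (\<lambda>h. (norm h)\<^sup>2)"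
  unfolding quad_form_def
  by (intro exI[of _ "\<lambda>h. h"]) (auto simp: power2_norm_eq_inner linear_id[unfolded id_def])

lemma quad_form_compose:
  fixes G :: "'b::euclidean_space \<Rightarrow> real" and T :: "'a::euclidean_space \<Rightarrow> 'b"
  assumes "quad_form G" "linear T" shows "quad_form (\<lambda>h. G (T h))"
proof -
  from assms obtain A where A: "linear A" "G = (\<lambda>h. h \<bullet> A h)"
    unfolding quad_form_def by auto
  have "linear (\<lambda>h. adjoint T (A (T h)))"
    using linear_compose[OF linear_compose[OF assms(2) A(1)] adjoint_linear[OF assms(2)]]
    by (simp add: o_def)
  then show ?thesis unfolding quad_form_def A(2) using assms(2)
    by (intro exI[of _ "\<lambda>h. adjoint T (A (T h))"]) (auto simp: adjoint_clauses)
qed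

lemma quad_form_norm_compose:
  "linear (T :: 'a::euclidean_space \<Rightarrow> 'b::euclidean_space) \<Longrightarrow> quad_form (\<lambda>h. (norm (T h))\<^sup>2)"
  using quad_form_compose[OF quad_form_norm] .

lemma quad_form_inner_square: "quad_form (\<lambda>h. (a \<bullet> h)\<^sup>2)"
proof -
  have "linear (\<lambda>h. (a \<bullet> h) *\<^sub>R a)"
    by (rule linearI) (auto simp: inner_add_right scaleR_add_left)
  then show ?thesis unfolding quad_form_def
    by (intro exI[of _ "\<lambda>h. (a \<bullet> h) *\<^sub>R a"]) (auto simp: power2_eq_square inner_commute)
qed

lemma quad_form_bound:
  assumes "quad_form G" obtains K where "K > 0" "\<And>h. \<bar>G h\<bar> \<le> K * (norm h)\<^sup>2"
proof -
  from assms obtain A where A: "linear A" "G = (\<lambda>h. h \<bullet> A h)"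
    unfolding quad_form_def by auto
  obtain K where K: "K > 0" "\<And>h. norm (A h) \<le> K * norm h"
    using linear_bounded_pos[OF A(1)] by auto
  have "\<bar>G h\<bar> \<le> K * (norm h)\<^sup>2" for h
  proof -
    have "\<bar>G h\<bar> \<le> norm h * norm (A h)" unfolding A(2) by (rule Cauchy_Schwarz_ineq2)
    also have "\<dots> \<le> norm h * (K * norm h)" using K(2) by (intro mult_left_mono) auto
    finally show ?thesis by (simp add: power2_eq_square algebra_simps)
  qed
  with K(1) show ?thesis using that by blast
qed

lemma upper_jetI_ball:
  assumes "\<And>e. e > 0 \<Longrightarrow> \<exists>d>0. \<forall>h. x + h \<in> S \<longrightarrow> norm h < d \<longrightarrow>
     f (x + h) \<le> f x + p \<bullet> h + G h / 2 + e * (norm h)\<^sup>2"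
  shows "upper_jet S f x p G"
  unfolding upper_jet_def
proof (intro allI impI)
  fix e :: real assume "e > 0"
  from assms[OF this] obtain d where d: "d > 0" "\<And>h. x + h \<in> S \<Longrightarrow> norm h < d \<Longrightarrow>
     f (x + h) \<le> f x + p \<bullet> h + G h / 2 + e * (norm h)\<^sup>2" by blast
  show "\<forall>\<^sub>F y in at x within S. f y \<le> f x + p \<bullet> (y - x) + G (y - x) / 2 + e * (norm (y - x))\<^sup>2"
    unfolding eventually_at using d(1) d(2)[of "_ - x"] by (auto simp: dist_norm)
qed

lemma upper_jetD_ball:
  assumes "upper_jet S f x p G" "e > 0" "G 0 = 0"
  obtains d where "d > 0" "\<And>h. x + h \<in> S \<Longrightarrow> norm h < d \<Longrightarrow>
     f (x + h) \<le> f x + p \<bullet> h + G h / 2 + e * (norm h)\<^sup>2"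
proof -
  have "\<forall>\<^sub>F y in at x within S. f y \<le> f x + p \<bullet> (y - x) + G (y - x) / 2 + e * (norm (y - x))\<^sup>2"
    using assms unfolding upper_jet_def by blast
  then obtain d where d: "d > 0" "\<And>y. y \<in> S \<Longrightarrow> y \<noteq> x \<Longrightarrow> dist y x < d \<Longrightarrow>
     f y \<le> f x + p \<bullet> (y - x) + G (y - x) / 2 + e * (norm (y - x))\<^sup>2"
    unfolding eventually_at by blast
  have "f (x + h) \<le> f x + p \<bullet> h + G h / 2 + e * (norm h)\<^sup>2" if "x + h \<in> S" "norm h < d" for h
  proof (cases "h = 0")
    case True then show ?thesis using assms(3) by simp
  next
    case False
    then show ?thesis using d(2)[of "x + h"] that by (simp add: dist_norm)
  qed
  with d(1) show ?thesis using that by blast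
qed

section \<open>Mollification\<close>

text \<open>The third derivative of the fourth power of the positive part is 24 times the positive
  part, hence a cubic remainder with a factor \<open>X\<close>. The constant 11 = 1 + 4 + 6 comes
  from the case in which \<open>x + t\<close> becomes negative: there \<open>x\<close> is at most
  |t| and every term is at most its coefficient times t^4.\<close>

lemma pos_pow4_taylor:
  fixes x t :: real
  assumes "\<bar>x\<bar> \<le> X" "\<bar>t\<bar> \<le> X"
  shows "\<bar>(max 0 (x + t))^4 - (max 0 x)^4 - 4 * (max 0 x)^3 * t - 6 * (max 0 x)^2 * t^2\<bar> \<le> 11 * X * \<bar>t\<bar>^3"
proof -
  have X: "X \<ge> 0" using assms by auto
  have t3: "0 \<le> \<bar>t\<bar>^3" by simp
  have t4: "t^4 \<le> X * \<bar>t\<bar>^3"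
  proof -
    have "t^4 = \<bar>t\<bar> * \<bar>t\<bar>^3" by (simp add: power_eq_if abs_mult[symmetric])
    also have "\<dots> \<le> X * \<bar>t\<bar>^3" using assms by (intro mult_right_mono) auto
    finally show ?thesis .
  qed
  consider "x \<ge> 0" "x + t \<ge> 0" | "x < 0" "x + t \<ge> 0" | "x < 0" "x + t < 0" | "x \<ge> 0" "x + t < 0" by linarith
  then show ?thesis
  proof cases
    case 1
    have "(x + t)^4 - x^4 - 4 * x^3 * t - 6 * x^2 * t^2 = 4 * x * t^3 + t^4"
      by (simp add: power_eq_if algebra_simps)
    moreover have "\<bar>x * t^3\<bar> \<le> X * \<bar>t\<bar>^3"
      using mult_right_mono[OF assms(1) t3] by (simp add: abs_mult power_abs)
    moreover have "t^4 \<ge> 0" by simp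
    moreover have "max 0 (x + t) = x + t" "max 0 x = x" using 1 by auto
    ultimately show ?thesis using t4 mult_nonneg_nonneg[OF X t3] by linarith
  next
    case 2
    have "(x + t)^4 \<le> t^4"
      using 2 by (intro power_mono) auto
    moreover have "(x + t)^4 \<ge> 0" by simp
    moreover have "(max 0 (x + t))^4 - (max 0 x)^4 - 4 * (max 0 x)^3 * t - 6 * (max 0 x)^2 * t^2 = (x + t)^4"
      using 2 by simp
    ultimately show ?thesis using t4 mult_nonneg_nonneg[OF X t3] by linarith
  next
    case 3
    then show ?thesis using X by (simp add: max_def)
  next
    case 4
    have xt: "x \<le> \<bar>t\<bar>" "x \<ge> 0" using 4 by auto
    have a: "x^4 \<le> \<bar>t\<bar>^4" using xt by (intro power_mono) auto
    have b: "x^3 * \<bar>t\<bar> \<le> \<bar>t\<bar>^3 * \<bar>t\<bar>" using xt by (intro mult_right_mono power_mono) auto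
    have c: "x^2 * t^2 \<le> \<bar>t\<bar>^2 * t^2" using xt by (intro mult_right_mono power_mono) auto
    have a': "x^4 \<le> t^4" using a by simp
    have b': "x^3 * \<bar>t\<bar> \<le> t^4" using b by (simp add: power_eq_if abs_mult[symmetric])
    have c': "x^2 * t^2 \<le> t^4" using c by (simp add: power_eq_if)
    have tt: "\<bar>t\<bar> = - t" using 4 by auto
    have b'': "- (x^3 * t) \<le> t^4" "0 \<le> - (x^3 * t)" using b' xt 4 unfolding tt by (auto simp: mult_nonneg_nonpos)
    have "\<bar>0 - x^4 - 4 * (x^3 * t) - 6 * (x^2 * t^2)\<bar> \<le> 11 * t^4"
      using a' b'' c' zero_le_power[OF xt(2), of 4] mult_nonneg_nonneg[OF zero_le_power2[of x] zero_le_power2[of t]]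
      unfolding abs_le_iff by linarith
    moreover have "(max 0 (x + t))^4 - (max 0 x)^4 - 4 * (max 0 x)^3 * t - 6 * (max 0 x)^2 * t^2
       = 0 - x^4 - 4 * (x^3 * t) - 6 * (x^2 * t^2)" using 4 by (simp add: max_def)
    ultimately show ?thesis using t4 by linarith
  qed
qed

text \<open>The power 4 makes the bump three times continuously differentiable, as a second-order
  Taylor formula with cubic remainder asks for. Normalisation is left to
  \<open>moll\<close>.\<close>

definition ker :: "'a::euclidean_space \<Rightarrow> real" where "ker y = (max 0 (1 - y \<bullet> y))^4"

lemma ker_nonneg [simp]: "ker y \<ge> 0" unfolding ker_def by simp

lemma ker_zero: "norm y \<ge> 1 \<Longrightarrow> ker y = 0"
proof -
  assume "norm y \<ge> 1"
  then have "y \<bullet> y \<ge> 1" by (simp add: norm_ge_square)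
  then show ?thesis by (simp add: ker_def max_def)
qed

lemma continuous_ker [continuous_intros]: "continuous_on S ker"
  unfolding ker_def by (intro continuous_intros)

text \<open>The second-order Taylor polynomial of \<open>ker\<close> at \<open>y\<close>; \<open>max 0 (1 - y \<bullet> y)\<close> is \<open>C\<^sup>3\<close>-flat at the unit sphere.\<close>

definition ker1 :: "'a::euclidean_space \<Rightarrow> 'a" where "ker1 y = (- 8 * (max 0 (1 - y \<bullet> y))^3) *\<^sub>R y"

definition ker2 :: "'a::euclidean_space \<Rightarrow> 'a \<Rightarrow> 'a" where
  "ker2 y h = (48 * (max 0 (1 - y \<bullet> y))^2 * (y \<bullet> h)) *\<^sub>R y - (8 * (max 0 (1 - y \<bullet> y))^3) *\<^sub>R h"

lemma continuous_ker1 [continuous_intros]: "continuous_on S ker1"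
  unfolding ker1_def by (intro continuous_intros)

lemma continuous_ker2 [continuous_intros]: "continuous_on S (\<lambda>y. ker2 y h)"
  unfolding ker2_def by (intro continuous_intros)

lemma ker12_zero: "norm y \<ge> 1 \<Longrightarrow> ker1 y = 0 \<and> ker2 y h = 0"
proof -
  assume "norm y \<ge> 1"
  then have "y \<bullet> y \<ge> 1" by (simp add: norm_ge_square)
  then show ?thesis by (simp add: ker1_def ker2_def max_def)
qed

text \<open>With x = 1 - |y|^2 and t = -(2 y.h + |h|^2) this reduces to
  \<open>pos_pow4_taylor\<close>; for large \<open>y\<close> both bumps vanish. Uniformity in
  \<open>y\<close> permits integration later, and \<open>D\<close> may be large because a shift of
  the argument by h becomes a shift of the kernel variable by h/s.\<close>

lemma ker_taylor:
  assumes "D \<ge> 1"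
  shows "\<exists>\<Lambda>\<ge>0. \<forall>(y::'a::euclidean_space) h. norm h \<le> D \<longrightarrow>
    \<bar>ker (y + h) - ker y - ker1 y \<bullet> h - (h \<bullet> ker2 y h) / 2\<bar> \<le> \<Lambda> * (norm h)^3"
proof -
  define X where "X = 1 + 4 * (1 + D)^2 + D^2"
  define \<Lambda> where "\<Lambda> = 11 * X * (2 * (1+D) + D)^3 + 24 * (1+D) + 6 * D"
  have X0: "X \<ge> 1" "D \<ge> 0" using assms by (auto simp: X_def)
  have L0: "\<Lambda> \<ge> 0" unfolding \<Lambda>_def using assms X0 by simp
  have main: "\<bar>ker (y + h) - ker y - ker1 y \<bullet> h - (h \<bullet> ker2 y h) / 2\<bar> \<le> \<Lambda> * (norm h)^3"
    if h: "norm h \<le> D" for y h :: 'a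
  proof (cases "norm y \<ge> 1 + D")
    case True
    have "norm (y + h) \<ge> 1" using norm_diff_ineq[of y h] True h by linarith
    moreover have "norm y \<ge> 1" using True X0 by linarith
    ultimately show ?thesis using ker_zero[of y] ker_zero[of "y+h"] ker12_zero[of y] L0 by simp
  next
    case False
    define x where "x = 1 - y \<bullet> y"
    define t where "t = - (2 * (y \<bullet> h) + h \<bullet> h)"
    define m where "m = max 0 x"
    let ?n = "norm h"
    have yn: "norm y \<le> 1 + D" using False by simp
    have n0: "?n \<ge> 0" by simp
    have yh: "\<bar>y \<bullet> h\<bar> \<le> (1 + D) * ?n"
      using Cauchy_Schwarz_ineq2[of y h] yn mult_right_mono[OF yn n0] by linarith
    have hh: "h \<bullet> h = ?n^2" by (simp add: power2_norm_eq_inner)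
    have hh2: "?n^2 \<le> D * ?n" using h by (simp add: power2_eq_square mult_right_mono)
    have tb: "\<bar>t\<bar> \<le> (2 * (1+D) + D) * ?n"
    proof -
      have "\<bar>t\<bar> \<le> 2 * \<bar>y \<bullet> h\<bar> + ?n^2" unfolding t_def hh using zero_le_power2[of ?n] by (simp add: abs_if)
      then show ?thesis using yh hh2 by (simp add: algebra_simps)
    qed
    have yy: "y \<bullet> y \<le> (1+D)^2"
      using yn by (metis norm_ge_zero power2_norm_eq_inner power_mono)
    have xb: "\<bar>x\<bar> \<le> X" using yy X0 inner_ge_zero[of y] unfolding x_def X_def abs_le_iff
      using zero_le_power2[of "1+D"] zero_le_power2[of D] by linarith
    have tX: "\<bar>t\<bar> \<le> X"
    proof -
      have "\<bar>t\<bar> \<le> (2 * (1+D) + D) * D"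
        by (rule order_trans[OF tb mult_left_mono[OF h]]) (use X0 in auto)
      also have "\<dots> \<le> X" unfolding X_def using X0 mult_nonneg_nonneg[OF X0(2) X0(2)] by (simp add: power2_eq_square algebra_simps)
      finally show ?thesis .
    qed
    have T: "\<bar>(max 0 (x + t))^4 - m^4 - 4 * m^3 * t - 6 * m^2 * t^2\<bar> \<le> 11 * X * \<bar>t\<bar>^3"
      unfolding m_def by (rule pos_pow4_taylor[OF xb tX])
    have e1: "ker (y + h) = (max 0 (x + t))^4"
      unfolding ker_def x_def t_def by (simp add: inner_add_left inner_add_right inner_commute algebra_simps)
    have e2: "ker y = m^4" unfolding ker_def m_def x_def by simp
    have e3: "ker1 y \<bullet> h = - 8 * m^3 * (y \<bullet> h)" unfolding ker1_def m_def x_def by simp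
    have e4: "h \<bullet> ker2 y h = 48 * m^2 * (y \<bullet> h)^2 - 8 * m^3 * ?n^2"
      unfolding ker2_def m_def x_def
      by (simp add: inner_diff_right inner_commute hh power2_eq_square)
    have m1: "0 \<le> m" "m \<le> 1" unfolding m_def x_def by auto
    have m2: "m^2 \<le> 1" using m1 by (simp add: power_le_one)
    \<comment> \<open>The square of t also produces (y.h)|h|^2 and |h|^4, which have order at least
      three and go into the error.\<close>
    have key: "ker (y + h) - ker y - ker1 y \<bullet> h - (h \<bullet> ker2 y h) / 2
       = ((max 0 (x + t))^4 - m^4 - 4 * m^3 * t - 6 * m^2 * t^2) + 6 * m^2 * (4 * (y \<bullet> h) * ?n^2 + ?n^4)"
      unfolding e1 e2 e3 e4 unfolding t_def hh by (simp add: field_simps power2_eq_square power4_eq_xxxx)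
    have r: "\<bar>6 * m^2 * (4 * (y \<bullet> h) * ?n^2 + ?n^4)\<bar> \<le> (24 * (1+D) + 6 * D) * ?n^3"
    proof -
      have a: "\<bar>4 * (y \<bullet> h) * ?n^2\<bar> \<le> 4 * (1+D) * ?n^3"
        using mult_right_mono[OF yh, of "?n^2"] by (simp add: abs_mult power_eq_if algebra_simps)
      have b: "?n^4 \<le> D * ?n^3" using mult_right_mono[OF h, of "?n^3"] by (simp add: power_eq_if)
      have c: "\<bar>4 * (y \<bullet> h) * ?n^2 + ?n^4\<bar> \<le> (4 * (1+D) + D) * ?n^3"
      proof -
        have "\<bar>4 * (y \<bullet> h) * ?n^2 + ?n^4\<bar> \<le> \<bar>4 * (y \<bullet> h) * ?n^2\<bar> + ?n^4"
          using abs_triangle_ineq[of "4 * (y \<bullet> h) * ?n^2" "?n^4"] by simp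
        then show ?thesis using a b by (simp add: distrib_right)
      qed
      have "\<bar>6 * m^2 * (4 * (y \<bullet> h) * ?n^2 + ?n^4)\<bar> = 6 * m^2 * \<bar>4 * (y \<bullet> h) * ?n^2 + ?n^4\<bar>"
        by (simp add: abs_mult)
      also have "\<dots> \<le> 6 * 1 * ((4 * (1+D) + D) * ?n^3)"
        using m2 c by (intro mult_mono) auto
      finally show ?thesis by (simp add: algebra_simps)
    qed
    have q: "\<bar>t\<bar>^3 \<le> (2 * (1+D) + D)^3 * ?n^3"
      using power_mono[OF tb, of 3] by (simp add: power_mult_distrib)
    have "11 * X * \<bar>t\<bar>^3 \<le> 11 * X * ((2 * (1+D) + D)^3 * ?n^3)"
      using q X0 by (intro mult_left_mono) auto
    then have "\<bar>ker (y + h) - ker y - ker1 y \<bullet> h - (h \<bullet> ker2 y h) / 2\<bar>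
      \<le> 11 * X * ((2 * (1+D) + D)^3 * ?n^3) + (24 * (1+D) + 6 * D) * ?n^3"
      unfolding key using T r by linarith
    also have "\<dots> = \<Lambda> * ?n^3" unfolding \<Lambda>_def by (simp add: algebra_simps)
    finally show ?thesis .
  qed
  show ?thesis using main L0 by blast
qed

section \<open>Integrals over a compact support and mollification\<close>

lemma integrable_compact_support:
  fixes g :: "'a::euclidean_space \<Rightarrow> real"
  assumes "continuous_on UNIV g" "\<And>y. norm y \<ge> R \<Longrightarrow> g y = 0"
  shows "integrable lborel g"
proof -
  have "integrable lborel (\<lambda>y. indicator (cball 0 R) y *\<^sub>R g y)"
    using assms(1) by (intro borel_integrable_compact) (auto intro: continuous_on_subset)
  also have "(\<lambda>y. indicator (cball 0 R) y *\<^sub>R g y) = g"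
    using assms(2) by (force simp: indicator_def)
  finally show ?thesis .
qed

lemma integral_bound_ball:
  fixes g :: "'a::euclidean_space \<Rightarrow> real"
  assumes "\<And>y. norm y \<ge> R \<Longrightarrow> g y = 0" "\<And>y. norm y \<le> R \<Longrightarrow> \<bar>g y\<bar> \<le> C" "C \<ge> 0"
  shows "\<bar>LINT y|lborel. g y\<bar> \<le> C * measure lborel (cball (0::'a) R)"
proof (cases "integrable lborel g")
  case True
  have i: "integrable lborel (\<lambda>y. indicator (cball (0::'a) R) y *\<^sub>R C)"
    by (intro borel_integrable_compact) auto
  have "\<bar>LINT y|lborel. g y\<bar> \<le> (LINT y|lborel. indicator (cball (0::'a) R) y *\<^sub>R C)"
  proof (rule order_trans[OF integral_abs_bound Bochner_Integration.integral_mono[OF _ i]])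
    show "\<bar>g y\<bar> \<le> indicator (cball (0::'a) R) y *\<^sub>R C" for y
      using assms(1)[of y] assms(2)[of y] assms(3) by (cases "norm y \<le> R") (auto simp: indicator_def)
  qed (use True in auto)
  also have "\<dots> = C * measure lborel (cball (0::'a) R)"
    by (simp add: mult.commute)
  finally show ?thesis by simp
next
  case False
  \<comment> \<open>Without integrability the integral is 0 by convention, so the bound still
    holds.\<close>
  then show ?thesis using assms(3) by (simp add: not_integrable_integral_eq)
qed

lemma integral_translate:
  fixes g :: "'a::euclidean_space \<Rightarrow> real"
  assumes "continuous_on UNIV g"
  shows "(LINT y|lborel. g (k + y)) = (LINT y|lborel. g y)"
proof -
  have "(LINT y|lborel. g y) = (LINT y|distr lborel borel ((+) k). g y)"
    by (simp add: lborel_distr_plus)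
  also have "\<dots> = (LINT y|lborel. g (k + y))"
    using borel_measurable_continuous_onI[OF assms] by (subst integral_distr) auto
  finally show ?thesis by simp
qed

definition moll :: "real \<Rightarrow> ('a::euclidean_space \<Rightarrow> real) \<Rightarrow> 'a \<Rightarrow> real" where
  "moll s f x = (LINT y|lborel. f (x + s *\<^sub>R y) * ker y) / (LINT y|lborel. ker (y::'a))"

lemma ker_integral_pos: "(LINT y|lborel. ker (y::'a::euclidean_space)) > 0"
proof -
  let ?U = "cball (0::'a) (1/2)"
  have i: "integrable lborel (\<lambda>y. indicator ?U y *\<^sub>R (1/16::real))"
    by (intro borel_integrable_compact) auto
  have "0 < measure lborel ?U" using content_cball_pos[of "1/2" "0::'a"] by simp
  then have "0 < (LINT y|lborel. indicator ?U y *\<^sub>R (1/16::real))" by simp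
  also have "\<dots> \<le> (LINT y|lborel. ker (y::'a))"
  proof (rule integral_mono[OF i])
    show "integrable lborel (ker::'a \<Rightarrow> real)"
      by (rule integrable_compact_support[OF continuous_ker ker_zero])
    show "indicator ?U y *\<^sub>R (1/16::real) \<le> ker y" for y
    proof (cases "y \<in> ?U")
      case True
      then have "(norm y)^2 \<le> (1/2)^2" by (intro power_mono) auto
      then have "y \<bullet> y \<le> 1/4" unfolding power2_norm_eq_inner by (simp add: power2_eq_square)
      then have k: "1/2 \<le> max 0 (1 - y \<bullet> y)" by linarith
      have "(1/2::real)^4 \<le> (max 0 (1 - y \<bullet> y))^4" by (rule power_mono[OF k]) simp
      moreover have "(1/2::real)^4 = 1/16" by (simp add: power_divide)
      ultimately have "1/16 \<le> ker y" unfolding ker_def by linarith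
      then show ?thesis using True by simp
    qed auto
  qed
  finally show ?thesis .
qed

lemma moll_integrable:
  assumes "continuous_on UNIV f"
  shows "integrable lborel (\<lambda>y. f (x + s *\<^sub>R y) * ker y)"
  by (rule integrable_compact_support[where R = 1])
    (auto simp: ker_zero intro!: continuous_intros continuous_on_compose2[OF assms])

text \<open>Only values within distance |s| of the two base points enter. This locality lets an
  inequality known near a point pass to the mollification; two different base points cover
  translation estimates.\<close>

lemma moll_le:
  assumes f: "continuous_on UNIV f" and g: "continuous_on UNIV g"
    and le: "\<And>y. norm y < 1 \<Longrightarrow> f (x + s *\<^sub>R y) + K \<le> g (x' + s *\<^sub>R y)"
  shows "moll s f x + K \<le> moll s g x'"
proof -
  let ?m = "LINT y|lborel. ker (y::'a)"
  have ik: "integrable lborel (ker::'a \<Rightarrow> real)"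
    by (rule integrable_compact_support[OF continuous_ker ker_zero])
  have "(LINT y|lborel. f (x + s *\<^sub>R y) * ker y) + K * ?m = (LINT y|lborel. f (x + s *\<^sub>R y) * ker y + K * ker y)"
    using moll_integrable[OF f] ik by simp
  also have "\<dots> \<le> (LINT y|lborel. g (x' + s *\<^sub>R y) * ker y)"
  proof (rule integral_mono)
    show "integrable lborel (\<lambda>y. f (x + s *\<^sub>R y) * ker y + K * ker y)"
      using moll_integrable[OF f] ik by simp
    show "f (x + s *\<^sub>R y) * ker y + K * ker y \<le> g (x' + s *\<^sub>R y) * ker y" for y
    proof (cases "norm y < 1")
      case True
      have "(f (x + s *\<^sub>R y) + K) * ker y \<le> g (x' + s *\<^sub>R y) * ker y"
        using le[OF True] by (intro mult_right_mono) auto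
      then show ?thesis by (simp only: distrib_right)
    next
      case False
      then show ?thesis using ker_zero[of y] by simp
    qed
  qed (rule moll_integrable[OF g])
  finally have "((LINT y|lborel. f (x + s *\<^sub>R y) * ker y) + K * ?m) / ?m \<le> (LINT y|lborel. g (x' + s *\<^sub>R y) * ker y) / ?m"
    using ker_integral_pos[where 'a='a] by (intro divide_right_mono) auto
  then show ?thesis using ker_integral_pos[where 'a='a] unfolding moll_def
    by (simp add: add_divide_distrib)
qed

lemma moll_const [simp]: "moll s (\<lambda>_. K) (x::'a::euclidean_space) = K"
  unfolding moll_def using ker_integral_pos[where 'a='a] by simp

lemma moll_sum:
  assumes "\<And>k. k \<in> I \<Longrightarrow> continuous_on UNIV (f k)"
  shows "moll s (\<lambda>x. \<Sum>k\<in>I. f k x) x = (\<Sum>k\<in>I. moll s (f k) x)"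
  unfolding moll_def using moll_integrable[OF assms]
  by (simp add: sum_distrib_right sum_divide_distrib)

lemma moll_add:
  assumes "continuous_on UNIV f" "continuous_on UNIV g"
  shows "moll s (\<lambda>x. f x + g x) x = moll s f x + moll s g x"
  unfolding moll_def using moll_integrable[OF assms(1)] moll_integrable[OF assms(2)]
  by (simp add: distrib_right add_divide_distrib)

lemma moll_divide: "moll s (\<lambda>x. f x / c) x = moll s f x / c"
  unfolding moll_def by simp

lemma moll_shift: "moll s (\<lambda>x. f (x + a)) x = moll s f (x + a)"
  unfolding moll_def by (simp add: algebra_simps)

lemma moll_close:
  assumes "L-lipschitz_on UNIV f" "s > 0"
  shows "\<bar>moll s f x - f x\<bar> \<le> L * s"
proof -
  have c: "continuous_on UNIV f" using assms(1) by (rule lipschitz_on_continuous_on)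
  have d: "\<bar>f (x + s *\<^sub>R y) - f x\<bar> \<le> L * s" if "norm y < 1" for y
  proof -
    have "\<bar>f (x + s *\<^sub>R y) - f x\<bar> \<le> L * norm (s *\<^sub>R y)"
      using lipschitz_onD[OF assms(1), of "x + s *\<^sub>R y" x] by (simp add: dist_norm)
    also have "\<dots> \<le> L * (s * 1)"
      using that assms lipschitz_on_nonneg[OF assms(1)] by (intro mult_left_mono) auto
    finally show ?thesis by simp
  qed
  have "moll s f x + (- L * s) \<le> moll s (\<lambda>_. f x) x"
    using d by (intro moll_le c continuous_on_const) (auto simp: abs_le_iff algebra_simps)
  moreover have "moll s (\<lambda>_. f x) x + (- L * s) \<le> moll s f x"
    using d by (intro moll_le c continuous_on_const) (auto simp: abs_le_iff algebra_simps)
  ultimately show ?thesis by simp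
qed

lemma moll_lipschitz:
  assumes "L-lipschitz_on UNIV f"
  shows "L-lipschitz_on UNIV (moll s f)"
proof (rule lipschitz_onI)
  have c: "continuous_on UNIV f" using assms(1) by (rule lipschitz_on_continuous_on)
  fix x y :: 'a
  have d: "\<bar>f (x + z) - f (y + z)\<bar> \<le> L * dist x y" for z
    using lipschitz_onD[OF assms(1), of "x + z" "y + z"] by (simp add: dist_norm)
  have d1: "f (x + z) + (- L * dist x y) \<le> f (y + z)" for z using d[of z] by (auto simp: abs_le_iff)
  have d2: "f (y + z) + (- L * dist x y) \<le> f (x + z)" for z using d[of z] by (auto simp: abs_le_iff)
  have "moll s f x + (- L * dist x y) \<le> moll s f y" by (intro moll_le c d1)
  moreover have "moll s f y + (- L * dist x y) \<le> moll s f x" by (intro moll_le c d2)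
  ultimately show "dist (moll s f x) (moll s f y) \<le> L * dist x y" by (simp add: dist_real_def)
qed (rule lipschitz_on_nonneg[OF assms])

text \<open>A quantitative form of being C^2 with Lipschitz second derivative: one constant bounds
  Hessians and cubic remainders at all points. The gradient stays existential because only Hessians
  are compared. Averaging translates does not worsen the constant, and the iteration of
  \<open>walk\<close> depends on that.\<close>

definition second_order :: "real \<Rightarrow> ('a::euclidean_space \<Rightarrow> real) \<Rightarrow> ('a \<Rightarrow> 'a \<Rightarrow> real) \<Rightarrow> bool" where
  "second_order \<Lambda> f G \<longleftrightarrow>
    (\<forall>x. quad_form (G x) \<and> (\<forall>h. \<bar>G x h\<bar> \<le> \<Lambda> * (norm h)^2) \<and>
      (\<exists>p. \<forall>h. norm h \<le> 1 \<longrightarrow> \<bar>f (x + h) - f x - p \<bullet> h - G x h / 2\<bar> \<le> \<Lambda> * (norm h)^3))"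

text \<open>A translation of the integration variable moves the increment h from \<open>f\<close> to
  the kernel, where \<open>ker_taylor\<close> applies. Integrating the increment \<open>b\<close> of
  \<open>f\<close> instead of \<open>f\<close> itself keeps the constants independent of x although
  \<open>f\<close> may be unbounded.\<close>

lemma moll_second_order:
  fixes f :: "'a::euclidean_space \<Rightarrow> real"
  assumes lip: "L-lipschitz_on UNIV f" and s: "s > 0"
  shows "\<exists>\<Lambda>\<ge>0. \<exists>G. second_order \<Lambda> (moll s f) G"
proof -
  have c: "continuous_on UNIV f" using lip by (rule lipschitz_on_continuous_on)
  have L: "L \<ge> 0" using lip by (rule lipschitz_on_nonneg)
  define D where "D = max 1 (1/s)"
  have D: "D \<ge> 1" "1 / s \<le> D" unfolding D_def by auto
  obtain \<Lambda>0 where L0: "\<Lambda>0 \<ge> 0" and tay: "\<And>(y::'a) h. norm h \<le> D \<Longrightarrow>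
    \<bar>ker (y + h) - ker y - ker1 y \<bullet> h - (h \<bullet> ker2 y h) / 2\<bar> \<le> \<Lambda>0 * (norm h)^3"
    using ker_taylor[OF D(1)] by blast
  define m where "m = (LINT y|lborel. ker (y::'a))"
  have m: "m > 0" unfolding m_def by (rule ker_integral_pos)
  define b where "b x y = f (x + s *\<^sub>R y) - f x" for x y
  have bc: "continuous_on UNIV (b x)" for x unfolding b_def
    by (intro continuous_intros continuous_on_compose2[OF c]) auto
  have bb: "\<bar>b x y\<bar> \<le> L * (s * norm y)" for x y
    using lipschitz_onD[OF lip, of "x + s *\<^sub>R y" x] s by (simp add: dist_norm b_def)
  \<comment> \<open>The kernel variable is shifted by -h/s: two kernel derivatives give the factor
    1/s^2 here, one gives the factor -1/s in \<open>p\<close>.\<close>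
  define A where "A x h = (1 / (s\<^sup>2 * m)) *\<^sub>R (LINT y|lborel. b x y *\<^sub>R ker2 y h)" for x h
  define p where "p x = (- 1 / (s * m)) *\<^sub>R (LINT y|lborel. b x y *\<^sub>R ker1 y)" for x
  have int2: "integrable lborel (\<lambda>y. b x y *\<^sub>R ker2 y h)" for x h
  proof -
    have "integrable lborel (\<lambda>y. indicator (cball 0 1) y *\<^sub>R (b x y *\<^sub>R ker2 y h))"
      by (intro borel_integrable_compact continuous_intros continuous_on_subset[OF bc]) auto
    also have "(\<lambda>y. indicator (cball 0 1) y *\<^sub>R (b x y *\<^sub>R ker2 y h)) = (\<lambda>y. b x y *\<^sub>R ker2 y h)"
      using ker12_zero by (force simp: indicator_def)
    finally show ?thesis .
  qed
  have int1: "integrable lborel (\<lambda>y. b x y *\<^sub>R ker1 y)" for x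
  proof -
    have "integrable lborel (\<lambda>y. indicator (cball 0 1) y *\<^sub>R (b x y *\<^sub>R ker1 y))"
      by (intro borel_integrable_compact continuous_intros continuous_on_subset[OF bc]) auto
    also have "(\<lambda>y. indicator (cball 0 1) y *\<^sub>R (b x y *\<^sub>R ker1 y)) = (\<lambda>y. b x y *\<^sub>R ker1 y)"
      using ker12_zero by (force simp: indicator_def)
    finally show ?thesis .
  qed
  have intk: "integrable lborel (\<lambda>y. b x y * ker (y + k))" for x k
  proof (rule integrable_compact_support[where R = "1 + norm k"])
    show "continuous_on UNIV (\<lambda>y. b x y * ker (y + k))"
      by (intro continuous_intros continuous_on_compose2[OF continuous_ker[of UNIV]] bc) auto
    show "b x y * ker (y + k) = 0" if "norm y \<ge> 1 + norm k" for y
      using ker_zero[of "y + k"] norm_diff_ineq[of y k] that by simp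
  qed
  have linA: "linear (A x)" for x
  proof (rule linearI)
    fix h h' :: 'a and r :: real
    have "ker2 y (h + h') = ker2 y h + ker2 y h'" for y
      unfolding ker2_def by (simp add: algebra_simps inner_add_right)
    then show "A x (h + h') = A x h + A x h'" unfolding A_def using int2
      by (simp add: scaleR_add_right)
    have "ker2 y (r *\<^sub>R h) = r *\<^sub>R ker2 y h" for y
      unfolding ker2_def by (simp add: algebra_simps)
    then have "(LINT y|lborel. b x y *\<^sub>R ker2 y (r *\<^sub>R h)) = (LINT y|lborel. r *\<^sub>R (b x y *\<^sub>R ker2 y h))"
      by (simp add: mult.commute)
    also have "\<dots> = r *\<^sub>R (LINT y|lborel. b x y *\<^sub>R ker2 y h)"
      using int2[of x h] by (simp del: scaleR_scaleR)
    finally show "A x (r *\<^sub>R h) = r *\<^sub>R A x h" unfolding A_def by (simp add: mult.commute)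
  qed
  have ex: "moll s f (x + h) = f x + (LINT y|lborel. b x y * ker (y + (- 1/s) *\<^sub>R h)) / m" for x h
  proof -
    let ?k = "(- 1/s) *\<^sub>R h"
    have eq: "moll s f (x + h) = (LINT y|lborel. f (x + h + s *\<^sub>R (?k + y)) * ker (?k + y)) / m"
      unfolding moll_def m_def
      by (subst integral_translate[of "\<lambda>y. f (x + h + s *\<^sub>R y) * ker y" ?k])
        (auto intro!: continuous_intros continuous_on_compose2[OF c])
    have "f (x + h + s *\<^sub>R (?k + y)) * ker (?k + y) = b x y * ker (y + ?k) + f x * ker (?k + y)" for y
      using s unfolding b_def by (simp add: algebra_simps)
    then have "(LINT y|lborel. f (x + h + s *\<^sub>R (?k + y)) * ker (?k + y)) =
      (LINT y|lborel. b x y * ker (y + ?k) + f x * ker (?k + y))" by simp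
    also have "\<dots> = (LINT y|lborel. b x y * ker (y + ?k)) + (LINT y|lborel. f x * ker (?k + y))"
    proof (rule Bochner_Integration.integral_add[OF intk])
      show "integrable lborel (\<lambda>y. f x * ker (?k + y))"
      proof (rule integrable_compact_support[where R = "1 + norm ?k"])
        show "continuous_on UNIV (\<lambda>y. f x * ker (?k + y))"
          by (intro continuous_intros continuous_on_compose2[OF continuous_ker[of UNIV]]) auto
        show "f x * ker (?k + y) = 0" if "norm y \<ge> 1 + norm ?k" for y
          using ker_zero[of "?k + y"] norm_diff_ineq[of y ?k] that by (simp add: add.commute)
      qed
    qed
    also have "(LINT y|lborel. f x * ker (?k + y)) = f x * m"
      unfolding m_def by (simp only: integral_mult_right_zero integral_translate[OF continuous_ker, of ?k])
    finally show ?thesis using m unfolding eq by (simp add: field_simps)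
  qed
  define V where "V = measure lborel (cball (0::'a) (1 + D))"
  \<comment> \<open>The first summand bounds the Taylor remainder, the second the Hessian; 56 = 48 +
    8 collects the coefficients in \<open>ker2\<close>.\<close>
  define \<Lambda> where "\<Lambda> = L * (s * (1 + D)) * \<Lambda>0 / s^3 * V / m + 56 * (L * s) * measure lborel (cball (0::'a) 1) / (s\<^sup>2 * m)"
  have LL: "\<Lambda> \<ge> 0" unfolding \<Lambda>_def V_def using L s D L0 m by simp
  have A1: "L * (s * (1 + D)) * \<Lambda>0 / s^3 * V / m \<le> \<Lambda>"
    unfolding \<Lambda>_def using L s m by simp
  have A2: "56 * (L * s) * measure lborel (cball (0::'a) 1) / (s\<^sup>2 * m) \<le> \<Lambda>"
    unfolding \<Lambda>_def V_def using L s m D L0 by simp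
  have "second_order \<Lambda> (moll s f) (\<lambda>x h. h \<bullet> A x h)"
    unfolding second_order_def
  proof (intro allI conjI)
    fix x
    show "quad_form (\<lambda>h. h \<bullet> A x h)" unfolding quad_form_def using linA by blast
    have hA: "h \<bullet> A x h = (LINT y|lborel. b x y * (h \<bullet> ker2 y h)) / (s\<^sup>2 * m)" for h
      unfolding A_def using int2[of x h] by (simp flip: integral_inner_right)
    show "\<bar>h \<bullet> A x h\<bar> \<le> \<Lambda> * (norm h)^2" for h
    proof -
      have "\<bar>LINT y|lborel. b x y * (h \<bullet> ker2 y h)\<bar> \<le> ((L * s) * (56 * (norm h)^2)) * measure lborel (cball (0::'a) 1)"
      proof (rule integral_bound_ball)
        show "b x y * (h \<bullet> ker2 y h) = 0" if "1 \<le> norm y" for y using ker12_zero[OF that] by simp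
        show "\<bar>b x y * (h \<bullet> ker2 y h)\<bar> \<le> (L * s) * (56 * (norm h)^2)" if y: "norm y \<le> 1" for y
        proof -
          define q where "q = max 0 (1 - y \<bullet> y)"
          have q: "0 \<le> q" "q \<le> 1" unfolding q_def by auto
          have yh: "\<bar>y \<bullet> h\<bar> \<le> norm h"
            using Cauchy_Schwarz_ineq2[of y h] y mult_right_mono[OF y, of "norm h"] by simp
          have yh2: "(y \<bullet> h)^2 \<le> (norm h)^2" using power_mono[OF yh, of 2] by simp
          have e: "h \<bullet> ker2 y h = 48 * (q^2 * (y \<bullet> h)^2) - 8 * (q^3 * (norm h)^2)"
            unfolding ker2_def q_def by (simp add: inner_diff_right inner_commute dot_square_norm power2_eq_square)
          have "q^2 \<le> 1" "q^3 \<le> 1" using q by (auto intro: power_le_one)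
          then have "q^2 * (y \<bullet> h)^2 \<le> 1 * (norm h)^2" "q^3 * (norm h)^2 \<le> 1 * (norm h)^2"
            by (intro mult_mono mult_right_mono yh2; simp)+
          moreover have "0 \<le> q^2 * (y \<bullet> h)^2" "0 \<le> q^3 * (norm h)^2" using q by auto
          ultimately have "\<bar>h \<bullet> ker2 y h\<bar> \<le> 56 * (norm h)^2" unfolding e abs_le_iff by linarith
          moreover have "\<bar>b x y\<bar> \<le> L * s"
            using bb[of x y] mult_left_mono[OF mult_left_mono[OF y, of s], of L] L s by simp
          ultimately show ?thesis unfolding abs_mult using L s by (intro mult_mono) auto
        qed
      qed (use L s in auto)
      then have "\<bar>h \<bullet> A x h\<bar> \<le> (56 * (L * s) * measure lborel (cball (0::'a) 1) / (s\<^sup>2 * m)) * (norm h)^2"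
        unfolding hA using s m by (simp add: abs_divide abs_mult field_simps)
      also have "\<dots> \<le> \<Lambda> * (norm h)^2" using A2 by (intro mult_right_mono) auto
      finally show ?thesis .
    qed
    show "\<exists>p. \<forall>h. norm h \<le> 1 \<longrightarrow> \<bar>moll s f (x + h) - moll s f x - p \<bullet> h - h \<bullet> A x h / 2\<bar> \<le> \<Lambda> * (norm h)^3"
    proof (intro exI[of _ "p x"] allI impI)
      fix h :: 'a assume h: "norm h \<le> 1"
      let ?k = "(- 1/s) *\<^sub>R h"
      have kD: "norm ?k \<le> D"
      proof -
        have "norm ?k = norm h * (1/s)" using s by simp
        also have "\<dots> \<le> 1 * (1/s)" using h s by (intro mult_right_mono) auto
        finally show ?thesis using D(2) by linarith
      qed
      define R where "R y = ker (y + ?k) - ker y - ker1 y \<bullet> ?k - (?k \<bullet> ker2 y ?k) / 2" for y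
      have ph: "p x \<bullet> h = (LINT y|lborel. b x y * (ker1 y \<bullet> ?k)) / m"
        unfolding p_def using int1[of x] s by (simp flip: integral_inner_left)
      have Gh: "h \<bullet> A x h = (LINT y|lborel. b x y * (?k \<bullet> ker2 y ?k)) / m"
      proof -
        have "?k \<bullet> ker2 y ?k = (h \<bullet> ker2 y h) / s\<^sup>2" for y
          unfolding ker2_def using s by (simp add: field_simps power2_eq_square inner_diff_right)
        then show ?thesis unfolding hA using s by simp
      qed
      have i1: "integrable lborel (\<lambda>y. b x y * (ker1 y \<bullet> ?k))"
        using integrable_inner_left[of ?k, OF int1[of x]] by simp
      have i2: "integrable lborel (\<lambda>y. b x y * (?k \<bullet> ker2 y ?k))"
        using integrable_inner_right[of ?k, OF int2[of x ?k]] by simp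
      have i0: "integrable lborel (\<lambda>y. b x y * ker y)" using intk[of x 0] by simp
      have "(LINT y|lborel. b x y * R y) = (LINT y|lborel. b x y * ker (y + ?k) - b x y * ker y - b x y * (ker1 y \<bullet> ?k)
            - b x y * (?k \<bullet> ker2 y ?k) / 2)"
        unfolding R_def by (simp only: algebra_simps times_divide_eq_right)
      also have "\<dots> = (LINT y|lborel. b x y * ker (y + ?k)) - (LINT y|lborel. b x y * ker y)
           - (LINT y|lborel. b x y * (ker1 y \<bullet> ?k)) - (LINT y|lborel. b x y * (?k \<bullet> ker2 y ?k)) / 2"
        using intk[of x ?k] i0 i1 i2 by (simp only: Bochner_Integration.integral_diff Bochner_Integration.integrable_diff integrable_divide integral_divide_zero)
      finally have "moll s f (x + h) - moll s f x - p x \<bullet> h - h \<bullet> A x h / 2 = (LINT y|lborel. b x y * R y) / m"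
        unfolding ex[of x h] ph Gh using ex[of x 0] m by (simp add: field_simps)
      moreover have "\<bar>LINT y|lborel. b x y * R y\<bar> \<le> (L * (s * (1 + D)) * (\<Lambda>0 * (norm ?k)^3)) * V"
        unfolding V_def
      proof (rule integral_bound_ball)
        show "b x y * R y = 0" if "1 + D \<le> norm y" for y
        proof -
          have "norm (y + ?k) \<ge> 1" using norm_diff_ineq[of y ?k] kD that by linarith
          moreover have "norm y \<ge> 1" using that D by linarith
          ultimately show ?thesis unfolding R_def using ker_zero[of y] ker_zero[of "y + ?k"] ker12_zero[of y] by simp
        qed
        show "\<bar>b x y * R y\<bar> \<le> L * (s * (1 + D)) * (\<Lambda>0 * (norm ?k)^3)" if y: "norm y \<le> 1 + D" for y
        proof -
          have "\<bar>R y\<bar> \<le> \<Lambda>0 * (norm ?k)^3" unfolding R_def by (rule tay[OF kD])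
          moreover have "\<bar>b x y\<bar> \<le> L * (s * (1 + D))"
            using bb[of x y] mult_left_mono[OF mult_left_mono[OF y, of s], of L] L s by simp
          ultimately show ?thesis unfolding abs_mult using L s D by (intro mult_mono) auto
        qed
      qed (use L s D L0 in auto)
      moreover have "(norm ?k)^3 = (norm h)^3 / s^3" using s by (simp add: power_divide)
      ultimately have "\<bar>moll s f (x + h) - moll s f x - p x \<bullet> h - h \<bullet> A x h / 2\<bar>
        \<le> ((L * (s * (1 + D)) * (\<Lambda>0 * ((norm h)^3 / s^3))) * V) / m"
        using m by (simp only: abs_divide abs_of_pos divide_right_mono less_imp_le)
      also have "\<dots> = (L * (s * (1 + D)) * \<Lambda>0 / s^3 * V / m) * (norm h)^3"
        by simp
      also have "\<dots> \<le> \<Lambda> * (norm h)^3" using A1 by (intro mult_right_mono) auto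
      finally show "\<bar>moll s f (x + h) - moll s f x - p x \<bullet> h - h \<bullet> A x h / 2\<bar> \<le> \<Lambda> * (norm h)^3" .
    qed
  qed
  with LL show ?thesis by blast
qed

section \<open>Discrete heat flow\<close>

text \<open>One step of a symmetric random walk. For small \<open>a\<close> it changes
  \<open>f\<close> by about a^2 / (2 \<open>CARD('m)\<close>) times the sum of the second
  derivatives along the \<open>d k\<close>, so j steps with a^2 = 2 \<open>CARD('m)\<close> t / j
  approximate the heat flow of that operator up to time t.\<close>

definition walk :: "('m::finite \<Rightarrow> 'a::real_vector) \<Rightarrow> real \<Rightarrow> ('a \<Rightarrow> real) \<Rightarrow> 'a \<Rightarrow> real" where
  "walk d a f x = (\<Sum>k\<in>UNIV. f (x + a *\<^sub>R d k) + f (x - a *\<^sub>R d k)) / (2 * CARD('m))"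

lemma walk_mono: "(\<And>y. f y \<le> g y) \<Longrightarrow> walk d a f x \<le> walk d a g x"
  unfolding walk_def by (intro divide_right_mono sum_mono add_mono) auto

lemma walk_add: "walk d a (\<lambda>y. f y + g y) x = walk d a f x + walk d a g x"
  unfolding walk_def by (simp add: sum.distrib add_divide_distrib)

lemma walk_cmult: "walk d a (\<lambda>y. c * f y) x = c * walk d a f x"
proof -
  have "c * f (x + a *\<^sub>R d k) + c * f (x - a *\<^sub>R d k) = c * (f (x + a *\<^sub>R d k) + f (x - a *\<^sub>R d k))" for k
    by (simp add: distrib_left)
  then show ?thesis unfolding walk_def by (simp add: sum_distrib_left)
qed

lemma walk_const: "walk d a (\<lambda>y. c) x = c"
  unfolding walk_def by simp

lemma walk_lipschitz:
  fixes f :: "'a::real_normed_vector \<Rightarrow> real" and d :: "'m::finite \<Rightarrow> 'a"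
  assumes "L-lipschitz_on UNIV f" shows "L-lipschitz_on UNIV (walk d a f)"
proof (rule lipschitz_onI)
  fix x y
  have d: "\<bar>f (x + z) - f (y + z)\<bar> \<le> L * dist x y" for z
    using lipschitz_onD[OF assms(1), of "x + z" "y + z"] by (simp add: dist_norm)
  have d': "\<bar>f (x - z) - f (y - z)\<bar> \<le> L * dist x y" for z using d[of "-z"] by simp
  have "walk d a f x - walk d a f y = (\<Sum>k\<in>UNIV. (f (x + a *\<^sub>R d k) - f (y + a *\<^sub>R d k)) + (f (x - a *\<^sub>R d k) - f (y - a *\<^sub>R d k))) / (2 * CARD('m))"
    unfolding walk_def by (simp add: sum_subtractf sum.distrib diff_divide_distrib add_divide_distrib)
  also have "\<bar>\<dots>\<bar> \<le> (\<Sum>k\<in>(UNIV::'m set). 2 * (L * dist x y)) / (2 * CARD('m))"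
  proof -
    have "\<bar>\<Sum>k\<in>(UNIV::'m set). (f (x + a *\<^sub>R d k) - f (y + a *\<^sub>R d k)) + (f (x - a *\<^sub>R d k) - f (y - a *\<^sub>R d k))\<bar> \<le> (\<Sum>k\<in>(UNIV::'m set). 2 * (L * dist x y))"
    proof (rule order_trans[OF sum_abs sum_mono])
      fix k
      show "\<bar>(f (x + a *\<^sub>R d k) - f (y + a *\<^sub>R d k)) + (f (x - a *\<^sub>R d k) - f (y - a *\<^sub>R d k))\<bar> \<le> 2 * (L * dist x y)"
        using d[of "a *\<^sub>R d k"] d'[of "a *\<^sub>R d k"] by linarith
    qed
    from divide_right_mono[OF this, of "2 * real CARD('m)"] show ?thesis unfolding abs_divide by simp
  qed
  also have "\<dots> = L * dist x y" by simp
  finally show "dist (walk d a f x) (walk d a f y) \<le> L * dist x y" by (simp add: dist_real_def)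
qed (rule lipschitz_on_nonneg[OF assms])

lemma walk_moll:
  fixes d :: "'m::finite \<Rightarrow> 'a::euclidean_space"
  assumes "continuous_on UNIV f"
  shows "moll s (walk d a f) x = walk d a (moll s f) x"
proof -
  have c: "continuous_on UNIV (\<lambda>x. f (x + c))" for c
    by (intro continuous_intros continuous_on_compose2[OF assms]) auto
  have c': "continuous_on UNIV (\<lambda>x. f (x - c))" for c
    by (intro continuous_intros continuous_on_compose2[OF assms]) auto
  have eq: "walk d a f = (\<lambda>x. (\<Sum>k\<in>UNIV. f (x + a *\<^sub>R d k) + f (x - a *\<^sub>R d k)) / (2 * CARD('m)))"
    unfolding walk_def by auto
  show ?thesis unfolding eq moll_divide using c c'
    by (simp add: moll_sum moll_add continuous_on_add moll_shift moll_shift[of _ _ "- _", simplified] walk_def)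
qed

text \<open>Both operations average translates, so they commute. This is where it matters that the
  directions \<open>d k\<close> do not depend on the point.\<close>

lemma walk_pow_moll:
  assumes "L-lipschitz_on UNIV f"
  shows "moll s ((walk d a ^^ j) f) x = (walk d a ^^ j) (moll s f) x \<and> L-lipschitz_on UNIV ((walk d a ^^ j) f)"
proof (induction j arbitrary: x)
  case 0
  then show ?case using assms by simp
next
  case (Suc j)
  have c: "continuous_on UNIV ((walk d a ^^ j) f)" using Suc lipschitz_on_continuous_on by blast
  have "moll s ((walk d a ^^ j) f) = (walk d a ^^ j) (moll s f)" using Suc by auto
  then show ?case using Suc walk_lipschitz[of L "(walk d a ^^ j) f" d a] walk_moll[OF c, of s d a x] by simp
qed

section \<open>Functions with uniform second-order expansions\<close>

lemma second_orderD:
  assumes "second_order \<Lambda> f G"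
  shows "quad_form (G x)" "\<bar>G x h\<bar> \<le> \<Lambda> * (norm h)^2"
    "\<exists>p. \<forall>h. norm h \<le> 1 \<longrightarrow> \<bar>f (x + h) - f x - p \<bullet> h - G x h / 2\<bar> \<le> \<Lambda> * (norm h)^3"
  using assms unfolding second_order_def by auto

lemma second_order_diff2:
  assumes "second_order \<Lambda> f G" "norm h \<le> 1"
  shows "\<bar>f (x + h) + f (x - h) - 2 * f x - G x h\<bar> \<le> 2 * \<Lambda> * (norm h)^3"
proof -
  obtain p where p: "\<And>h. norm h \<le> 1 \<Longrightarrow> \<bar>f (x + h) - f x - p \<bullet> h - G x h / 2\<bar> \<le> \<Lambda> * (norm h)^3"
    using second_orderD(3)[OF assms(1)] by blast
  have "G x (-h) = G x h" by (rule quad_form_minus[OF second_orderD(1)[OF assms(1)]])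
  then show ?thesis using p[of h] p[of "-h"] assms(2) by (simp add: abs_le_iff)
qed

lemma second_order_mono: "second_order \<Lambda> f G \<Longrightarrow> \<Lambda> \<le> \<Lambda>' \<Longrightarrow> second_order \<Lambda>' f G"
  unfolding second_order_def by (meson mult_right_mono norm_ge_zero order_trans zero_le_power zero_le_power2)

lemma second_order_add:
  assumes "second_order \<Lambda> f G" "second_order \<Lambda>' f' G'"
  shows "second_order (\<Lambda> + \<Lambda>') (\<lambda>x. f x + f' x) (\<lambda>x h. G x h + G' x h)"
  unfolding second_order_def
proof (intro allI conjI)
  fix x
  show "quad_form (\<lambda>h. G x h + G' x h)"
    using assms by (intro quad_form_add second_orderD(1))
  show "\<bar>G x h + G' x h\<bar> \<le> (\<Lambda> + \<Lambda>') * (norm h)\<^sup>2" for h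
    using second_orderD(2)[OF assms(1), of x h] second_orderD(2)[OF assms(2), of x h]
      abs_triangle_ineq[of "G x h" "G' x h"] by (simp add: distrib_right)
  obtain p where p: "\<And>h. norm h \<le> 1 \<Longrightarrow> \<bar>f (x + h) - f x - p \<bullet> h - G x h / 2\<bar> \<le> \<Lambda> * (norm h)^3"
    using second_orderD(3)[OF assms(1)] by blast
  obtain q where q: "\<And>h. norm h \<le> 1 \<Longrightarrow> \<bar>f' (x + h) - f' x - q \<bullet> h - G' x h / 2\<bar> \<le> \<Lambda>' * (norm h)^3"
    using second_orderD(3)[OF assms(2)] by blast
  show "\<exists>p. \<forall>h. norm h \<le> 1 \<longrightarrow>
             \<bar>f (x + h) + f' (x + h) - (f x + f' x) - p \<bullet> h - (G x h + G' x h) / 2\<bar>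
             \<le> (\<Lambda> + \<Lambda>') * norm h ^ 3"
  proof (intro exI[of _ "p + q"] allI impI)
    fix h :: 'a assume h: "norm h \<le> 1"
    have e: "f (x + h) + f' (x + h) - (f x + f' x) - (p + q) \<bullet> h - (G x h + G' x h) / 2
       = (f (x + h) - f x - p \<bullet> h - G x h / 2) + (f' (x + h) - f' x - q \<bullet> h - G' x h / 2)"
      by (simp add: inner_add_left field_simps)
    show "\<bar>f (x + h) + f' (x + h) - (f x + f' x) - (p + q) \<bullet> h - (G x h + G' x h) / 2\<bar>
             \<le> (\<Lambda> + \<Lambda>') * norm h ^ 3"
      unfolding e distrib_right using p[OF h] q[OF h] by linarith
  qed
qed

lemma second_order_cmult:
  assumes "second_order \<Lambda> f G"
  shows "second_order (\<bar>c\<bar> * \<Lambda>) (\<lambda>x. c * f x) (\<lambda>x h. c * G x h)"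
  unfolding second_order_def
proof (intro allI conjI)
  fix x
  show "quad_form (\<lambda>h. c * G x h)"
    using assms by (intro quad_form_cmult second_orderD(1))
  show "\<bar>c * G x h\<bar> \<le> (\<bar>c\<bar> * \<Lambda>) * (norm h)\<^sup>2" for h
    using mult_left_mono[OF second_orderD(2)[OF assms(1), of x h], of "\<bar>c\<bar>"] by (simp add: abs_mult)
  obtain p where p: "\<And>h. norm h \<le> 1 \<Longrightarrow> \<bar>f (x + h) - f x - p \<bullet> h - G x h / 2\<bar> \<le> \<Lambda> * (norm h)^3"
    using second_orderD(3)[OF assms(1)] by blast
  show "\<exists>p. \<forall>h. norm h \<le> 1 \<longrightarrow>
             \<bar>c * f (x + h) - c * f x - p \<bullet> h - c * G x h / 2\<bar> \<le> (\<bar>c\<bar> * \<Lambda>) * norm h ^ 3"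
  proof (intro exI[of _ "c *\<^sub>R p"] allI impI)
    fix h :: 'a assume h: "norm h \<le> 1"
    have e: "c * f (x + h) - c * f x - (c *\<^sub>R p) \<bullet> h - c * G x h / 2 = c * (f (x + h) - f x - p \<bullet> h - G x h / 2)"
      by (simp add: field_simps)
    show "\<bar>c * f (x + h) - c * f x - (c *\<^sub>R p) \<bullet> h - c * G x h / 2\<bar> \<le> (\<bar>c\<bar> * \<Lambda>) * norm h ^ 3"
      unfolding e abs_mult using mult_left_mono[OF p[OF h], of "\<bar>c\<bar>"] by simp
  qed
qed

lemma second_order_shift:
  assumes "second_order \<Lambda> f G"
  shows "second_order \<Lambda> (\<lambda>x. f (x + c)) (\<lambda>x. G (x + c))"
  unfolding second_order_def
proof (intro allI conjI)
  fix x
  show "\<exists>p. \<forall>h. norm h \<le> 1 \<longrightarrow> \<bar>f (x + h + c) - f (x + c) - p \<bullet> h - G (x + c) h / 2\<bar> \<le> \<Lambda> * norm h ^ 3"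
    using second_orderD(3)[OF assms, of "x + c"] by (simp add: add.commute add.left_commute)
qed (use second_orderD[OF assms] in auto)

lemma second_order_sum:
  fixes \<Lambda> :: real
  assumes "finite I" "\<And>k. k \<in> I \<Longrightarrow> second_order \<Lambda> (f k) (G k)"
  shows "second_order (card I * \<Lambda>) (\<lambda>x. \<Sum>k\<in>I. f k x) (\<lambda>x h. \<Sum>k\<in>I. G k x h)"
  using assms
proof (induction I rule: finite_induct)
  case empty
  then show ?case by (auto simp: second_order_def quad_form_zero intro!: exI[of _ 0])
next
  case (insert k I)
  then have "second_order (\<Lambda> + card I * \<Lambda>) (\<lambda>x. f k x + (\<Sum>k\<in>I. f k x)) (\<lambda>x h. G k x h + (\<Sum>k\<in>I. G k x h))"
    by (intro second_order_add) auto
  then show ?case using insert by (simp add: algebra_simps)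
qed

lemma second_order_walk:
  fixes d :: "'m::finite \<Rightarrow> 'a::euclidean_space"
  assumes "second_order \<Lambda> f G"
  shows "\<exists>G'. second_order \<Lambda> (walk d a f) G'"
proof -
  define g where "g k x = f (x + a *\<^sub>R d k) + f (x - a *\<^sub>R d k)" for k x
  have m: "real CARD('m) > 0" by simp
  have "\<exists>G'. second_order (2 * \<Lambda>) (g k) G'" for k
    using second_order_add[OF second_order_shift[OF assms, of "a *\<^sub>R d k"] second_order_shift[OF assms, of "- a *\<^sub>R d k"]]
    unfolding g_def by (auto intro!: exI)
  then obtain G' where G': "\<And>k. second_order (2 * \<Lambda>) (g k) (G' k)" by metis
  have "second_order (\<bar>1 / (2 * CARD('m))\<bar> * (CARD('m) * (2 * \<Lambda>))) (\<lambda>x. 1 / (2 * CARD('m)) * (\<Sum>k\<in>UNIV. g k x))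
     (\<lambda>x h. 1 / (2 * CARD('m)) * (\<Sum>k\<in>UNIV. G' k x h))"
    by (intro second_order_cmult second_order_sum G') simp
  moreover have "\<bar>1 / (2 * CARD('m))\<bar> * (CARD('m) * (2 * \<Lambda>)) = \<Lambda>" by simp
  moreover have "(\<lambda>x. 1 / (2 * CARD('m)) * (\<Sum>k\<in>UNIV. g k x)) = walk d a f"
    unfolding g_def walk_def by auto
  ultimately show ?thesis by auto
qed

text \<open>Odd terms cancel between the two signs of each direction; the Hessian term and the cubic
  remainders are left.\<close>

lemma second_order_walk_step:
  fixes d :: "'m::finite \<Rightarrow> 'a::euclidean_space"
  assumes so: "second_order \<Lambda> f G" and D: "\<And>k. norm (d k) \<le> D" and a: "0 < a" "a * D \<le> 1"
  shows "\<bar>walk d a f x - f x - a^2 / (2 * CARD('m)) * (\<Sum>k\<in>UNIV. G x (d k))\<bar> \<le> \<Lambda> * (a * D)^3"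
proof -
  have D0: "D \<ge> 0" using D[of undefined] norm_ge_zero order_trans by blast
  have "0 \<le> \<Lambda> * (norm (d k))\<^sup>2" for k
    using second_orderD(2)[OF so, of x "d k"] by linarith
  have nd: "norm (a *\<^sub>R d k) \<le> a * D" for k using D[of k] a by (simp add: mult_left_mono)
  have L0: "\<Lambda> \<ge> 0"
  proof -
    obtain b :: 'a where b: "b \<in> Basis" using nonempty_Basis by blast
    show ?thesis using second_orderD(2)[OF so, of x b] b by simp
  qed
  let ?N = "2 * real CARD('m)"
  have "walk d a f x - f x - a^2 / ?N * (\<Sum>k\<in>UNIV. G x (d k)) =
     (\<Sum>k\<in>UNIV. f (x + a *\<^sub>R d k) + f (x - a *\<^sub>R d k) - 2 * f x - G x (a *\<^sub>R d k)) / ?N"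
    unfolding walk_def quad_form_scale[OF second_orderD(1)[OF so]]
    by (simp add: sum_subtractf sum.distrib diff_divide_distrib sum_distrib_left sum_divide_distrib)
  also have "\<bar>\<dots>\<bar> \<le> (\<Sum>k\<in>(UNIV::'m set). 2 * \<Lambda> * (a * D)^3) / ?N"
    unfolding abs_divide
  proof (intro divide_mono order_trans[OF sum_abs sum_mono])
    fix k
    have "\<bar>f (x + a *\<^sub>R d k) + f (x - a *\<^sub>R d k) - 2 * f x - G x (a *\<^sub>R d k)\<bar> \<le> 2 * \<Lambda> * (norm (a *\<^sub>R d k))^3"
      by (rule second_order_diff2[OF so order_trans[OF nd a(2)]])
    also have "\<dots> \<le> 2 * \<Lambda> * (a * D)^3"
      using nd[of k] L0 by (intro mult_left_mono power_mono) auto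
    finally show "\<bar>f (x + a *\<^sub>R d k) + f (x - a *\<^sub>R d k) - 2 * f x - G x (a *\<^sub>R d k)\<bar> \<le> 2 * \<Lambda> * (a * D)^3" .
  qed (auto simp: L0 D0 a less_imp_le)
  also have "\<dots> = \<Lambda> * (a * D)^3" by simp
  finally show ?thesis by simp
qed

text \<open>Both Hessians are compared with second differences of step \<open>b\<close>.\<close>

lemma second_order_close:
  assumes f: "second_order \<Lambda> f G" and g: "second_order \<Lambda> g G'" and close: "\<And>y. \<bar>f y - g y\<bar> \<le> \<delta>"
    and b: "b > 0" "b * D \<le> 1" "norm h \<le> D"
  shows "\<bar>G x h - G' x h\<bar> \<le> 4 * \<delta> / b\<^sup>2 + 4 * \<Lambda> * b * D^3"
proof -
  have L0: "\<Lambda> \<ge> 0"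
  proof -
    obtain b :: 'a where b: "b \<in> Basis" using nonempty_Basis by blast
    show ?thesis using second_orderD(2)[OF f, of x b] b by simp
  qed
  have nb: "norm (b *\<^sub>R h) \<le> b * D" using b by simp
  then have nb1: "norm (b *\<^sub>R h) \<le> 1" using b(2) by (rule order_trans)
  have "\<Lambda> * (norm (b *\<^sub>R h))^3 \<le> \<Lambda> * (b * D)^3"
    using nb L0 by (intro mult_left_mono power_mono) auto
  then have "\<bar>G x (b *\<^sub>R h) - G' x (b *\<^sub>R h)\<bar> \<le> 4 * \<delta> + 4 * (\<Lambda> * (b * D)^3)"
    using second_order_diff2[OF f nb1, of x] second_order_diff2[OF g nb1, of x]
      close[of x] close[of "x + b *\<^sub>R h"] close[of "x - b *\<^sub>R h"] by linarith
  moreover have "G x (b *\<^sub>R h) - G' x (b *\<^sub>R h) = b\<^sup>2 * (G x h - G' x h)"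
    using quad_form_scale second_orderD(1)[OF f] second_orderD(1)[OF g] by (metis right_diff_distrib)
  ultimately have "b\<^sup>2 * \<bar>G x h - G' x h\<bar> \<le> 4 * \<delta> + 4 * (\<Lambda> * (b * D)^3)" by (simp add: abs_mult)
  then have "\<bar>G x h - G' x h\<bar> \<le> (4 * \<delta> + 4 * (\<Lambda> * (b * D)^3)) / b\<^sup>2"
    using b by (simp add: field_simps)
  also have "\<dots> = 4 * \<delta> / b\<^sup>2 + 4 * \<Lambda> * b * D^3"
    using b by (simp add: field_simps power2_eq_square power3_eq_cube)
  finally show ?thesis .
qed

lemma second_order_nonneg: "second_order \<Lambda> f G \<Longrightarrow> \<Lambda> \<ge> 0"
proof -
  assume so: "second_order \<Lambda> f G"
  obtain b :: 'a where b: "b \<in> Basis" using nonempty_Basis by blast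
  show ?thesis using second_orderD(2)[OF so, of undefined b] b by simp
qed

lemma second_order_expansion:
  assumes so: "second_order \<Lambda> f G"
  obtains p where "\<And>e. e > 0 \<Longrightarrow> \<exists>r>0. \<forall>h. norm h < r \<longrightarrow> \<bar>f (x + h) - f x - p \<bullet> h - G x h / 2\<bar> \<le> e * (norm h)\<^sup>2"
proof -
  obtain p where p: "\<And>h. norm h \<le> 1 \<Longrightarrow> \<bar>f (x + h) - f x - p \<bullet> h - G x h / 2\<bar> \<le> \<Lambda> * (norm h)^3"
    using second_orderD(3)[OF so] by blast
  note L0 = second_order_nonneg[OF so]
  have "\<exists>r>0. \<forall>h. norm h < r \<longrightarrow> \<bar>f (x + h) - f x - p \<bullet> h - G x h / 2\<bar> \<le> e * (norm h)\<^sup>2" if e: "e > 0" for e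
  proof -
    define r where "r = min 1 (e / (\<Lambda> + 1))"
    have r: "r > 0" "r \<le> 1" "\<Lambda> * r \<le> e"
    proof -
      show "r > 0" "r \<le> 1" unfolding r_def using e L0 by auto
      have "\<Lambda> * r \<le> \<Lambda> * (e / (\<Lambda> + 1))" unfolding r_def using L0 by (intro mult_left_mono) auto
      also have "\<dots> \<le> e" using e L0 by (simp add: field_simps)
      finally show "\<Lambda> * r \<le> e" .
    qed
    have "\<bar>f (x + h) - f x - p \<bullet> h - G x h / 2\<bar> \<le> e * (norm h)\<^sup>2" if h: "norm h < r" for h
    proof -
      have "\<Lambda> * (norm h)^3 = (\<Lambda> * norm h) * (norm h)\<^sup>2" by (simp add: power_eq_if)
      also have "\<dots> \<le> e * (norm h)\<^sup>2"
        using h r mult_left_mono[of "norm h" r \<Lambda>] L0 by (intro mult_right_mono) auto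
      finally show ?thesis using p[of h] h r by linarith
    qed
    then show ?thesis using r(1) by blast
  qed
  then show ?thesis using that by blast
qed

text \<open>The quadratic penalty beats the linear growth of \<open>f\<close> outside the ball of
  radius B/\<nu>, so a maximum over that ball is global.\<close>

lemma penalized_max:
  fixes f :: "'a::euclidean_space \<Rightarrow> real"
  assumes "B-lipschitz_on UNIV f" "\<nu> > 0"
  obtains x where "\<And>y. f y - \<nu> * (norm y)\<^sup>2 \<le> f x - \<nu> * (norm x)\<^sup>2"
proof -
  define R where "R = B / \<nu>"
  have B: "B \<ge> 0" by (rule lipschitz_on_nonneg[OF assms(1)])
  have R: "R \<ge> 0" unfolding R_def using B assms(2) by simp
  let ?F = "\<lambda>y. f y - \<nu> * (norm y)\<^sup>2"
  have "continuous_on (cball 0 R) ?F"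
    by (intro continuous_intros continuous_on_subset[OF lipschitz_on_continuous_on[OF assms(1)]]) auto
  then obtain x where x: "x \<in> cball 0 R" "\<And>y. y \<in> cball 0 R \<Longrightarrow> ?F y \<le> ?F x"
    using continuous_attains_sup[of "cball 0 R" ?F] R by auto
  have "?F y \<le> ?F x" for y
  proof (cases "norm y \<le> R")
    case False
    have "\<bar>f y - f 0\<bar> \<le> B * norm y" using lipschitz_onD[OF assms(1), of y 0] by (simp add: dist_norm)
    moreover have "B * norm y \<le> \<nu> * (norm y)\<^sup>2"
    proof -
      have "B \<le> \<nu> * norm y" using False assms(2) unfolding R_def by (simp add: field_simps)
      then show ?thesis using mult_right_mono[of B "\<nu> * norm y" "norm y"] by (simp add: power2_eq_square)
    qed
    ultimately have "?F y \<le> ?F 0" by simp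
    also have "\<dots> \<le> ?F x" using x(2)[of 0] R by simp
    finally show ?thesis .
  qed (use x in auto)
  then show ?thesis using that by blast
qed

text \<open>One step of the discrete maximum principle: \<open>z\<close> touches \<open>c\<close> from above at a penalized
  maximum of \<open>c - z\<close>, so the Hessian of \<open>z\<close> there is constrained by the jets of \<open>c\<close>.\<close>

lemma max_principle_step:
  fixes c :: "'a::euclidean_space \<Rightarrow> real" and d :: "'m::finite \<Rightarrow> 'a"
  assumes c: "B-lipschitz_on UNIV c" and z: "B'-lipschitz_on UNIV z" "second_order \<Lambda> z G"
    and jets: "\<And>x p Q. quad_form Q \<Longrightarrow> upper_jet UNIV c x p Q \<Longrightarrow> (\<Sum>k\<in>UNIV. Q (d k)) \<ge> \<eta> x"
    and step: "\<And>x. z x - z' x \<ge> \<tau> * ((\<Sum>k\<in>UNIV. G x (d k)) - \<eta> x) - \<tau> * e"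
    and le: "\<And>x. c x - z' x \<le> K" and tau: "\<tau> \<ge> 0"
  shows "c x0 - z x0 \<le> K + \<tau> * e"
proof (rule field_le_epsilon)
  fix \<epsilon> :: real assume eps: "\<epsilon> > 0"
  define S where "S = (\<Sum>k\<in>(UNIV::'m set). (norm (d k))\<^sup>2)"
  have S: "S \<ge> 0" unfolding S_def by (simp add: sum_nonneg)
  \<comment> \<open>One part of \<epsilon> pays for the Hessian of the penalty summed over the
    \<open>d k\<close>, the other for the penalty at \<open>x0\<close>.\<close>
  define \<nu> where "\<nu> = \<epsilon> / (2 * \<tau> * S + (norm x0)\<^sup>2 + 1)"
  have den: "2 * \<tau> * S + (norm x0)\<^sup>2 + 1 > 0" using tau S by (simp add: add_nonneg_pos)
  have nu: "\<nu> > 0" unfolding \<nu>_def using eps den by simp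
  obtain x where x: "\<And>y. (c y - z y) - \<nu> * (norm y)\<^sup>2 \<le> (c x - z x) - \<nu> * (norm x)\<^sup>2"
    using penalized_max[OF lipschitz_on_diff[OF c z(1)] nu] by metis
  obtain p where p: "\<And>e. e > 0 \<Longrightarrow> \<exists>r>0. \<forall>h. norm h < r \<longrightarrow> \<bar>z (x + h) - z x - p \<bullet> h - G x h / 2\<bar> \<le> e * (norm h)\<^sup>2"
    using second_order_expansion[OF z(2)] by metis
  \<comment> \<open>\<open>c\<close> lies below a constant plus \<open>z\<close> plus the penalty,
    with equality at \<open>x\<close>, so the Hessians of the latter two form an upper jet of
    \<open>c\<close>.\<close>
  let ?Q = "\<lambda>h. G x h + 2 * \<nu> * (norm h)\<^sup>2"
  have "quad_form ?Q"
    by (intro quad_form_add quad_form_cmult quad_form_norm second_orderD(1)[OF z(2)])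
  moreover have "upper_jet UNIV c x (p + (2 * \<nu>) *\<^sub>R x) ?Q"
  proof (rule upper_jetI_ball)
    fix e :: real assume e: "e > 0"
    obtain r where r: "r > 0" "\<And>h. norm h < r \<Longrightarrow> \<bar>z (x + h) - z x - p \<bullet> h - G x h / 2\<bar> \<le> e * (norm h)\<^sup>2"
      using p[OF e] by blast
    have "c (x + h) \<le> c x + (p + (2 * \<nu>) *\<^sub>R x) \<bullet> h + ?Q h / 2 + e * (norm h)\<^sup>2" if h: "norm h < r" for h
    proof -
      have "z (x + h) \<le> z x + p \<bullet> h + G x h / 2 + e * (norm h)\<^sup>2"
        using r(2)[OF h] by (simp add: abs_le_iff)
      moreover have "(norm (x + h))\<^sup>2 = (norm x)\<^sup>2 + 2 * (x \<bullet> h) + (norm h)\<^sup>2"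
        by (simp add: power2_norm_eq_inner inner_add_left inner_add_right inner_commute)
      ultimately show ?thesis using x[of "x + h"]
        by (simp add: inner_add_left field_simps)
    qed
    then show "\<exists>r>0. \<forall>h. x + h \<in> UNIV \<longrightarrow> norm h < r \<longrightarrow>
      c (x + h) \<le> c x + (p + (2 * \<nu>) *\<^sub>R x) \<bullet> h + ?Q h / 2 + e * (norm h)\<^sup>2" using r(1) by blast
  qed
  ultimately have "\<eta> x \<le> (\<Sum>k\<in>UNIV. ?Q (d k))" by (rule jets)
  also have "\<dots> = (\<Sum>k\<in>UNIV. G x (d k)) + 2 * \<nu> * S"
    unfolding S_def by (simp add: sum.distrib sum_distrib_left)
  finally have "\<tau> * (- 2 * \<nu> * S) \<le> \<tau> * ((\<Sum>k\<in>UNIV. G x (d k)) - \<eta> x)"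
    using tau by (intro mult_left_mono) auto
  then have "c x - z x \<le> K + \<tau> * e + 2 * \<tau> * S * \<nu>"
    using step[of x] le[of x] by (simp add: algebra_simps)
  then have "c x0 - z x0 \<le> K + \<tau> * e + \<nu> * (2 * \<tau> * S + (norm x0)\<^sup>2)"
  proof -
    have "0 \<le> \<nu> * (norm x)\<^sup>2" using nu by simp
    then have "c x0 - z x0 \<le> (c x - z x) + \<nu> * (norm x0)\<^sup>2" using x[of x0] by linarith
    moreover have "\<nu> * (2 * \<tau> * S + (norm x0)\<^sup>2) = 2 * \<tau> * S * \<nu> + \<nu> * (norm x0)\<^sup>2" by (simp add: algebra_simps)
    ultimately show ?thesis using \<open>c x - z x \<le> _\<close> by linarith
  qed
  also have "\<nu> * (2 * \<tau> * S + (norm x0)\<^sup>2) \<le> \<epsilon>"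
    unfolding \<nu>_def using den eps by (simp add: field_simps)
  finally show "c x0 - z x0 \<le> K + \<tau> * e + \<epsilon>" by simp
qed

text \<open>By the jet hypothesis \<open>c\<close> is a stationary subsolution of the heat equation
  with sink h \<psi>. The scheme \<open>z\<close> solves this equation explicitly, starting from the
  mollified \<open>c\<close>, and comparison keeps \<open>c\<close> below \<open>z j\<close> up to
  small errors (\<open>clow\<close>). On the other hand the sink lowers the pure walk by about t h
  \<psi> (\<open>zup\<close>); the diffusion of \<psi> itself accounts for the t^2 loss.\<close>

lemma heat_lower:
  fixes c \<psi> :: "'a::euclidean_space \<Rightarrow> real" and d :: "'m::finite \<Rightarrow> 'a"
  assumes c: "B-lipschitz_on UNIV c" and chi: "B'-lipschitz_on UNIV \<psi>" "second_order \<Lambda>' \<psi> G'"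
    and h: "h \<ge> 0"
    and jets: "\<And>x p Q. quad_form Q \<Longrightarrow> upper_jet UNIV c x p Q \<Longrightarrow> (\<Sum>k\<in>UNIV. Q (d k)) \<ge> h * \<psi> x"
    and chi01: "\<And>x. \<bar>\<psi> x\<bar> \<le> 1"
  obtains C where "C \<ge> 0" "\<And>t e. 0 < t \<Longrightarrow> t \<le> 1 \<Longrightarrow> e > 0 \<Longrightarrow>
     \<forall>\<^sub>F j in sequentially. \<forall>x. c x + t * h * \<psi> x - C * t\<^sup>2 \<le> (walk d (sqrt (2 * real CARD('m) * t / real j)) ^^ j) c x + e"
proof -
  define m where "m = real CARD('m)"
  have m: "m > 0" unfolding m_def by simp
  have B: "B \<ge> 0" using lipschitz_on_nonneg[OF c] .
  note L' = second_order_nonneg[OF chi(2)]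
  define D where "D = 1 + (\<Sum>k\<in>(UNIV::'m set). norm (d k))"
  have D: "D \<ge> 1" "\<And>k. norm (d k) \<le> D"
  proof -
    show "D \<ge> 1" unfolding D_def by (simp add: sum_nonneg)
    show "norm (d k) \<le> D" for k using member_le_sum[of k UNIV "\<lambda>k. norm (d k)"] unfolding D_def by simp
  qed
  define Cx where "Cx = m * \<Lambda>' * D^2 + 2 * m * \<Lambda>' * D^3"
  have Cx: "Cx \<ge> 0" unfolding Cx_def using m L' D by simp
  show ?thesis
  proof (rule that[of "h * Cx"])
    show "h * Cx \<ge> 0" using h Cx by simp
    fix t e :: real assume t: "0 < t" "t \<le> 1" and e: "e > 0"
    \<comment> \<open>Replacing \<open>c\<close> by its mollification costs e/4 in
      \<open>clow\<close> and again in \<open>zup\<close>; the remaining e/2 is for the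
      scheme.\<close>
    define s where "s = e / (4 * (B + 1))"
    have s: "s > 0" "B * s \<le> e / 4" unfolding s_def using e B by (auto simp: field_simps)
    obtain \<Lambda>s Gs where cs: "\<Lambda>s \<ge> 0" "second_order \<Lambda>s (moll s c) Gs"
      using moll_second_order[OF c s(1)] by blast
    define \<Lambda> where "\<Lambda> = \<Lambda>s + h * \<Lambda>'"
    have L: "\<Lambda> \<ge> 0" unfolding \<Lambda>_def using cs h L' by simp
    \<comment> \<open>The consistency error of one step divided by its duration \<tau>; it tends to
      0 with \<open>a\<close>.\<close>
    define E where "E a = 2 * m * \<Lambda> * a * D^3 + m * (4 * a * (\<Lambda> * D^2 / 2 + \<Lambda> * a * D^3 + h / (2 * m)) + 4 * \<Lambda> * sqrt a * D^3)" for a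
    define a where "a j = sqrt (2 * m * t / real j)" for j :: nat
    have a0: "a \<longlonglongrightarrow> 0"
    proof -
      have "(\<lambda>j. sqrt (2 * m * t / real j)) \<longlonglongrightarrow> sqrt 0"
        by (intro tendsto_real_sqrt lim_const_over_n)
      then show ?thesis unfolding a_def by simp
    qed
    have E0: "(\<lambda>j. E (a j)) \<longlonglongrightarrow> 0"
    proof -
      have "(\<lambda>j. E (a j)) \<longlonglongrightarrow> 2 * m * \<Lambda> * 0 * D^3 + m * (4 * 0 * (\<Lambda> * D^2 / 2 + \<Lambda> * 0 * D^3 + h / (2 * m)) + 4 * \<Lambda> * sqrt 0 * D^3)"
        unfolding E_def by (intro tendsto_intros a0) (use m in auto)
      then show ?thesis by simp
    qed
    have ev1: "\<forall>\<^sub>F j in sequentially. E (a j) < e / 2"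
      using order_tendstoD(2)[OF E0, of "e/2"] e by simp
    have ev2: "\<forall>\<^sub>F j in sequentially. a j < (1 / D)^2"
      using order_tendstoD(2)[OF a0, of "(1/D)^2"] D by simp
    have ev3: "\<forall>\<^sub>F j in sequentially. j > (0::nat)" by (rule eventually_gt_at_top)
    show "\<forall>\<^sub>F j in sequentially. \<forall>x. c x + t * h * \<psi> x - h * Cx * t\<^sup>2 \<le> (walk d (sqrt (2 * real CARD('m) * t / real j)) ^^ j) c x + e"
      using ev1 ev2 ev3
    proof eventually_elim
      case (elim j)
      define \<alpha> where "\<alpha> = a j"
      define \<tau> where "\<tau> = t / real j"
      \<comment> \<open>Consecutive iterates differ by \<delta> = O(\<alpha>^2), and their Hessians
        are compared by second differences of step \<open>b\<close>. With b^2 = \<alpha> both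
        \<delta>/b^2 and the remainder of order \<open>b\<close> vanish in the limit.\<close>
      define b where "b = sqrt \<alpha>"
      have al: "\<alpha> > 0" unfolding \<alpha>_def a_def using m t elim by simp
      have al2: "\<alpha>^2 = 2 * m * \<tau>" unfolding \<alpha>_def a_def \<tau>_def using m t by simp
      have tau: "\<tau> > 0" "real j * \<tau> = t" unfolding \<tau>_def using t elim by auto
      have b: "b > 0" "b * D \<le> 1" "b^2 = \<alpha>" "b \<le> 1"
      proof -
        show "b > 0" "b^2 = \<alpha>" unfolding b_def using al by auto
        have "b \<le> sqrt ((1/D)^2)" unfolding b_def using elim(2) by (intro real_sqrt_le_mono) (simp add: \<alpha>_def)
        also have "\<dots> = 1 / D" using D by simp
        finally have "b \<le> 1 / D" .
        then show "b * D \<le> 1" using D by (simp add: field_simps)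
        show "b \<le> 1" using \<open>b \<le> 1 / D\<close> D by (auto intro: order_trans)
      qed
      have alb: "\<alpha> \<le> b"
      proof -
        have "b * b \<le> 1 * b" using b by (intro mult_right_mono) auto
        then show ?thesis using b(3) by (simp add: power2_eq_square)
      qed
      have al1: "\<alpha> \<le> 1" using alb b by simp
      have alD: "\<alpha> * D \<le> 1"
        by (rule order_trans[OF mult_right_mono[OF alb] b(2)]) (use D in auto)
      have aD3: "(\<alpha> * D)^3 = \<tau> * (2 * m * \<alpha> * D^3)"
      proof -
        have "(\<alpha> * D)^3 = \<alpha>^2 * \<alpha> * D^3" by (simp add: power_eq_if)
        then show ?thesis unfolding al2 by simp
      qed
      define z where "z i = rec_nat (moll s c) (\<lambda>_ f x. walk d \<alpha> f x - \<tau> * h * \<psi> x) i" for i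
      have z0: "z 0 = moll s c" and zS: "z (Suc i) = (\<lambda>x. walk d \<alpha> (z i) x - \<tau> * h * \<psi> x)" for i
        unfolding z_def by auto
      have reg: "\<exists>G. second_order (\<Lambda>s + real i * \<tau> * h * \<Lambda>') (z i) G \<and> (\<exists>B. B-lipschitz_on UNIV (z i))" for i
      proof (induction i)
        case 0
        then show ?case using cs moll_lipschitz[OF c] unfolding z0 by auto
      next
        case (Suc i)
        then obtain G B1 where IH: "second_order (\<Lambda>s + real i * \<tau> * h * \<Lambda>') (z i) G" "B1-lipschitz_on UNIV (z i)" by blast
        obtain G1 where G1: "second_order (\<Lambda>s + real i * \<tau> * h * \<Lambda>') (walk d \<alpha> (z i)) G1"
          using second_order_walk[OF IH(1)] by blast
        have e1: "\<Lambda>s + real (Suc i) * \<tau> * h * \<Lambda>' = (\<Lambda>s + real i * \<tau> * h * \<Lambda>') + \<bar>- (\<tau> * h)\<bar> * \<Lambda>'"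
          using tau h by (simp add: algebra_simps)
        have e2: "z (Suc i) = (\<lambda>x. walk d \<alpha> (z i) x + (- (\<tau> * h)) * \<psi> x)" unfolding zS by auto
        have "second_order (\<Lambda>s + real (Suc i) * \<tau> * h * \<Lambda>') (z (Suc i)) (\<lambda>x h'. G1 x h' + (- (\<tau> * h)) * G' x h')"
          unfolding e1 e2 by (intro second_order_add second_order_cmult G1 chi(2))
        moreover have "(B1 + \<bar>\<tau> * h\<bar> * B')-lipschitz_on UNIV (z (Suc i))"
        proof -
          have "(\<bar>\<tau> * h\<bar> * B')-lipschitz_on UNIV (\<lambda>x. (\<tau> * h) * \<psi> x)"
            using lipschitz_on_cmult_real[OF chi(1)] by simp
          then show ?thesis unfolding zS using lipschitz_on_diff[OF walk_lipschitz[OF IH(2)]] by simp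
        qed
        ultimately show ?case by blast
      qed
      \<comment> \<open>The sink adds \<tau> h \<Lambda>' per step and j \<tau> = t is at most 1, so
        one constant serves all iterates.\<close>
      have so: "\<exists>G. second_order \<Lambda> (z i) G \<and> (\<exists>B. B-lipschitz_on UNIV (z i))" if "i \<le> j" for i
      proof -
        have "real i * \<tau> \<le> 1" using mult_right_mono[of "real i" "real j" \<tau>] that tau t by simp
        then have "real i * \<tau> * (h * \<Lambda>') \<le> 1 * (h * \<Lambda>')" using h L' by (intro mult_right_mono) auto
        then have "\<Lambda>s + real i * \<tau> * h * \<Lambda>' \<le> \<Lambda>" unfolding \<Lambda>_def by simp
        then show ?thesis using reg[of i] second_order_mono by blast
      qed
      have clow: "c x - z i x \<le> B * s + real i * (\<tau> * E \<alpha>)" if "i \<le> j" for i x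
        using that
      proof (induction i arbitrary: x)
        case 0
        then show ?case using moll_close[OF c s(1), of x] unfolding z0 by (simp add: abs_le_iff)
      next
        case (Suc i)
        obtain G where G: "second_order \<Lambda> (z i) G" using so[of i] Suc.prems by auto
        obtain G1 B1 where G1: "second_order \<Lambda> (z (Suc i)) G1" "B1-lipschitz_on UNIV (z (Suc i))"
          using so[of "Suc i"] Suc.prems by auto
        define \<delta> where "\<delta> = \<tau> * (m * \<Lambda> * D^2) + \<Lambda> * (\<alpha> * D)^3 + \<tau> * h"
        have ws: "\<bar>walk d \<alpha> (z i) x - z i x - \<tau> * (\<Sum>k\<in>UNIV. G x (d k))\<bar> \<le> \<Lambda> * (\<alpha> * D)^3" for x
          using second_order_walk_step[where d=d, OF G D(2) al alD, of x] unfolding al2 using m by (simp add: m_def)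
        have GD: "\<bar>G x (d k)\<bar> \<le> \<Lambda> * D^2" for x k
        proof -
          have "(norm (d k))^2 \<le> D^2" using D by (intro power_mono) auto
          then show ?thesis using second_orderD(2)[OF G, of x "d k"] mult_left_mono[OF _ L] by (blast intro: order_trans)
        qed
        have GS: "\<bar>\<Sum>k\<in>UNIV. G x (d k)\<bar> \<le> m * \<Lambda> * D^2" for x
        proof -
          have "\<bar>\<Sum>k\<in>UNIV. G x (d k)\<bar> \<le> (\<Sum>k\<in>(UNIV::'m set). \<Lambda> * D^2)"
            by (rule order_trans[OF sum_abs sum_mono[OF GD]])
          then show ?thesis unfolding m_def by simp
        qed
        have close: "\<bar>z i x - z (Suc i) x\<bar> \<le> \<delta>" for x
        proof -
          have "\<bar>\<tau> * (\<Sum>k\<in>UNIV. G x (d k))\<bar> \<le> \<tau> * (m * \<Lambda> * D^2)"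
            using GS[of x] tau by (simp add: abs_mult)
          moreover have "\<bar>\<tau> * h * \<psi> x\<bar> \<le> \<tau> * h * 1"
            unfolding abs_mult using tau h chi01[of x] by (intro mult_mono) auto
          ultimately show ?thesis using ws[of x] unfolding zS \<delta>_def by linarith
        qed
        define e2 where "e2 = 4 * \<delta> / b\<^sup>2 + 4 * \<Lambda> * b * D^3"
        \<comment> \<open>The explicit step uses the Hessian of \<open>z i\<close>, whereas the
          maximum principle constrains that of \<open>z (Suc i)\<close>; the difference is charged
          to \<open>e2\<close>.\<close>
        have GG: "(\<Sum>k\<in>UNIV. G x (d k)) \<ge> (\<Sum>k\<in>UNIV. G1 x (d k)) - m * e2" for x
        proof -
          have "(\<Sum>k\<in>UNIV. G1 x (d k) - G x (d k)) \<le> (\<Sum>k\<in>(UNIV::'m set). e2)"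
            unfolding e2_def using second_order_close[OF G G1(1) close b(1,2) D(2)]
            by (intro sum_mono) (auto simp: abs_le_iff)
          then show ?thesis unfolding m_def by (simp add: sum_subtractf)
        qed
        have Ea: "\<tau> * E \<alpha> = \<Lambda> * (\<alpha> * D)^3 + \<tau> * (m * e2)"
        proof -
          have "\<delta> = \<alpha> * (\<alpha> * (\<Lambda> * D^2 / 2 + \<Lambda> * \<alpha> * D^3 + h / (2 * m)))"
          proof -
            have t2: "\<tau> = \<alpha>^2 / (2 * m)" using al2 m by simp
            show ?thesis unfolding \<delta>_def t2 using m by (simp add: field_simps power2_eq_square power3_eq_cube)
          qed
          then have "\<delta> / b\<^sup>2 = \<alpha> * (\<Lambda> * D^2 / 2 + \<Lambda> * \<alpha> * D^3 + h / (2 * m))" using b al by simp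
          then have e2': "e2 = 4 * \<alpha> * (\<Lambda> * D^2 / 2 + \<Lambda> * \<alpha> * D^3 + h / (2 * m)) + 4 * \<Lambda> * b * D^3"
            unfolding e2_def by (simp add: times_divide_eq_right[symmetric] del: times_divide_eq_right)
          have "E \<alpha> = 2 * m * \<Lambda> * \<alpha> * D^3 + m * e2" unfolding E_def e2' b_def ..
          then show ?thesis unfolding aD3 by (simp add: algebra_simps)
        qed
        have "c x - z (Suc i) x \<le> (B * s + real i * (\<tau> * E \<alpha>)) + \<tau> * E \<alpha>"
        proof (rule max_principle_step[OF c G1(2) G1(1) jets])
          show "\<tau> * ((\<Sum>k\<in>UNIV. G1 x (d k)) - h * \<psi> x) - \<tau> * E \<alpha> \<le> z (Suc i) x - z i x" for x
          proof -
            have "\<tau> * ((\<Sum>k\<in>UNIV. G1 x (d k)) - m * e2) \<le> \<tau> * (\<Sum>k\<in>UNIV. G x (d k))"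
              using GG[of x] tau by (intro mult_left_mono) auto
            then show ?thesis using ws[of x] unfolding Ea zS by (simp add: abs_le_iff algebra_simps)
          qed
          show "c x - z i x \<le> B * s + real i * (\<tau> * E \<alpha>)" for x using Suc by simp
        qed (use tau in auto)
        then show ?case by (simp add: algebra_simps)
      qed
      have chiw: "walk d \<alpha> \<psi> x \<ge> \<psi> x - \<tau> * Cx" for x
      proof -
        have ws: "\<bar>walk d \<alpha> \<psi> x - \<psi> x - \<tau> * (\<Sum>k\<in>UNIV. G' x (d k))\<bar> \<le> \<Lambda>' * (\<alpha> * D)^3"
          using second_order_walk_step[where d=d, OF chi(2) D(2) al alD, of x] unfolding al2 using m by (simp add: m_def)
        have GD: "\<bar>G' x (d k)\<bar> \<le> \<Lambda>' * D^2" for k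
        proof -
          have "(norm (d k))^2 \<le> D^2" using D by (intro power_mono) auto
          then show ?thesis using second_orderD(2)[OF chi(2), of x "d k"] mult_left_mono[OF _ L'] by (blast intro: order_trans)
        qed
        have "\<bar>\<Sum>k\<in>UNIV. G' x (d k)\<bar> \<le> (\<Sum>k\<in>(UNIV::'m set). \<Lambda>' * D^2)"
          by (rule order_trans[OF sum_abs sum_mono[OF GD]])
        then have "\<bar>\<Sum>k\<in>UNIV. G' x (d k)\<bar> \<le> m * \<Lambda>' * D^2" unfolding m_def by simp
        then have "\<tau> * (- (m * \<Lambda>' * D^2)) \<le> \<tau> * (\<Sum>k\<in>UNIV. G' x (d k))"
          using tau by (intro mult_left_mono) (auto simp: abs_le_iff)
        moreover have "\<Lambda>' * (\<alpha> * D)^3 \<le> \<tau> * (2 * m * \<Lambda>' * D^3)"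
        proof -
          have "\<Lambda>' * (\<alpha> * D)^3 = \<alpha> * (\<tau> * (2 * m * \<Lambda>' * D^3))" unfolding aD3 by simp
          also have "\<dots> \<le> 1 * (\<tau> * (2 * m * \<Lambda>' * D^3))"
            using al1 tau m L' D by (intro mult_right_mono) auto
          finally show ?thesis by simp
        qed
        ultimately show ?thesis using ws unfolding Cx_def by (simp add: abs_le_iff algebra_simps)
      qed
      have zup: "z i x \<le> (walk d \<alpha> ^^ i) c x + B * s - real i * \<tau> * h * \<psi> x + h * Cx * (real i * \<tau>)\<^sup>2" for i x
      proof (induction i arbitrary: x)
        case 0
        then show ?case using moll_close[OF c s(1), of x] unfolding z0 by (simp add: abs_le_iff)
      next
        case (Suc i)
        let ?w = "(walk d \<alpha> ^^ i) c"
        let ?K = "B * s + h * Cx * (real i * \<tau>)\<^sup>2"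
        let ?g = "\<lambda>x. (?w x + ?K) + (- (real i * \<tau> * h)) * \<psi> x"
        have "walk d \<alpha> (z i) x \<le> walk d \<alpha> ?g x"
          using Suc by (intro walk_mono) (simp add: algebra_simps)
        also have "\<dots> = walk d \<alpha> ?w x + ?K - (real i * \<tau> * h) * walk d \<alpha> \<psi> x"
          unfolding walk_add walk_cmult walk_const by simp
        also have "\<dots> \<le> walk d \<alpha> ?w x + ?K - (real i * \<tau> * h) * (\<psi> x - \<tau> * Cx)"
          using mult_left_mono[OF chiw[of x], of "real i * \<tau> * h"] tau h by simp
        finally have "z (Suc i) x \<le> walk d \<alpha> ?w x + ?K - (real i * \<tau> * h) * (\<psi> x - \<tau> * Cx) - \<tau> * h * \<psi> x"
          unfolding zS by simp
        also have "\<dots> = walk d \<alpha> ?w x + B * s - real (Suc i) * \<tau> * h * \<psi> x + h * Cx * ((real i * \<tau>)\<^sup>2 + real i * \<tau> * \<tau>)"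
          by (simp add: algebra_simps)
        also have "\<dots> \<le> walk d \<alpha> ?w x + B * s - real (Suc i) * \<tau> * h * \<psi> x + h * Cx * (real (Suc i) * \<tau>)\<^sup>2"
        proof -
          have "(real i * \<tau>)\<^sup>2 + real i * \<tau> * \<tau> \<le> (real (Suc i) * \<tau>)\<^sup>2"
            using tau by (simp add: algebra_simps power2_eq_square)
          then show ?thesis using mult_left_mono[of _ _ "h * Cx"] h Cx by simp
        qed
        finally show ?case by simp
      qed
      show ?case
      proof
        fix x
        have "t * E \<alpha> \<le> 1 * (e / 2)"
          using t elim(1) e L m D al h unfolding \<alpha>_def[symmetric] by (intro mult_mono) (auto simp: E_def)
        moreover have "real j * (\<tau> * E \<alpha>) = t * E \<alpha>" using tau by (simp add: mult.assoc[symmetric])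
        moreover have "c x \<le> z j x + B * s + real j * (\<tau> * E \<alpha>)" using clow[of j x] by simp
        moreover have "z j x \<le> (walk d \<alpha> ^^ j) c x + B * s - t * h * \<psi> x + h * Cx * t\<^sup>2"
          using zup[of j x] unfolding tau(2) .
        ultimately have "c x + t * h * \<psi> x - h * Cx * t\<^sup>2 \<le> (walk d \<alpha> ^^ j) c x + e" using s(2) by linarith
        then show "c x + t * h * \<psi> x - h * Cx * t\<^sup>2 \<le> (walk d (sqrt (2 * real CARD('m) * t / real j)) ^^ j) c x + e"
          unfolding \<alpha>_def a_def m_def by simp
      qed
    qed
  qed
qed

text \<open>The sum of second derivatives at x exceeds its value at \<open>x0\<close> by at most
  \<epsilon>/2 + Ce |x - x0|^2: continuity gives this near \<open>x0\<close>, boundedness far away.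
  A step of the walk raises |x - x0|^2 by at most a multiple of \<tau>, so the quadratic term costs
  only O(t^2).\<close>

lemma heat_upper:
  fixes f :: "'a::euclidean_space \<Rightarrow> real" and d :: "'m::finite \<Rightarrow> 'a"
  assumes lip: "B-lipschitz_on UNIV f" and so: "second_order \<Lambda> f G" and eps: "\<epsilon> > 0"
  obtains C where "C \<ge> 0" "\<And>t. 0 < t \<Longrightarrow> t \<le> 1 \<Longrightarrow>
     \<forall>\<^sub>F j in sequentially. (walk d (sqrt (2 * real CARD('m) * t / real j)) ^^ j) f x0 \<le> f x0 + t * ((\<Sum>k\<in>UNIV. G x0 (d k)) + \<epsilon> + C * t)"
proof -
  define m where "m = real CARD('m)"
  have m: "m > 0" unfolding m_def by simp
  have B: "B \<ge> 0" using lipschitz_on_nonneg[OF lip] .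
  note L = second_order_nonneg[OF so]
  define D where "D = 1 + (\<Sum>k\<in>(UNIV::'m set). norm (d k))"
  have D: "D \<ge> 1" "\<And>k. norm (d k) \<le> D"
  proof -
    show "D \<ge> 1" unfolding D_def by (simp add: sum_nonneg)
    show "norm (d k) \<le> D" for k using member_le_sum[of k UNIV "\<lambda>k. norm (d k)"] unfolding D_def by simp
  qed
  define S where "S x = (\<Sum>k\<in>UNIV. G x (d k))" for x
  have Sb: "\<bar>S x\<bar> \<le> m * \<Lambda> * D^2" for x
  proof -
    have GD: "\<bar>G x (d k)\<bar> \<le> \<Lambda> * D^2" for k
    proof -
      have "(norm (d k))^2 \<le> D^2" using D by (intro power_mono) auto
      then show ?thesis using second_orderD(2)[OF so, of x "d k"] mult_left_mono[OF _ L] by (blast intro: order_trans)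
    qed
    have "\<bar>\<Sum>k\<in>UNIV. G x (d k)\<bar> \<le> (\<Sum>k\<in>(UNIV::'m set). \<Lambda> * D^2)"
      by (rule order_trans[OF sum_abs sum_mono[OF GD]])
    then show ?thesis unfolding m_def S_def by simp
  qed
  obtain r where r: "r > 0" "\<And>y. norm y < r \<Longrightarrow> S (x0 + y) \<le> S x0 + \<epsilon> / 2"
  proof -
    \<comment> \<open>Step of the second differences that compare the Hessian of \<open>f\<close> at
      \<open>x0\<close> with that of a translate of \<open>f\<close>; it determines the radius of
      continuity \<open>r\<close>.\<close>
    define b where "b = min (1 / D) (\<epsilon> / (16 * m * (\<Lambda> + 1) * D^3))"
    have b: "b > 0" "b * D \<le> 1" "4 * \<Lambda> * b * D^3 \<le> \<epsilon> / (4 * m)"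
    proof -
      show "b > 0" unfolding b_def using eps m D L by simp
      have "b \<le> 1 / D" unfolding b_def by simp
      then show "b * D \<le> 1" using D by (simp add: field_simps)
      have P: "16 * m * (\<Lambda> + 1) * D^3 > 0" using m L D by simp
      have "b \<le> \<epsilon> / (16 * m * (\<Lambda> + 1) * D^3)" unfolding b_def by simp
      then have "b * (16 * m * (\<Lambda> + 1) * D^3) \<le> \<epsilon>" using pos_le_divide_eq[OF P] by blast
      moreover have "b * (16 * m * (\<Lambda> + 1) * D^3) = (4 * \<Lambda> * b * D^3) * (4 * m) + 16 * m * b * D^3"
        by (simp add: algebra_simps)
      moreover have "0 \<le> 16 * m * b * D^3" using m \<open>b > 0\<close> D by simp
      ultimately have "(4 * \<Lambda> * b * D^3) * (4 * m) \<le> \<epsilon>" by linarith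
      then show "4 * \<Lambda> * b * D^3 \<le> \<epsilon> / (4 * m)" using pos_le_divide_eq[of "4 * m"] m by simp
    qed
    define r where "r = \<epsilon> * b\<^sup>2 / (16 * m * (B + 1))"
    have r: "r > 0" unfolding r_def using eps b m B by simp
    have "S (x0 + y) \<le> S x0 + \<epsilon> / 2" if y: "norm y < r" for y
    proof -
      have cl: "\<bar>f x - f (x + y)\<bar> \<le> B * r" for x
        using lipschitz_onD[OF lip, of x "x + y"] mult_left_mono[OF less_imp_le[OF y] B] by (simp add: dist_norm)
      have "r * (16 * m * (B + 1)) = \<epsilon> * b\<^sup>2" unfolding r_def using m B by simp
      moreover have "r * (16 * m * (B + 1)) = (4 * (B * r)) * (4 * m) + 16 * m * r" by (simp add: algebra_simps)
      moreover have "0 \<le> 16 * m * r" using m r by simp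
      ultimately have "(4 * (B * r)) * (4 * m) \<le> \<epsilon> * b\<^sup>2" by linarith
      then have "4 * (B * r) / b\<^sup>2 \<le> \<epsilon> / (4 * m)" using b(1) m by (simp add: pos_divide_le_eq pos_le_divide_eq)
      then have x: "4 * (B * r) / b\<^sup>2 + 4 * \<Lambda> * b * D^3 \<le> \<epsilon> / (2 * m)" using b(3) by simp
      have "\<bar>G x0 (d k) - G (x0 + y) (d k)\<bar> \<le> \<epsilon> / (2 * m)" for k
        using second_order_close[OF so second_order_shift[OF so, of y] cl b(1,2) D(2)] x by (rule order_trans)
      then have "(\<Sum>k\<in>UNIV. G (x0 + y) (d k) - G x0 (d k)) \<le> (\<Sum>k\<in>(UNIV::'m set). \<epsilon> / (2 * m))"
        by (intro sum_mono) (auto simp: abs_le_iff)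
      then show ?thesis unfolding S_def using m by (simp add: sum_subtractf m_def[symmetric])
    qed
    then show ?thesis using that r by blast
  qed
  define Ce where "Ce = 2 * m * \<Lambda> * D^2 / r\<^sup>2"
  have Ce: "Ce \<ge> 0" unfolding Ce_def using m L by simp
  have Sx: "S x \<le> S x0 + \<epsilon> / 2 + Ce * (norm (x - x0))\<^sup>2" for x
  proof (cases "norm (x - x0) < r")
    case True
    then show ?thesis using r(2)[of "x - x0"] mult_nonneg_nonneg[OF Ce zero_le_power2[of "norm (x - x0)"]] by simp
  next
    case False
    have "Ce * r\<^sup>2 \<le> Ce * (norm (x - x0))\<^sup>2" using False r(1) Ce by (intro mult_left_mono power_mono) auto
    moreover have "Ce * r\<^sup>2 = 2 * (m * \<Lambda> * D^2)" unfolding Ce_def using r by simp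
    ultimately show ?thesis using Sb[of x] Sb[of x0] eps by (simp add: abs_le_iff)
  qed
  show ?thesis
  proof (rule that[of "Ce * (2 * m * D^2)"])
    show "0 \<le> Ce * (2 * m * D^2)" using Ce m by simp
    fix t :: real assume t: "0 < t" "t \<le> 1"
    define a where "a j = sqrt (2 * m * t / real j)" for j :: nat
    have a0: "a \<longlonglongrightarrow> 0"
    proof -
      have "(\<lambda>j. sqrt (2 * m * t / real j)) \<longlonglongrightarrow> sqrt 0"
        by (intro tendsto_real_sqrt lim_const_over_n)
      then show ?thesis unfolding a_def by simp
    qed
    have ev1: "\<forall>\<^sub>F j in sequentially. a j < 1 / D" using order_tendstoD(2)[OF a0, of "1/D"] D by simp
    have ev2: "\<forall>\<^sub>F j in sequentially. a j < \<epsilon> / (4 * m * (\<Lambda> + 1) * D^3)"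
      using order_tendstoD(2)[OF a0, of "\<epsilon> / (4 * m * (\<Lambda> + 1) * D^3)"] D eps m L by simp
    have ev3: "\<forall>\<^sub>F j in sequentially. j > (0::nat)" by (rule eventually_gt_at_top)
    show "\<forall>\<^sub>F j in sequentially. (walk d (sqrt (2 * real CARD('m) * t / real j)) ^^ j) f x0
       \<le> f x0 + t * ((\<Sum>k\<in>UNIV. G x0 (d k)) + \<epsilon> + Ce * (2 * m * D^2) * t)"
      using ev1 ev2 ev3
    proof eventually_elim
      case (elim j)
      define \<alpha> where "\<alpha> = a j"
      define \<tau> where "\<tau> = t / real j"
      have al: "\<alpha> > 0" unfolding \<alpha>_def a_def using m t elim by simp
      have al2: "\<alpha>^2 = 2 * m * \<tau>" unfolding \<alpha>_def a_def \<tau>_def using m t by simp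
      have tau: "\<tau> > 0" "real j * \<tau> = t" unfolding \<tau>_def using t elim by auto
      have alD: "\<alpha> * D \<le> 1" using elim(1) D unfolding \<alpha>_def by (simp add: field_simps)
      have aD3: "\<Lambda> * (\<alpha> * D)^3 \<le> \<tau> * (\<epsilon> / 2)"
      proof -
        have "(\<alpha> * D)^3 = \<alpha>^2 * \<alpha> * D^3" by (simp add: power_eq_if)
        then have "\<Lambda> * (\<alpha> * D)^3 = \<tau> * (2 * m * \<Lambda> * D^3 * \<alpha>)" unfolding al2 by simp
        also have "\<dots> \<le> \<tau> * (\<epsilon> / 2)"
        proof (intro mult_left_mono)
          have P: "4 * m * (\<Lambda> + 1) * D^3 > 0" using m L D by simp
          have "\<alpha> * (4 * m * (\<Lambda> + 1) * D^3) \<le> \<epsilon>"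
            using elim(2) pos_less_divide_eq[OF P] unfolding \<alpha>_def by (simp add: less_imp_le)
          moreover have "\<alpha> * (4 * m * (\<Lambda> + 1) * D^3) = 2 * (2 * m * \<Lambda> * D^3 * \<alpha>) + 4 * m * \<alpha> * D^3"
            by (simp add: algebra_simps)
          moreover have "0 \<le> 4 * m * \<alpha> * D^3" using m al D by simp
          ultimately show "2 * m * \<Lambda> * D^3 * \<alpha> \<le> \<epsilon> / 2" by linarith
        qed (use tau in auto)
        finally show ?thesis .
      qed
      let ?l = "S x0 + \<epsilon>"
      let ?n = "\<lambda>x. (norm (x - x0))\<^sup>2"
      have wf: "walk d \<alpha> f x \<le> f x + \<tau> * (?l + Ce * ?n x)" for x
      proof -
        have "\<bar>walk d \<alpha> f x - f x - \<tau> * S x\<bar> \<le> \<Lambda> * (\<alpha> * D)^3"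
          using second_order_walk_step[where d=d, OF so D(2) al alD, of x] unfolding al2 S_def using m by (simp add: m_def)
        moreover have "\<tau> * S x \<le> \<tau> * (S x0 + \<epsilon> / 2 + Ce * ?n x)"
          using Sx tau by (intro mult_left_mono) auto
        ultimately show ?thesis using aD3 by (simp add: abs_le_iff algebra_simps)
      qed
      have wn: "walk d \<alpha> ?n x \<le> ?n x + \<tau> * (2 * m * D^2)" for x
      proof -
        have e: "?n (x + \<alpha> *\<^sub>R d k) + ?n (x - \<alpha> *\<^sub>R d k) = 2 * ?n x + 2 * (\<alpha>^2 * (norm (d k))^2)" for k
          unfolding power2_norm_eq_inner
          by (simp add: inner_diff_left inner_diff_right inner_add_left inner_add_right inner_commute power2_eq_square algebra_simps)
        have "(\<Sum>k\<in>UNIV. ?n (x + \<alpha> *\<^sub>R d k) + ?n (x - \<alpha> *\<^sub>R d k)) \<le> (\<Sum>k\<in>(UNIV::'m set). 2 * ?n x + 2 * (\<alpha>^2 * D^2))"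
          unfolding e using D by (intro sum_mono add_mono mult_left_mono power_mono) auto
        then have "walk d \<alpha> ?n x \<le> (\<Sum>k\<in>(UNIV::'m set). 2 * ?n x + 2 * (\<alpha>^2 * D^2)) / (2 * CARD('m))"
          unfolding walk_def by (intro divide_right_mono) auto
        also have "\<dots> = ?n x + \<alpha>^2 * D^2" by simp
        finally show ?thesis unfolding al2 by (simp add: algebra_simps)
      qed
      have main: "(walk d \<alpha> ^^ i) f x \<le> f x + real i * \<tau> * ?l + Ce * (real i * \<tau> * ?n x + 2 * m * D^2 * (real i * \<tau>)\<^sup>2)" for i x
      proof (induction i arbitrary: x)
        case (Suc i)
        let ?K = "real i * \<tau> * ?l + Ce * (2 * m * D^2 * (real i * \<tau>)\<^sup>2)"
        let ?g = "\<lambda>x. (f x + ?K) + (Ce * (real i * \<tau>)) * ?n x"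
        have "(walk d \<alpha> ^^ Suc i) f x \<le> walk d \<alpha> ?g x"
          unfolding funpow.simps o_def using Suc by (intro walk_mono) (simp add: algebra_simps)
        also have "\<dots> = walk d \<alpha> f x + ?K + (Ce * (real i * \<tau>)) * walk d \<alpha> ?n x"
          unfolding walk_add walk_cmult walk_const by simp
        also have "\<dots> \<le> (f x + \<tau> * (?l + Ce * ?n x)) + ?K + (Ce * (real i * \<tau>)) * (?n x + \<tau> * (2 * m * D^2))"
          using wf wn Ce tau m by (intro add_mono mult_left_mono) auto
        also have "\<dots> = f x + real (Suc i) * \<tau> * ?l + Ce * (real (Suc i) * \<tau> * ?n x + 2 * m * D^2 * ((real i * \<tau>)\<^sup>2 + real i * \<tau> * \<tau>))"
          by (simp add: algebra_simps)
        also have "\<dots> \<le> f x + real (Suc i) * \<tau> * ?l + Ce * (real (Suc i) * \<tau> * ?n x + 2 * m * D^2 * (real (Suc i) * \<tau>)\<^sup>2)"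
        proof -
          have "(real i * \<tau>)\<^sup>2 + real i * \<tau> * \<tau> \<le> (real (Suc i) * \<tau>)\<^sup>2"
            using tau by (simp add: algebra_simps power2_eq_square)
          then show ?thesis using Ce m by (intro add_left_mono mult_left_mono) auto
        qed
        finally show ?case .
      qed simp
      have "(walk d \<alpha> ^^ j) f x0 \<le> f x0 + t * ?l + Ce * (2 * m * D^2 * t\<^sup>2)"
        using main[of j x0] unfolding tau(2) by simp
      also have "\<dots> = f x0 + t * (S x0 + \<epsilon> + Ce * (2 * m * D^2) * t)"
        by (simp add: algebra_simps power2_eq_square)
      finally show ?case unfolding \<alpha>_def a_def S_def m_def .
    qed
  qed
qed

text \<open>Adding the expansions in opposite directions removes the gradient. This serves both the
  mollified function and the region in which no other lower bound for the jets of \<open>c\<close>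
  is given.\<close>

lemma midconvex_jet_nonneg:
  assumes mid: "\<And>a. c (x + a) + c (x - a) \<ge> 2 * c x" and Q: "quad_form Q" and jet: "upper_jet UNIV c x p Q"
  shows "Q v \<ge> 0"
proof (rule field_le_epsilon)
  fix \<epsilon> :: real assume eps: "\<epsilon> > 0"
  define e where "e = \<epsilon> / (2 * ((norm v)\<^sup>2 + 1))"
  have n: "(norm v)\<^sup>2 + 1 > 0" by (simp add: add_nonneg_pos)
  have e: "e > 0" unfolding e_def using eps n by simp
  obtain r where r: "r > 0" "\<And>h. norm h < r \<Longrightarrow> c (x + h) \<le> c x + p \<bullet> h + Q h / 2 + e * (norm h)\<^sup>2"
    using upper_jetD_ball[OF jet e quad_form_0[OF Q]] by auto
  define b where "b = r / (2 * (norm v + 1))"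
  have b: "b > 0" unfolding b_def using r(1) by (simp add: add_nonneg_pos)
  have "norm (b *\<^sub>R v) < r"
  proof -
    have "norm (b *\<^sub>R v) = r * (norm v / (2 * (norm v + 1)))" unfolding b_def using r by simp
    also have "\<dots> < r * 1"
    proof (rule mult_strict_left_mono[OF _ r(1)])
      have "norm v < norm v + norm v + 2" using norm_ge_zero[of v] by linarith
      then have "norm v < 2 * (norm v + 1)" by simp
      moreover have "0 < 2 * (norm v + 1)" by (simp add: add_nonneg_pos)
      ultimately show "norm v / (2 * (norm v + 1)) < 1" by (subst pos_divide_less_eq) auto
    qed
    finally show ?thesis by simp
  qed
  then have "0 \<le> Q (b *\<^sub>R v) + 2 * e * (norm (b *\<^sub>R v))\<^sup>2"
    using r(2)[of "b *\<^sub>R v"] r(2)[of "- (b *\<^sub>R v)"] mid[of "b *\<^sub>R v"] quad_form_minus[OF Q, of "b *\<^sub>R v"] by simp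
  then have "0 \<le> b\<^sup>2 * (Q v + 2 * e * (norm v)\<^sup>2)"
    unfolding quad_form_scale[OF Q] using b by (simp add: power_mult_distrib algebra_simps)
  then have "0 \<le> Q v + 2 * e * (norm v)\<^sup>2" using b by (simp add: zero_le_mult_iff)
  also have "2 * e * (norm v)\<^sup>2 \<le> \<epsilon>"
  proof -
    have "e * (2 * ((norm v)\<^sup>2 + 1)) = \<epsilon>" unfolding e_def using n by simp
    then show ?thesis using e by (simp add: algebra_simps)
  qed
  finally show "0 \<le> Q v + \<epsilon>" by simp
qed

lemma second_order_upper_jet:
  assumes "second_order \<Lambda> f G" obtains p where "upper_jet UNIV f x p (G x)"
proof -
  obtain p where p: "\<And>e. e > 0 \<Longrightarrow> \<exists>r>0. \<forall>h. norm h < r \<longrightarrow> \<bar>f (x + h) - f x - p \<bullet> h - G x h / 2\<bar> \<le> e * (norm h)\<^sup>2"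
    using second_order_expansion[OF assms] by metis
  have "upper_jet UNIV f x p (G x)"
  proof (rule upper_jetI_ball)
    fix e :: real assume "e > 0"
    then obtain r where "r > 0" "\<And>h. norm h < r \<Longrightarrow> \<bar>f (x + h) - f x - p \<bullet> h - G x h / 2\<bar> \<le> e * (norm h)\<^sup>2"
      using p by blast
    then show "\<exists>r>0. \<forall>h. x + h \<in> UNIV \<longrightarrow> norm h < r \<longrightarrow> f (x + h) \<le> f x + p \<bullet> h + G x h / 2 + e * (norm h)\<^sup>2"
      by (intro exI[of _ r]) (auto simp: abs_le_iff algebra_simps)
  qed
  then show ?thesis using that by blast
qed

text \<open>No twice differentiability of \<open>c\<close> is used: \<open>c\<close> is compared with its discrete heat flow.\<close>

theorem moll_hessian_ge:
  fixes c :: "'a::euclidean_space \<Rightarrow> real" and d :: "'m::finite \<Rightarrow> 'a"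
  assumes c: "B-lipschitz_on UNIV c" and mid: "\<And>x a. c (x + a) + c (x - a) \<ge> 2 * c x"
    and jets: "\<And>x p Q. dist x xh < r \<Longrightarrow> quad_form Q \<Longrightarrow> upper_jet UNIV c x p Q \<Longrightarrow> (\<Sum>k\<in>UNIV. Q (d k)) \<ge> h"
    and s: "\<sigma> > 0" "dist x0 xh + \<sigma> < r" and so: "second_order \<Lambda> (moll \<sigma> c) G"
  shows "(\<Sum>k\<in>UNIV. G x0 (d k)) \<ge> h"
proof -
  have cc: "continuous_on UNIV c" by (rule lipschitz_on_continuous_on[OF c])
  have cc': "continuous_on UNIV (\<lambda>x. c (x + a))" for a
    by (intro continuous_intros continuous_on_compose2[OF cc]) auto
  have G0: "G x0 v \<ge> 0" for v
  proof -
    obtain p where "upper_jet UNIV (moll \<sigma> c) x0 p (G x0)" using second_order_upper_jet[OF so] .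
    moreover have "moll \<sigma> c (x0 + a) + moll \<sigma> c (x0 - a) \<ge> 2 * moll \<sigma> c x0" for a
    proof -
      have "moll \<sigma> (\<lambda>x. c x + c x) x0 + 0 \<le> moll \<sigma> (\<lambda>x. c (x + a) + c (x + (- a))) x0"
        using mid[of _ a] by (intro moll_le continuous_on_add cc cc') (simp add: mult_2[symmetric])
      then show ?thesis by (simp only: moll_add[OF cc cc] moll_add[OF cc' cc'] moll_shift) simp
    qed
    ultimately show ?thesis using midconvex_jet_nonneg second_orderD(1)[OF so] by blast
  qed
  show ?thesis
  proof (cases "h \<le> 0")
    case True
    then show ?thesis using G0 by (meson order_trans sum_nonneg)
  next
    case False
    define g where "g = r - \<sigma> - dist x0 xh"
    have g: "g > 0" unfolding g_def using s by simp
    \<comment> \<open>A cutoff that is 1 up to distance \<sigma> + g/3 from \<open>x0\<close> and 0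
      beyond \<sigma> + 2g/3. Mollified at scale g/4 it is still 1 within distance \<sigma> of
      \<open>x0\<close> and 0 at distance at least \<open>r\<close> from \<open>xh\<close>.\<close>
    define \<psi>0 where "\<psi>0 x = max 0 (min 1 (2 - (norm (x - x0) - \<sigma>) * (3 / g)))" for x
    have lp: "(3 / g)-lipschitz_on UNIV \<psi>0"
    proof (rule lipschitz_onI)
      fix x y
      have "\<bar>\<psi>0 x - \<psi>0 y\<bar> \<le> \<bar>(norm (x - x0) - \<sigma>) * (3 / g) - (norm (y - x0) - \<sigma>) * (3 / g)\<bar>"
      proof -
        have "\<bar>max 0 (min 1 (2 - A)) - max 0 (min 1 (2 - B))\<bar> \<le> \<bar>A - B\<bar>" for A B :: real
          by linarith
        then show ?thesis unfolding \<psi>0_def .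
      qed
      also have "\<dots> = (3 / g) * \<bar>norm (x - x0) - norm (y - x0)\<bar>"
      proof -
        have "(norm (x - x0) - \<sigma>) * (3 / g) - (norm (y - x0) - \<sigma>) * (3 / g) = (3 / g) * (norm (x - x0) - norm (y - x0))"
          by (simp only: ring_distribs mult.commute)
        then show ?thesis using g by (simp only: abs_mult) simp
      qed
      also have "\<dots> \<le> (3 / g) * dist x y"
      proof -
        have "\<bar>norm (x - x0) - norm (y - x0)\<bar> \<le> dist x y"
          using norm_triangle_ineq3[of "x - x0" "y - x0"] by (simp add: dist_norm)
        then show ?thesis using g by (intro mult_left_mono) auto
      qed
      finally show "dist (\<psi>0 x) (\<psi>0 y) \<le> (3 / g) * dist x y" by (simp add: dist_real_def)
    qed (use g in auto)
    have c0: "continuous_on UNIV \<psi>0" by (rule lipschitz_on_continuous_on[OF lp])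
    define \<psi> where "\<psi> = moll (g / 4) \<psi>0"
    have pl: "(3 / g)-lipschitz_on UNIV \<psi>" unfolding \<psi>_def by (rule moll_lipschitz[OF lp])
    obtain \<Lambda>' G' where pso: "second_order \<Lambda>' \<psi> G'"
      using moll_second_order[OF lp, of "g/4"] g unfolding \<psi>_def by auto
    have psi0: "\<psi> x \<ge> 0" for x
    proof -
      have "moll (g / 4) (\<lambda>_. 0) x + 0 \<le> moll (g / 4) \<psi>0 x"
        by (rule moll_le[OF continuous_on_const c0]) (simp add: \<psi>0_def)
      then show ?thesis unfolding \<psi>_def by simp
    qed
    have psi1: "\<psi> x \<le> 1" for x
    proof -
      have "moll (g / 4) \<psi>0 x + 0 \<le> moll (g / 4) (\<lambda>_. 1) x"
        by (rule moll_le[OF c0 continuous_on_const]) (simp add: \<psi>0_def)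
      then show ?thesis unfolding \<psi>_def by simp
    qed
    have nb: "norm ((g / 4) *\<^sub>R y) \<le> g / 4" if "norm y < 1" for y :: 'a using that g by simp
    have psi_in: "\<psi> x = 1" if x: "norm (x - x0) \<le> \<sigma>" for x
    proof -
      have "1 \<le> \<psi>0 (x + (g / 4) *\<^sub>R y)" if y: "norm y < 1" for y
      proof -
        have "norm (x + (g / 4) *\<^sub>R y - x0) \<le> norm (x - x0) + norm ((g / 4) *\<^sub>R y)"
          using norm_triangle_ineq[of "x - x0" "(g / 4) *\<^sub>R y"] by (simp add: algebra_simps)
        then have "norm (x + (g / 4) *\<^sub>R y - x0) - \<sigma> \<le> g / 4" using nb[OF y] x by linarith
        then have "(norm (x + (g / 4) *\<^sub>R y - x0) - \<sigma>) * (3 / g) \<le> (g / 4) * (3 / g)"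
          using g by (intro mult_right_mono) auto
        moreover have "(g / 4) * (3 / g) = 3 / 4" using g by simp
        moreover have "1 \<le> max 0 (min 1 (2 - A))" if "A \<le> 3 / 4" for A :: real using that by linarith
        ultimately show ?thesis unfolding \<psi>0_def by metis
      qed
      then have "moll (g / 4) (\<lambda>_. 1) x + 0 \<le> moll (g / 4) \<psi>0 x"
        by (intro moll_le[OF continuous_on_const c0]) simp
      then have "1 \<le> \<psi> x" unfolding \<psi>_def by simp
      then show ?thesis using psi1[of x] by simp
    qed
    have psi_out: "\<psi> x = 0" if x: "dist x xh \<ge> r" for x
    proof -
      have "\<psi>0 (x + (g / 4) *\<^sub>R y) \<le> 0" if y: "norm y < 1" for y
      proof -
        have "r \<le> norm (x + (g / 4) *\<^sub>R y - x0) + norm ((g / 4) *\<^sub>R y) + dist x0 xh"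
          using x norm_triangle_ineq4[of "x + (g / 4) *\<^sub>R y - x0" "(g / 4) *\<^sub>R y"] dist_triangle[of x xh x0]
          by (simp add: dist_norm)
        then have "norm (x + (g / 4) *\<^sub>R y - x0) - \<sigma> \<ge> 3 * g / 4" using nb[OF y] unfolding g_def by simp
        then have "(norm (x + (g / 4) *\<^sub>R y - x0) - \<sigma>) * (3 / g) \<ge> (3 * g / 4) * (3 / g)"
          using g by (intro mult_right_mono) auto
        moreover have "(3 * g / 4) * (3 / g) = 9 / 4" using g by simp
        moreover have "max 0 (min 1 (2 - A)) \<le> 0" if "A \<ge> 9 / 4" for A :: real using that by linarith
        ultimately show ?thesis unfolding \<psi>0_def by metis
      qed
      then have "moll (g / 4) \<psi>0 x + 0 \<le> moll (g / 4) (\<lambda>_. 0) x"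
        by (intro moll_le[OF c0 continuous_on_const]) simp
      then have "\<psi> x \<le> 0" unfolding \<psi>_def by simp
      then show ?thesis using psi0[of x] by simp
    qed
    \<comment> \<open>The cutoff makes the jet bound global: outside the ball \<psi> vanishes and
      midpoint convexity supplies the lower bound 0.\<close>
    have jets': "(\<Sum>k\<in>UNIV. Q (d k)) \<ge> h * \<psi> x" if "quad_form Q" "upper_jet UNIV c x p Q" for x p Q
    proof (cases "dist x xh < r")
      case True
      have "h * \<psi> x \<le> h * 1" using psi1 False by (intro mult_left_mono) auto
      then show ?thesis using jets[OF True that] by simp
    next
      case out: False
      then have "\<psi> x = 0" using psi_out by simp
      then show ?thesis using midconvex_jet_nonneg[OF mid that] by (simp add: sum_nonneg)
    qed
    obtain C where C: "C \<ge> 0" "\<And>t e. 0 < t \<Longrightarrow> t \<le> 1 \<Longrightarrow> e > 0 \<Longrightarrow>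
     \<forall>\<^sub>F j in sequentially. \<forall>x. c x + t * h * \<psi> x - C * t\<^sup>2 \<le> (walk d (sqrt (2 * real CARD('m) * t / real j)) ^^ j) c x + e"
    proof (rule heat_lower[where d=d, OF c pl pso])
      show "(\<Sum>k\<in>UNIV. Q (d k)) \<ge> h * \<psi> x" if "quad_form Q" "upper_jet UNIV c x p Q" for x p Q
        by (rule jets'[OF that])
      show "0 \<le> h" using False by simp
      show "\<bar>\<psi> x\<bar> \<le> 1" for x using psi0[of x] psi1[of x] by simp
    qed (rule that)
    show ?thesis
    proof (rule field_le_epsilon)
      fix \<epsilon> :: real assume eps: "\<epsilon> > 0"
      obtain C' where C': "C' \<ge> 0" "\<And>t. 0 < t \<Longrightarrow> t \<le> 1 \<Longrightarrow>
         \<forall>\<^sub>F j in sequentially. (walk d (sqrt (2 * real CARD('m) * t / real j)) ^^ j) (moll \<sigma> c) x0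
            \<le> moll \<sigma> c x0 + t * ((\<Sum>k\<in>UNIV. G x0 (d k)) + \<epsilon> / 2 + C' * t)"
      proof (rule heat_upper[where d=d, OF moll_lipschitz[OF c] so])
        show "0 < \<epsilon> / 2" using eps by simp
      qed (rule that)
      \<comment> \<open>\<open>C\<close> and \<open>C'\<close> come from the two O(t^2) estimates,
        the 1 from taking e = t^2 in the first.\<close>
      define t where "t = min 1 (\<epsilon> / (2 * (C + C' + 1)))"
      have t: "0 < t" "t \<le> 1" "(C + C' + 1) * t \<le> \<epsilon> / 2"
      proof -
        show "0 < t" "t \<le> 1" unfolding t_def using eps C C' by auto
        have "(C + C' + 1) * t \<le> (C + C' + 1) * (\<epsilon> / (2 * (C + C' + 1)))"
          unfolding t_def using C C' by (intro mult_left_mono) auto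
        moreover have "K * (\<epsilon> / (2 * K)) = \<epsilon> / 2" if "K > 0" for K using that by simp
        ultimately show "(C + C' + 1) * t \<le> \<epsilon> / 2" using C C' by (metis add_nonneg_nonneg add_nonneg_pos zero_less_one)
      qed
      have "\<forall>\<^sub>F j in sequentially. t * h \<le> t * ((\<Sum>k\<in>UNIV. G x0 (d k)) + \<epsilon> / 2 + (C + C' + 1) * t)"
        using C(2)[OF t(1,2) zero_less_power[OF t(1), of 2]] C'(2)[OF t(1,2)]
      proof eventually_elim
        case (elim j)
        let ?w = "walk d (sqrt (2 * real CARD('m) * t / real j)) ^^ j"
        have wc: "continuous_on UNIV (?w c)" "moll \<sigma> (?w c) x0 = ?w (moll \<sigma> c) x0"
          using walk_pow_moll[OF c] lipschitz_on_continuous_on by blast+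
        \<comment> \<open>The lower estimate is mollified at \<open>x0\<close>, where only points
          with \<psi> = 1 enter. As the walk commutes with mollification, this is a lower bound for
          the rise of the mollified \<open>c\<close>, whose upper bound by the Hessian is
          \<open>heat_upper\<close>.\<close>
        have "moll \<sigma> c x0 + (t * h - C * t\<^sup>2 - t\<^sup>2) \<le> moll \<sigma> (?w c) x0"
        proof (rule moll_le[OF cc wc(1)])
          fix y :: 'a assume y: "norm y < 1"
          have "norm (x0 + \<sigma> *\<^sub>R y - x0) \<le> \<sigma>" using y s by simp
          then have "\<psi> (x0 + \<sigma> *\<^sub>R y) = 1" by (rule psi_in)
          then show "c (x0 + \<sigma> *\<^sub>R y) + (t * h - C * t\<^sup>2 - t\<^sup>2) \<le> ?w c (x0 + \<sigma> *\<^sub>R y)"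
            using elim(1)[rule_format, of "x0 + \<sigma> *\<^sub>R y"] t by simp
        qed
        then show ?case using elim(2) unfolding wc(2) by (simp add: algebra_simps power2_eq_square)
      qed
      then have "t * h \<le> t * ((\<Sum>k\<in>UNIV. G x0 (d k)) + \<epsilon> / 2 + (C + C' + 1) * t)"
        by simp
      then show "h \<le> (\<Sum>k\<in>UNIV. G x0 (d k)) + \<epsilon>" using t by simp
    qed
  qed
qed

section \<open>Semicontinuity and sup-convolution\<close>

lemma usc_onD:
  assumes "usc_on S f" "x \<in> S" "f x < a"
  obtains T where "open T" "x \<in> T" "\<And>y. y \<in> T \<Longrightarrow> y \<in> S \<Longrightarrow> f y < a"
proof -
  have "\<forall>\<^sub>F y in at x within S. f y < a" using assms unfolding usc_on_def by blast
  then obtain T where "open T" "x \<in> T" "\<forall>y\<in>T. y \<noteq> x \<longrightarrow> y \<in> S \<longrightarrow> f y < a"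
    unfolding eventually_at_topological by blast
  then show ?thesis using that assms(3) by metis
qed

lemma usc_onI:
  assumes "\<And>x a. x \<in> S \<Longrightarrow> f x < a \<Longrightarrow> \<exists>T. open T \<and> x \<in> T \<and> (\<forall>y\<in>T. y \<in> S \<longrightarrow> f y < a)"
  shows "usc_on S f"
  unfolding usc_on_def eventually_at_topological using assms by metis

lemma usc_on_subset: "usc_on S f \<Longrightarrow> T \<subseteq> S \<Longrightarrow> usc_on T f"
  by (rule usc_onI) (meson subset_iff usc_onD)

lemma usc_on_add:
  assumes "usc_on S f" "usc_on S g" shows "usc_on S (\<lambda>x. f x + g x)"
proof (rule usc_onI)
  fix x a assume x: "x \<in> S" and a: "f x + g x < a"
  define e where "e = (a - (f x + g x)) / 2"
  have e: "f x < f x + e" "g x < g x + e" unfolding e_def using a by auto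
  obtain T1 where "open T1" "x \<in> T1" "\<And>y. y \<in> T1 \<Longrightarrow> y \<in> S \<Longrightarrow> f y < f x + e"
    using usc_onD[OF assms(1) x e(1)] by blast
  moreover obtain T2 where "open T2" "x \<in> T2" "\<And>y. y \<in> T2 \<Longrightarrow> y \<in> S \<Longrightarrow> g y < g x + e"
    using usc_onD[OF assms(2) x e(2)] by blast
  ultimately show "\<exists>T. open T \<and> x \<in> T \<and> (\<forall>y\<in>T. y \<in> S \<longrightarrow> f y + g y < a)"
    unfolding e_def by (intro exI[of _ "T1 \<inter> T2"]) (fastforce simp: field_simps)
qed

lemma usc_on_compose:
  assumes "usc_on S f" "continuous_on T g" "g ` T \<subseteq> S" shows "usc_on T (\<lambda>x. f (g x))"
proof (rule usc_onI)
  fix x a assume x: "x \<in> T" and a: "f (g x) < a"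
  have gx: "g x \<in> S" using assms(3) x by blast
  obtain O' where O': "open O'" "g x \<in> O'" "\<And>y. y \<in> O' \<Longrightarrow> y \<in> S \<Longrightarrow> f y < a"
    using usc_onD[OF assms(1) gx a] by blast
  obtain A where A: "open A" "A \<inter> T = g -` O' \<inter> T"
    using assms(2) O'(1) unfolding continuous_on_open_invariant by metis
  have "\<forall>y\<in>A. y \<in> T \<longrightarrow> f (g y) < a" using A O'(3) assms(3) by blast
  moreover have "x \<in> A" using A(2) x O'(2) by blast
  ultimately show "\<exists>A. open A \<and> x \<in> A \<and> (\<forall>y\<in>A. y \<in> T \<longrightarrow> f (g y) < a)" using A(1) by blast
qed

lemma continuous_imp_usc_on:
  assumes "continuous_on S (f :: _ \<Rightarrow> real)" shows "usc_on S f"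
  unfolding usc_on_def using assms by (auto simp: continuous_on_def order_tendsto_iff)

lemma lsc_imp_usc_uminus: "lsc_on S f \<Longrightarrow> usc_on S (\<lambda>x. - f x)"
  unfolding usc_on_def lsc_on_def
proof (intro ballI allI impI)
  fix x a assume l: "\<forall>x\<in>S. \<forall>a<f x. \<forall>\<^sub>F y in at x within S. a < f y" and x: "x \<in> S" "- f x < a"
  then have "\<forall>\<^sub>F y in at x within S. - a < f y" by (metis minus_less_iff)
  then show "\<forall>\<^sub>F y in at x within S. - f y < a" by eventually_elim simp
qed

lemma usc_attains_sup:
  assumes "compact S" "S \<noteq> {}" "usc_on S f"
  obtains x where "x \<in> S" "\<And>y. y \<in> S \<Longrightarrow> f y \<le> f x"
proof -
  have "\<exists>x\<in>S. \<forall>y\<in>S. f y \<le> f x"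
  proof (rule ccontr)
    assume "\<not> ?thesis"
    then have "\<forall>x\<in>S. \<exists>z\<in>S. f x < f z" by (meson not_le)
    then obtain g where g: "\<And>x. x \<in> S \<Longrightarrow> g x \<in> S" "\<And>x. x \<in> S \<Longrightarrow> f x < f (g x)" by metis
    have "\<exists>T. open T \<and> x \<in> T \<and> (\<forall>y\<in>T. y \<in> S \<longrightarrow> f y < f (g x))" if "x \<in> S" for x
      using usc_onD[OF assms(3) that g(2)[OF that]] by metis
    then obtain T where T: "\<And>x. x \<in> S \<Longrightarrow> open (T x)" "\<And>x. x \<in> S \<Longrightarrow> x \<in> T x"
      "\<And>x y. x \<in> S \<Longrightarrow> y \<in> T x \<Longrightarrow> y \<in> S \<Longrightarrow> f y < f (g x)" by metis
    obtain C where C: "C \<subseteq> S" "finite C" "S \<subseteq> (\<Union>c\<in>C. T c)"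
      using compactE_image[OF assms(1), of S T] T by blast
    have "C \<noteq> {}" using C assms(2) by auto
    then have "Max ((\<lambda>c. f (g c)) ` C) \<in> (\<lambda>c. f (g c)) ` C" using C(2) by simp
    then obtain c where "c \<in> C" "f (g c) = Max ((\<lambda>c. f (g c)) ` C)" by auto
    then have c: "c \<in> C" "\<And>c'. c' \<in> C \<Longrightarrow> f (g c') \<le> f (g c)" using C(2) by auto
    have "g c \<in> S" using c C g by blast
    then obtain c' where "c' \<in> C" "g c \<in> T c'" using C by blast
    then have "f (g c) < f (g c')" using T(3) C \<open>g c \<in> S\<close> by blast
    then show False using c(2)[OF \<open>c' \<in> C\<close>] by simp
  qed
  then show ?thesis using that by blast
qed

lemma usc_superlevel_compact:
  assumes "compact S" "usc_on S f" shows "compact {x \<in> S. a \<le> f x}"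
proof -
  have "\<exists>T. open T \<and> x \<in> T \<and> (\<forall>y\<in>T. y \<in> S \<longrightarrow> f y < a)" if "x \<in> S" "f x < a" for x
    using usc_onD[OF assms(2) that] by metis
  then obtain T where T: "\<And>x. x \<in> S \<Longrightarrow> f x < a \<Longrightarrow> open (T x)" "\<And>x. x \<in> S \<Longrightarrow> f x < a \<Longrightarrow> x \<in> T x"
    "\<And>x y. x \<in> S \<Longrightarrow> f x < a \<Longrightarrow> y \<in> T x \<Longrightarrow> y \<in> S \<Longrightarrow> f y < a" by metis
  have "{x \<in> S. a \<le> f x} = S - (\<Union>x\<in>{x \<in> S. f x < a}. T x)"
  proof (intro equalityI subsetI)
    fix x assume x: "x \<in> {x \<in> S. a \<le> f x}"
    have "x \<notin> T y" if "y \<in> S" "f y < a" for y using T(3)[OF that, of x] x by auto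
    then show "x \<in> S - (\<Union>x\<in>{x \<in> S. f x < a}. T x)" using x by blast
  next
    fix x assume x: "x \<in> S - (\<Union>x\<in>{x \<in> S. f x < a}. T x)"
    then have "\<not> f x < a" using T(2)[of x] by blast
    then show "x \<in> {x \<in> S. a \<le> f x}" using x by simp
  qed
  then show ?thesis using T assms(1) by (simp add: compact_diff open_UN)
qed

section \<open>Sup-convolution and its optimal points\<close>

definition sup_conv :: "real \<Rightarrow> 'a::euclidean_space set \<Rightarrow> ('a \<Rightarrow> real) \<Rightarrow> 'a \<Rightarrow> real" where
  "sup_conv \<kappa> S f x = (SUP y\<in>S. f y - \<kappa> / 2 * (norm (x - y))\<^sup>2)"

lemma sup_conv_attained:
  assumes "compact S" "S \<noteq> {}" "usc_on S f"
  obtains y where "y \<in> S" "sup_conv \<kappa> S f x = f y - \<kappa> / 2 * (norm (x - y))\<^sup>2"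
    "\<And>y. y \<in> S \<Longrightarrow> f y - \<kappa> / 2 * (norm (x - y))\<^sup>2 \<le> sup_conv \<kappa> S f x"
proof -
  have "usc_on S (\<lambda>y. f y + (- (\<kappa> / 2 * (norm (x - y))\<^sup>2)))"
    by (intro usc_on_add assms continuous_imp_usc_on continuous_intros)
  then obtain y where y: "y \<in> S" "\<And>z. z \<in> S \<Longrightarrow> f z - \<kappa> / 2 * (norm (x - z))\<^sup>2 \<le> f y - \<kappa> / 2 * (norm (x - y))\<^sup>2"
    using usc_attains_sup[OF assms(1,2)] by (metis (no_types, lifting) add.commute uminus_add_conv_diff)
  have "sup_conv \<kappa> S f x = f y - \<kappa> / 2 * (norm (x - y))\<^sup>2"
    unfolding sup_conv_def using y by (intro cSup_eq_maximum) auto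
  then show ?thesis using that y by metis
qed

context
  fixes S :: "'a::euclidean_space set" and f :: "'a \<Rightarrow> real" and \<kappa> :: real
  assumes S: "compact S" "S \<noteq> {}" and f: "usc_on S f" and lam: "\<kappa> > 0"
begin

lemma sup_conv_ge: "y \<in> S \<Longrightarrow> f y - \<kappa> / 2 * (norm (x - y))\<^sup>2 \<le> sup_conv \<kappa> S f x"
  using sup_conv_attained[OF S f] by metis

text \<open>Expanding the square exhibits a supremum over y in \<open>S\<close> of affine functions
  of x with slopes \<kappa> y, and \<open>S\<close> is bounded.\<close>

lemma sup_conv_convex_part:
  obtains B where "B-lipschitz_on UNIV (\<lambda>x. sup_conv \<kappa> S f x + \<kappa> / 2 * (norm x)\<^sup>2)"
    "\<And>x a. (sup_conv \<kappa> S f (x + a) + \<kappa> / 2 * (norm (x + a))\<^sup>2) + (sup_conv \<kappa> S f (x - a) + \<kappa> / 2 * (norm (x - a))\<^sup>2)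
       \<ge> 2 * (sup_conv \<kappa> S f x + \<kappa> / 2 * (norm x)\<^sup>2)"
proof -
  define c where "c x = sup_conv \<kappa> S f x + \<kappa> / 2 * (norm x)\<^sup>2" for x
  have e: "f y - \<kappa> / 2 * (norm (x - y))\<^sup>2 + \<kappa> / 2 * (norm x)\<^sup>2 = f y - \<kappa> / 2 * (norm y)\<^sup>2 + \<kappa> * (x \<bullet> y)" for x y
    unfolding power2_norm_eq_inner by (simp add: inner_diff_left inner_diff_right inner_commute field_simps)
  have lo: "f y - \<kappa> / 2 * (norm y)\<^sup>2 + \<kappa> * (x \<bullet> y) \<le> c x" if "y \<in> S" for x y
    using sup_conv_ge[OF that, of x] e[of y x] unfolding c_def by linarith
  have at: "\<exists>y\<in>S. c x = f y - \<kappa> / 2 * (norm y)\<^sup>2 + \<kappa> * (x \<bullet> y)" for x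
    using sup_conv_attained[OF S f, of \<kappa> x] e[of _ x] unfolding c_def by metis
  obtain R where R: "\<And>y. y \<in> S \<Longrightarrow> norm y \<le> R"
    using compact_imp_bounded[OF S(1)] unfolding bounded_iff by blast
  have R0: "R \<ge> 0" using R S(2) norm_ge_zero order_trans by (metis ex_in_conv)
  have le: "c x \<le> c x' + (\<kappa> * R) * dist x x'" for x x'
  proof -
    obtain y where y: "y \<in> S" "c x = f y - \<kappa> / 2 * (norm y)\<^sup>2 + \<kappa> * (x \<bullet> y)" using at by blast
    have "c x \<le> c x' + \<kappa> * ((x - x') \<bullet> y)" using lo[OF y(1), of x'] y(2) by (simp add: inner_diff_left algebra_simps)
    also have "(x - x') \<bullet> y \<le> norm (x - x') * R"
      using norm_cauchy_schwarz[of "x - x'" y] mult_left_mono[OF R[OF y(1)], of "norm (x - x')"] by simp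
    finally show ?thesis using lam by (simp add: dist_norm mult_left_mono mult.assoc mult.commute[of R])
  qed
  have "(\<kappa> * R)-lipschitz_on UNIV c"
  proof (rule lipschitz_onI)
    show "dist (c x) (c y) \<le> (\<kappa> * R) * dist x y" for x y
      using le[of x y] le[of y x] unfolding dist_real_def abs_le_iff dist_commute[of y x] by linarith
  qed (use lam R0 in auto)
  moreover have "c (x + a) + c (x - a) \<ge> 2 * c x" for x a
  proof -
    obtain y where y: "y \<in> S" "c x = f y - \<kappa> / 2 * (norm y)\<^sup>2 + \<kappa> * (x \<bullet> y)" using at by blast
    show ?thesis using lo[OF y(1), of "x + a"] lo[OF y(1), of "x - a"] y(2)
      by (simp add: inner_add_left inner_diff_left algebra_simps)
  qed
  ultimately show ?thesis using that unfolding c_def by blast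
qed

text \<open>The shift between \<open>x\<close> and \<open>y\<close> is coupled through an arbitrary linear map \<open>T\<close>; this is what
  turns variable coefficients at \<open>y\<close> into constant coefficients.\<close>

lemma sup_conv_jet:
  assumes jet: "upper_jet UNIV (sup_conv \<kappa> S f) x p Q" and Q: "quad_form Q"
    and y: "y \<in> S" "sup_conv \<kappa> S f x = f y - \<kappa> / 2 * (norm (x - y))\<^sup>2"
  shows "p = \<kappa> *\<^sub>R (y - x)"
    and "linear T \<Longrightarrow> upper_jet S f y p (\<lambda>h. Q (T h) + \<kappa> * (norm (T h - h))\<^sup>2)"
proof -
  let ?W = "sup_conv \<kappa> S f"
  have up: "f (y + k) - \<kappa> / 2 * (norm (x + h - (y + k)))\<^sup>2 \<le> ?W (x + h)" if "y + k \<in> S" for h k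
    by (rule sup_conv_ge[OF that])
  show p: "p = \<kappa> *\<^sub>R (y - x)"
  proof -
    \<comment> \<open>With \<open>y\<close> kept fixed, the sup-convolution has at \<open>x\<close>
      a paraboloid with gradient \<kappa> (y - x) below it. The upper jet must have the same
      gradient; the increment h = t v with small t shows it.\<close>
    define v where "v = \<kappa> *\<^sub>R (y - x) - p"
    obtain K where K: "K > 0" "\<And>h. \<bar>Q h\<bar> \<le> K * (norm h)\<^sup>2" using quad_form_bound[OF Q] by blast
    obtain r where r: "r > 0" "\<And>h. norm h < r \<Longrightarrow> ?W (x + h) \<le> ?W x + p \<bullet> h + Q h / 2 + 1 * (norm h)\<^sup>2"
      using upper_jetD_ball[OF jet zero_less_one quad_form_0[OF Q]] by auto
    have ineq: "v \<bullet> h \<le> (K + 1 + \<kappa>) * (norm h)\<^sup>2" if h: "norm h < r" for h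
    proof -
      have "?W x - \<kappa> / 2 * ((norm (x + h - y))\<^sup>2 - (norm (x - y))\<^sup>2) \<le> ?W (x + h)"
        using up[of 0 h] y by (simp add: algebra_simps)
      moreover have "(norm (x + h - y))\<^sup>2 - (norm (x - y))\<^sup>2 = 2 * ((x - y) \<bullet> h) + (norm h)\<^sup>2"
        unfolding power2_norm_eq_inner by (simp add: inner_diff_left inner_diff_right inner_add_left inner_add_right inner_commute)
      ultimately have "?W x - \<kappa> / 2 * (2 * ((x - y) \<bullet> h) + (norm h)\<^sup>2) \<le> ?W (x + h)" by simp
      moreover have "\<kappa> / 2 * (2 * ((x - y) \<bullet> h) + (norm h)\<^sup>2) = - (\<kappa> * ((y - x) \<bullet> h)) + \<kappa> / 2 * (norm h)\<^sup>2"
        by (simp add: inner_diff_left field_simps)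
      ultimately have "\<kappa> * ((y - x) \<bullet> h) - \<kappa> / 2 * (norm h)\<^sup>2 \<le> p \<bullet> h + Q h / 2 + (norm h)\<^sup>2"
        using r(2)[OF h] by linarith
      moreover have "Q h / 2 \<le> K * (norm h)\<^sup>2" using K(2)[of h] K(1) by (smt (verit) field_sum_of_halves zero_le_power2 mult_nonneg_nonneg)
      moreover have "\<kappa> / 2 * (norm h)\<^sup>2 \<le> \<kappa> * (norm h)\<^sup>2" using lam by (intro mult_right_mono) auto
      ultimately show ?thesis unfolding v_def by (simp add: inner_diff_left distrib_right)
    qed
    have "v = 0"
    proof (rule ccontr)
      assume v: "v \<noteq> 0"
      define t where "t = min (r / (2 * norm v)) (1 / (2 * (K + 1 + \<kappa>)))"
      have t: "t > 0" unfolding t_def using r v K lam by simp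
      have "t * norm v \<le> r / (2 * norm v) * norm v" unfolding t_def by (intro mult_right_mono) auto
      also have "\<dots> = r / 2" using v by simp
      finally have "norm (t *\<^sub>R v) < r" using t r(1) by simp
      from ineq[OF this] have "t * (norm v)\<^sup>2 \<le> t * ((K + 1 + \<kappa>) * t * (norm v)\<^sup>2)"
        by (simp add: power_mult_distrib dot_square_norm abs_of_pos[OF t] power2_eq_square algebra_simps)
      then have "(norm v)\<^sup>2 \<le> (K + 1 + \<kappa>) * t * (norm v)\<^sup>2" using t by simp
      also have "\<dots> \<le> (1 / 2) * (norm v)\<^sup>2"
      proof (rule mult_right_mono)
        have "(K + 1 + \<kappa>) * t \<le> (K + 1 + \<kappa>) * (1 / (2 * (K + 1 + \<kappa>)))"
          unfolding t_def using K lam by (intro mult_left_mono) auto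
        also have "\<dots> = 1 / 2" using K lam by simp
        finally show "(K + 1 + \<kappa>) * t \<le> 1 / 2" .
      qed simp
      finally show False using v by simp
    qed
    then show ?thesis unfolding v_def by simp
  qed
  assume T: "linear T"
  show "upper_jet S f y p (\<lambda>h. Q (T h) + \<kappa> * (norm (T h - h))\<^sup>2)"
  proof (rule upper_jetI_ball)
    fix e :: real assume e: "e > 0"
    obtain K where K: "K > 0" "\<And>h. norm (T h) \<le> norm h * K"
      using linear_bounded_pos[OF T] by (metis mult.commute)
    define e' where "e' = e / K\<^sup>2"
    have e': "e' > 0" unfolding e'_def using e K by simp
    obtain r where r: "r > 0" "\<And>h. norm h < r \<Longrightarrow> ?W (x + h) \<le> ?W x + p \<bullet> h + Q h / 2 + e' * (norm h)\<^sup>2"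
      using upper_jetD_ball[OF jet e' quad_form_0[OF Q]] by auto
    have "f (y + k) \<le> f y + p \<bullet> k + (Q (T k) + \<kappa> * (norm (T k - k))\<^sup>2) / 2 + e * (norm k)\<^sup>2"
      if k: "y + k \<in> S" "norm k < r / K" for k
    proof -
      have "norm k * K < r" using k(2) K by (simp add: field_simps)
      then have nT: "norm (T k) < r" using K(2)[of k] by linarith
      have "(norm (T k))\<^sup>2 \<le> (norm k * K)\<^sup>2" using K(2) by (intro power_mono) auto
      then have "e' * (norm (T k))\<^sup>2 \<le> e' * (norm k * K)\<^sup>2" using e' by (intro mult_left_mono) auto
      also have "\<dots> = e * (norm k)\<^sup>2" unfolding e'_def using K by (simp add: power_mult_distrib)
      finally have e1: "e' * (norm (T k))\<^sup>2 \<le> e * (norm k)\<^sup>2" .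
      have "(norm (x + T k - (y + k)))\<^sup>2 = (norm (x - y))\<^sup>2 + 2 * ((x - y) \<bullet> (T k - k)) + (norm (T k - k))\<^sup>2"
        unfolding power2_norm_eq_inner by (simp add: inner_diff_left inner_diff_right inner_add_left inner_add_right inner_commute)
      then have e2: "\<kappa> / 2 * (norm (x + T k - (y + k)))\<^sup>2
          = \<kappa> / 2 * (norm (x - y))\<^sup>2 + \<kappa> * ((x - y) \<bullet> (T k - k)) + \<kappa> * (norm (T k - k))\<^sup>2 / 2"
      proof -
        have "\<kappa> / 2 * (a + 2 * b + c) = \<kappa> / 2 * a + \<kappa> * b + \<kappa> * c / 2" for a b c :: real by (simp add: field_simps)
        then show ?thesis using \<open>(norm (x + T k - (y + k)))\<^sup>2 = _\<close> by simp
      qed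
      \<comment> \<open>This cancels the gradient term p.(T k) of the sup-convolution and leaves
        p.k, so the gradient of the new jet does not depend on \<open>T\<close>.\<close>
      have e3: "\<kappa> * ((x - y) \<bullet> (T k - k)) = p \<bullet> k - p \<bullet> T k" unfolding p by (simp add: inner_diff_left inner_diff_right algebra_simps)
      show ?thesis using up[OF k(1), of "T k"] r(2)[OF nT] e1 e2 e3 y(2) by (simp add: field_simps)
    qed
    then show "\<exists>d>0. \<forall>k. y + k \<in> S \<longrightarrow> norm k < d \<longrightarrow>
       f (y + k) \<le> f y + p \<bullet> k + (Q (T k) + \<kappa> * (norm (T k - k))\<^sup>2) / 2 + e * (norm k)\<^sup>2"
      using r(1) K by (intro exI[of _ "r / K"]) auto
  qed
qed

text \<open>\<open>touch\<close> puts a paraboloid above the sup-convolution at \<open>xh\<close>,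
  while every optimal point puts one below it. Optimal points for nearby x must therefore lie near
  \<open>yh\<close>, within 5 |x - xh|.\<close>

lemma sup_conv_optimal_near:
  assumes yh: "yh \<in> S" "sup_conv \<kappa> S f xh = f yh - \<kappa> / 2 * (norm (xh - yh))\<^sup>2"
    and touch: "\<And>h. sup_conv \<kappa> S f (xh + h) \<le> sup_conv \<kappa> S f xh + \<kappa> * ((yh - xh) \<bullet> h) + \<kappa> / 2 * (norm h)\<^sup>2"
    and r: "r > 0"
  obtains \<rho> where "\<rho> > 0" "\<And>x y. norm (x - xh) < \<rho> \<Longrightarrow> y \<in> S \<Longrightarrow> sup_conv \<kappa> S f x = f y - \<kappa> / 2 * (norm (x - y))\<^sup>2 \<Longrightarrow>
     norm (y - yh) \<le> r \<and> \<bar>f y - f yh\<bar> \<le> r \<and> norm (\<kappa> *\<^sub>R (y - x) - \<kappa> *\<^sub>R (yh - xh)) \<le> r"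
proof -
  let ?W = "sup_conv \<kappa> S f"
  have near: "norm (y - yh) \<le> 5 * norm (x - xh)" if y: "y \<in> S" "?W x = f y - \<kappa> / 2 * (norm (x - y))\<^sup>2" for x y
  proof -
    define h where "h = x - xh"
    define v where "v = y - yh"
    have key: "v \<bullet> k \<le> (norm (h + k))\<^sup>2" for k
    proof -
      have a: "f y - \<kappa> / 2 * (norm (xh + (h + k) - y))\<^sup>2 \<le> ?W (xh + (h + k))" by (rule sup_conv_ge[OF y(1)])
      have b: "?W (xh + (h + k)) \<le> ?W xh + \<kappa> * ((yh - xh) \<bullet> (h + k)) + \<kappa> / 2 * (norm (h + k))\<^sup>2" by (rule touch)
      have c: "f yh - \<kappa> / 2 * (norm (xh + h - yh))\<^sup>2 \<le> ?W (xh + h)" by (rule sup_conv_ge[OF yh(1)])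
      have d: "?W (xh + h) = f y - \<kappa> / 2 * (norm (xh + h - y))\<^sup>2" using y(2) unfolding h_def by simp
      have "\<kappa> / 2 * ((norm (xh + h - y))\<^sup>2 - (norm (xh + (h + k) - y))\<^sup>2 - ((norm (xh + h - yh))\<^sup>2 - (norm (xh - yh))\<^sup>2)
          - 2 * ((yh - xh) \<bullet> (h + k)) - (norm (h + k))\<^sup>2) \<le> 0"
        using a b c d yh(2) by (simp add: algebra_simps)
      then have "(norm (xh + h - y))\<^sup>2 - (norm (xh + (h + k) - y))\<^sup>2 - ((norm (xh + h - yh))\<^sup>2 - (norm (xh - yh))\<^sup>2)
          - 2 * ((yh - xh) \<bullet> (h + k)) - (norm (h + k))\<^sup>2 \<le> 0" using lam by (simp add: mult_le_0_iff)
      then show ?thesis unfolding v_def power2_norm_eq_inner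
        by (simp add: inner_diff_left inner_diff_right inner_add_left inner_add_right inner_commute)
    qed
    \<comment> \<open>The choice k = v/2 yields |v|^2/4 \<le> |h|^2 + |h||v|, which excludes |h| <
      |v|/5 because 1/25 + 1/5 < 1/4.\<close>
    have "v \<bullet> ((1/2) *\<^sub>R v) \<le> (norm (h + (1/2) *\<^sub>R v))\<^sup>2" by (rule key)
    also have "\<dots> \<le> (norm h + norm v / 2)\<^sup>2"
      using norm_triangle_ineq[of h "(1/2) *\<^sub>R v"] by (intro power_mono) auto
    finally have q: "(norm v)\<^sup>2 / 4 \<le> (norm h)\<^sup>2 + norm h * norm v"
      by (simp add: power2_sum power2_norm_eq_inner power2_eq_square[of "norm v / 2"] field_simps)
    show ?thesis
    proof (rule ccontr)
      assume "\<not> ?thesis"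
      then have lt: "norm h < norm v / 5" unfolding h_def v_def by simp
      then have le: "norm h \<le> norm v / 5" by simp
      have "(norm h)\<^sup>2 \<le> (norm v / 5)\<^sup>2" by (rule power_mono[OF le]) simp
      moreover have "norm h * norm v \<le> norm v / 5 * norm v" by (rule mult_right_mono[OF le]) simp
      moreover have "(norm v / 5)\<^sup>2 = (norm v)\<^sup>2 / 25" "norm v / 5 * norm v = (norm v)\<^sup>2 / 5" by (simp_all add: power2_eq_square)
      ultimately have "(norm v)\<^sup>2 \<le> 0" using q by linarith
      then have "norm v = 0" by simp
      then show False using lt norm_ge_zero[of h] by simp
    qed
  qed
  obtain B where B: "B-lipschitz_on UNIV (\<lambda>x. ?W x + \<kappa> / 2 * (norm x)\<^sup>2)"
    by (rule sup_conv_convex_part) (rule that)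
  \<comment> \<open>At an optimal pair \<open>F\<close> is the value of \<open>f\<close> at the
    second point. Its continuity gives two-sided closeness of values although \<open>f\<close> is
    only upper semicontinuous.\<close>
  define F where "F q = (?W (fst q) + \<kappa> / 2 * (norm (fst q))\<^sup>2) - \<kappa> / 2 * (norm (fst q))\<^sup>2 + \<kappa> / 2 * (norm (fst q - snd q))\<^sup>2" for q
  have "continuous_on UNIV F" unfolding F_def
    by (intro continuous_intros continuous_on_compose2[OF lipschitz_on_continuous_on[OF B]]) auto
  then have "isCont F (xh, yh)" by (simp add: continuous_on_eq_continuous_at)
  then obtain \<delta> where del: "\<delta> > 0" "\<And>q. dist q (xh, yh) < \<delta> \<Longrightarrow> dist (F q) (F (xh, yh)) < r"
    using r unfolding continuous_at_eps_delta by blast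
  define \<rho> where "\<rho> = min (r / 5) (min (\<delta> / 6) (r / (6 * \<kappa>)))"
  show ?thesis
  proof (rule that[of \<rho>])
    show "\<rho> > 0" unfolding \<rho>_def using r del lam by simp
    fix x y assume x: "norm (x - xh) < \<rho>" and y: "y \<in> S" "?W x = f y - \<kappa> / 2 * (norm (x - y))\<^sup>2"
    have n: "norm (y - yh) \<le> 5 * norm (x - xh)" by (rule near[OF y])
    have "dist (x, y) (xh, yh) \<le> dist x xh + dist y yh"
      unfolding dist_Pair_Pair by (rule sqrt_sum_squares_le_sum) auto
    also have "\<dots> = norm (x - xh) + norm (y - yh)" by (simp add: dist_norm)
    also have "\<dots> < \<delta>" using n x unfolding \<rho>_def by simp
    finally have "dist (F (x, y)) (F (xh, yh)) < r" by (rule del(2))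
    moreover have "F (x, y) = f y" "F (xh, yh) = f yh" unfolding F_def using y yh by auto
    ultimately have 1: "\<bar>f y - f yh\<bar> \<le> r" by (simp add: dist_real_def)
    have "norm ((y - x) - (yh - xh)) \<le> norm (y - yh) + norm (x - xh)"
      using norm_triangle_ineq4[of "y - yh" "x - xh"] by (simp add: algebra_simps)
    also have "\<dots> \<le> r / \<kappa>" using n x unfolding \<rho>_def by (simp add: field_simps)
    finally have "\<kappa> * norm ((y - x) - (yh - xh)) \<le> r" using lam by (simp add: field_simps)
    then have 2: "norm (\<kappa> *\<^sub>R (y - x) - \<kappa> *\<^sub>R (yh - xh)) \<le> r"
      using lam by (simp add: scaleR_diff_right[symmetric] del: scaleR_diff_right)
    show "norm (y - yh) \<le> r \<and> \<bar>f y - f yh\<bar> \<le> r \<and> norm (\<kappa> *\<^sub>R (y - x) - \<kappa> *\<^sub>R (yh - xh)) \<le> r"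
      using 1 2 n x unfolding \<rho>_def by simp
  qed
qed

end

text \<open>A substitute for the theorem on sums, for operators that are concave in the Hessian.  The
  quadratic form \<open>A\<close> is, up to small corrections, the Hessian of a mollified sup-convolution of \<open>U\<close>;
  it inherits every constant-coefficient linear inequality satisfied by the jets of \<open>U\<close>.\<close>

theorem doubling_jets:
  fixes U V :: "'a::euclidean_space \<Rightarrow> real" and Z :: "'a set" and yh zh :: 'a and \<kappa> :: real
  defines "ph \<equiv> (\<kappa> / 2) *\<^sub>R (yh - zh)"
  assumes Z: "compact Z" and U: "usc_on Z U" and V: "usc_on Z V" and lam: "\<kappa> > 0"
    and yh: "yh \<in> Z" and zh: "zh \<in> Z"
    and max: "\<And>y z. y \<in> Z \<Longrightarrow> z \<in> Z \<Longrightarrow>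
       U y + V z - \<kappa> / 4 * (norm (y - z))\<^sup>2 \<le> U yh + V zh - \<kappa> / 4 * (norm (yh - zh))\<^sup>2"
    and r: "r > 0"
  obtains A z p where "quad_form A" "z \<in> Z" "norm (z - zh) \<le> r" "\<bar>V z - V zh\<bar> \<le> r" "norm (p - ph) \<le> r"
    "\<And>T. linear T \<Longrightarrow> upper_jet Z V z (- p) (\<lambda>h. - A (T h) + \<kappa> * (norm (T h - h))\<^sup>2)"
    "\<And>(d :: 'm::finite \<Rightarrow> 'a) h.
       (\<And>y q Q. y \<in> Z \<Longrightarrow> norm (y - yh) \<le> r \<Longrightarrow> \<bar>U y - U yh\<bar> \<le> r \<Longrightarrow> norm (q - ph) \<le> r \<Longrightarrow> quad_form Q \<Longrightarrow>
         (\<And>T. linear T \<Longrightarrow> upper_jet Z U y q (\<lambda>h. Q (T h) + \<kappa> * (norm (T h - h))\<^sup>2)) \<Longrightarrow>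
         h \<le> (\<Sum>k\<in>UNIV. Q (d k)))
       \<Longrightarrow> h \<le> (\<Sum>k\<in>UNIV. A (d k)) + r * (\<Sum>k\<in>UNIV. (norm (d k))\<^sup>2)"
proof -
  have ne: "Z \<noteq> {}" using yh by blast
  \<comment> \<open>|x - yh|^2 + |x - zh|^2 has its least value |yh - zh|^2/2 at the midpoint. Hence
    the doubled maximum with weight \<kappa>/4 is the maximum of the sum of the two sup-convolutions
    with weight \<kappa>/2, attained at \<open>xh\<close>.\<close>
  define xh where "xh = (1/2) *\<^sub>R (yh + zh)"
  define W where "W = sup_conv \<kappa> Z U"
  define W' where "W' = sup_conv \<kappa> Z V"
  define M where "M = U yh + V zh - \<kappa> / 4 * (norm (yh - zh))\<^sup>2"
  note Wge = sup_conv_ge[OF Z ne U lam, folded W_def] and W'ge = sup_conv_ge[OF Z ne V lam, folded W'_def]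
  have xy: "xh - yh = (1/2) *\<^sub>R (zh - yh)" "xh - zh = (1/2) *\<^sub>R (yh - zh)" "yh - xh = (1/2) *\<^sub>R (yh - zh)"
    unfolding xh_def by (simp_all add: algebra_simps flip: scaleR_add_left)
  have ph1: "ph = \<kappa> *\<^sub>R (yh - xh)" and ph2: "ph = - (\<kappa> *\<^sub>R (zh - xh))"
    unfolding ph_def xy(3) minus_diff_eq[symmetric, of zh xh] xy(2) by (simp_all add: algebra_simps)
  have sumle: "W x + W' x \<le> M" for x
  proof -
    obtain y where y: "y \<in> Z" "W x = U y - \<kappa> / 2 * (norm (x - y))\<^sup>2"
      using sup_conv_attained[OF Z ne U] unfolding W_def by metis
    obtain z where z: "z \<in> Z" "W' x = V z - \<kappa> / 2 * (norm (x - z))\<^sup>2"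
      using sup_conv_attained[OF Z ne V] unfolding W'_def by metis
    have "(norm (y - z))\<^sup>2 + (norm (x - y + (x - z)))\<^sup>2 = 2 * (norm (x - y))\<^sup>2 + 2 * (norm (x - z))\<^sup>2"
      unfolding power2_norm_eq_inner by (simp add: inner_diff_left inner_diff_right inner_add_left inner_add_right inner_commute)
    then have "(norm (y - z))\<^sup>2 \<le> 2 * (norm (x - y))\<^sup>2 + 2 * (norm (x - z))\<^sup>2"
      using zero_le_power2[of "norm (x - y + (x - z))"] by linarith
    then have "\<kappa> / 4 * (norm (y - z))\<^sup>2 \<le> \<kappa> / 4 * (2 * (norm (x - y))\<^sup>2 + 2 * (norm (x - z))\<^sup>2)"
      using lam by (intro mult_left_mono) auto
    then show ?thesis using max[OF y(1) z(1)] y(2) z(2) unfolding M_def by (simp add: field_simps)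
  qed
  have nh: "(norm (xh - yh))\<^sup>2 = (norm (yh - zh))\<^sup>2 / 4" "(norm (xh - zh))\<^sup>2 = (norm (yh - zh))\<^sup>2 / 4"
    unfolding xy by (simp_all add: power_divide norm_minus_commute)
  have Wxh: "W xh = U yh - \<kappa> / 2 * (norm (xh - yh))\<^sup>2" and W'xh: "W' xh = V zh - \<kappa> / 2 * (norm (xh - zh))\<^sup>2"
    and WW: "W xh + W' xh = M"
    using Wge[OF yh, of xh] W'ge[OF zh, of xh] sumle[of xh] unfolding nh M_def by (auto simp: field_simps)
  have touch: "W (xh + h) \<le> W xh + \<kappa> * ((yh - xh) \<bullet> h) + \<kappa> / 2 * (norm h)\<^sup>2" for h
  proof -
    have "W (xh + h) \<le> M - (V zh - \<kappa> / 2 * (norm (xh + h - zh))\<^sup>2)" using sumle[of "xh + h"] W'ge[OF zh, of "xh + h"] by linarith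
    also have "\<dots> = W xh + \<kappa> / 2 * ((norm (xh + h - zh))\<^sup>2 - (norm (xh - zh))\<^sup>2)"
      using WW W'xh by (simp add: algebra_simps)
    also have "(norm (xh + h - zh))\<^sup>2 - (norm (xh - zh))\<^sup>2 = 2 * ((xh - zh) \<bullet> h) + (norm h)\<^sup>2"
      unfolding power2_norm_eq_inner by (simp add: inner_diff_left inner_diff_right inner_add_left inner_add_right inner_commute)
    finally show ?thesis unfolding xy(2,3) by (simp add: field_simps)
  qed
  have touch': "W' (xh + h) \<le> W' xh + \<kappa> * ((zh - xh) \<bullet> h) + \<kappa> / 2 * (norm h)\<^sup>2" for h
  proof -
    have "W' (xh + h) \<le> M - (U yh - \<kappa> / 2 * (norm (xh + h - yh))\<^sup>2)" using sumle[of "xh + h"] Wge[OF yh, of "xh + h"] by linarith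
    also have "\<dots> = W' xh + \<kappa> / 2 * ((norm (xh + h - yh))\<^sup>2 - (norm (xh - yh))\<^sup>2)"
      using WW Wxh by (simp add: algebra_simps)
    also have "(norm (xh + h - yh))\<^sup>2 - (norm (xh - yh))\<^sup>2 = 2 * ((xh - yh) \<bullet> h) + (norm h)\<^sup>2"
      unfolding power2_norm_eq_inner by (simp add: inner_diff_left inner_diff_right inner_add_left inner_add_right inner_commute)
    also have "xh - yh = zh - xh" unfolding xh_def by (simp add: algebra_simps flip: scaleR_add_left)
    finally show ?thesis by (simp add: field_simps)
  qed
  obtain \<rho>1 where rho1: "\<rho>1 > 0" "\<And>x y. norm (x - xh) < \<rho>1 \<Longrightarrow> y \<in> Z \<Longrightarrow> W x = U y - \<kappa> / 2 * (norm (x - y))\<^sup>2 \<Longrightarrow>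
     norm (y - yh) \<le> r \<and> \<bar>U y - U yh\<bar> \<le> r \<and> norm (\<kappa> *\<^sub>R (y - x) - \<kappa> *\<^sub>R (yh - xh)) \<le> r"
    by (rule sup_conv_optimal_near[OF Z ne U lam, folded W_def, OF yh Wxh touch r]) (rule that)
  obtain \<rho>2 where rho2: "\<rho>2 > 0" "\<And>x y. norm (x - xh) < \<rho>2 \<Longrightarrow> y \<in> Z \<Longrightarrow> W' x = V y - \<kappa> / 2 * (norm (x - y))\<^sup>2 \<Longrightarrow>
     norm (y - zh) \<le> r \<and> \<bar>V y - V zh\<bar> \<le> r \<and> norm (\<kappa> *\<^sub>R (y - x) - \<kappa> *\<^sub>R (zh - xh)) \<le> r"
    by (rule sup_conv_optimal_near[OF Z ne V lam, folded W'_def, OF zh W'xh touch' r]) (rule that)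
  define \<rho> where "\<rho> = min \<rho>1 \<rho>2"
  have rho: "\<rho> > 0" unfolding \<rho>_def using rho1 rho2 by simp
  obtain B where cl: "B-lipschitz_on UNIV (\<lambda>x. W x + \<kappa> / 2 * (norm x)\<^sup>2)" and
    cm: "\<And>x a. (W (x + a) + \<kappa> / 2 * (norm (x + a))\<^sup>2) + (W (x - a) + \<kappa> / 2 * (norm (x - a))\<^sup>2) \<ge> 2 * (W x + \<kappa> / 2 * (norm x)\<^sup>2)"
    by (rule sup_conv_convex_part[OF Z ne U lam, folded W_def]) (rule that)
  define c where "c x = W x + \<kappa> / 2 * (norm x)\<^sup>2" for x
  have cl: "B-lipschitz_on UNIV c" using cl unfolding c_def .
  have cm: "c (x + a) + c (x - a) \<ge> 2 * c x" for x a using cm unfolding c_def .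
  obtain B' where W'l: "B'-lipschitz_on UNIV (\<lambda>x. W' x + \<kappa> / 2 * (norm x)\<^sup>2)"
    by (rule sup_conv_convex_part[OF Z ne V lam, folded W'_def]) (rule that)
  have W'c: "continuous_on UNIV W'"
  proof -
    have "continuous_on UNIV (\<lambda>x. (W' x + \<kappa> / 2 * (norm x)\<^sup>2) - \<kappa> / 2 * (norm x)\<^sup>2)"
      by (intro continuous_intros lipschitz_on_continuous_on[OF W'l])
    then show ?thesis by simp
  qed
  have B: "B \<ge> 0" by (rule lipschitz_on_nonneg[OF cl])
  \<comment> \<open>The penalty with coefficient \<nu> makes the maximum at \<open>xh\<close>
    strict; its Hessian coefficient 2 \<nu> = r is the correction in the conclusion. Mollification
    moves values by at most B \<sigma>, and \<sigma> is so small that the maximum cannot reach the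
    sphere of radius \<rho>/2.\<close>
  define \<nu> where "\<nu> = r / 2"
  define \<sigma> where "\<sigma> = min (\<rho> / 4) (\<nu> * \<rho>\<^sup>2 / (16 * (B + 1)))"
  have nu: "\<nu> > 0" unfolding \<nu>_def using r by simp
  have sig: "\<sigma> > 0" "\<sigma> \<le> \<rho> / 4" "2 * (B * \<sigma>) < \<nu> * (\<rho> / 2)\<^sup>2"
  proof -
    show "\<sigma> > 0" unfolding \<sigma>_def using rho nu B by simp
    show "\<sigma> \<le> \<rho> / 4" unfolding \<sigma>_def by (rule min.cobounded1)
    have "\<sigma> \<le> \<nu> * \<rho>\<^sup>2 / (16 * (B + 1))" unfolding \<sigma>_def by simp
    then have "\<sigma> * (16 * (B + 1)) \<le> \<nu> * \<rho>\<^sup>2" using B by (simp add: pos_le_divide_eq)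
    then have "16 * (B * \<sigma>) \<le> \<nu> * \<rho>\<^sup>2" using \<open>\<sigma> > 0\<close> by (simp add: algebra_simps)
    moreover have "0 < \<nu> * \<rho>\<^sup>2" using nu rho by simp
    ultimately show "2 * (B * \<sigma>) < \<nu> * (\<rho> / 2)\<^sup>2" by (simp add: power_divide)
  qed
  obtain \<Lambda> G where so: "second_order \<Lambda> (moll \<sigma> c) G" using moll_second_order[OF cl sig(1)] by blast
  define w where "w x = moll \<sigma> c x - \<kappa> / 2 * (norm x)\<^sup>2 - \<nu> * (norm (x - xh))\<^sup>2" for x
  have mc: "continuous_on UNIV (moll \<sigma> c)" by (rule lipschitz_on_continuous_on[OF moll_lipschitz[OF cl]])
  have "continuous_on (cball xh (\<rho>/2)) (\<lambda>x. w x + W' x)" unfolding w_def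
    by (intro continuous_intros continuous_on_subset[OF mc] continuous_on_subset[OF W'c]) auto
  then have "\<exists>x\<in>cball xh (\<rho>/2). \<forall>y\<in>cball xh (\<rho>/2). w y + W' y \<le> w x + W' x"
    using rho by (intro continuous_attains_sup) auto
  then obtain x1 where x1: "x1 \<in> cball xh (\<rho>/2)" "\<And>x. x \<in> cball xh (\<rho>/2) \<Longrightarrow> w x + W' x \<le> w x1 + W' x1" by blast
  have x1i: "norm (x1 - xh) < \<rho> / 2"
  proof (rule ccontr)
    assume "\<not> ?thesis"
    then have e: "norm (x1 - xh) = \<rho> / 2" using x1(1) by (simp add: dist_norm norm_minus_commute)
    have "w x1 + W' x1 \<le> M + B * \<sigma> - \<nu> * (\<rho> / 2)\<^sup>2"
      using moll_close[OF cl sig(1), of x1] sumle[of x1] unfolding w_def e c_def by (simp add: abs_le_iff)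
    moreover have "w xh + W' xh \<ge> M - B * \<sigma>"
      using moll_close[OF cl sig(1), of xh] WW unfolding w_def c_def by (simp add: abs_le_iff)
    ultimately show False using x1(2)[of xh] sig(3) rho by simp
  qed
  obtain p0 where p0: "\<And>e. e > 0 \<Longrightarrow> \<exists>r>0. \<forall>h. norm h < r \<longrightarrow> \<bar>moll \<sigma> c (x1 + h) - moll \<sigma> c x1 - p0 \<bullet> h - G x1 h / 2\<bar> \<le> e * (norm h)\<^sup>2"
    using second_order_expansion[OF so] by metis
  \<comment> \<open>Hessian and gradient of \<open>w\<close> at \<open>x1\<close>. Since w + W' is
    maximal there, their negatives form an upper jet of \<open>W'\<close>, which
    \<open>sup_conv_jet\<close> passes on to \<open>V\<close> at \<open>z\<close>.\<close>
  define A where "A h = G x1 h - (\<kappa> + 2 * \<nu>) * (norm h)\<^sup>2" for h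
  define p where "p = p0 - \<kappa> *\<^sub>R x1 - (2 * \<nu>) *\<^sub>R (x1 - xh)"
  have qA: "quad_form A" unfolding A_def
    by (intro quad_form_diff quad_form_cmult quad_form_norm second_orderD(1)[OF so])
  have jW': "upper_jet UNIV W' x1 (- p) (\<lambda>h. - A h)"
  proof (rule upper_jetI_ball)
    fix e :: real assume e: "e > 0"
    obtain s where s: "s > 0" "\<And>h. norm h < s \<Longrightarrow> \<bar>moll \<sigma> c (x1 + h) - moll \<sigma> c x1 - p0 \<bullet> h - G x1 h / 2\<bar> \<le> e * (norm h)\<^sup>2"
      using p0[OF e] by blast
    have "W' (x1 + h) \<le> W' x1 + (- p) \<bullet> h + - A h / 2 + e * (norm h)\<^sup>2" if h: "norm h < min s (\<rho> / 2 - norm (x1 - xh))" for h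
    proof -
      have "norm (x1 + h - xh) \<le> norm (x1 - xh) + norm h" using norm_triangle_ineq[of "x1 - xh" h] by (simp add: algebra_simps)
      then have "x1 + h \<in> cball xh (\<rho>/2)" using h by (simp add: dist_norm norm_minus_commute)
      then have "W' (x1 + h) \<le> W' x1 + w x1 - w (x1 + h)" using x1(2) by fastforce
      moreover have "(norm (x1 + h))\<^sup>2 = (norm x1)\<^sup>2 + 2 * (x1 \<bullet> h) + (norm h)\<^sup>2"
        "(norm (x1 + h - xh))\<^sup>2 = (norm (x1 - xh))\<^sup>2 + 2 * ((x1 - xh) \<bullet> h) + (norm h)\<^sup>2"
        unfolding power2_norm_eq_inner by (simp_all add: inner_diff_left inner_diff_right inner_add_left inner_add_right inner_commute)
      ultimately have "W' (x1 + h) \<le> W' x1 + (moll \<sigma> c x1 - moll \<sigma> c (x1 + h)) + \<kappa> / 2 * (2 * (x1 \<bullet> h) + (norm h)\<^sup>2)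
          + \<nu> * (2 * ((x1 - xh) \<bullet> h) + (norm h)\<^sup>2)"
        unfolding w_def by (simp add: field_simps)
      moreover have "(- p) \<bullet> h + - A h / 2 = - (p0 \<bullet> h) - G x1 h / 2 + \<kappa> / 2 * (2 * (x1 \<bullet> h) + (norm h)\<^sup>2)
          + \<nu> * (2 * ((x1 - xh) \<bullet> h) + (norm h)\<^sup>2)"
        unfolding p_def A_def by (simp add: inner_diff_left inner_add_left field_simps)
      ultimately show ?thesis using s(2)[of h] h by (simp add: abs_le_iff)
    qed
    then show "\<exists>s>0. \<forall>h. x1 + h \<in> UNIV \<longrightarrow> norm h < s \<longrightarrow> W' (x1 + h) \<le> W' x1 + (- p) \<bullet> h + - A h / 2 + e * (norm h)\<^sup>2"
      using s(1) x1i by (intro exI[of _ "min s (\<rho> / 2 - norm (x1 - xh))"]) auto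
  qed
  obtain z where z: "z \<in> Z" "W' x1 = V z - \<kappa> / 2 * (norm (x1 - z))\<^sup>2"
    using sup_conv_attained[OF Z ne V] unfolding W'_def by metis
  have x1r: "norm (x1 - xh) < \<rho>2" using x1i rho unfolding \<rho>_def by simp
  note zn = rho2(2)[OF x1r z]
  have mp: "- p = \<kappa> *\<^sub>R (z - x1)"
    by (rule sup_conv_jet(1)[OF Z ne V lam jW'[unfolded W'_def] quad_form_uminus[OF qA] z[unfolded W'_def]])
  have "norm (p - ph) = norm (- p - - ph)" by (simp add: norm_minus_commute)
  also have "\<dots> = norm (\<kappa> *\<^sub>R (z - x1) - \<kappa> *\<^sub>R (zh - xh))" unfolding mp ph2 by simp
  finally have pr: "norm (p - ph) \<le> r" using zn by simp
  show ?thesis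
  proof (rule that[OF qA z(1) _ _ pr])
    show "norm (z - zh) \<le> r" "\<bar>V z - V zh\<bar> \<le> r" using zn by auto
    show "upper_jet Z V z (- p) (\<lambda>h. - A (T h) + \<kappa> * (norm (T h - h))\<^sup>2)" if "linear T" for T
      by (rule sup_conv_jet(2)[OF Z ne V lam jW'[unfolded W'_def] quad_form_uminus[OF qA] z[unfolded W'_def] that])
    fix d :: "'m \<Rightarrow> 'a" and h :: real
    assume hyp: "\<And>y q Q. y \<in> Z \<Longrightarrow> norm (y - yh) \<le> r \<Longrightarrow> \<bar>U y - U yh\<bar> \<le> r \<Longrightarrow> norm (q - ph) \<le> r \<Longrightarrow> quad_form Q \<Longrightarrow>
         (\<And>T. linear T \<Longrightarrow> upper_jet Z U y q (\<lambda>h. Q (T h) + \<kappa> * (norm (T h - h))\<^sup>2)) \<Longrightarrow>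
         h \<le> (\<Sum>k\<in>UNIV. Q (d k))"
    define S where "S = (\<Sum>k\<in>UNIV. (norm (d k))\<^sup>2)"
    \<comment> \<open>\<open>c\<close> exceeds \<open>W\<close> by \<kappa>/2 |x|^2, so a lower
      bound h for the jets of \<open>W\<close> becomes h + \<kappa> S for those of
      \<open>c\<close>.\<close>
    have "h + \<kappa> * S \<le> (\<Sum>k\<in>UNIV. G x1 (d k))"
    proof (rule moll_hessian_ge[where d = d, OF cl cm _ sig(1) _ so])
      show "dist x1 xh + \<sigma> < \<rho>" using x1i sig(2) rho by (simp add: dist_norm)
      fix x q Q assume x: "dist x xh < \<rho>" and Q: "quad_form Q" and jet: "upper_jet UNIV c x q Q"
      define Q' where "Q' h = Q h - \<kappa> * (norm h)\<^sup>2" for h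
      have Q': "quad_form Q'" unfolding Q'_def by (intro quad_form_diff quad_form_cmult quad_form_norm Q)
      have jW: "upper_jet UNIV W x (q - \<kappa> *\<^sub>R x) Q'"
      proof (rule upper_jetI_ball)
        fix e :: real assume e: "e > 0"
        obtain s where s: "s > 0" "\<And>h. norm h < s \<Longrightarrow> c (x + h) \<le> c x + q \<bullet> h + Q h / 2 + e * (norm h)\<^sup>2"
          using upper_jetD_ball[OF jet e quad_form_0[OF Q]] by auto
        have "W (x + h) \<le> W x + (q - \<kappa> *\<^sub>R x) \<bullet> h + Q' h / 2 + e * (norm h)\<^sup>2" if h: "norm h < s" for h
        proof -
          have "(norm (x + h))\<^sup>2 = (norm x)\<^sup>2 + 2 * (x \<bullet> h) + (norm h)\<^sup>2"
            unfolding power2_norm_eq_inner by (simp_all add: inner_diff_left inner_diff_right inner_add_left inner_add_right inner_commute)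
          then show ?thesis using s(2)[OF h] unfolding c_def Q'_def by (simp add: inner_diff_left field_simps)
        qed
        then show "\<exists>s>0. \<forall>h. x + h \<in> UNIV \<longrightarrow> norm h < s \<longrightarrow> W (x + h) \<le> W x + (q - \<kappa> *\<^sub>R x) \<bullet> h + Q' h / 2 + e * (norm h)\<^sup>2"
          using s(1) by blast
      qed
      obtain y where y: "y \<in> Z" "W x = U y - \<kappa> / 2 * (norm (x - y))\<^sup>2"
        using sup_conv_attained[OF Z ne U] unfolding W_def by metis
      have xr: "norm (x - xh) < \<rho>1" using x unfolding \<rho>_def by (simp add: dist_norm)
      note yn = rho1(2)[OF xr y]
      have q: "q - \<kappa> *\<^sub>R x = \<kappa> *\<^sub>R (y - x)"
        by (rule sup_conv_jet(1)[OF Z ne U lam jW[unfolded W_def] Q' y[unfolded W_def]])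
      have "h \<le> (\<Sum>k\<in>UNIV. Q' (d k))"
      proof (rule hyp[OF y(1) _ _ _ Q'])
        show "norm (y - yh) \<le> r" "\<bar>U y - U yh\<bar> \<le> r" using yn by auto
        show "norm ((q - \<kappa> *\<^sub>R x) - ph) \<le> r" using yn unfolding q ph1 by simp
        show "upper_jet Z U y (q - \<kappa> *\<^sub>R x) (\<lambda>h. Q' (T h) + \<kappa> * (norm (T h - h))\<^sup>2)" if "linear T" for T
          by (rule sup_conv_jet(2)[OF Z ne U lam jW[unfolded W_def] Q' y[unfolded W_def] that])
      qed
      then show "h + \<kappa> * S \<le> (\<Sum>k\<in>UNIV. Q (d k))"
        unfolding Q'_def S_def by (simp add: sum_subtractf sum_distrib_left)
    qed
    then have "h \<le> (\<Sum>k\<in>UNIV. A (d k)) + 2 * \<nu> * S"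
      unfolding A_def S_def by (simp add: sum_subtractf sum_distrib_left distrib_right sum.distrib)
    then show "h \<le> (\<Sum>k\<in>UNIV. A (d k)) + r * (\<Sum>k\<in>UNIV. (norm (d k))\<^sup>2)" unfolding S_def \<nu>_def by simp
  qed
qed

section \<open>Determinants of symmetric matrices\<close>

lemma symmetric_inner:
  fixes S :: "real^'m^'m"
  assumes "transpose S = S" shows "x \<bullet> (S *v y) = (S *v x) \<bullet> y"
  by (metis assms dot_lmul_matrix vector_transpose_matrix)

text \<open>A maximiser of the quadratic form on the unit sphere of the orthogonal complement of
  \<open>B\<close> is an eigenvector: the first variation vanishes, and the complement is invariant
  because \<open>S\<close> is symmetric and \<open>B\<close> consists of eigenvectors.\<close>

lemma orthogonal_eigenbasis_extend:
  fixes S :: "real^'m^'m"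
  assumes sym: "transpose S = S"
    and B: "pairwise orthogonal B" "\<And>b. b \<in> B \<Longrightarrow> norm b = 1 \<and> (\<exists>l. S *v b = l *\<^sub>R b)"
    and sp: "span B \<noteq> UNIV"
  obtains v l where "norm v = 1" "S *v v = l *\<^sub>R v" "\<And>b. b \<in> B \<Longrightarrow> orthogonal b v"
proof -
  define N where "N = {x. \<forall>b\<in>B. b \<bullet> x = 0}"
  have sub: "subspace N" unfolding N_def subspace_def by (auto simp: inner_add_right)
  obtain x0 where x0: "x0 \<noteq> 0" "\<And>y. y \<in> span B \<Longrightarrow> orthogonal x0 y"
    using orthogonal_to_subspace_exists_gen[of B UNIV] sp by (auto simp: psubset_eq span_UNIV)
  have x0N: "x0 \<in> N" unfolding N_def using x0(2) span_base by (force simp: orthogonal_def inner_commute)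
  have clN: "closed N" using sub by (rule closed_subspace)
  have comp: "compact (sphere 0 1 \<inter> N)" using clN by (intro compact_Int_closed) auto
  have "(1 / norm x0) *\<^sub>R x0 \<in> sphere 0 1 \<inter> N" using x0 x0N sub by (simp add: subspace_scale)
  then have ne: "sphere 0 1 \<inter> N \<noteq> {}" by blast
  have "continuous_on (sphere 0 1 \<inter> N) (\<lambda>x. x \<bullet> (S *v x))"
    by (intro continuous_intros)
  from continuous_attains_sup[OF comp ne this]
  obtain v where v: "v \<in> sphere 0 1 \<inter> N" "\<And>x. x \<in> sphere 0 1 \<inter> N \<Longrightarrow> x \<bullet> (S *v x) \<le> v \<bullet> (S *v v)"
    by blast
  define l where "l = v \<bullet> (S *v v)"
  have nv: "norm v = 1" and vN: "v \<in> N" using v(1) by auto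
  have le: "x \<bullet> (S *v x) \<le> l * (x \<bullet> x)" if x: "x \<in> N" for x
  proof (cases "x = 0")
    case False
    have "(1 / norm x) *\<^sub>R x \<in> sphere 0 1 \<inter> N" using x False sub by (simp add: subspace_scale)
    from v(2)[OF this] have "(x \<bullet> (S *v x)) / (norm x)\<^sup>2 \<le> l"
      unfolding l_def by (simp add: matrix_vector_mult_scaleR power2_eq_square)
    then show ?thesis using False by (simp add: field_simps power2_norm_eq_inner)
  qed simp
  have SN: "S *v x \<in> N" if "x \<in> N" for x
  proof -
    have "b \<bullet> (S *v x) = 0" if b: "b \<in> B" for b
    proof -
      obtain k where "S *v b = k *\<^sub>R b" using B(2)[OF b] by blast
      then show ?thesis using \<open>x \<in> N\<close> b unfolding symmetric_inner[OF sym] N_def by simp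
    qed
    then show ?thesis unfolding N_def by simp
  qed
  have orth: "y \<bullet> (l *\<^sub>R v - S *v v) = 0" if y: "y \<in> N" for y
  proof -
    define a where "a = y \<bullet> (l *\<^sub>R v - S *v v)"
    define q where "q = l * (y \<bullet> y) - y \<bullet> (S *v y)"
    have "0 \<le> 2 * t * a + t\<^sup>2 * q" for t
    proof -
      have "v + t *\<^sub>R y \<in> N" using y vN sub by (simp add: subspace_add subspace_scale)
      from le[OF this] show ?thesis
        unfolding a_def q_def using nv
        by (simp add: matrix_vector_right_distrib matrix_vector_mult_scaleR inner_add_left inner_add_right inner_diff_right
          power2_eq_square algebra_simps norm_eq_1 symmetric_inner[OF sym, of v y] inner_commute[of "S *v v"] inner_commute[of v y] flip: l_def)
    qed
    note pos = this
    have "a = 0"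
    proof (rule ccontr)
      assume a: "a \<noteq> 0"
      \<comment> \<open>With sign opposite to \<open>a\<close> and this size, the linear term 2 t a
        outweighs t^2 |q|.\<close>
      define t where "t = - a / (\<bar>q\<bar> + 1)"
      have "0 \<le> 2 * t * a + t\<^sup>2 * \<bar>q\<bar>" using pos[of t] mult_left_mono[OF abs_ge_self[of q] zero_le_power2[of t]] by linarith
      also have "t\<^sup>2 * \<bar>q\<bar> \<le> t\<^sup>2 * (\<bar>q\<bar> + 1)" by (intro mult_left_mono) auto
      also have "t\<^sup>2 * (\<bar>q\<bar> + 1) = - t * a"
      proof -
        have "(- a / K)\<^sup>2 * K = - (- a / K) * a" if "K > 0" for K using that by (simp add: power2_eq_square)
        then show ?thesis unfolding t_def by (simp add: add_nonneg_pos)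
      qed
      finally have "0 \<le> t * a" by (simp add: mult.commute)
      moreover have "t * a = - (a\<^sup>2 / (\<bar>q\<bar> + 1))" unfolding t_def by (simp add: power2_eq_square)
      moreover have "a\<^sup>2 / (\<bar>q\<bar> + 1) > 0" using a by (simp add: add_nonneg_pos)
      ultimately show False by simp
    qed
    then show ?thesis unfolding a_def .
  qed
  have "l *\<^sub>R v - S *v v \<in> N" using SN[OF vN] vN sub by (simp add: subspace_diff subspace_scale)
  then have "l *\<^sub>R v - S *v v = 0" using orth inner_eq_zero_iff by blast
  then show ?thesis using that[of v l] nv vN unfolding N_def orthogonal_def by auto
qed

text \<open>An orthonormal set of eigenvectors of maximal size spans, since otherwise
  \<open>orthogonal_eigenbasis_extend\<close> enlarges it.\<close>

theorem symmetric_spectral: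
  fixes S :: "real^'m^'m"
  assumes sym: "transpose S = S"
  obtains P :: "real^'m^'m" and l :: "'m \<Rightarrow> real"
  where "orthogonal_matrix P" "\<And>k. S *v column k P = l k *\<^sub>R column k P"
proof -
  define \<B> where "\<B> = {B. pairwise orthogonal B \<and> (\<forall>b\<in>B. norm b = 1 \<and> (\<exists>l. S *v b = l *\<^sub>R b))}"
  have ind: "independent B" "finite B" "card B \<le> CARD('m)" if "B \<in> \<B>" for B
  proof -
    show "independent B" using that unfolding \<B>_def by (intro pairwise_orthogonal_independent) auto
    then show "finite B" "card B \<le> CARD('m)" using independent_bound[of B] by auto
  qed
  have "{} \<in> \<B>" unfolding \<B>_def by auto
  moreover have "\<forall>B. B \<in> \<B> \<longrightarrow> card B < Suc CARD('m)" using ind(3) by (simp add: le_imp_less_Suc)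
  ultimately obtain B where B: "B \<in> \<B>" "\<And>B'. B' \<in> \<B> \<Longrightarrow> card B' \<le> card B"
    using ex_has_greatest_nat[of "\<lambda>B. B \<in> \<B>" "{}" card "Suc CARD('m)"] by (meson less_imp_le)
  have sp: "span B = UNIV"
  proof (rule ccontr)
    assume sp: "span B \<noteq> UNIV"
    have B1: "pairwise orthogonal B" and B2: "\<And>b. b \<in> B \<Longrightarrow> norm b = 1 \<and> (\<exists>l. S *v b = l *\<^sub>R b)"
      using B(1) unfolding \<B>_def by auto
    obtain v l where v: "norm v = 1" "S *v v = l *\<^sub>R v" "\<And>b. b \<in> B \<Longrightarrow> orthogonal b v"
      using orthogonal_eigenbasis_extend[OF sym B1 B2 sp] by blast
    have "insert v B \<in> \<B>" unfolding \<B>_def using B1 B2 v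
      by (auto simp: pairwise_insert orthogonal_commute)
    then have "card (insert v B) \<le> card B" by (rule B(2))
    moreover have "v \<notin> B" using v(1,3) by (auto simp: orthogonal_def norm_eq_1)
    ultimately show False using ind(2)[OF B(1)] by simp
  qed
  have "card B = CARD('m)"
    using dim_span_eq_card_independent[OF ind(1)[OF B(1)]] sp by (simp add: dim_UNIV)
  then obtain g where g: "bij_betw g (UNIV :: 'm set) B"
    using finite_same_card_bij[OF finite[of UNIV] ind(2)[OF B(1)]] by auto
  define P :: "real^'m^'m" where "P = (\<chi> i j. g j $ i)"
  have col: "column k P = g k" for k unfolding P_def column_def by (simp add: vec_eq_iff)
  have gB: "g k \<in> B" for k using g by (auto simp: bij_betw_def)
  have "orthogonal_matrix P" unfolding orthogonal_matrix_orthonormal_columns col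
  proof (intro conjI allI impI)
    show "norm (g i) = 1" for i using B(1) gB unfolding \<B>_def by blast
    fix i j :: 'm assume "i \<noteq> j"
    then have "g i \<noteq> g j" using g by (auto simp: bij_betw_def inj_on_def)
    then show "orthogonal (g i) (g j)" using B(1) gB unfolding \<B>_def pairwise_def by blast
  qed
  moreover have "\<exists>l. \<forall>k. S *v column k P = l k *\<^sub>R column k P"
    unfolding col using B(1) gB unfolding \<B>_def by (intro choice) blast
  ultimately show ?thesis using that by blast
qed

lemma congruence_entry:
  fixes S C :: "real^'m^'m"
  shows "(transpose C ** S ** C) $ i $ j = column i C \<bullet> (S *v column j C)"
proof -
  have e: "(transpose C *v w) $ i = column i C \<bullet> w" for w :: "real^'m"
    by (simp add: matrix_vector_mult_def transpose_def column_def inner_vec_def)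
  have "(transpose C ** S ** C) $ i $ j = ((transpose C ** S ** C) *v axis j 1) $ i"
    unfolding matrix_vector_mult_basis by (simp add: column_def)
  also have "(transpose C ** S ** C) *v axis j 1 = transpose C *v (S *v (C *v axis j 1))"
    by (simp only: matrix_vector_mul_assoc matrix_mul_assoc)
  finally show ?thesis unfolding e matrix_vector_mult_basis .
qed

lemma symmetric_eigenvalues:
  fixes S :: "real^'m^'m"
  assumes sym: "transpose S = S"
  obtains P l where "orthogonal_matrix (P :: real^'m^'m)" "\<And>k. S *v column k P = l k *\<^sub>R column k P"
    "det S = (\<Prod>k\<in>UNIV. l k)" "trace S = (\<Sum>k\<in>UNIV. l k)" "\<And>k. l k = column k P \<bullet> (S *v column k P)"
    "\<And>k. norm (column k P) = 1"
proof -
  obtain P l where P: "orthogonal_matrix (P :: real^'m^'m)" and l: "\<And>k. S *v column k P = l k *\<^sub>R column k P"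
    using symmetric_spectral[OF sym] by blast
  have on: "norm (column i P) = 1" "i \<noteq> j \<Longrightarrow> column i P \<bullet> column j P = 0" for i j
    using P unfolding orthogonal_matrix_orthonormal_columns orthogonal_def by auto
  define D where "D = transpose P ** S ** P"
  have Dij: "D $ i $ j = (if i = j then l i else 0)" for i j
    unfolding D_def congruence_entry l using on by (auto simp: norm_eq_1)
  have PP: "P ** transpose P = mat 1" "transpose P ** P = mat 1" using P unfolding orthogonal_matrix_def by auto
  have "det D = (\<Prod>k\<in>UNIV. l k)" using det_diagonal[of D] Dij by simp
  moreover have "det D = det S"
  proof -
    have "det D = det (transpose P ** P) * det S" unfolding D_def by (simp add: det_mul)
    then show ?thesis by (simp add: PP)
  qed
  moreover have "trace D = (\<Sum>k\<in>UNIV. l k)" unfolding trace_def Dij by simp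
  moreover have "trace D = trace S"
  proof -
    have "trace D = trace (P ** (transpose P ** S))" unfolding D_def by (rule trace_mul_sym)
    also have "P ** (transpose P ** S) = S" by (simp add: matrix_mul_assoc PP)
    finally show ?thesis .
  qed
  moreover have "l k = column k P \<bullet> (S *v column k P)" for k unfolding l using on by (simp add: norm_eq_1)
  ultimately show ?thesis using that[OF P l] on by simp
qed

lemma prod_ge_one_plus_sum:
  fixes a :: "'a \<Rightarrow> real"
  assumes "finite I" "\<And>i. i \<in> I \<Longrightarrow> 0 \<le> a i" shows "1 + (\<Sum>i\<in>I. a i) \<le> (\<Prod>i\<in>I. 1 + a i)"
  using assms
proof (induction I rule: finite_induct)
  case (insert i I)
  have "0 \<le> (\<Sum>i\<in>I. a i)" using insert by (intro sum_nonneg) auto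
  have "1 + (a i + sum a I) \<le> (1 + a i) * (1 + sum a I)"
    using insert.prems[of i] \<open>0 \<le> sum a I\<close> by (simp add: algebra_simps)
  also have "\<dots> \<le> (1 + a i) * (\<Prod>i\<in>I. 1 + a i)"
    using insert by (intro mult_left_mono) (auto simp: add_nonneg_nonneg)
  finally show ?case using insert by simp
qed simp

text \<open>The eigenvalues are 1 + a_k with nonnegative a_k, and their product is at least 1 plus
  the sum of the a_k.\<close>

lemma det_ge_trace_excess:
  fixes S :: "real^'m^'m"
  assumes sym: "transpose S = S" and ge: "\<And>x. x \<bullet> x \<le> x \<bullet> (S *v x)"
  shows "1 + (trace S - CARD('m)) \<le> det S"
proof -
  obtain P l where P: "\<And>k. S *v column k P = l k *\<^sub>R column k P"
    "det S = (\<Prod>k\<in>UNIV. l k)" "trace S = (\<Sum>k\<in>UNIV. l k)" "\<And>k. l k = column k P \<bullet> (S *v column k P)"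
    "\<And>k. norm (column k (P :: real^'m^'m)) = 1"
    using symmetric_eigenvalues[OF sym] by metis
  have "0 \<le> l k - 1" for k using ge[of "column k P"] P(5)[of k] P(4)[of k] by (simp add: norm_eq_1)
  then have "1 + (\<Sum>k\<in>UNIV. l k - 1) \<le> (\<Prod>k\<in>UNIV. 1 + (l k - 1))" by (intro prod_ge_one_plus_sum) auto
  then show ?thesis unfolding P(2,3) by (simp add: sum_subtractf)
qed

lemma psd_det_trace:
  fixes S :: "real^'m^'m"
  assumes sym: "transpose S = S" and psd: "\<And>x. 0 \<le> x \<bullet> (S *v x)"
  shows "0 \<le> det S" "CARD('m) * root CARD('m) (det S) \<le> trace S"
proof -
  obtain P l where P: "\<And>k. S *v column k P = l k *\<^sub>R column k P"
    "det S = (\<Prod>k\<in>UNIV. l k)" "trace S = (\<Sum>k\<in>UNIV. l k)" "\<And>k. l k = column k P \<bullet> (S *v column k P)"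
    "\<And>k. norm (column k (P :: real^'m^'m)) = 1"
    using symmetric_eigenvalues[OF sym] by metis
  have l: "0 \<le> l k" for k using psd P(4) by simp
  show 0: "0 \<le> det S" unfolding P(2) using l by (intro prod_nonneg) auto
  have "root CARD('m) (det S) = det S powr (1 / CARD('m))"
  proof (cases "det S = 0")
    case False
    then show ?thesis using 0 by (simp add: root_powr_inverse)
  qed simp
  also have "\<dots> \<le> (\<Sum>k\<in>(UNIV :: 'm set). l k / CARD('m))"
    unfolding P(2) using arith_geom_mean[of "UNIV :: 'm set" l] l by simp
  also have "\<dots> = trace S / CARD('m)" unfolding P(3) by (simp add: sum_divide_distrib)
  finally show "CARD('m) * root CARD('m) (det S) \<le> trace S" by (simp add: field_simps)
qed

lemma congruence_psd:
  fixes S C :: "real^'m^'m"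
  assumes sym: "transpose S = S" and psd: "\<And>x. 0 \<le> x \<bullet> (S *v x)"
  shows "transpose (transpose C ** S ** C) = transpose C ** S ** C" "0 \<le> x \<bullet> ((transpose C ** S ** C) *v x)"
proof -
  show "transpose (transpose C ** S ** C) = transpose C ** S ** C"
    by (simp add: matrix_transpose_mul sym matrix_mul_assoc)
  have "x \<bullet> ((transpose C ** S ** C) *v x) = (C *v x) \<bullet> (S *v (C *v x))"
    by (metis dot_lmul_matrix matrix_vector_mul_assoc transpose_transpose vector_transpose_matrix)
  then show "0 \<le> x \<bullet> ((transpose C ** S ** C) *v x)" using psd by simp
qed

text \<open>The inequality of arithmetic and geometric means for the eigenvalues of the congruent
  matrix, whose determinant is that of \<open>S\<close>.\<close>

theorem det_root_le_trace:
  fixes S C :: "real^'m^'m"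
  assumes sym: "transpose S = S" and psd: "\<And>x. 0 \<le> x \<bullet> (S *v x)" and C: "\<bar>det C\<bar> = 1"
  shows "CARD('m) * root CARD('m) (det S) \<le> (\<Sum>k\<in>UNIV. column k C \<bullet> (S *v column k C))"
proof -
  let ?M = "transpose C ** S ** C"
  have "det ?M = det C * det C * det S" by (simp add: det_mul)
  also have "det C * det C = 1" using C by (metis abs_mult_self_eq mult_1)
  finally have d: "det ?M = det S" by simp
  have "CARD('m) * root CARD('m) (det ?M) \<le> trace ?M"
    by (rule psd_det_trace(2)[OF congruence_psd[OF sym psd]])
  then show ?thesis unfolding d trace_def congruence_entry .
qed

text \<open>Equality in \<open>det_root_le_trace\<close>: orthonormal eigenvectors are rescaled so
  that all columns contribute equally. That each term, and not only the sum, equals the root later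
  bounds the columns of \<open>C\<close> by coercivity.\<close>

theorem det_root_attained:
  fixes S :: "real^'m^'m"
  assumes sym: "transpose S = S" and pd: "\<And>x. x \<noteq> 0 \<Longrightarrow> 0 < x \<bullet> (S *v x)"
  obtains C :: "real^'m^'m" where "\<bar>det C\<bar> = 1" "\<And>k. column k C \<bullet> (S *v column k C) = root CARD('m) (det S)"
proof -
  obtain P l where P: "orthogonal_matrix (P :: real^'m^'m)" "\<And>k. S *v column k P = l k *\<^sub>R column k P"
    "det S = (\<Prod>k\<in>UNIV. l k)" "trace S = (\<Sum>k\<in>UNIV. l k)" "\<And>k. l k = column k P \<bullet> (S *v column k P)"
    "\<And>k. norm (column k (P :: real^'m^'m)) = 1"
    using symmetric_eigenvalues[OF sym] by metis
  have l: "0 < l k" for k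
  proof -
    have "column k P \<noteq> 0" using P(6)[of k] by auto
    then show ?thesis using pd P(5) by simp
  qed
  have dS: "det S > 0" unfolding P(3) using l by (intro prod_pos) auto
  define s where "s = sqrt (root CARD('m) (det S))"
  have s: "s > 0" "s\<^sup>2 = root CARD('m) (det S)" unfolding s_def using dS by auto
  define a where "a k = s / sqrt (l k)" for k
  define D :: "real^'m^'m" where "D = (\<chi> i j. if i = j then a i else 0)"
  define C where "C = P ** D"
  have col: "column k C = a k *\<^sub>R column k P" for k
    unfolding C_def D_def column_def by (simp add: vec_eq_iff matrix_matrix_mult_def if_distrib cong: if_cong)
  have "column k C \<bullet> (S *v column k C) = root CARD('m) (det S)" for k
  proof -
    have "column k C \<bullet> (S *v column k C) = (a k)\<^sup>2 * l k"
      unfolding col using P(5)[of k] by (simp add: matrix_vector_mult_scaleR power2_eq_square)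
    also have "\<dots> = s\<^sup>2" unfolding a_def using l[of k] by (simp add: power_divide)
    finally show ?thesis using s by simp
  qed
  moreover have "\<bar>det C\<bar> = 1"
  proof -
    have "det D = (\<Prod>k\<in>UNIV. a k)" using det_diagonal[of D] unfolding D_def by simp
    then have "(det D)\<^sup>2 = (\<Prod>k\<in>UNIV. (a k)\<^sup>2)" by (simp add: prod_power_distrib)
    also have "\<dots> = (\<Prod>k\<in>UNIV. s\<^sup>2 / l k)" unfolding a_def using l by (intro prod.cong) (auto simp: power_divide less_imp_le)
    also have "\<dots> = (s\<^sup>2) ^ CARD('m) / det S" unfolding P(3) by (simp add: prod_dividef)
    also have "\<dots> = 1" unfolding s(2) using dS by simp
    finally have "\<bar>det D\<bar> = 1" by (simp add: power2_eq_1_iff abs_if) linarith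
    moreover have "\<bar>det P\<bar> = 1" using det_orthogonal_matrix[OF P(1)] by auto
    ultimately show ?thesis unfolding C_def by (simp add: det_mul abs_mult)
  qed
  ultimately show ?thesis using that by blast
qed

section \<open>Viscosity inequalities for jets\<close>

lemma C2_from_gradient:
  fixes f :: "'a::euclidean_space \<Rightarrow> real"
  assumes f: "\<And>y. (f has_derivative (\<lambda>k. k \<bullet> g y)) (at y)"
    and g: "\<And>y. (g has_derivative D y) (at y)"
    and D: "\<And>k. continuous_on UNIV (\<lambda>y. D y k)"
  shows "C2_on S f" "C2_closure S f"
proof -
  define f' where "f' y = blinfun_inner_left (g y)" for y
  define f'' where "f'' y = Blinfun (\<lambda>k. blinfun_inner_left (D y k))" for y
  have bD: "bounded_linear (D y)" for y using g by (rule has_derivative_bounded_linear)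
  have b2: "bounded_linear (\<lambda>k. blinfun_inner_left (D y k))" for y
    by (rule bounded_linear_compose[OF bounded_linear_blinfun_inner_left bD])
  have f''a: "blinfun_apply (f'' y) = (\<lambda>k. blinfun_inner_left (D y k))" for y
    unfolding f''_def by (rule bounded_linear_Blinfun_apply[OF b2])
  have 1: "(f has_derivative blinfun_apply (f' x)) (at x)" for x
    using f[of x] unfolding f'_def by (simp add: inner_commute)
  have 2: "(f' has_derivative blinfun_apply (f'' x)) (at x)" for x
    unfolding f''a f'_def by (rule bounded_linear.has_derivative[OF bounded_linear_blinfun_inner_left g])
  have 3: "continuous_on UNIV f''"
    by (rule continuous_on_blinfun_componentwise)
      (simp add: f''a bounded_linear.continuous_on[OF bounded_linear_blinfun_inner_left D])
  have cf: "continuous_on UNIV f" and cf': "continuous_on UNIV f'"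
    using 1 2 by (meson has_derivative_continuous continuous_at_imp_continuous_on)+
  show "C2_on S f" unfolding C2_on_def using 1 2 continuous_on_subset[OF 3] by blast
  show "C2_closure S f" unfolding C2_closure_def
    using 1 2 continuous_on_subset[OF 3] continuous_on_subset[OF cf] continuous_on_subset[OF cf'] by blast
qed

definition vf_comb :: "('m::finite \<Rightarrow> 'a \<Rightarrow> 'a) \<Rightarrow> 'a \<Rightarrow> real^'m \<Rightarrow> 'a::real_vector" where
  "vf_comb X x \<xi> = (\<Sum>j\<in>UNIV. \<xi> $ j *\<^sub>R X j x)"

text \<open>The acceleration of the integral curves of the field Y =
  \<open>\<lambda>x. vf_comb X x \<xi>\<close>, that is, the derivative of Y in the direction
  Y.\<close>

definition vf_acc :: "('m::finite \<Rightarrow> 'a \<Rightarrow> 'a) \<Rightarrow> ('m \<Rightarrow> 'a \<Rightarrow> 'a \<Rightarrow> 'a) \<Rightarrow> 'a \<Rightarrow> real^'m \<Rightarrow> 'a::real_vector" where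
  "vf_acc X DX x \<xi> = (\<Sum>i\<in>UNIV. \<Sum>j\<in>UNIV. (\<xi> $ i * \<xi> $ j) *\<^sub>R DX j x (X i x))"

text \<open>The matrix \<open>D2_vf X \<phi> x\<close> for a test function with gradient \<open>p\<close> and Hessian form \<open>G\<close> at \<open>x\<close>.\<close>

definition jet_matrix ::
  "('m::finite \<Rightarrow> 'a \<Rightarrow> 'a) \<Rightarrow> ('m \<Rightarrow> 'a \<Rightarrow> 'a \<Rightarrow> 'a) \<Rightarrow> 'a \<Rightarrow> 'a \<Rightarrow> ('a::real_inner \<Rightarrow> real) \<Rightarrow> real^'m^'m" where
  "jet_matrix X DX x p G = (\<chi> i j. (G (X i x + X j x) - G (X i x) - G (X j x)) / 2
     + (p \<bullet> DX j x (X i x) + p \<bullet> DX i x (X j x)) / 2)"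

lemma jet_matrix_symmetric: "transpose (jet_matrix X DX x p G) = jet_matrix X DX x p G"
  unfolding jet_matrix_def transpose_def by (simp add: vec_eq_iff add.commute)

lemma linear_vf_comb: "linear (vf_comb X x)"
  unfolding vf_comb_def by (rule linearI) (simp_all add: scaleR_add_left sum.distrib scaleR_sum_right)

text \<open>The second derivative of the test function along an integral curve of the combined
  field: Hessian on the velocity plus gradient on the acceleration.\<close>

lemma jet_matrix_form:
  fixes X :: "'m::finite \<Rightarrow> 'a::euclidean_space \<Rightarrow> 'a"
  assumes "quad_form G"
  shows "\<xi> \<bullet> (jet_matrix X DX x p G *v \<xi>) = G (vf_comb X x \<xi>) + p \<bullet> vf_acc X DX x \<xi>"
proof -
  from assms obtain A where A: "linear A" "G = (\<lambda>h. h \<bullet> A h)" unfolding quad_form_def by auto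
  let ?a = "\<lambda>i j. X i x \<bullet> A (X j x)" and ?d = "\<lambda>i j. p \<bullet> DX j x (X i x)"
  have "\<xi> \<bullet> (jet_matrix X DX x p G *v \<xi>) = (\<Sum>i\<in>UNIV. \<Sum>j\<in>UNIV. \<xi> $ i * \<xi> $ j * ((?a i j + ?a j i) / 2 + (?d i j + ?d j i) / 2))"
    unfolding inner_vec_def matrix_vector_mult_def jet_matrix_def A(2)
    by (simp add: sum_distrib_left linear_add[OF A(1)] inner_add_left inner_add_right algebra_simps)
  also have "\<dots> = (\<Sum>i\<in>UNIV. \<Sum>j\<in>UNIV. \<xi> $ i * \<xi> $ j * (?a i j + ?d i j)) / 2
       + (\<Sum>i\<in>UNIV. \<Sum>j\<in>UNIV. \<xi> $ i * \<xi> $ j * (?a j i + ?d j i)) / 2"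
    by (simp add: sum_divide_distrib flip: sum.distrib) (simp add: field_simps)
  also have "(\<Sum>i\<in>UNIV. \<Sum>j\<in>UNIV. \<xi> $ i * \<xi> $ j * (?a j i + ?d j i)) = (\<Sum>i\<in>UNIV. \<Sum>j\<in>UNIV. \<xi> $ i * \<xi> $ j * (?a i j + ?d i j))"
    by (subst sum.swap) (simp add: mult.commute)
  finally have "\<xi> \<bullet> (jet_matrix X DX x p G *v \<xi>) = (\<Sum>i\<in>UNIV. \<Sum>j\<in>UNIV. \<xi> $ i * \<xi> $ j * (?a i j + ?d i j))" by simp
  moreover have "G (vf_comb X x \<xi>) = (\<Sum>i\<in>UNIV. \<Sum>j\<in>UNIV. \<xi> $ i * \<xi> $ j * ?a i j)"
  proof -
    have "G (vf_comb X x \<xi>) = (\<Sum>j\<in>UNIV. \<Sum>i\<in>UNIV. \<xi> $ i * \<xi> $ j * ?a i j)"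
      unfolding A(2) vf_comb_def by (simp add: linear_sum[OF A(1)] linear_cmul[OF A(1)] inner_sum_left inner_sum_right sum_distrib_left mult_ac)
    then show ?thesis by (subst (asm) sum.swap)
  qed
  moreover have "p \<bullet> vf_acc X DX x \<xi> = (\<Sum>i\<in>UNIV. \<Sum>j\<in>UNIV. \<xi> $ i * \<xi> $ j * ?d i j)"
    unfolding vf_acc_def by (simp add: inner_sum_right)
  ultimately show ?thesis by (simp add: distrib_left sum.distrib)
qed

text \<open>The term with \<open>ca\<close> shifts the Hessian and absorbs the error of a jet. The
  quartic term has no second-order part at \<open>x0\<close> and serves to make a local touching
  global.\<close>

lemma test_function:
  fixes X :: "'m::finite \<Rightarrow> 'a::euclidean_space \<Rightarrow> 'a" and p :: 'a and ca cb :: real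
  assumes G: "quad_form G" and DX: "\<And>j. (X j has_derivative DX j x0) (at x0)"
  defines "\<phi> \<equiv> \<lambda>y. p \<bullet> (y - x0) + G (y - x0) / 2 + ca * (norm (y - x0))\<^sup>2 + cb * (norm (y - x0))^4"
  shows "C2_on S \<phi>" "C2_closure S \<phi>" "D_vf X \<phi> x0 = (\<chi> j. p \<bullet> X j x0)"
    "D2_vf X \<phi> x0 = jet_matrix X DX x0 p (\<lambda>h. G h + 2 * ca * (norm h)\<^sup>2)"
proof -
  from G obtain A where A: "linear A" "G = (\<lambda>h. h \<bullet> A h)" unfolding quad_form_def by auto
  define A' where "A' = adjoint A"
  have A': "linear A'" unfolding A'_def by (rule adjoint_linear[OF A(1)])
  have adj: "a \<bullet> A b = b \<bullet> A' a" for a b unfolding A'_def using adjoint_works[OF A(1), of b a] by (simp add: inner_commute)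
  have adj2: "A b \<bullet> a = b \<bullet> A' a" for a b using adj[of a b] by (simp add: inner_commute)
  have bA: "bounded_linear A" "bounded_linear A'" using A(1) A' by (simp_all add: linear_conv_bounded_linear)
  define g where "g y = p + (1/2) *\<^sub>R (A (y - x0) + A' (y - x0)) + (2 * ca) *\<^sub>R (y - x0) + (4 * cb * ((y - x0) \<bullet> (y - x0))) *\<^sub>R (y - x0)" for y
  define D where "D y k = (1/2) *\<^sub>R (A k + A' k) + (2 * ca) *\<^sub>R k + (4 * cb * ((y - x0) \<bullet> (y - x0))) *\<^sub>R k + (4 * cb * (2 * ((y - x0) \<bullet> k))) *\<^sub>R (y - x0)" for y k
  have phi: "\<phi> = (\<lambda>y. p \<bullet> (y - x0) + ((y - x0) \<bullet> A (y - x0)) / 2 + ca * ((y - x0) \<bullet> (y - x0)) + cb * (((y - x0) \<bullet> (y - x0))\<^sup>2))"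
    unfolding \<phi>_def A(2) power2_norm_eq_inner[symmetric] by (simp add: power_mult[symmetric])
  have dA: "((\<lambda>y. A (y - x0)) has_derivative A) (at y)" "((\<lambda>y. A' (y - x0)) has_derivative A') (at y)" for y
    by (rule bounded_linear.has_derivative[OF bA(1), of "\<lambda>y. y - x0" "\<lambda>h. h", simplified] bounded_linear.has_derivative[OF bA(2), of "\<lambda>y. y - x0" "\<lambda>h. h", simplified]; auto intro!: derivative_eq_intros)+
  have fd: "(\<phi> has_derivative (\<lambda>k. k \<bullet> g y)) (at y)" for y
    unfolding phi
    apply (rule derivative_eq_intros dA refl | simp)+
    unfolding g_def by (rule ext) (simp add: adj[of "y - x0"] adj2[of _ "y - x0"] inner_add_right inner_commute ring_distribs add_divide_distrib)
  have gd: "(g has_derivative D y) (at y)" for y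
    unfolding g_def
    apply (rule derivative_eq_intros dA refl | simp)+
    unfolding D_def by (rule ext) (simp add: inner_commute algebra_simps)
  have Dc: "continuous_on UNIV (\<lambda>y. D y k)" for k
    unfolding D_def by (intro continuous_intros)
  show "C2_on S \<phi>" "C2_closure S \<phi>" using C2_from_gradient[OF fd gd Dc] by auto
  have vf: "vf_deriv Y \<phi> = (\<lambda>y. Y y \<bullet> g y)" for Y
    unfolding vf_deriv_def using frechet_derivative_at[OF fd] by (metis (no_types, lifting))
  have g0: "g x0 = p" unfolding g_def using linear_0[OF A(1)] linear_0[OF A'] by simp
  show "D_vf X \<phi> x0 = (\<chi> j. p \<bullet> X j x0)" unfolding D_vf_def vf g0 by (simp add: inner_commute)
  have vf2: "vf_deriv Y (vf_deriv (X j) \<phi>) x0 = X j x0 \<bullet> D x0 (Y x0) + p \<bullet> DX j x0 (Y x0)" for Y j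
  proof -
    have "((\<lambda>y. X j y \<bullet> g y) has_derivative (\<lambda>h. X j x0 \<bullet> D x0 h + DX j x0 h \<bullet> g x0)) (at x0)"
      by (rule has_derivative_inner[OF DX gd])
    note e = frechet_derivative_at[OF this]
    show ?thesis unfolding vf unfolding vf_deriv_def e[symmetric] g0 by (simp add: inner_commute)
  qed
  have e1: "((a + b) \<bullet> A (a + b) + 2 * ca * ((a + b) \<bullet> (a + b)) - (a \<bullet> A a + 2 * ca * (a \<bullet> a)) - (b \<bullet> A b + 2 * ca * (b \<bullet> b))) / 2
      = (b \<bullet> A a + a \<bullet> A b) / 2 + 2 * ca * (a \<bullet> b)" for a b
    by (simp add: linear_add[OF A(1)] inner_add_left inner_add_right inner_commute[of b a] field_simps)
  have e2: "b \<bullet> D x0 a = (b \<bullet> A a + a \<bullet> A b) / 2 + 2 * ca * (a \<bullet> b)" for a b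
    unfolding D_def by (simp add: inner_add_right adj[of a b, symmetric] inner_commute[of b a])
  show "D2_vf X \<phi> x0 = jet_matrix X DX x0 p (\<lambda>h. G h + 2 * ca * (norm h)\<^sup>2)"
    unfolding D2_vf_def jet_matrix_def vf2 A(2) power2_norm_eq_inner e1 e2 vec_eq_iff vec_lambda_beta
    by (simp add: inner_commute[of "X _ x0" "X _ x0"] field_simps)
qed

text \<open>Near \<open>x\<close> the jet suffices. At distance at least \<open>r\<close> all other
  terms are bounded by a constant \<open>C\<close>, and N = C / r^4 lets the quartic term dominate
  it.\<close>

lemma jet_global:
  fixes u :: "'a::euclidean_space \<Rightarrow> real"
  assumes jet: "upper_jet Z u x p G" and G: "quad_form G" and x: "x \<in> Z" and Z: "bounded Z" and u: "bounded (u ` Z)" and e: "e > 0"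
  obtains N where "\<And>y. y \<in> Z \<Longrightarrow> u y \<le> u x + p \<bullet> (y - x) + G (y - x) / 2 + e * (norm (y - x))\<^sup>2 + N * (norm (y - x))^4"
proof -
  obtain r where r: "r > 0" "\<And>h. x + h \<in> Z \<Longrightarrow> norm h < r \<Longrightarrow> u (x + h) \<le> u x + p \<bullet> h + G h / 2 + e * (norm h)\<^sup>2"
    using upper_jetD_ball[OF jet e quad_form_0[OF G]] by auto
  obtain M where M: "\<And>y. y \<in> Z \<Longrightarrow> \<bar>u y\<bar> \<le> M" using u unfolding bounded_iff by auto
  obtain R where R: "\<And>y. y \<in> Z \<Longrightarrow> norm y \<le> R" using Z unfolding bounded_iff by auto
  obtain K where K: "K > 0" "\<And>h. \<bar>G h\<bar> \<le> K * (norm h)\<^sup>2" using quad_form_bound[OF G] by blast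
  have M0: "M \<ge> 0" using M[OF x] by simp
  have R0: "R \<ge> 0" using R[OF x] norm_ge_zero order_trans by blast
  define C where "C = 2 * M + norm p * (2 * R) + K * (2 * R)\<^sup>2"
  have C0: "C \<ge> 0" unfolding C_def using M0 R0 K by simp
  define N where "N = C / r^4"
  have N0: "N \<ge> 0" unfolding N_def using C0 r by simp
  have "u y \<le> u x + p \<bullet> (y - x) + G (y - x) / 2 + e * (norm (y - x))\<^sup>2 + N * (norm (y - x))^4" if y: "y \<in> Z" for y
  proof (cases "norm (y - x) < r")
    case True
    then show ?thesis using r(2)[of "y - x"] y mult_nonneg_nonneg[OF N0, of "(norm (y - x))^4"] by simp
  next
    case False
    have n: "norm (y - x) \<le> 2 * R" using R[OF y] R[OF x] norm_triangle_ineq4[of y x] by linarith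
    have "C = N * r^4" unfolding N_def using r by simp
    also have "\<dots> \<le> N * (norm (y - x))^4" using False N0 r(1) by (intro mult_left_mono power_mono) auto
    finally have CN: "C \<le> N * (norm (y - x))^4" .
    have "\<bar>p \<bullet> (y - x)\<bar> \<le> norm p * (2 * R)"
      using Cauchy_Schwarz_ineq2[of p "y - x"] mult_left_mono[OF n, of "norm p"] by simp
    moreover have "\<bar>G (y - x)\<bar> \<le> K * (2 * R)\<^sup>2"
      by (rule order_trans[OF K(2) mult_left_mono[OF power_mono[OF n]]]) (use K(1) in auto)
    moreover have "0 \<le> e * (norm (y - x))\<^sup>2" using e by simp
    ultimately show ?thesis using CN M[OF y] M[OF x] unfolding C_def by (simp add: abs_le_iff)
  qed
  then show ?thesis using that by blast
qed

lemma tendsto_det: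
  fixes A :: "'b \<Rightarrow> real^'m^'m"
  assumes "\<And>i j. ((\<lambda>e. A e $ i $ j) \<longlongrightarrow> B $ i $ j) F"
  shows "((\<lambda>e. det (A e)) \<longlongrightarrow> det B) F"
  unfolding det_def by (intro tendsto_intros assms)

lemma jet_matrix_tendsto:
  fixes X :: "'m::finite \<Rightarrow> 'a::euclidean_space \<Rightarrow> 'a"
  shows "((\<lambda>e. jet_matrix X DX x p (\<lambda>h. G h + 2 * e * (norm h)\<^sup>2) $ i $ j) \<longlongrightarrow> jet_matrix X DX x p G $ i $ j) (at 0)"
proof -
  have "((\<lambda>e. jet_matrix X DX x p (\<lambda>h. G h + 2 * e * (norm h)\<^sup>2) $ i $ j) \<longlongrightarrow> jet_matrix X DX x p (\<lambda>h. G h + 2 * 0 * (norm h)\<^sup>2) $ i $ j) (at 0)"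
    unfolding jet_matrix_def vec_lambda_beta by (intro tendsto_intros) auto
  then show ?thesis by simp
qed

lemma det_jet_tendsto:
  fixes X :: "'m::finite \<Rightarrow> 'a::euclidean_space \<Rightarrow> 'a"
  shows "((\<lambda>e. det (jet_matrix X DX x p (\<lambda>h. G h + 2 * e * (norm h)\<^sup>2))) \<longlongrightarrow> det (jet_matrix X DX x p G)) (at 0)"
  by (intro tendsto_det jet_matrix_tendsto)

text \<open>\<open>jet_global\<close> turns the jet into an admissible test function at the price of
  an extra quadratic term with coefficient e; then e tends to 0. The next two lemmas follow the same
  pattern, the last one with negative e.\<close>

lemma vf_convex_jet:
  fixes X :: "'m::finite \<Rightarrow> 'a::euclidean_space \<Rightarrow> 'a"
  assumes conv: "vf_convex X \<Omega> u" and x: "x \<in> \<Omega>" and bd: "bounded \<Omega>" and u: "bounded (u ` closure \<Omega>)"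
    and DX: "\<And>j. (X j has_derivative DX j x) (at x)"
    and G: "quad_form G" and jet: "upper_jet (closure \<Omega>) u x p G"
  shows "0 \<le> G (vf_comb X x \<xi>) + p \<bullet> vf_acc X DX x \<xi>"
proof -
  have xc: "x \<in> closure \<Omega>" using x closure_subset by blast
  have bdc: "bounded (closure \<Omega>)" using bd by (rule bounded_closure)
  have pos: "0 \<le> G (vf_comb X x \<xi>) + p \<bullet> vf_acc X DX x \<xi> + 2 * e * (norm (vf_comb X x \<xi>))\<^sup>2" if e: "e > 0" for e
  proof -
    obtain N where N: "\<And>y. y \<in> closure \<Omega> \<Longrightarrow> u y \<le> u x + p \<bullet> (y - x) + G (y - x) / 2 + e * (norm (y - x))\<^sup>2 + N * (norm (y - x))^4"
      by (rule jet_global[OF jet G xc bdc u e]) (rule that)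
    let ?\<phi> = "\<lambda>y. p \<bullet> (y - x) + G (y - x) / 2 + e * (norm (y - x))\<^sup>2 + N * (norm (y - x))^4"
    note T = test_function[where X = X and DX = DX, OF G DX, where p = p and ca = e and cb = N]
    have "is_arg_max (\<lambda>y. u y - ?\<phi> y) (\<lambda>y. y \<in> \<Omega>) x"
    proof -
      have "u y - ?\<phi> y \<le> u x - ?\<phi> x" if "y \<in> \<Omega>" for y
        using N[of y] closure_subset[of \<Omega>] that quad_form_0[OF G] by auto
      then show ?thesis unfolding is_arg_max_def using x by (auto simp: not_less)
    qed
    then have "pos_semidef (D2_vf X ?\<phi> x)" using conv T(1) x unfolding vf_convex_def by blast
    then have "0 \<le> \<xi> \<bullet> (D2_vf X ?\<phi> x *v \<xi>)" unfolding pos_semidef_def by blast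
    then show ?thesis unfolding T(4)
      by (subst (asm) jet_matrix_form) (auto intro!: quad_form_add quad_form_cmult quad_form_norm G)
  qed
  have "((\<lambda>e. G (vf_comb X x \<xi>) + p \<bullet> vf_acc X DX x \<xi> + 2 * e * (norm (vf_comb X x \<xi>))\<^sup>2) \<longlongrightarrow>
     G (vf_comb X x \<xi>) + p \<bullet> vf_acc X DX x \<xi> + 2 * 0 * (norm (vf_comb X x \<xi>))\<^sup>2) (at_right 0)"
    by (intro tendsto_intros)
  then have "0 \<le> G (vf_comb X x \<xi>) + p \<bullet> vf_acc X DX x \<xi> + 2 * 0 * (norm (vf_comb X x \<xi>))\<^sup>2"
    by (rule tendsto_lowerbound) (auto simp: eventually_at_right_less intro!: eventually_at_rightI[of 0 1] pos)
  then show ?thesis by simp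
qed

lemma subsolution_jet:
  fixes X :: "'m::finite \<Rightarrow> 'a::euclidean_space \<Rightarrow> 'a"
  assumes sub: "subsolution X \<Omega> H u" and x: "x \<in> \<Omega>" and bd: "bounded \<Omega>" and u: "bounded (u ` closure \<Omega>)"
    and DX: "\<And>j. (X j has_derivative DX j x) (at x)"
    and G: "quad_form G" and jet: "upper_jet (closure \<Omega>) u x p G"
  shows "H x (u x) (\<chi> j. p \<bullet> X j x) \<le> det (jet_matrix X DX x p G)"
proof -
  have xc: "x \<in> closure \<Omega>" using x closure_subset by blast
  have bdc: "bounded (closure \<Omega>)" using bd by (rule bounded_closure)
  have pos: "H x (u x) (\<chi> j. p \<bullet> X j x) \<le> det (jet_matrix X DX x p (\<lambda>h. G h + 2 * e * (norm h)\<^sup>2))" if e: "e > 0" for e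
  proof -
    obtain N where N: "\<And>y. y \<in> closure \<Omega> \<Longrightarrow> u y \<le> u x + p \<bullet> (y - x) + G (y - x) / 2 + e * (norm (y - x))\<^sup>2 + N * (norm (y - x))^4"
      by (rule jet_global[OF jet G xc bdc u e]) (rule that)
    let ?\<phi> = "\<lambda>y. p \<bullet> (y - x) + G (y - x) / 2 + e * (norm (y - x))\<^sup>2 + N * (norm (y - x))^4"
    note T = test_function[where X = X and DX = DX, OF G DX, where p = p and ca = e and cb = N]
    have "is_arg_max (\<lambda>y. u y - ?\<phi> y) (\<lambda>y. y \<in> closure \<Omega>) x"
    proof -
      have "u y - ?\<phi> y \<le> u x - ?\<phi> x" if "y \<in> closure \<Omega>" for y
        using N[OF that] quad_form_0[OF G] by auto
      then show ?thesis unfolding is_arg_max_def using xc by (auto simp: not_less)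
    qed
    then have "- det (D2_vf X ?\<phi> x) + H x (u x) (D_vf X ?\<phi> x) \<le> 0" using sub T(2) x unfolding subsolution_def by blast
    then show ?thesis unfolding T(3,4) by simp
  qed
  show ?thesis
    by (rule tendsto_lowerbound[OF tendsto_mono[OF at_le det_jet_tendsto], of "{0<..}"])
      (auto intro!: eventually_at_rightI[of 0 1] pos)
qed

text \<open>Touching \<open>v\<close> from below costs a quadratic term with e < 0, which lowers the
  matrix. Coercivity with constant \<open>c\<close> keeps it positive definite for |e| < c / (4
  K^2), so the test function belongs to the restricted class.\<close>

lemma supersolution_jet:
  fixes X :: "'m::finite \<Rightarrow> 'a::euclidean_space \<Rightarrow> 'a"
  assumes sup: "supersolution X \<Omega> H v" and x: "x \<in> \<Omega>" and bd: "bounded \<Omega>" and v: "bounded (v ` closure \<Omega>)"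
    and DX: "\<And>j. (X j has_derivative DX j x) (at x)"
    and G: "quad_form G" and jet: "upper_jet (closure \<Omega>) (\<lambda>y. - v y) x (- p) (\<lambda>h. - G h)"
    and pd: "c > 0" "\<And>\<xi>. c * (norm \<xi>)\<^sup>2 \<le> G (vf_comb X x \<xi>) + p \<bullet> vf_acc X DX x \<xi>"
  shows "det (jet_matrix X DX x p G) \<le> H x (v x) (\<chi> j. p \<bullet> X j x)"
proof -
  have xc: "x \<in> closure \<Omega>" using x closure_subset by blast
  have bdc: "bounded (closure \<Omega>)" using bd by (rule bounded_closure)
  have bv: "bounded ((\<lambda>y. - v y) ` closure \<Omega>)" using v unfolding bounded_iff by auto
  obtain K where K: "K > 0" "\<And>\<xi>. norm (vf_comb X x \<xi>) \<le> norm \<xi> * K"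
    using linear_bounded_pos[OF linear_vf_comb[of X x]] by (metis mult.commute)
  have pos: "det (jet_matrix X DX x p (\<lambda>h. G h + 2 * e * (norm h)\<^sup>2)) \<le> H x (v x) (\<chi> j. p \<bullet> X j x)"
    if e: "e < 0" "- (c / (4 * K\<^sup>2)) < e" for e
  proof -
    have e0: "- e > 0" using e by simp
    obtain N where N: "\<And>y. y \<in> closure \<Omega> \<Longrightarrow> - v y \<le> - v x + (- p) \<bullet> (y - x) + (- G (y - x)) / 2 + (- e) * (norm (y - x))\<^sup>2 + N * (norm (y - x))^4"
      by (rule jet_global[OF jet quad_form_uminus[OF G] xc bdc bv e0]) (rule that)
    let ?\<phi> = "\<lambda>y. p \<bullet> (y - x) + G (y - x) / 2 + e * (norm (y - x))\<^sup>2 + (- N) * (norm (y - x))^4"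
    note T = test_function[where X = X and DX = DX, OF G DX, where p = p and ca = e and cb = "- N"]
    have am: "is_arg_min (\<lambda>y. v y - ?\<phi> y) (\<lambda>y. y \<in> closure \<Omega>) x"
    proof -
      have "v x - ?\<phi> x \<le> v y - ?\<phi> y" if "y \<in> closure \<Omega>" for y
        using N[OF that] quad_form_0[OF G] by auto
      then show ?thesis unfolding is_arg_min_def using xc by (auto simp: not_less)
    qed
    have "pos_def (D2_vf X ?\<phi> x)"
      unfolding pos_def_def T(4)
    proof (intro conjI allI impI jet_matrix_symmetric)
      fix \<xi> :: "real^'m" assume xi: "\<xi> \<noteq> 0"
      have "(- e) * (2 * (norm (vf_comb X x \<xi>))\<^sup>2) \<le> (c / (4 * K\<^sup>2)) * (2 * (norm \<xi> * K)\<^sup>2)"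
        using e K by (intro mult_mono mult_left_mono power_mono) auto
      also have "\<dots> = c / 2 * (norm \<xi>)\<^sup>2" using K by (simp add: power_mult_distrib field_simps)
      also have "\<dots> < c * (norm \<xi>)\<^sup>2" using pd(1) xi by simp
      finally have "0 < G (vf_comb X x \<xi>) + 2 * e * (norm (vf_comb X x \<xi>))\<^sup>2 + p \<bullet> vf_acc X DX x \<xi>"
        using pd(2)[of \<xi>] by simp
      then show "0 < \<xi> \<bullet> (jet_matrix X DX x p (\<lambda>h. G h + 2 * e * (norm h)\<^sup>2) *v \<xi>)"
        by (subst jet_matrix_form) (auto intro!: quad_form_add quad_form_cmult quad_form_norm G)
    qed
    then have "- det (D2_vf X ?\<phi> x) + H x (v x) (D_vf X ?\<phi> x) \<ge> 0" using sup T(2) x am unfolding supersolution_def by blast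
    then show ?thesis unfolding T(3,4) by simp
  qed
  have "eventually (\<lambda>e. det (jet_matrix X DX x p (\<lambda>h. G h + 2 * e * (norm h)\<^sup>2)) \<le> H x (v x) (\<chi> j. p \<bullet> X j x)) (at_left 0)"
    by (rule eventually_at_leftI[of "- (c / (4 * K\<^sup>2))"]) (use pos pd K in auto)
  then show ?thesis
    by (intro tendsto_upperbound[OF tendsto_mono[OF at_le det_jet_tendsto], of "{..<0}"]) auto
qed

section \<open>Integral curves and barriers\<close>

lemma vector_derivative_norm_bound:
  fixes \<gamma> :: "real \<Rightarrow> 'a::real_normed_vector"
  assumes "\<And>t. a \<le> t \<Longrightarrow> t \<le> b \<Longrightarrow> (\<gamma> has_vector_derivative g t) (at t)"
    and "\<And>t. a \<le> t \<Longrightarrow> t \<le> b \<Longrightarrow> norm (g t) \<le> B"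
    and "x \<in> {a..b}" "y \<in> {a..b}"
  shows "norm (\<gamma> x - \<gamma> y) \<le> B * \<bar>x - y\<bar>"
proof -
  have "norm (\<gamma> x - \<gamma> y) \<le> B * norm (x - y)"
  proof (rule differentiable_bound[where S = "{a..b}" and f' = "\<lambda>t h. h *\<^sub>R g t"])
    fix t assume t: "t \<in> {a..b}"
    show "(\<gamma> has_derivative (\<lambda>h. h *\<^sub>R g t)) (at t within {a..b})"
      using assms(1)[of t] t unfolding has_vector_derivative_def by (auto intro: has_derivative_at_withinI)
    have B: "norm (g t) \<le> B" using assms(2) t by auto
    have "norm (h *\<^sub>R g t) \<le> B * norm h" for h :: real
      using mult_left_mono[OF B, of "\<bar>h\<bar>"] by (simp add: mult.commute)
    then show "onorm (\<lambda>h. h *\<^sub>R g t) \<le> B" using B norm_ge_zero order_trans by (intro onorm_bound) blast+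
  qed (use assms in auto)
  then show ?thesis by simp
qed

text \<open>Picard iteration on bounded continuous functions on the whole line, with time clamped to
  [-T, T], so that the complete space is a type. Integrals start at -T and the value at 0 is
  subtracted, which includes negative times; their lengths are at most 2 T and T, whence the factor
  3.\<close>

lemma lipschitz_flow_exists:
  fixes F :: "'a::euclidean_space \<Rightarrow> 'a"
  assumes lip: "L-lipschitz_on UNIV F" and bd: "\<And>x. norm (F x) \<le> B" and T: "T > 0" "3 * T * L \<le> 1 / 2"
  obtains \<gamma> where "\<gamma> 0 = y0" "\<And>t. \<bar>t\<bar> < T \<Longrightarrow> (\<gamma> has_vector_derivative F (\<gamma> t)) (at t)"
proof -
  have L: "L \<ge> 0" by (rule lipschitz_on_nonneg[OF lip])
  have B: "B \<ge> 0" using bd norm_ge_zero order_trans by blast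
  have Fc: "continuous_on UNIV F" by (rule lipschitz_on_continuous_on[OF lip])
  define cl where "cl t = max (- T) (min T t)" for t :: real
  have cl: "- T \<le> cl t" "cl t \<le> T" for t unfolding cl_def using T by auto
  have clc: "continuous_on UNIV cl" unfolding cl_def by (intro continuous_intros)
  define J where "J (g :: real \<Rightarrow>\<^sub>C 'a) t = integral {- T..t} (\<lambda>s. F (g s))" for g t
  define P where "P g t = y0 + (J g (cl t) - J g 0)" for g t
  have Fg: "continuous_on S (\<lambda>s. F (apply_bcontfun g s))" for S and g :: "real \<Rightarrow>\<^sub>C 'a"
    by (rule continuous_on_compose2[OF Fc]) auto
  have Fi: "(\<lambda>s. F (apply_bcontfun g s)) integrable_on {a..b}" for a b and g :: "real \<Rightarrow>\<^sub>C 'a"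
    by (rule integrable_continuous_real[OF Fg])
  have Jb: "norm (J g t) \<le> B * (2 * T)" if "- T \<le> t" "t \<le> T" for g t
  proof -
    have "norm (J g t) \<le> B * (t - (- T))" unfolding J_def
      by (rule integral_bound) (use that bd Fg in auto)
    also have "\<dots> \<le> B * (2 * T)" using that B by (intro mult_left_mono) auto
    finally show ?thesis .
  qed
  have Jc: "continuous_on {- T..T} (J g)" for g
    unfolding J_def by (rule indefinite_integral_continuous_1[OF Fi])
  have Pb: "P g \<in> bcontfun" for g
    unfolding bcontfun_def
  proof (intro CollectI conjI)
    show "continuous_on UNIV (P g)" unfolding P_def
      by (intro continuous_intros continuous_on_compose2[OF Jc clc]) (use cl in auto)
    have "norm (P g t) \<le> norm y0 + 2 * (B * (2 * T))" for t
    proof -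
      have "norm (P g t) \<le> norm y0 + (norm (J g (cl t)) + norm (J g 0))"
        unfolding P_def by (intro order_trans[OF norm_triangle_ineq] add_left_mono norm_triangle_ineq4)
      then show ?thesis using Jb[OF cl, of g t] Jb[of 0 g] T by simp
    qed
    then show "bounded (range (P g))" unfolding bounded_iff by blast
  qed
  define Q where "Q g = Bcontfun (P g)" for g
  have Q: "apply_bcontfun (Q g) = P g" for g unfolding Q_def by (rule Bcontfun_inverse[OF Pb])
  have Jd: "norm (J g t - J h t) \<le> L * dist g h * (t + T)" if "- T \<le> t" "t \<le> T" for g h t
  proof -
    have "J g t - J h t = integral {- T..t} (\<lambda>s. F (g s) - F (h s))"
      unfolding J_def by (rule Henstock_Kurzweil_Integration.integral_diff[OF Fi Fi, symmetric])
    also have "norm \<dots> \<le> (L * dist g h) * (t - (- T))"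
    proof (rule integral_bound)
      show "continuous_on {- T..t} (\<lambda>s. F (g s) - F (h s))" by (intro continuous_intros Fg)
      show "norm (F (g s) - F (h s)) \<le> L * dist g h" for s
        using lipschitz_onD[OF lip, of "g s" "h s"] mult_left_mono[OF dist_bounded[of g s h] L] by (simp add: dist_norm)
    qed (use that in auto)
    finally show ?thesis by simp
  qed
  have "\<exists>!g. Q g = g"
  proof (rule banach_fix_type[of "1/2"])
    show "\<forall>g h. dist (Q g) (Q h) \<le> 1 / 2 * dist g h"
    proof (intro allI dist_bound)
      fix g h :: "real \<Rightarrow>\<^sub>C 'a" and t
      have "norm (P g t - P h t) \<le> norm (J g (cl t) - J h (cl t)) + norm (J g 0 - J h 0)"
        unfolding P_def using norm_triangle_ineq4[of "J g (cl t) - J h (cl t)" "J g 0 - J h 0"] by (simp add: algebra_simps)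
      also have "\<dots> \<le> L * dist g h * (cl t + T) + L * dist g h * (0 + T)"
        using T by (intro add_mono Jd cl) auto
      also have "\<dots> \<le> L * dist g h * (2 * T) + L * dist g h * T"
        using cl[of t] L by (intro add_mono mult_left_mono) auto
      also have "\<dots> = (3 * T * L) * dist g h" by (simp add: algebra_simps)
      also have "\<dots> \<le> 1 / 2 * dist g h" using T(2) by (intro mult_right_mono) auto
      finally show "dist (Q g t) (Q h t) \<le> 1 / 2 * dist g h" unfolding Q by (simp add: dist_norm)
    qed
  qed auto
  then obtain g where g: "Q g = g" by blast
  have fix1: "apply_bcontfun g t = P g t" for t using Q[of g] unfolding g by simp
  show ?thesis
  proof (rule that[of "apply_bcontfun g"])
    show "apply_bcontfun g 0 = y0" unfolding fix1 P_def cl_def using T by simp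
    fix t :: real assume t: "\<bar>t\<bar> < T"
    have "(J g has_vector_derivative F (g t)) (at t within {- T..T})"
      unfolding J_def by (rule integral_has_vector_derivative[OF Fg]) (use t in auto)
    then have "(J g has_vector_derivative F (g t)) (at t)"
      using at_within_Icc_at[of "- T" t T] t by simp
    then have d: "((\<lambda>t. y0 + (J g t - J g 0)) has_vector_derivative F (g t)) (at t)"
      by (auto intro!: derivative_eq_intros)
    have S: "open {- T<..<T}" "t \<in> {- T<..<T}" using t by auto
    show "(apply_bcontfun g has_vector_derivative F (g t)) (at t)"
    proof (rule has_vector_derivative_transform_within_open[OF d S])
      show "y0 + (J g s - J g 0) = apply_bcontfun g s" if "s \<in> {- T<..<T}" for s
        unfolding fix1[of s] P_def cl_def using that by simp
    qed
  qed
qed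

text \<open>The second derivative is assumed at \<open>t\<close> alone. The derivative of the
  remainder is at most e |\<theta>| near 0, and the mean value bound integrates this.\<close>

lemma curve_taylor2:
  fixes \<gamma> :: "real \<Rightarrow> 'a::real_normed_vector"
  assumes \<gamma>: "\<And>s. \<bar>s - t\<bar> < r \<Longrightarrow> (\<gamma> has_vector_derivative g s) (at s)"
    and g: "(g has_vector_derivative a) (at t)" and r: "r > 0" and e: "e > 0"
  obtains \<delta> where "\<delta> > 0" "\<And>s. \<bar>s\<bar> < \<delta> \<Longrightarrow> norm (\<gamma> (t + s) - \<gamma> t - s *\<^sub>R g t - (s\<^sup>2 / 2) *\<^sub>R a) \<le> e * s\<^sup>2"
proof -
  have "(g has_derivative (\<lambda>h. h *\<^sub>R a)) (at t)" using g unfolding has_vector_derivative_def .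
  then obtain \<delta>0 where d0: "\<delta>0 > 0" "\<And>y. norm (y - t) < \<delta>0 \<Longrightarrow> norm (g y - g t - (y - t) *\<^sub>R a) \<le> e * norm (y - t)"
    unfolding has_derivative_at_alt using e by blast
  define \<delta> where "\<delta> = min \<delta>0 r"
  show ?thesis
  proof (rule that[of \<delta>])
    show "\<delta> > 0" unfolding \<delta>_def using d0 r by simp
    fix s :: real assume s: "\<bar>s\<bar> < \<delta>"
    define f where "f \<theta> = \<gamma> (t + \<theta>) - \<gamma> t - \<theta> *\<^sub>R g t - (\<theta>\<^sup>2 / 2) *\<^sub>R a" for \<theta>
    have "norm (f s - f 0) \<le> (e * \<bar>s\<bar>) * \<bar>s - 0\<bar>"
    proof (rule vector_derivative_norm_bound[where a = "- \<bar>s\<bar>" and b = "\<bar>s\<bar>" and g = "\<lambda>\<theta>. g (t + \<theta>) - g t - \<theta> *\<^sub>R a"])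
      fix \<theta> assume th: "- \<bar>s\<bar> \<le> \<theta>" "\<theta> \<le> \<bar>s\<bar>"
      have "((\<lambda>\<theta>. \<gamma> (t + \<theta>)) has_vector_derivative g (t + \<theta>)) (at \<theta>)"
      proof -
        have "(\<gamma> has_vector_derivative g (t + \<theta>)) (at (t + \<theta>))" using \<gamma>[of "t + \<theta>"] th s unfolding \<delta>_def by auto
        then have "((\<gamma> \<circ> (\<lambda>\<theta>. t + \<theta>)) has_vector_derivative (1 *\<^sub>R g (t + \<theta>))) (at \<theta>)"
          by (intro vector_diff_chain_at) (auto intro!: derivative_eq_intros)
        then show ?thesis by (simp add: o_def)
      qed
      then show "(f has_vector_derivative g (t + \<theta>) - g t - \<theta> *\<^sub>R a) (at \<theta>)"
        unfolding f_def by (auto intro!: derivative_eq_intros)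
      have "norm (g (t + \<theta>) - g t - \<theta> *\<^sub>R a) \<le> e * \<bar>\<theta>\<bar>" using d0(2)[of "t + \<theta>"] th s unfolding \<delta>_def by auto
      also have "\<dots> \<le> e * \<bar>s\<bar>" using th e by (intro mult_left_mono) auto
      finally show "norm (g (t + \<theta>) - g t - \<theta> *\<^sub>R a) \<le> e * \<bar>s\<bar>" .
    qed auto
    also have "(e * \<bar>s\<bar>) * \<bar>s - 0\<bar> = e * s\<^sup>2" by (simp add: power2_eq_square)
    finally show "norm (\<gamma> (t + s) - \<gamma> t - s *\<^sub>R g t - (s\<^sup>2 / 2) *\<^sub>R a) \<le> e * s\<^sup>2" unfolding f_def by simp
  qed
qed

text \<open>The barrier of the gradient bound, \<open>\<beta> t - \<kappa> t\<^sup>2 + C |x - \<gamma> t|\<^sup>2\<close> with \<open>t = e \<bullet> (x - y0)\<close>, has second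
  derivative along \<open>Y\<close> bounded by \<open>- 2 \<kappa>\<close> plus a multiple of \<open>C |x - \<gamma> t|\<^sup>2\<close>.\<close>

lemma barrier_jet:
  fixes Y acc :: "'a::euclidean_space \<Rightarrow> 'a" and \<gamma> :: "real \<Rightarrow> 'a"
  assumes \<gamma>: "\<And>s. \<bar>s\<bar> < T \<Longrightarrow> (\<gamma> has_vector_derivative Y (\<gamma> s)) (at s)"
    and accd: "((\<lambda>s. Y (\<gamma> s)) has_vector_derivative acc (\<gamma> ts)) (at ts)" and ts: "\<bar>ts\<bar> < T" "ts = e \<bullet> (xs - y0)"
    and max: "\<delta>0 > 0" "\<And>h. norm h < \<delta>0 \<Longrightarrow> xs + h \<in> Z \<Longrightarrow>
       u (xs + h) - (\<beta> * (e \<bullet> (xs + h - y0)) - \<kappa> * (e \<bullet> (xs + h - y0))\<^sup>2 + C * (norm (xs + h - \<gamma> (e \<bullet> (xs + h - y0))))\<^sup>2)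
        \<le> u xs - (\<beta> * ts - \<kappa> * ts\<^sup>2 + C * (norm (xs - \<gamma> ts))\<^sup>2)"
    and e: "norm e = 1" and C: "C \<ge> 0"
    and conv: "\<And>p G. quad_form G \<Longrightarrow> upper_jet Z u xs p G \<Longrightarrow> 0 \<le> G (Y xs) + p \<bullet> acc xs"
    and eY: "e \<bullet> Y xs = 1" and eacc: "e \<bullet> acc xs = 0"
  shows "0 \<le> - 2 * \<kappa> + 2 * C * ((norm (Y xs - Y (\<gamma> ts)))\<^sup>2 + (xs - \<gamma> ts) \<bullet> (acc xs - acc (\<gamma> ts)))"
proof -
  define dv where "dv = xs - \<gamma> ts"
  define Ys where "Ys = Y (\<gamma> ts)"
  define as where "as = acc (\<gamma> ts)"
  \<comment> \<open>The derivative of x - \<gamma> (e.(x - y0)) at \<open>xs\<close> in direction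
    \<open>h\<close>.\<close>
  define k where "k h = h - (e \<bullet> h) *\<^sub>R Ys" for h
  have lk: "linear k" unfolding k_def by (rule linearI) (auto simp: inner_add_right scaleR_add_left algebra_simps)
  \<comment> \<open>Gradient and, in the next line, Hessian of the barrier at \<open>xs\<close>; the
    curvature of \<gamma> enters through \<open>as\<close>.\<close>
  define p where "p = (\<beta> - 2 * \<kappa> * ts - 2 * C * (dv \<bullet> Ys)) *\<^sub>R e + (2 * C) *\<^sub>R dv"
  define G where "G h = (- 2 * \<kappa> - 2 * C * (dv \<bullet> as)) * (e \<bullet> h)\<^sup>2 + 2 * C * (norm (k h))\<^sup>2" for h
  have qG: "quad_form G" unfolding G_def
    by (intro quad_form_add quad_form_cmult quad_form_inner_square quad_form_norm_compose lk)
  define K where "K = norm dv + 1 + norm Ys + norm as + 1"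
  have K: "K \<ge> 1" unfolding K_def by simp
  have jet: "upper_jet Z u xs p G"
  proof (rule upper_jetI_ball)
    fix \<epsilon> :: real assume eps: "\<epsilon> > 0"
    define \<epsilon>' where "\<epsilon>' = min 1 (\<epsilon> / (6 * (C + 1) * K))"
    have eps': "\<epsilon>' > 0" "\<epsilon>' \<le> 1" unfolding \<epsilon>'_def using eps C K by auto
    have eps2: "6 * C * K * \<epsilon>' \<le> \<epsilon>"
    proof -
      have P: "6 * (C + 1) * K > 0" using C K by simp
      have "\<epsilon>' \<le> \<epsilon> / (6 * (C + 1) * K)" unfolding \<epsilon>'_def by simp
      then have "\<epsilon>' * (6 * (C + 1) * K) \<le> \<epsilon>" using pos_le_divide_eq[OF P] by blast
      moreover have "\<epsilon>' * (6 * (C + 1) * K) = 6 * C * K * \<epsilon>' + 6 * \<epsilon>' * K" by (simp add: algebra_simps)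
      moreover have "0 \<le> 6 * \<epsilon>' * K" using eps' K by simp
      ultimately show ?thesis by linarith
    qed
    have "\<bar>s - ts\<bar> < T - \<bar>ts\<bar> \<Longrightarrow> (\<gamma> has_vector_derivative Y (\<gamma> s)) (at s)" for s
      by (rule \<gamma>) linarith
    then obtain \<delta>1 where d1: "\<delta>1 > 0" "\<And>s. \<bar>s\<bar> < \<delta>1 \<Longrightarrow> norm (\<gamma> (ts + s) - \<gamma> ts - s *\<^sub>R Ys - (s\<^sup>2 / 2) *\<^sub>R as) \<le> \<epsilon>' * s\<^sup>2"
      unfolding Ys_def as_def using curve_taylor2[OF _ accd _ eps'(1), of "T - \<bar>ts\<bar>"] ts by (metis diff_gt_0_iff_gt)
    define \<delta> where "\<delta> = min \<delta>0 (min \<delta>1 (\<epsilon>' / K))"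
    have "u (xs + h) \<le> u xs + p \<bullet> h + G h / 2 + \<epsilon> * (norm h)\<^sup>2" if hZ: "xs + h \<in> Z" and h: "norm h < \<delta>" for h
    proof -
      define s where "s = e \<bullet> h"
      define \<rho> where "\<rho> = \<gamma> (ts + s) - \<gamma> ts - s *\<^sub>R Ys - (s\<^sup>2 / 2) *\<^sub>R as"
      have sh: "\<bar>s\<bar> \<le> norm h" unfolding s_def using Cauchy_Schwarz_ineq2[of e h] e by simp
      have s2: "s\<^sup>2 \<le> (norm h)\<^sup>2" using power_mono[OF sh, of 2] by simp
      have rho: "norm \<rho> \<le> \<epsilon>' * s\<^sup>2" unfolding \<rho>_def by (rule d1(2)) (use sh h in \<open>auto simp: \<delta>_def\<close>)
      have t: "e \<bullet> (xs + h - y0) = ts + s" unfolding ts(2) s_def by (simp add: inner_diff_right inner_add_right)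
      define q where "q = (s\<^sup>2 / 2) *\<^sub>R as + \<rho>"
      have vec: "xs + h - \<gamma> (ts + s) = dv + k h - q" unfolding dv_def k_def q_def \<rho>_def s_def by simp
      have nq: "norm q \<le> K * (norm h)\<^sup>2"
      proof -
        have "norm q \<le> s\<^sup>2 / 2 * norm as + \<epsilon>' * s\<^sup>2"
          unfolding q_def using norm_triangle_ineq[of "(s\<^sup>2 / 2) *\<^sub>R as" \<rho>] rho by simp
        also have "\<dots> \<le> s\<^sup>2 * norm as + 1 * s\<^sup>2" using eps' by (intro add_mono mult_right_mono) auto
        also have "\<dots> = s\<^sup>2 * (norm as + 1)" by (simp add: algebra_simps)
        also have "\<dots> \<le> (norm h)\<^sup>2 * K" unfolding K_def using s2 by (intro mult_mono) auto
        finally show ?thesis by (simp add: mult.commute)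
      qed
      have nk: "norm (k h) \<le> K * norm h"
      proof -
        have "norm (k h) \<le> norm h + \<bar>s\<bar> * norm Ys" unfolding k_def s_def by (rule order_trans[OF norm_triangle_ineq4]) simp
        also have "\<dots> \<le> norm h + norm h * norm Ys" using sh by (intro add_mono mult_right_mono) auto
        also have "\<dots> = (1 + norm Ys) * norm h" by (simp add: algebra_simps)
        also have "\<dots> \<le> K * norm h" unfolding K_def by (intro mult_right_mono) auto
        finally show ?thesis .
      qed
      have Kh: "K * norm h \<le> \<epsilon>'" using h K unfolding \<delta>_def by (simp add: field_simps)
      have ex: "(norm (dv + k h - q))\<^sup>2 = (norm dv)\<^sup>2 + 2 * (dv \<bullet> k h) + (norm (k h))\<^sup>2 - 2 * (dv \<bullet> q) - 2 * (k h \<bullet> q) + (norm q)\<^sup>2"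
        unfolding power2_norm_eq_inner by (simp add: inner_diff_left inner_diff_right inner_add_left inner_add_right inner_commute)
      have dq: "- 2 * (dv \<bullet> q) \<le> - s\<^sup>2 * (dv \<bullet> as) + 2 * K * \<epsilon>' * (norm h)\<^sup>2"
      proof -
        have "- (dv \<bullet> \<rho>) \<le> norm dv * norm \<rho>" using Cauchy_Schwarz_ineq2[of dv \<rho>] by linarith
        also have "\<dots> \<le> K * (\<epsilon>' * (norm h)\<^sup>2)"
        proof (rule mult_mono)
          show "norm \<rho> \<le> \<epsilon>' * (norm h)\<^sup>2" by (rule order_trans[OF rho mult_left_mono[OF s2]]) (use eps' in auto)
        qed (use K in \<open>auto simp: K_def\<close>)
        finally show ?thesis unfolding q_def by (simp add: inner_add_right algebra_simps)
      qed
      have kq: "- 2 * (k h \<bullet> q) \<le> 2 * K * \<epsilon>' * (norm h)\<^sup>2"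
      proof -
        have "- (k h \<bullet> q) \<le> norm (k h) * norm q" using Cauchy_Schwarz_ineq2[of "k h" q] by linarith
        also have "\<dots> \<le> \<epsilon>' * (K * (norm h)\<^sup>2)"
          by (rule mult_mono[OF order_trans[OF nk Kh] nq]) (use eps' in auto)
        finally have "- (k h \<bullet> q) \<le> \<epsilon>' * (K * (norm h)\<^sup>2)" .
        moreover have "2 * K * \<epsilon>' * (norm h)\<^sup>2 = 2 * (\<epsilon>' * (K * (norm h)\<^sup>2))" by (simp add: mult_ac)
        ultimately show ?thesis by linarith
      qed
      have qq: "(norm q)\<^sup>2 \<le> 2 * K * \<epsilon>' * (norm h)\<^sup>2"
      proof -
        have "1 * norm h \<le> K * norm h" using K by (intro mult_right_mono) auto
        then have h1: "norm h \<le> 1" using Kh eps' by linarith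
        have nq': "norm q \<le> \<epsilon>'"
        proof -
          have "norm q \<le> (K * norm h) * norm h" using nq by (simp add: power2_eq_square)
          also have "\<dots> \<le> \<epsilon>' * 1" by (rule mult_mono[OF Kh h1]) (use eps' in auto)
          finally show ?thesis by simp
        qed
        have "norm q * norm q \<le> \<epsilon>' * (K * (norm h)\<^sup>2)" by (rule mult_mono[OF nq' nq]) (use eps' in auto)
        also have "\<dots> \<le> 2 * (\<epsilon>' * (K * (norm h)\<^sup>2))" using eps' K by simp
        finally show ?thesis by (simp add: power2_eq_square mult_ac)
      qed
      have "(norm (dv + k h - q))\<^sup>2 \<le> (norm dv)\<^sup>2 + 2 * (dv \<bullet> k h) + (norm (k h))\<^sup>2 - s\<^sup>2 * (dv \<bullet> as) + 6 * K * \<epsilon>' * (norm h)\<^sup>2"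
        unfolding ex using dq kq qq by linarith
      from mult_left_mono[OF this C]
      have m1: "C * (norm (dv + k h - q))\<^sup>2 \<le> C * (norm dv)\<^sup>2 + 2 * C * (dv \<bullet> k h) + C * (norm (k h))\<^sup>2 - C * (dv \<bullet> as) * s\<^sup>2 + (6 * C * K * \<epsilon>') * (norm h)\<^sup>2"
        by (simp add: algebra_simps)
      have m2: "(6 * C * K * \<epsilon>') * (norm h)\<^sup>2 \<le> \<epsilon> * (norm h)\<^sup>2" using eps2 by (intro mult_right_mono) auto
      have m3: "u (xs + h) - (\<beta> * (ts + s) - \<kappa> * (ts + s)\<^sup>2 + C * (norm (dv + k h - q))\<^sup>2) \<le> u xs - (\<beta> * ts - \<kappa> * ts\<^sup>2 + C * (norm dv)\<^sup>2)"
        using max(2)[of h] h hZ unfolding t vec \<delta>_def dv_def[symmetric] by simp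
      have m4: "\<beta> * (ts + s) - \<kappa> * (ts + s)\<^sup>2 = (\<beta> * ts - \<kappa> * ts\<^sup>2) + (\<beta> - 2 * \<kappa> * ts) * s - \<kappa> * s\<^sup>2"
        by (simp add: power2_eq_square algebra_simps)
      have m5: "p \<bullet> h = (\<beta> - 2 * \<kappa> * ts) * s + 2 * C * (dv \<bullet> k h)"
        unfolding p_def k_def s_def by (simp add: inner_add_left inner_diff_right algebra_simps)
      have m6: "G h / 2 = - \<kappa> * s\<^sup>2 - C * (dv \<bullet> as) * s\<^sup>2 + C * (norm (k h))\<^sup>2"
        unfolding G_def s_def by (simp add: field_simps)
      show ?thesis using m1 m2 m3 unfolding m4 m5 m6 by linarith
    qed
    then show "\<exists>d>0. \<forall>h. xs + h \<in> Z \<longrightarrow> norm h < d \<longrightarrow> u (xs + h) \<le> u xs + p \<bullet> h + G h / 2 + \<epsilon> * (norm h)\<^sup>2"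
      using max(1) d1(1) eps' K unfolding \<delta>_def by (intro exI[of _ \<delta>]) (auto simp: \<delta>_def)
  qed
  \<comment> \<open>The jet is tested on Y: e.Y = 1 and e.acc = 0 remove \<beta>, and
    \<open>k (Y xs)\<close> is the difference of the velocities at \<open>xs\<close> and on the
    curve.\<close>
  have "0 \<le> G (Y xs) + p \<bullet> acc xs" by (rule conv[OF qG jet])
  also have "\<dots> = - 2 * \<kappa> + 2 * C * ((norm (Y xs - Ys))\<^sup>2 + dv \<bullet> (acc xs - as))"
    unfolding G_def p_def k_def using eY eacc by (simp add: inner_add_left inner_diff_right algebra_simps)
  finally show ?thesis unfolding Ys_def as_def dv_def .
qed

text \<open>If the slope exceeded \<beta>, u minus the barrier would have an interior maximum in a
  tube around the integral curve for times in [-s, r], which \<open>barrier_jet\<close> excludes. At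
  t = r the barrier exceeds the oscillation of \<open>u\<close>, on the lateral side a large C has
  that effect, and at t = -s the slope above \<beta> and the touching paraboloid push the difference
  below its value at \<open>y0\<close>. \<beta> is fixed before the field, the point and the jet, so
  it serves all of them.\<close>

theorem slope_bound:
  fixes M L B d :: real
  assumes L: "L \<ge> 0" and B: "B \<ge> 0" and d: "d > 0" and M: "M \<ge> 0"
  obtains \<beta> where "\<And>(Y :: 'a::euclidean_space \<Rightarrow> 'a) DY acc e y0 u Z p N.
    cball y0 d \<subseteq> Z \<Longrightarrow> usc_on Z u \<Longrightarrow> (\<And>x. x \<in> Z \<Longrightarrow> \<bar>u x\<bar> \<le> M) \<Longrightarrow>
    (\<And>x. x \<in> cball y0 d \<Longrightarrow> norm (Y x) \<le> B \<and> (Y has_derivative DY x) (at x) \<and> acc x = DY x (Y x)) \<Longrightarrow>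
    L-lipschitz_on (cball y0 d) Y \<Longrightarrow> L-lipschitz_on (cball y0 d) acc \<Longrightarrow>
    norm e = 1 \<Longrightarrow> (\<And>x. e \<bullet> Y x = 1) \<Longrightarrow> (\<And>x. e \<bullet> acc x = 0) \<Longrightarrow>
    (\<And>x q G. x \<in> ball y0 d \<Longrightarrow> quad_form G \<Longrightarrow> upper_jet Z u x q G \<Longrightarrow> 0 \<le> G (Y x) + q \<bullet> acc x) \<Longrightarrow>
    (\<And>x. x \<in> Z \<Longrightarrow> u x \<le> u y0 + p \<bullet> (x - y0) + N * (norm (x - y0))\<^sup>2) \<Longrightarrow> p \<bullet> Y y0 \<le> \<beta>"
proof -
  \<comment> \<open>The curve exists up to time T and stays within d/2 of its start.\<close>
  define T where "T = min (1 / (6 * (L + 1))) (d / (2 * (B + 1)))"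
  have T: "T > 0" "3 * T * L \<le> 1 / 2" "B * T \<le> d / 2"
  proof -
    show "T > 0" unfolding T_def using L B d by simp
    have "T \<le> 1 / (6 * (L + 1))" unfolding T_def by simp
    then have "T * (6 * (L + 1)) \<le> 1" using L by (simp add: pos_le_divide_eq)
    then show "3 * T * L \<le> 1 / 2" using \<open>T > 0\<close> by (simp add: algebra_simps)
    have "T \<le> d / (2 * (B + 1))" unfolding T_def by simp
    then have "T * (2 * (B + 1)) \<le> d" using B by (simp add: pos_le_divide_eq)
    then show "B * T \<le> d / 2" using \<open>T > 0\<close> by (simp add: algebra_simps)
  qed
  \<comment> \<open>The coefficient of C |dv|^2 in the conclusion of \<open>barrier_jet\<close> when
    Y and its acceleration are L-Lipschitz.\<close>
  define \<Lambda> where "\<Lambda> = 2 * (L\<^sup>2 + L)"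
  have Lam: "\<Lambda> \<ge> 0" unfolding \<Lambda>_def using L by simp
  define r where "r = min (T / 2) (min 1 (1 / (2 * (\<Lambda> + 1))))"
  have r: "r > 0" "r < T" "r \<le> 1" "\<Lambda> * r\<^sup>2 \<le> 1 / 2"
  proof -
    show r0: "r > 0" unfolding r_def using T Lam by simp
    show "r < T" unfolding r_def using T by simp
    show r1: "r \<le> 1" unfolding r_def by simp
    have "r \<le> 1 / (2 * (\<Lambda> + 1))" unfolding r_def by simp
    then have "r * (2 * (\<Lambda> + 1)) \<le> 1" using Lam by (simp add: pos_le_divide_eq)
    then have "\<Lambda> * r \<le> 1 / 2" using r0 by (simp add: algebra_simps)
    moreover have "\<Lambda> * r\<^sup>2 \<le> \<Lambda> * r" using r0 r1 Lam by (intro mult_left_mono) (auto simp: power2_eq_square mult_left_le)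
    ultimately show "\<Lambda> * r\<^sup>2 \<le> 1 / 2" by simp
  qed
  \<comment> \<open>At the maximum C |dv|^2 is at most 4 M + 1 + 2 \<kappa> r^2, and \<Lambda> r^2
    \<le> 1/2; the second derivative is then at most -\<kappa> + \<Lambda> (4 M + 1), negative for
    this \<kappa>.\<close>
  define \<kappa> where "\<kappa> = \<Lambda> * (4 * M + 2) + 1"
  have kap: "\<kappa> \<ge> 1" unfolding \<kappa>_def using Lam M by simp
  \<comment> \<open>Chosen so that \<beta> r - \<kappa> r^2 = 2 M + 1 exceeds the oscillation 2 M of
    \<open>u\<close> at the end t = r.\<close>
  define \<beta> where "\<beta> = (2 * M + 1 + \<kappa> * r\<^sup>2) / r"
  have bet: "\<beta> \<ge> 0" "\<beta> * r = 2 * M + 1 + \<kappa> * r\<^sup>2" unfolding \<beta>_def using M kap r by auto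
  show ?thesis
  proof (rule that[of \<beta>], rule ccontr)
    fix Y :: "'a \<Rightarrow> 'a" and DY acc e y0 u Z p N
    assume Z: "cball y0 d \<subseteq> Z" and usc: "usc_on Z u" and uM: "\<And>x. x \<in> Z \<Longrightarrow> \<bar>u x\<bar> \<le> M"
      and Y: "\<And>x. x \<in> cball y0 d \<Longrightarrow> norm (Y x) \<le> B \<and> (Y has_derivative DY x) (at x) \<and> acc x = DY x (Y x)"
      and lipY: "L-lipschitz_on (cball y0 d) Y" and lipa: "L-lipschitz_on (cball y0 d) acc"
      and e: "norm e = 1" and eY: "\<And>x. e \<bullet> Y x = 1" and ea: "\<And>x. e \<bullet> acc x = 0"
      and conv: "\<And>x q G. x \<in> ball y0 d \<Longrightarrow> quad_form G \<Longrightarrow> upper_jet Z u x q G \<Longrightarrow> 0 \<le> G (Y x) + q \<bullet> acc x"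
      and touch: "\<And>x. x \<in> Z \<Longrightarrow> u x \<le> u y0 + p \<bullet> (x - y0) + N * (norm (x - y0))\<^sup>2"
      and neg: "\<not> p \<bullet> Y y0 \<le> \<beta>"
    \<comment> \<open>Composition with the projection onto the ball extends Y to a bounded Lipschitz
      field on the whole space.\<close>
    define F where "F x = Y (closest_point (cball y0 d) x)" for x
    have cb: "convex (cball y0 d)" "closed (cball y0 d)" "cball y0 d \<noteq> {}" using d by auto
    have cpin: "closest_point (cball y0 d) x \<in> cball y0 d" for x by (rule closest_point_in_set[OF cb(2,3)])
    have Flip: "L-lipschitz_on UNIV F"
    proof (rule lipschitz_onI)
      fix x y
      have "dist (F x) (F y) \<le> L * dist (closest_point (cball y0 d) x) (closest_point (cball y0 d) y)"
        unfolding F_def by (rule lipschitz_onD[OF lipY cpin cpin])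
      also have "\<dots> \<le> L * dist x y" using closest_point_lipschitz[OF cb] L by (intro mult_left_mono) auto
      finally show "dist (F x) (F y) \<le> L * dist x y" .
    qed (rule L)
    have FB: "norm (F x) \<le> B" for x unfolding F_def using Y[OF cpin] by blast
    obtain \<gamma> where g0: "\<gamma> 0 = y0" and gF: "\<And>t. \<bar>t\<bar> < T \<Longrightarrow> (\<gamma> has_vector_derivative F (\<gamma> t)) (at t)"
      by (rule lipschitz_flow_exists[OF Flip FB T(1,2)]) (rule that)
    have gB: "norm (\<gamma> t - y0) \<le> B * \<bar>t\<bar>" if "\<bar>t\<bar> < T" for t
    proof -
      have "norm (\<gamma> t - \<gamma> 0) \<le> B * \<bar>t - 0\<bar>"
        by (rule vector_derivative_norm_bound[where a = "- \<bar>t\<bar>" and b = "\<bar>t\<bar>" and g = "\<lambda>t. F (\<gamma> t)"]) (use that gF FB in auto)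
      then show ?thesis using g0 by simp
    qed
    have gd2: "norm (\<gamma> t - y0) \<le> d / 2" if "\<bar>t\<bar> < T" for t
      using gB[OF that] mult_left_mono[OF less_imp_le[OF that] B] T(3) by linarith
    have gin: "\<gamma> t \<in> cball y0 d" if "\<bar>t\<bar> < T" for t using gd2[OF that] d by (simp add: dist_norm norm_minus_commute)
    have FY: "F x = Y x" if "x \<in> cball y0 d" for x unfolding F_def using closest_point_self[OF that] by simp
    have gY: "(\<gamma> has_vector_derivative Y (\<gamma> t)) (at t)" if "\<bar>t\<bar> < T" for t
      using gF[OF that] FY[OF gin[OF that]] by simp
    have gacc: "((\<lambda>s. Y (\<gamma> s)) has_vector_derivative acc (\<gamma> t)) (at t)" if "\<bar>t\<bar> < T" for t
    proof -
      have "(Y has_derivative DY (\<gamma> t)) (at (\<gamma> t) within range \<gamma>)"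
        using Y[OF gin[OF that]] by (auto intro: has_derivative_at_withinI)
      from vector_derivative_diff_chain_within[OF gY[OF that] this]
      show ?thesis using Y[OF gin[OF that]] by (simp add: o_def)
    qed
    have gc: "continuous_on {- r..r} \<gamma>"
    proof (rule continuous_at_imp_continuous_on, rule ballI)
      fix t assume "t \<in> {- r..r}"
      then have "\<bar>t\<bar> < T" using r by auto
      then show "isCont \<gamma> t" by (rule has_vector_derivative_continuous[OF gY])
    qed
    define a where "a = p \<bullet> Y y0"
    define \<delta> where "\<delta> = a - \<beta>"
    have del: "\<delta> > 0" unfolding \<delta>_def a_def using neg by simp
    define N' where "N' = max N 0"
    have N': "N' \<ge> 0" unfolding N'_def by simp
    have touch': "u x \<le> u y0 + p \<bullet> (x - y0) + N' * (norm (x - y0))\<^sup>2" if "x \<in> Z" for x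
      using touch[OF that] mult_right_mono[of N N' "(norm (x - y0))\<^sup>2"] unfolding N'_def by simp
    have y0c: "y0 \<in> cball y0 d" using d by simp
    obtain \<delta>1 where d1: "\<delta>1 > 0" "\<And>t. \<bar>t\<bar> < \<delta>1 \<Longrightarrow> norm (\<gamma> t - y0 - t *\<^sub>R Y y0) \<le> (\<delta> / (8 * (norm p + 1))) * \<bar>t\<bar>"
    proof -
      have "(\<gamma> has_derivative (\<lambda>h. h *\<^sub>R Y y0)) (at 0)" using gY[of 0] T g0 unfolding has_vector_derivative_def by simp
      moreover have "\<delta> / (8 * (norm p + 1)) > 0" using del by (simp add: add_nonneg_pos)
      ultimately obtain \<delta>1 where "\<delta>1 > 0" "\<And>y. norm (y - 0) < \<delta>1 \<Longrightarrow> norm (\<gamma> y - \<gamma> 0 - (y - 0) *\<^sub>R Y y0) \<le> (\<delta> / (8 * (norm p + 1))) * norm (y - 0)"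
        unfolding has_derivative_at_alt by blast
      then show ?thesis using that[of \<delta>1] g0 by simp
    qed
    \<comment> \<open>Short enough that the deviation of the curve from its tangent, the
      \<kappa>-term and the touching paraboloid cost at most s \<delta> / 8 each; a fourth such
      share goes to \<open>young\<close>.\<close>
    define s where "s = min r (min (\<delta>1 / 2) (min (\<delta> / (8 * (\<kappa> + 1))) (\<delta> / (16 * (N' * B\<^sup>2 + 1)))))"
    have s: "s > 0" "s \<le> r" "s < \<delta>1" "\<kappa> * s \<le> \<delta> / 8" "2 * N' * B\<^sup>2 * s \<le> \<delta> / 8"
    proof -
      have P: "16 * (N' * B\<^sup>2 + 1) > 0" using N' by (simp add: add_nonneg_pos)
      show s0: "s > 0" unfolding s_def using r d1 del kap P by simp
      show "s \<le> r" unfolding s_def by simp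
      have "s \<le> \<delta>1 / 2" unfolding s_def by (rule min.coboundedI2, rule min.coboundedI1, rule order_refl)
      then show "s < \<delta>1" using d1 by simp
      have "s \<le> \<delta> / (8 * (\<kappa> + 1))" unfolding s_def by (rule min.coboundedI2, rule min.coboundedI2, rule min.coboundedI1, rule order_refl)
      then have "s * (8 * (\<kappa> + 1)) \<le> \<delta>" using kap by (simp add: pos_le_divide_eq)
      then show "\<kappa> * s \<le> \<delta> / 8" using s0 by (simp add: algebra_simps)
      have "s \<le> \<delta> / (16 * (N' * B\<^sup>2 + 1))" unfolding s_def by (rule min.coboundedI2, rule min.coboundedI2, rule min.coboundedI2, rule order_refl)
      then have "s * (16 * (N' * B\<^sup>2 + 1)) \<le> \<delta>" using pos_le_divide_eq[OF P] by blast
      moreover have "s * (16 * (N' * B\<^sup>2 + 1)) = 8 * (2 * N' * B\<^sup>2 * s) + 16 * s" by (simp add: algebra_simps)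
      ultimately show "2 * N' * B\<^sup>2 * s \<le> \<delta> / 8" using s0 by linarith
    qed
    define E where "E = 2 * M + 1 + \<beta> * r + \<kappa> * r\<^sup>2"
    have E: "E \<ge> 0" unfolding E_def using M bet r kap by simp
    \<comment> \<open>Large enough for Young's inequality against |p| and for the lateral wall at
      distance d/4. The extra 2 N' in \<open>C\<close> pays for the touching paraboloid.\<close>
    define C1 where "C1 = 2 * (norm p)\<^sup>2 / (s * \<delta>) + 16 * E / d\<^sup>2 + 1"
    have sd: "s * \<delta> > 0" using s del by simp
    have C1: "C1 \<ge> 1" "2 * (norm p)\<^sup>2 \<le> C1 * (s * \<delta>)" "16 * E \<le> C1 * d\<^sup>2"
    proof -
      have a1: "2 * (norm p)\<^sup>2 / (s * \<delta>) \<ge> 0" "16 * E / d\<^sup>2 \<ge> 0" using sd E by auto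
      then show "C1 \<ge> 1" unfolding C1_def by linarith
      have "2 * (norm p)\<^sup>2 / (s * \<delta>) \<le> C1" "16 * E / d\<^sup>2 \<le> C1" unfolding C1_def using a1 by linarith+
      then show "2 * (norm p)\<^sup>2 \<le> C1 * (s * \<delta>)" "16 * E \<le> C1 * d\<^sup>2" using sd d by (simp_all add: pos_divide_le_eq)
    qed
    define C where "C = 2 * N' + C1"
    have C: "C \<ge> C1" "C \<ge> 0" unfolding C_def using N' C1 by auto
    have young: "norm p * x \<le> C1 * x\<^sup>2 + s * \<delta> / 8" for x
    proof -
      have "0 \<le> (2 * C1 * x - norm p)\<^sup>2" by simp
      then have "4 * C1 * (norm p * x) \<le> 4 * C1 * (C1 * x\<^sup>2) + (norm p)\<^sup>2" by (simp add: power2_eq_square algebra_simps)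
      also have "\<dots> \<le> 4 * C1 * (C1 * x\<^sup>2) + 4 * C1 * (s * \<delta> / 8)" using C1(2) by (simp add: mult_ac)
      finally have "4 * C1 * (norm p * x) \<le> 4 * C1 * (C1 * x\<^sup>2 + s * \<delta> / 8)" by (simp add: algebra_simps)
      then show ?thesis using C1(1) by simp
    qed
    define t where "t x = e \<bullet> (x - y0)" for x
    have tc: "continuous_on S t" for S unfolding t_def by (intro continuous_intros)
    define dv where "dv x = x - \<gamma> (t x)" for x
    define \<Phi> where "\<Phi> x = \<beta> * t x - \<kappa> * (t x)\<^sup>2 + C * (norm (dv x))\<^sup>2" for x
    define S where "S = {x. - s \<le> t x \<and> t x \<le> r}"
    define Q where "Q = {x \<in> S. norm (dv x) \<le> d / 4}"
    have clS: "closed S" unfolding S_def t_def by (intro closed_Collect_conj closed_Collect_le continuous_intros)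
    have dc: "continuous_on S dv" unfolding dv_def
      by (intro continuous_intros continuous_on_compose2[OF gc tc]) (use s in \<open>auto simp: S_def\<close>)
    have clQ: "closed Q" unfolding Q_def by (intro continuous_on_closed_Collect_le continuous_intros dc clS)
    have tT: "\<bar>t x\<bar> \<le> r" "\<bar>t x\<bar> < T" if "x \<in> S" for x using that s r unfolding S_def by auto
    have Qd: "norm (x - y0) < d" if "x \<in> Q" for x
    proof -
      have "x \<in> S" "norm (dv x) \<le> d / 4" using that unfolding Q_def by auto
      moreover have "norm (x - y0) \<le> norm (dv x) + norm (\<gamma> (t x) - y0)"
        unfolding dv_def using norm_triangle_ineq[of "x - \<gamma> (t x)" "\<gamma> (t x) - y0"] by simp
      ultimately show ?thesis using gd2[OF tT(2)] d by fastforce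
    qed
    have Qb: "Q \<subseteq> ball y0 d" using Qd by (auto simp: dist_norm norm_minus_commute)
    have QZ: "Q \<subseteq> Z" using Qb Z ball_subset_cball by blast
    have cQ: "compact Q" using clQ Qb bounded_subset[OF bounded_ball] compact_eq_bounded_closed by blast
    have y0Q: "y0 \<in> Q" unfolding Q_def S_def dv_def t_def using s r g0 d by simp
    have "continuous_on Q \<Phi>" unfolding \<Phi>_def
      by (intro continuous_intros continuous_on_subset[OF dc] tc) (auto simp: Q_def)
    then have "usc_on Q (\<lambda>x. u x + (- \<Phi> x))"
      by (intro usc_on_add usc_on_subset[OF usc QZ] continuous_imp_usc_on continuous_on_minus)
    then obtain xs where xs: "xs \<in> Q" "\<And>x. x \<in> Q \<Longrightarrow> u x + - \<Phi> x \<le> u xs + - \<Phi> xs"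
      using usc_attains_sup[OF cQ] y0Q by blast
    have Phi0: "\<Phi> y0 = 0" unfolding \<Phi>_def dv_def t_def using g0 by simp
    have top: "u y0 \<le> u xs - \<Phi> xs" using xs(2)[OF y0Q] Phi0 by simp
    have xsS: "xs \<in> S" and xsd: "norm (dv xs) \<le> d / 4" using xs(1) unfolding Q_def by auto
    have uy0: "- M \<le> u y0" "u y0 \<le> M" using uM[of y0] y0Q QZ by (auto simp: abs_le_iff)
    have uxs: "u xs \<le> M" using uM[of xs] xs(1) QZ by (auto simp: abs_le_iff)
    have bt: "- (\<beta> * r) \<le> \<beta> * t xs" "\<kappa> * (t xs)\<^sup>2 \<le> \<kappa> * r\<^sup>2"
    proof -
      have "\<beta> * (- r) \<le> \<beta> * t xs" using tT(1)[OF xsS] bet by (intro mult_left_mono) auto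
      then show "- (\<beta> * r) \<le> \<beta> * t xs" by simp
      have "\<bar>t xs\<bar>\<^sup>2 \<le> r\<^sup>2" using tT(1)[OF xsS] by (intro power_mono) auto
      then show "\<kappa> * (t xs)\<^sup>2 \<le> \<kappa> * r\<^sup>2" using kap by (intro mult_left_mono) auto
    qed
    have i1: "t xs < r"
    proof (rule ccontr)
      assume "\<not> t xs < r"
      then have e1: "t xs = r" using xsS unfolding S_def by simp
      have "0 \<le> C * (norm (dv xs))\<^sup>2" using C by simp
      then have "\<Phi> xs \<ge> 2 * M + 1" unfolding \<Phi>_def e1 using bet by simp
      then show False using top uy0 uxs by linarith
    qed
    have i2: "norm (dv xs) < d / 4"
    proof (rule ccontr)
      assume "\<not> norm (dv xs) < d / 4"
      then have e1: "norm (dv xs) = d / 4" using xsd by simp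
      have "E \<le> C * (norm (dv xs))\<^sup>2"
        unfolding e1 using C1(3) mult_right_mono[OF C(1), of "d\<^sup>2"] by (simp add: power_divide)
      then have "\<Phi> xs \<ge> 2 * M + 1" unfolding \<Phi>_def E_def using bt by linarith
      then show False using top uy0 uxs by linarith
    qed
    have i3: "- s < t xs"
    proof (rule ccontr)
      assume "\<not> - s < t xs"
      then have e1: "t xs = - s" using xsS unfolding S_def by simp
      have sT: "\<bar>- s\<bar> < T" "\<bar>- s\<bar> < \<delta>1" using s r by auto
      let ?d = "dv xs" and ?g = "\<gamma> (- s) - y0"
      have dec: "xs - y0 = ?d + ?g" unfolding dv_def e1 by simp
      have g1: "p \<bullet> ?g \<le> - s * a + s * \<delta> / 8"
      proof -
        let ?w = "?g - (- s) *\<^sub>R Y y0"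
        have "p \<bullet> ?w \<le> norm p * norm ?w" using Cauchy_Schwarz_ineq2[of p ?w] by linarith
        also have "\<dots> \<le> (norm p + 1) * ((\<delta> / (8 * (norm p + 1))) * s)"
          using d1(2)[OF sT(2)] s by (intro mult_mono) auto
        also have "\<dots> = s * \<delta> / 8"
        proof -
          have "K * (\<delta> / (8 * K) * s) = s * \<delta> / 8" if "K > 0" for K using that by simp
          moreover have "norm p + 1 > 0" by (simp add: add_nonneg_pos)
          ultimately show ?thesis by blast
        qed
        finally show ?thesis unfolding a_def by (simp add: inner_diff_right inner_add_right algebra_simps)
      qed
      have g2: "(norm (xs - y0))\<^sup>2 \<le> 2 * (norm ?d)\<^sup>2 + 2 * B\<^sup>2 * s\<^sup>2"
      proof -
        have "norm (xs - y0) \<le> norm ?d + B * s" unfolding dec using norm_triangle_ineq[of ?d ?g] gB[OF sT(1)] s by simp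
        then have "(norm (xs - y0))\<^sup>2 \<le> (norm ?d + B * s)\<^sup>2" by (intro power_mono) auto
        also have "\<dots> \<le> 2 * (norm ?d)\<^sup>2 + 2 * (B * s)\<^sup>2"
          using zero_le_power2[of "norm ?d - B * s"] by (simp add: power2_eq_square algebra_simps)
        finally show ?thesis by (simp add: power_mult_distrib)
      qed
      have g3: "N' * (norm (xs - y0))\<^sup>2 \<le> 2 * N' * (norm ?d)\<^sup>2 + s * \<delta> / 8"
      proof -
        have "N' * (norm (xs - y0))\<^sup>2 \<le> N' * (2 * (norm ?d)\<^sup>2 + 2 * B\<^sup>2 * s\<^sup>2)" using g2 N' by (rule mult_left_mono)
        also have "\<dots> = 2 * N' * (norm ?d)\<^sup>2 + (2 * N' * B\<^sup>2 * s) * s" by (simp add: power2_eq_square algebra_simps)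
        also have "\<dots> \<le> 2 * N' * (norm ?d)\<^sup>2 + \<delta> / 8 * s" using s by (intro add_left_mono mult_right_mono) auto
        finally show ?thesis by (simp add: mult.commute)
      qed
      have g4: "p \<bullet> ?d \<le> C1 * (norm ?d)\<^sup>2 + s * \<delta> / 8" using Cauchy_Schwarz_ineq2[of p ?d] young[of "norm ?d"] by linarith
      have g5: "\<kappa> * s\<^sup>2 \<le> s * \<delta> / 8" using mult_right_mono[OF s(4), of s] s(1) by (simp add: power2_eq_square mult_ac)
      have "u xs \<le> u y0 + (p \<bullet> ?d + p \<bullet> ?g) + N' * (norm (xs - y0))\<^sup>2"
        using touch'[of xs] xs(1) QZ unfolding dec by (auto simp: inner_add_right)
      moreover have "\<Phi> xs = - (\<beta> * s) - \<kappa> * s\<^sup>2 + 2 * N' * (norm ?d)\<^sup>2 + C1 * (norm ?d)\<^sup>2"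
        unfolding \<Phi>_def e1 C_def by (simp add: algebra_simps)
      moreover have "s * \<delta> = s * a - \<beta> * s" unfolding \<delta>_def by (simp add: algebra_simps)
      ultimately have "u xs - \<Phi> xs \<le> u y0 - s * \<delta> + s * \<delta> / 2" using g1 g3 g4 g5 by linarith
      then show False using top sd by linarith
    qed
    obtain \<delta>0 where d0: "\<delta>0 > 0" "\<And>h. norm h < \<delta>0 \<Longrightarrow> xs + h \<in> Q"
    proof -
      define S' where "S' = {x. - s < t x \<and> t x < r}"
      have oS: "open S'" unfolding S'_def t_def by (intro open_Collect_conj open_Collect_less continuous_intros)
      have "continuous_on S' (\<lambda>x. norm (dv x))"
        by (intro continuous_intros continuous_on_subset[OF dc]) (auto simp: S_def S'_def)
      then have "open (S' \<inter> (\<lambda>x. norm (dv x)) -` {..<d / 4})" by (rule continuous_open_preimage[OF _ oS]) simp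
      moreover have "xs \<in> S' \<inter> (\<lambda>x. norm (dv x)) -` {..<d / 4}" using i1 i2 i3 unfolding S'_def by simp
      ultimately obtain \<delta>0 where D: "\<delta>0 > 0" "ball xs \<delta>0 \<subseteq> S' \<inter> (\<lambda>x. norm (dv x)) -` {..<d / 4}"
        using openE by blast
      have "xs + h \<in> Q" if "norm h < \<delta>0" for h
      proof -
        have "xs + h \<in> ball xs \<delta>0" using that by (simp add: dist_norm)
        then have "xs + h \<in> S' \<inter> (\<lambda>x. norm (dv x)) -` {..<d / 4}" using D(2) by blast
        then show ?thesis unfolding Q_def S_def S'_def by auto
      qed
      then show ?thesis using that D(1) by blast
    qed
    have tsT: "\<bar>t xs\<bar> < T" using tT(2)[OF xsS] .
    have xsb: "xs \<in> ball y0 d" using Qb xs(1) by blast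
    have J: "0 \<le> - 2 * \<kappa> + 2 * C * ((norm (Y xs - Y (\<gamma> (t xs))))\<^sup>2 + (xs - \<gamma> (t xs)) \<bullet> (acc xs - acc (\<gamma> (t xs))))"
    proof (rule barrier_jet[where T = T and e = e and ?y0.0 = y0 and u = u and Z = Z and ?\<delta>0.0 = \<delta>0 and \<beta> = \<beta>])
      show "u (xs + h) - (\<beta> * (e \<bullet> (xs + h - y0)) - \<kappa> * (e \<bullet> (xs + h - y0))\<^sup>2 + C * (norm (xs + h - \<gamma> (e \<bullet> (xs + h - y0))))\<^sup>2)
        \<le> u xs - (\<beta> * t xs - \<kappa> * (t xs)\<^sup>2 + C * (norm (xs - \<gamma> (t xs)))\<^sup>2)" if "norm h < \<delta>0" for h
        using xs(2)[OF d0(2)[OF that]] unfolding \<Phi>_def dv_def t_def by simp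
      show "t xs = e \<bullet> (xs - y0)" unfolding t_def ..
    qed (use gY gacc tsT d0 e C eY ea conv[OF xsb] in auto)
    have in1: "xs \<in> cball y0 d" "\<gamma> (t xs) \<in> cball y0 d" using xsb gin[OF tsT] by auto
    have n1: "norm (Y xs - Y (\<gamma> (t xs))) \<le> L * norm (dv xs)"
      using lipschitz_onD[OF lipY in1] unfolding dv_def by (simp add: dist_norm)
    have n2: "norm (acc xs - acc (\<gamma> (t xs))) \<le> L * norm (dv xs)"
      using lipschitz_onD[OF lipa in1] unfolding dv_def by (simp add: dist_norm)
    have n3: "(norm (Y xs - Y (\<gamma> (t xs))))\<^sup>2 \<le> L\<^sup>2 * (norm (dv xs))\<^sup>2" using power_mono[OF n1, of 2] by (simp add: power_mult_distrib)
    have n4: "(xs - \<gamma> (t xs)) \<bullet> (acc xs - acc (\<gamma> (t xs))) \<le> L * (norm (dv xs))\<^sup>2"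
    proof -
      have "(xs - \<gamma> (t xs)) \<bullet> (acc xs - acc (\<gamma> (t xs))) \<le> norm (dv xs) * norm (acc xs - acc (\<gamma> (t xs)))"
        unfolding dv_def by (rule norm_cauchy_schwarz)
      also have "\<dots> \<le> norm (dv xs) * (L * norm (dv xs))" using n2 by (intro mult_left_mono) auto
      finally show ?thesis by (simp add: power2_eq_square mult_ac)
    qed
    have "2 * C * ((norm (Y xs - Y (\<gamma> (t xs))))\<^sup>2 + (xs - \<gamma> (t xs)) \<bullet> (acc xs - acc (\<gamma> (t xs))))
        \<le> 2 * C * (L\<^sup>2 * (norm (dv xs))\<^sup>2 + L * (norm (dv xs))\<^sup>2)"
      using n3 n4 C by (intro mult_left_mono add_mono) auto
    also have "\<dots> = \<Lambda> * (C * (norm (dv xs))\<^sup>2)" unfolding \<Lambda>_def by (simp add: algebra_simps)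
    also have "\<dots> \<le> \<Lambda> * (4 * M + 1 + 2 * (\<kappa> * r\<^sup>2))"
    proof (rule mult_left_mono[OF _ Lam])
      \<comment> \<open>\<open>C\<close> depends on the jet, but this bound for C |dv|^2 comes from
        maximality and does not; that keeps \<beta> uniform.\<close>
      have "C * (norm (dv xs))\<^sup>2 \<le> 2 * M - \<beta> * t xs + \<kappa> * (t xs)\<^sup>2" using top uy0 uxs unfolding \<Phi>_def by linarith
      then show "C * (norm (dv xs))\<^sup>2 \<le> 4 * M + 1 + 2 * (\<kappa> * r\<^sup>2)" using bt bet(2) by linarith
    qed
    also have "\<dots> = \<Lambda> * (4 * M + 1) + 2 * \<kappa> * (\<Lambda> * r\<^sup>2)" by (simp add: algebra_simps)
    also have "\<dots> \<le> \<Lambda> * (4 * M + 1) + 2 * \<kappa> * (1 / 2)" using r(4) kap by (intro add_left_mono mult_left_mono) auto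
    finally have "0 \<le> - \<kappa> + \<Lambda> * (4 * M + 1)" using J by simp
    then show False unfolding \<kappa>_def using Lam by (simp add: algebra_simps)
  qed
qed

section \<open>Gradient bound and perturbation\<close>

definition proj_coords :: "('m::finite \<Rightarrow> 'n::finite) \<Rightarrow> real^'n \<Rightarrow> real^'m" where
  "proj_coords \<iota> x = (\<chi> k. x $ \<iota> k)"

definition embed_coords :: "('m::finite \<Rightarrow> 'n::finite) \<Rightarrow> real^'m \<Rightarrow> real^'n" where
  "embed_coords \<iota> \<xi> = (\<Sum>k\<in>UNIV. \<xi> $ k *\<^sub>R axis (\<iota> k) 1)"

lemma linear_proj_coords: "linear (proj_coords \<iota>)"
  unfolding proj_coords_def by (rule linearI) (auto simp: vec_eq_iff)

lemma embed_inner: "embed_coords \<iota> \<xi> \<bullet> x = \<xi> \<bullet> proj_coords \<iota> x"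
proof -
  have "embed_coords \<iota> \<xi> \<bullet> x = (\<Sum>k\<in>UNIV. \<xi> $ k * (axis (\<iota> k) 1 \<bullet> x))"
    unfolding embed_coords_def by (simp add: inner_sum_left)
  also have "\<dots> = \<xi> \<bullet> proj_coords \<iota> x" unfolding proj_coords_def inner_vec_def[of \<xi>]
    by (simp add: inner_commute[of "axis _ _"] inner_axis)
  finally show ?thesis .
qed

lemma proj_embed:
  assumes "inj \<iota>" shows "proj_coords \<iota> (embed_coords \<iota> \<xi>) = \<xi>"
proof -
  have "embed_coords \<iota> \<xi> $ \<iota> j = \<xi> $ j" for j
  proof -
    have "embed_coords \<iota> \<xi> $ \<iota> j = (\<Sum>k\<in>UNIV. if k = j then \<xi> $ k else 0)"
      unfolding embed_coords_def sum_component by (rule sum.cong) (use assms in \<open>auto simp: axis_def inj_eq\<close>)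
    then show ?thesis by simp
  qed
  then show ?thesis unfolding proj_coords_def by (simp add: vec_eq_iff)
qed

lemma norm_embed: "inj \<iota> \<Longrightarrow> norm (embed_coords \<iota> \<xi>) = norm \<xi>"
  by (simp add: norm_eq_sqrt_inner embed_inner proj_embed)

lemma norm_proj:
  assumes "inj \<iota>" shows "norm (proj_coords \<iota> x) \<le> norm x"
proof -
  have "(norm (proj_coords \<iota> x))\<^sup>2 = embed_coords \<iota> (proj_coords \<iota> x) \<bullet> x"
    unfolding embed_inner by (simp add: power2_norm_eq_inner)
  also have "\<dots> \<le> norm (proj_coords \<iota> x) * norm x"
    using norm_cauchy_schwarz[of "embed_coords \<iota> (proj_coords \<iota> x)" x] by (simp add: norm_embed[OF assms])
  finally show ?thesis by (cases "norm (proj_coords \<iota> x) = 0") (auto simp: power2_eq_square)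
qed

lemma vf_form_coords:
  assumes "inj \<iota>" shows "vf_form \<iota> \<tau> j x $ \<iota> k = (if j = k then 1 else 0)"
proof -
  have e: "(\<Sum>i\<in>- range \<iota>. \<tau> i j x *\<^sub>R axis i 1) $ \<iota> k = 0"
    unfolding sum_component by (rule sum.neutral) (auto simp: axis_def)
  show ?thesis unfolding vf_form_def vector_add_component e using assms by (auto simp: axis_def inj_eq)
qed

lemma proj_vf_comb:
  assumes "inj \<iota>" "\<And>j. X j x = vf_form \<iota> \<tau> j x"
  shows "proj_coords \<iota> (vf_comb X x \<xi>) = \<xi>"
  unfolding proj_coords_def vf_comb_def by (simp add: vec_eq_iff assms vf_form_coords if_distrib cong: if_cong)

text \<open>The components of the fields in the range of \<iota> are constants and have derivative
  0. Along an integral curve these coordinates thus move with constant velocity \<xi>, and functions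
  of them see the frame as Euclidean.\<close>

lemma proj_vf_acc:
  assumes "inj \<iota>" and form: "\<And>j x. X j x = vf_form \<iota> \<tau> j x" and DX: "\<And>j. (X j has_derivative DX j x) (at x)"
  shows "proj_coords \<iota> (vf_acc X DX x \<xi>) = 0"
proof -
  have "DX j x h $ \<iota> k = 0" for j h k
  proof -
    have "((\<lambda>y. X j y $ \<iota> k) has_derivative (\<lambda>h. DX j x h $ \<iota> k)) (at x)"
      by (rule bounded_linear.has_derivative[OF bounded_linear_vec_nth DX])
    moreover have "(\<lambda>y. X j y $ \<iota> k) = (\<lambda>y. if j = k then 1 else 0)"
      using form vf_form_coords[OF assms(1)] by auto
    ultimately have "((\<lambda>y. if j = k then 1 else 0 :: real) has_derivative (\<lambda>h. DX j x h $ \<iota> k)) (at x)" by simp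
    then have "(\<lambda>h. DX j x h $ \<iota> k) = (\<lambda>h. 0)" using has_derivative_unique has_derivative_const by blast
    then show ?thesis by metis
  qed
  then show ?thesis unfolding proj_coords_def vf_acc_def by (simp add: vec_eq_iff)
qed

lemma continuous_bounded_cball:
  fixes g :: "'a::euclidean_space \<Rightarrow> 'b::real_normed_vector"
  assumes "continuous_on UNIV g" shows "\<exists>b. \<forall>x\<in>cball 0 R. norm (g x) \<le> b"
proof -
  have "compact (g ` cball 0 R)" by (intro compact_continuous_image continuous_on_subset[OF assms]) auto
  then have "bounded (g ` cball 0 R)" by (rule compact_imp_bounded)
  then show ?thesis unfolding bounded_iff by auto
qed

lemma C2_compact_bounds:
  fixes f :: "'a::euclidean_space \<Rightarrow> 'a"
  assumes "C2_on UNIV f"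
  obtains f' C where "C \<ge> 0" "\<And>x. (f has_derivative blinfun_apply (f' x)) (at x)"
    "\<And>x. x \<in> cball 0 R \<Longrightarrow> norm (f x) \<le> C" "\<And>x. x \<in> cball 0 R \<Longrightarrow> norm (f' x) \<le> C"
    "\<And>x y. x \<in> cball 0 R \<Longrightarrow> y \<in> cball 0 R \<Longrightarrow> norm (f x - f y) \<le> C * norm (x - y)"
    "\<And>x y. x \<in> cball 0 R \<Longrightarrow> y \<in> cball 0 R \<Longrightarrow> norm (f' x - f' y) \<le> C * norm (x - y)"
proof -
  obtain f' f'' where f: "\<And>x. (f has_derivative blinfun_apply (f' x)) (at x)"
    and f': "\<And>x. (f' has_derivative blinfun_apply (f'' x)) (at x)" and c: "continuous_on UNIV f''"
    using assms unfolding C2_on_def by blast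
  have cf: "continuous_on UNIV f" "continuous_on UNIV f'"
    by (intro continuous_at_imp_continuous_on ballI has_derivative_continuous[OF f] has_derivative_continuous[OF f'])+
  obtain b0 b1 b2 where b: "\<And>x. x \<in> cball 0 R \<Longrightarrow> norm (f x) \<le> b0" "\<And>x. x \<in> cball 0 R \<Longrightarrow> norm (f' x) \<le> b1"
    "\<And>x. x \<in> cball 0 R \<Longrightarrow> norm (f'' x) \<le> b2"
    using continuous_bounded_cball[OF cf(1)] continuous_bounded_cball[OF cf(2)] continuous_bounded_cball[OF c] by metis
  define C where "C = max 0 (max b0 (max b1 b2))"
  have C: "0 \<le> C" "b0 \<le> C" "b1 \<le> C" "b2 \<le> C" unfolding C_def by auto
  show ?thesis
  proof (rule that[OF C(1) f])
    show "norm (f x) \<le> C" "norm (f' x) \<le> C" if "x \<in> cball 0 R" for x using b[OF that] C by linarith+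
    fix x y :: 'a assume xy: "x \<in> cball 0 R" "y \<in> cball 0 R"
    show "norm (f x - f y) \<le> C * norm (x - y)"
    proof (rule differentiable_bound[where S = "cball 0 R"])
      show "(f has_derivative blinfun_apply (f' x)) (at x within cball 0 R)" for x using f by (rule has_derivative_at_withinI)
      show "onorm (blinfun_apply (f' x)) \<le> C" if "x \<in> cball 0 R" for x using b(2)[OF that] C by (simp add: norm_blinfun.rep_eq)
    qed (use xy in auto)
    show "norm (f' x - f' y) \<le> C * norm (x - y)"
    proof (rule differentiable_bound[where S = "cball 0 R"])
      show "(f' has_derivative blinfun_apply (f'' x)) (at x within cball 0 R)" for x using f' by (rule has_derivative_at_withinI)
      show "onorm (blinfun_apply (f'' x)) \<le> C" if "x \<in> cball 0 R" for x using b(3)[OF that] C by (simp add: norm_blinfun.rep_eq)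
    qed (use xy in auto)
  qed
qed

lemma vf_bounds:
  fixes X :: "'m::finite \<Rightarrow> 'a::euclidean_space \<Rightarrow> 'a"
  assumes "\<And>j. C2_on UNIV (X j)"
  obtains DX B where "B \<ge> 0" "\<And>j x. (X j has_derivative DX j x) (at x)"
    "\<And>x \<xi>. x \<in> cball 0 R \<Longrightarrow> norm (vf_comb X x \<xi>) \<le> B * norm \<xi>"
    "\<And>x \<xi>. x \<in> cball 0 R \<Longrightarrow> norm (vf_acc X DX x \<xi>) \<le> B * (norm \<xi>)\<^sup>2"
    "\<And>x y \<xi>. x \<in> cball 0 R \<Longrightarrow> y \<in> cball 0 R \<Longrightarrow> norm (vf_comb X x \<xi> - vf_comb X y \<xi>) \<le> B * norm \<xi> * norm (x - y)"
    "\<And>x y \<xi>. x \<in> cball 0 R \<Longrightarrow> y \<in> cball 0 R \<Longrightarrow> norm (vf_acc X DX x \<xi> - vf_acc X DX y \<xi>) \<le> B * (norm \<xi>)\<^sup>2 * norm (x - y)"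
proof -
  have "\<exists>f' C. C \<ge> 0 \<and> (\<forall>x. (X j has_derivative blinfun_apply (f' x)) (at x)) \<and>
    (\<forall>x\<in>cball 0 R. norm (X j x) \<le> C \<and> norm (f' x) \<le> C) \<and>
    (\<forall>x\<in>cball 0 R. \<forall>y\<in>cball 0 R. norm (X j x - X j y) \<le> C * norm (x - y) \<and> norm (f' x - f' y) \<le> C * norm (x - y))" for j
    by (rule C2_compact_bounds[OF assms, of j R]) blast
  then obtain f' C where C: "\<And>j. C j \<ge> 0" and D: "\<And>j x. (X j has_derivative blinfun_apply (f' j x)) (at x)" and
    b: "\<And>j x. x\<in>cball 0 R \<Longrightarrow> norm (X j x) \<le> C j \<and> norm (f' j x) \<le> C j" and
    l: "\<And>j x y. x\<in>cball 0 R \<Longrightarrow> y\<in>cball 0 R \<Longrightarrow> norm (X j x - X j y) \<le> C j * norm (x - y) \<and> norm (f' j x - f' j y) \<le> C j * norm (x - y)"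
    by metis
  define K where "K = (\<Sum>j\<in>UNIV. C j)"
  have CK: "C j \<le> K" for j unfolding K_def by (rule member_le_sum) (use C in auto)
  have K: "K \<ge> 0" unfolding K_def using C by (simp add: sum_nonneg)
  define DX where "DX j x = blinfun_apply (f' j x)" for j x
  let ?m = "real CARD('m)"
  define B where "B = ?m * K + 2 * ?m\<^sup>2 * K\<^sup>2"
  have B1: "?m * K \<le> B" unfolding B_def by simp
  have B2: "2 * ?m\<^sup>2 * K\<^sup>2 \<le> B" unfolding B_def using K by simp
  have B0: "0 \<le> B" unfolding B_def using K by simp
  have bX: "norm (X j x) \<le> K" "norm (f' j x) \<le> K" if "x \<in> cball 0 R" for j x using b[OF that] CK order_trans by blast+
  have lX: "norm (X j x - X j y) \<le> K * norm (x - y)" "norm (f' j x - f' j y) \<le> K * norm (x - y)"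
    if "x \<in> cball 0 R" "y \<in> cball 0 R" for j x y
    using l[OF that, of j] mult_right_mono[OF CK[of j] norm_ge_zero[of "x - y"]] order_trans by blast+
  have comb: "norm (\<Sum>j\<in>UNIV. \<xi> $ j *\<^sub>R w j) \<le> ?m * c * norm \<xi>" if "\<And>j. norm (w j) \<le> c" "c \<ge> 0" for \<xi> :: "real^'m" and w :: "'m \<Rightarrow> 'a" and c
  proof -
    have "norm (\<Sum>j\<in>UNIV. \<xi> $ j *\<^sub>R w j) \<le> (\<Sum>j\<in>(UNIV::'m set). norm \<xi> * c)"
      by (rule sum_norm_le) (use that component_le_norm_cart[of \<xi>] in \<open>auto intro!: mult_mono\<close>)
    then show ?thesis by (simp add: mult_ac)
  qed
  have comb2: "norm (\<Sum>i\<in>UNIV. \<Sum>j\<in>UNIV. (\<xi> $ i * \<xi> $ j) *\<^sub>R w i j) \<le> ?m\<^sup>2 * c * (norm \<xi>)\<^sup>2" if "\<And>i j. norm (w i j) \<le> c" "c \<ge> 0"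
    for \<xi> :: "real^'m" and w :: "'m \<Rightarrow> 'm \<Rightarrow> 'a" and c
  proof -
    have "norm (\<Sum>i\<in>UNIV. \<Sum>j\<in>UNIV. (\<xi> $ i * \<xi> $ j) *\<^sub>R w i j) \<le> (\<Sum>i\<in>(UNIV::'m set). \<Sum>j\<in>(UNIV::'m set). (norm \<xi> * norm \<xi>) * c)"
    proof (intro sum_norm_le)
      fix i j
      have "\<bar>\<xi> $ i\<bar> * \<bar>\<xi> $ j\<bar> \<le> norm \<xi> * norm \<xi>" by (intro mult_mono component_le_norm_cart) auto
      then show "norm ((\<xi> $ i * \<xi> $ j) *\<^sub>R w i j) \<le> (norm \<xi> * norm \<xi>) * c"
        unfolding norm_scaleR abs_mult using that(2) by (intro mult_mono[OF _ that(1)]) auto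
    qed
    then show ?thesis by (simp add: power2_eq_square mult_ac)
  qed
  have wb: "norm (DX j x (X i x)) \<le> K\<^sup>2" if "x \<in> cball 0 R" for i j x
  proof -
    have "norm (DX j x (X i x)) \<le> norm (f' j x) * norm (X i x)" unfolding DX_def by (rule norm_blinfun)
    also have "\<dots> \<le> K * K" using bX[OF that] K by (intro mult_mono) auto
    finally show ?thesis by (simp add: power2_eq_square)
  qed
  have wl: "norm (DX j x (X i x) - DX j y (X i y)) \<le> 2 * K\<^sup>2 * norm (x - y)" if xy: "x \<in> cball 0 R" "y \<in> cball 0 R" for i j x y
  proof -
    have "DX j x (X i x) - DX j y (X i y) = blinfun_apply (f' j x - f' j y) (X i x) + blinfun_apply (f' j y) (X i x - X i y)"
      unfolding DX_def by (simp add: blinfun.diff_left blinfun.diff_right)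
    also have "norm \<dots> \<le> norm (f' j x - f' j y) * norm (X i x) + norm (f' j y) * norm (X i x - X i y)"
      by (intro order_trans[OF norm_triangle_ineq] add_mono norm_blinfun)
    also have "\<dots> \<le> (K * norm (x - y)) * K + K * (K * norm (x - y))"
      using bX[OF xy(1)] bX[OF xy(2)] lX[OF xy] K by (intro add_mono mult_mono) auto
    finally show ?thesis by (simp add: power2_eq_square algebra_simps)
  qed
  show ?thesis
  proof (rule that[of B DX])
    show "(X j has_derivative DX j x) (at x)" for j x unfolding DX_def by (rule D)
    fix x :: 'a and \<xi> :: "real^'m" assume x: "x \<in> cball 0 R"
    show "norm (vf_comb X x \<xi>) \<le> B * norm \<xi>"
      by (rule order_trans[OF _ mult_right_mono[OF B1]]) (auto simp: vf_comb_def intro!: comb bX x K)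
    show "norm (vf_acc X DX x \<xi>) \<le> B * (norm \<xi>)\<^sup>2"
    proof -
      have "norm (vf_acc X DX x \<xi>) \<le> ?m\<^sup>2 * K\<^sup>2 * (norm \<xi>)\<^sup>2" unfolding vf_acc_def by (rule comb2) (use wb[OF x] in auto)
      also have "\<dots> \<le> B * (norm \<xi>)\<^sup>2"
      proof (rule mult_right_mono)
        have "0 \<le> ?m\<^sup>2 * K\<^sup>2" by simp
        then show "?m\<^sup>2 * K\<^sup>2 \<le> B" using B2 by linarith
      qed simp
      finally show ?thesis .
    qed
    fix y :: 'a assume y: "y \<in> cball 0 R"
    show "norm (vf_comb X x \<xi> - vf_comb X y \<xi>) \<le> B * norm \<xi> * norm (x - y)"
    proof -
      have "vf_comb X x \<xi> - vf_comb X y \<xi> = (\<Sum>j\<in>UNIV. \<xi> $ j *\<^sub>R (X j x - X j y))"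
        unfolding vf_comb_def by (simp add: sum_subtractf scaleR_diff_right)
      also have "norm \<dots> \<le> ?m * (K * norm (x - y)) * norm \<xi>" by (rule comb) (use lX[OF x y] K in auto)
      also have "\<dots> = (?m * K) * (norm \<xi> * norm (x - y))" by simp
      also have "\<dots> \<le> B * (norm \<xi> * norm (x - y))" using B1 by (intro mult_right_mono) auto
      finally show ?thesis by simp
    qed
    show "norm (vf_acc X DX x \<xi> - vf_acc X DX y \<xi>) \<le> B * (norm \<xi>)\<^sup>2 * norm (x - y)"
    proof -
      have "vf_acc X DX x \<xi> - vf_acc X DX y \<xi> = (\<Sum>i\<in>UNIV. \<Sum>j\<in>UNIV. (\<xi> $ i * \<xi> $ j) *\<^sub>R (DX j x (X i x) - DX j y (X i y)))"
        unfolding vf_acc_def by (simp add: sum_subtractf scaleR_diff_right)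
      also have "norm \<dots> \<le> ?m\<^sup>2 * (2 * K\<^sup>2 * norm (x - y)) * (norm \<xi>)\<^sup>2" by (rule comb2) (use wl[OF x y] in auto)
      also have "\<dots> = (2 * ?m\<^sup>2 * K\<^sup>2) * ((norm \<xi>)\<^sup>2 * norm (x - y))" by simp
      also have "\<dots> \<le> B * ((norm \<xi>)\<^sup>2 * norm (x - y))" using B2 by (intro mult_right_mono) auto
      finally show ?thesis by simp
    qed
  qed (rule B0)
qed

lemma horizontal_gradient_inner:
  "\<xi> \<bullet> (\<chi> j. p \<bullet> X j x) = p \<bullet> vf_comb X x \<xi>"
  unfolding vf_comb_def inner_vec_def[of \<xi>] by (simp add: inner_sum_right)

text \<open>The length of the horizontal gradient q is the slope in the direction \<xi> = q / |q|.
  For unit vectors \<xi> the combined field meets the hypotheses of \<open>slope_bound\<close> with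
  constants independent of \<xi>.\<close>

theorem horizontal_gradient_bound:
  fixes X :: "'m::finite \<Rightarrow> real^'n \<Rightarrow> real^'n" and u :: "real^'n \<Rightarrow> real"
  assumes inj: "inj \<iota>" and form: "\<And>j x. X j x = vf_form \<iota> \<tau> j x" and DX: "\<And>j x. (X j has_derivative DX j x) (at x)"
    and B: "B \<ge> 0" and R: "closure \<Omega> \<subseteq> cball 0 R"
    and b: "\<And>x \<xi>. x \<in> cball 0 R \<Longrightarrow> norm (vf_comb X x \<xi>) \<le> B * norm \<xi>"
    and l: "\<And>x y \<xi>. x \<in> cball 0 R \<Longrightarrow> y \<in> cball 0 R \<Longrightarrow> norm (vf_comb X x \<xi> - vf_comb X y \<xi>) \<le> B * norm \<xi> * norm (x - y)"
    and la: "\<And>x y \<xi>. x \<in> cball 0 R \<Longrightarrow> y \<in> cball 0 R \<Longrightarrow> norm (vf_acc X DX x \<xi> - vf_acc X DX y \<xi>) \<le> B * (norm \<xi>)\<^sup>2 * norm (x - y)"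
    and u: "usc_on (closure \<Omega>) u" "\<And>x. x \<in> closure \<Omega> \<Longrightarrow> \<bar>u x\<bar> \<le> M"
    and conv: "vf_convex X \<Omega> u" and d: "d > 0"
  obtains R1 where "\<And>y p G. cball y d \<subseteq> \<Omega> \<Longrightarrow> quad_form G \<Longrightarrow> upper_jet (closure \<Omega>) u y p G \<Longrightarrow> norm (\<chi> j. p \<bullet> X j y) \<le> R1"
proof (cases "\<exists>y. cball y d \<subseteq> \<Omega>")
  case False
  then show ?thesis using that by blast
next
  case True
  have bd: "bounded \<Omega>" using R bounded_subset[OF bounded_cball] closure_subset by blast
  have bu: "bounded (u ` closure \<Omega>)" using u(2) unfolding bounded_iff by (metis image_iff real_norm_def)
  have M: "M \<ge> 0"
  proof -
    obtain y where "y \<in> closure \<Omega>" using True d closure_subset by (metis centre_in_cball less_imp_le subsetD)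
    then show ?thesis using u(2)[of y] by simp
  qed
  show ?thesis
  proof (rule slope_bound[where 'a = "real^'n", OF B B d M], goal_cases)
    case (1 \<beta>)
    note \<beta> = 1
  show ?thesis
  proof (rule that[of "max 0 \<beta>"])
    fix y p G assume y: "cball y d \<subseteq> \<Omega>" and G: "quad_form G" and jet: "upper_jet (closure \<Omega>) u y p G"
    define q :: "real^'m" where "q = (\<chi> j. p \<bullet> X j y)"
    have yZ: "cball y d \<subseteq> closure \<Omega>" using y closure_subset by blast
    have yR: "cball y d \<subseteq> cball 0 R" using yZ R by blast
    have yin: "y \<in> closure \<Omega>" using yZ d by (auto simp: subset_iff)
    show "norm (\<chi> j. p \<bullet> X j y) \<le> max 0 \<beta>"
    proof (cases "q = 0")
      case False
      define \<xi> where "\<xi> = (1 / norm q) *\<^sub>R q"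
      have n1: "norm \<xi> = 1" unfolding \<xi>_def using False by simp
      obtain N where N: "\<And>x. x \<in> closure \<Omega> \<Longrightarrow> u x \<le> u y + p \<bullet> (x - y) + G (x - y) / 2 + 1 * (norm (x - y))\<^sup>2 + N * (norm (x - y))^4"
        by (rule jet_global[OF jet G yin bounded_closure[OF bd] bu zero_less_one]) (rule that)
      obtain K where K: "K > 0" "\<And>h. \<bar>G h\<bar> \<le> K * (norm h)\<^sup>2" using quad_form_bound[OF G] by blast
      \<comment> \<open>On a bounded set the quartic term of \<open>jet_global\<close> is absorbed
        in a quadratic one.\<close>
      define N1 where "N1 = K + 1 + \<bar>N\<bar> * (2 * R)\<^sup>2"
      have N1: "u x \<le> u y + p \<bullet> (x - y) + N1 * (norm (x - y))\<^sup>2" if x: "x \<in> closure \<Omega>" for x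
      proof -
        have "norm (x - y) \<le> 2 * R" using R x yin norm_triangle_ineq4[of x y] by (auto simp: subset_iff) (smt (verit))
        then have "(norm (x - y))\<^sup>2 \<le> (2 * R)\<^sup>2" by (intro power_mono) auto
        then have "\<bar>N\<bar> * (norm (x - y))\<^sup>2 * (norm (x - y))\<^sup>2 \<le> \<bar>N\<bar> * (2 * R)\<^sup>2 * (norm (x - y))\<^sup>2"
          by (intro mult_right_mono mult_left_mono) auto
        moreover have "N * (norm (x - y))^4 \<le> \<bar>N\<bar> * (norm (x - y))\<^sup>2 * (norm (x - y))\<^sup>2"
        proof -
          have "N * (norm (x - y))^4 \<le> \<bar>N\<bar> * (norm (x - y))^4" by (intro mult_right_mono) auto
          then show ?thesis by (simp add: power4_eq_xxxx power2_eq_square mult_ac)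
        qed
        moreover have "G (x - y) / 2 \<le> K * (norm (x - y))\<^sup>2" using K(2)[of "x - y"] mult_nonneg_nonneg[OF less_imp_le[OF K(1)] zero_le_power2[of "norm (x - y)"]]
          by (simp add: abs_le_iff)
        ultimately show ?thesis using N[OF x] unfolding N1_def by (simp add: distrib_right)
      qed
      have "p \<bullet> vf_comb X y \<xi> \<le> \<beta>"
      proof (rule \<beta>[where Y = "\<lambda>x. vf_comb X x \<xi>" and ?y0.0 = y and N = N1 and p = p and acc = "\<lambda>x. vf_acc X DX x \<xi>" and DY = "\<lambda>x h. \<Sum>j\<in>UNIV. \<xi> $ j *\<^sub>R DX j x h" and e = "embed_coords \<iota> \<xi>" and Z = "closure \<Omega>" and u = u])
        show "B-lipschitz_on (cball y d) (\<lambda>x. vf_comb X x \<xi>)"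
          using l[of _ _ \<xi>] yR n1 B by (intro lipschitz_onI) (auto simp: dist_norm subset_iff)
        show "B-lipschitz_on (cball y d) (\<lambda>x. vf_acc X DX x \<xi>)"
          using la[of _ _ \<xi>] yR n1 B by (intro lipschitz_onI) (auto simp: dist_norm subset_iff)
        show "norm (embed_coords \<iota> \<xi>) = 1" using n1 norm_embed[OF inj] by simp
        show "embed_coords \<iota> \<xi> \<bullet> vf_comb X x \<xi> = 1" for x
          unfolding embed_inner proj_vf_comb[OF inj form] using n1 by (simp add: norm_eq_1)
        show "embed_coords \<iota> \<xi> \<bullet> vf_acc X DX x \<xi> = 0" for x
          unfolding embed_inner proj_vf_acc[OF inj form DX] by simp
        show "0 \<le> G (vf_comb X x \<xi>) + q \<bullet> vf_acc X DX x \<xi>" if "x \<in> ball y d" "quad_form G" "upper_jet (closure \<Omega>) u x q G" for x q G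
          by (rule vf_convex_jet[where X = X and DX = DX and x = x, OF conv _ bd bu DX that(2,3)]) (use that(1) y in \<open>auto simp: subset_iff\<close>)
        show "norm (vf_comb X x \<xi>) \<le> B \<and> ((\<lambda>x. vf_comb X x \<xi>) has_derivative (\<lambda>h. \<Sum>j\<in>UNIV. \<xi> $ j *\<^sub>R DX j x h)) (at x) \<and>
           vf_acc X DX x \<xi> = (\<Sum>j\<in>UNIV. \<xi> $ j *\<^sub>R DX j x (vf_comb X x \<xi>))" if x: "x \<in> cball y d" for x
        proof (intro conjI)
          show "norm (vf_comb X x \<xi>) \<le> B" using b[of x \<xi>] yR x n1 by auto
          show "((\<lambda>x. vf_comb X x \<xi>) has_derivative (\<lambda>h. \<Sum>j\<in>UNIV. \<xi> $ j *\<^sub>R DX j x h)) (at x)"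
            unfolding vf_comb_def by (intro has_derivative_sum has_derivative_scaleR_right DX)
          have lin: "linear (DX j x)" for j using has_derivative_linear[OF DX] .
          have "DX j x (vf_comb X x \<xi>) = (\<Sum>i\<in>UNIV. \<xi> $ i *\<^sub>R DX j x (X i x))" for j
            unfolding vf_comb_def by (simp add: linear_sum[OF lin] linear_cmul[OF lin])
          then have "(\<Sum>j\<in>UNIV. \<xi> $ j *\<^sub>R DX j x (vf_comb X x \<xi>)) = (\<Sum>j\<in>UNIV. \<Sum>i\<in>UNIV. (\<xi> $ i * \<xi> $ j) *\<^sub>R DX j x (X i x))"
            by (simp add: scaleR_sum_right mult.commute)
          also have "\<dots> = vf_acc X DX x \<xi>" unfolding vf_acc_def by (rule sum.swap)
          finally show "vf_acc X DX x \<xi> = (\<Sum>j\<in>UNIV. \<xi> $ j *\<^sub>R DX j x (vf_comb X x \<xi>))" ..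
        qed
      qed (use yZ u N1 in auto)
      moreover have "p \<bullet> vf_comb X y \<xi> = \<xi> \<bullet> q" unfolding q_def horizontal_gradient_inner ..
      moreover have "\<xi> \<bullet> q = norm q" unfolding \<xi>_def using False by (simp add: dot_square_norm power2_eq_square)
      ultimately show ?thesis unfolding q_def by simp
    qed (simp add: q_def)
  qed
  qed
qed

section \<open>The strict perturbation\<close>

lemma exp_quadratic_lower:
  fixes x :: real assumes "\<bar>x\<bar> \<le> 1" shows "1 + x + x\<^sup>2 / 2 - 2 * \<bar>x\<bar>^3 \<le> exp x"
proof -
  have e: "(\<Sum>i\<le>(2::nat). x ^ i / fact i) = 1 + x + x\<^sup>2 / 2" by (simp add: numeral_2_eq_2)
  have "norm (exp x - (\<Sum>i\<le>2. x ^ i / fact i)) \<le> exp (norm x) * (norm x ^ Suc 2) / fact 2" by (rule Taylor_exp_field)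
  then have A: "\<bar>exp x - (1 + x + x\<^sup>2 / 2)\<bar> \<le> exp \<bar>x\<bar> * \<bar>x\<bar>^3 / 2" unfolding e by (simp add: eval_nat_numeral)
  have "exp \<bar>x\<bar> \<le> exp 1" using assms by simp
  also have "exp 1 \<le> (4::real)" using exp_le by linarith
  finally have B: "exp \<bar>x\<bar> * \<bar>x\<bar>^3 \<le> 4 * \<bar>x\<bar>^3" by (intro mult_right_mono) auto
  show ?thesis using A B by linarith
qed

text \<open>The strictness of the perturbed subsolution comes from adding a small multiple of this function,
  whose Hessian along the fields beats its gradient once \<open>\<mu>\<close> is large.\<close>

definition pert :: "('m::finite \<Rightarrow> 'n::finite) \<Rightarrow> real \<Rightarrow> real^'n \<Rightarrow> real" where
  "pert \<iota> \<mu> x = exp (\<mu> * (norm (proj_coords \<iota> x))\<^sup>2 / 2)"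

definition pert_grad :: "('m::finite \<Rightarrow> 'n::finite) \<Rightarrow> real \<Rightarrow> real^'n \<Rightarrow> real^'n" where
  "pert_grad \<iota> \<mu> x = (pert \<iota> \<mu> x * \<mu>) *\<^sub>R embed_coords \<iota> (proj_coords \<iota> x)"

definition pert_hess :: "('m::finite \<Rightarrow> 'n::finite) \<Rightarrow> real \<Rightarrow> real^'n \<Rightarrow> real^'n \<Rightarrow> real" where
  "pert_hess \<iota> \<mu> x h = (pert \<iota> \<mu> x * \<mu>) * ((norm (proj_coords \<iota> h))\<^sup>2 + \<mu> * (proj_coords \<iota> x \<bullet> proj_coords \<iota> h)\<^sup>2)"

lemma quad_form_pert_hess: "quad_form (pert_hess \<iota> \<mu> x)"
  unfolding pert_hess_def
  by (intro quad_form_cmult quad_form_add quad_form_norm_compose linear_proj_coords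
      quad_form_compose[OF quad_form_inner_square linear_proj_coords])

text \<open>A lower expansion is what is wanted, because \<open>pert\<close> is subtracted when a
  jet of the perturbed function is turned into a jet of \<open>u\<close>.\<close>

lemma pert_lower_expansion:
  assumes inj: "inj \<iota>" and mu: "\<mu> \<ge> 0" and e: "e > 0"
  obtains d where "d > 0" "\<And>h. norm h < d \<Longrightarrow>
    pert \<iota> \<mu> y + pert_grad \<iota> \<mu> y \<bullet> h + pert_hess \<iota> \<mu> y h / 2 - e * (norm h)\<^sup>2 \<le> pert \<iota> \<mu> (y + h)"
proof -
  define g where "g = pert \<iota> \<mu> y"
  have g: "g > 0" unfolding g_def pert_def by simp
  define K where "K = \<mu> * (norm y + 1) + 1"
  have K: "K \<ge> 1" unfolding K_def using mu by simp
  define C where "C = \<mu>\<^sup>2 * norm y / 2 + 2 * K^3"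
  have C: "C \<ge> 0" unfolding C_def using K by simp
  define d where "d = min (1 / K) (e / (g * (C + 1)))"
  show ?thesis
  proof (rule that[of d])
    show "d > 0" unfolding d_def using K g C e by (simp add: add_nonneg_pos)
    fix h :: "real^'b" assume h: "norm h < d"
    define a where "a = proj_coords \<iota> y \<bullet> proj_coords \<iota> h"
    define b where "b = (norm (proj_coords \<iota> h))\<^sup>2"
    define \<delta> where "\<delta> = \<mu> * (a + b / 2)"
    have hK: "K * norm h \<le> 1" "norm h \<le> 1"
    proof -
      have "norm h \<le> 1 / K" using h unfolding d_def by simp
      then show 1: "K * norm h \<le> 1" using K by (simp add: field_simps)
      have "1 * norm h \<le> K * norm h" using K by (intro mult_right_mono) auto
      then show "norm h \<le> 1" using 1 by simp
    qed
    have a: "\<bar>a\<bar> \<le> norm y * norm h"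
      unfolding a_def by (rule order_trans[OF Cauchy_Schwarz_ineq2 mult_mono]) (use norm_proj[OF inj] in auto)
    have b: "0 \<le> b" "b \<le> (norm h)\<^sup>2" unfolding b_def using norm_proj[OF inj, of h] by (auto intro: power_mono)
    have b2: "b \<le> norm h" using b(2) hK mult_right_mono[OF hK(2), of "norm h"] by (simp add: power2_eq_square)
    have del: "\<bar>\<delta>\<bar> \<le> K * norm h"
    proof -
      have "\<bar>a + b / 2\<bar> \<le> (norm y + 1) * norm h" using a b b2 by (simp add: abs_le_iff distrib_right)
      then have "\<mu> * \<bar>a + b / 2\<bar> \<le> \<mu> * ((norm y + 1) * norm h)" using mu by (rule mult_left_mono)
      moreover have "\<bar>\<delta>\<bar> = \<mu> * \<bar>a + b / 2\<bar>" unfolding \<delta>_def using mu by (simp only: abs_mult abs_of_nonneg)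
      moreover have "K * norm h = \<mu> * ((norm y + 1) * norm h) + norm h" unfolding K_def by (simp add: algebra_simps)
      ultimately show ?thesis using norm_ge_zero[of h] by linarith
    qed
    have "\<bar>\<delta>\<bar>^3 \<le> (K * norm h)^3" using del by (intro power_mono) auto
    then have d3: "2 * \<bar>\<delta>\<bar>^3 \<le> 2 * K^3 * (norm h)^3" by (simp add: power_mult_distrib)
    have d2: "\<mu>\<^sup>2 * a\<^sup>2 / 2 - (\<mu>\<^sup>2 * norm y / 2) * (norm h)^3 \<le> \<delta>\<^sup>2 / 2"
    proof -
      have "- (a * b) \<le> \<bar>a\<bar> * b" using b by (simp add: abs_if mult_right_mono)
      also have "\<dots> \<le> (norm y * norm h) * (norm h)\<^sup>2" using a b by (intro mult_mono) auto
      finally have "- (a * b) \<le> norm y * (norm h)^3" by (simp add: power2_eq_square power3_eq_cube)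
      then have "\<mu>\<^sup>2 * (- (a * b)) \<le> \<mu>\<^sup>2 * (norm y * (norm h)^3)" by (intro mult_left_mono) auto
      moreover have "\<delta>\<^sup>2 = \<mu>\<^sup>2 * a\<^sup>2 + \<mu>\<^sup>2 * (a * b) + \<mu>\<^sup>2 * (b\<^sup>2 / 4)"
        unfolding \<delta>_def by (simp add: power2_eq_square field_simps)
      moreover have "0 \<le> \<mu>\<^sup>2 * (b\<^sup>2 / 4)" by simp
      moreover have "\<mu>\<^sup>2 * (- (a * b)) = - (\<mu>\<^sup>2 * (a * b))" "(\<mu>\<^sup>2 * norm y / 2) * (norm h)^3 = \<mu>\<^sup>2 * (norm y * (norm h)^3) / 2" by simp_all
      ultimately show ?thesis by linarith
    qed
    have pe: "pert \<iota> \<mu> (y + h) = g * exp \<delta>"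
    proof -
      have "(norm (proj_coords \<iota> (y + h)))\<^sup>2 = (norm (proj_coords \<iota> y))\<^sup>2 + 2 * a + b"
        unfolding linear_add[OF linear_proj_coords] a_def b_def power2_norm_eq_inner
        by (simp add: inner_add_left inner_add_right inner_commute)
      then have "\<mu> * (norm (proj_coords \<iota> (y + h)))\<^sup>2 / 2 = \<mu> * (norm (proj_coords \<iota> y))\<^sup>2 / 2 + \<delta>"
        unfolding \<delta>_def by (simp add: field_simps)
      then show ?thesis unfolding pert_def g_def by (simp only: exp_add)
    qed
    have "1 + \<delta> + \<mu>\<^sup>2 * a\<^sup>2 / 2 - C * (norm h)^3 \<le> exp \<delta>"
      using exp_quadratic_lower[of \<delta>] del hK d2 d3 unfolding C_def by (simp add: distrib_right)
    then have "g * (1 + \<delta> + \<mu>\<^sup>2 * a\<^sup>2 / 2 - C * (norm h)^3) \<le> g * exp \<delta>" using g by (intro mult_left_mono) auto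
    moreover have "g * (C * (norm h)^3) \<le> e * (norm h)\<^sup>2"
    proof -
      have P: "g * (C + 1) > 0" using g C by simp
      have "norm h \<le> e / (g * (C + 1))" using h unfolding d_def by simp
      then have "norm h * (g * (C + 1)) \<le> e" using pos_le_divide_eq[OF P] by blast
      moreover have "norm h * (g * (C + 1)) = g * C * norm h + g * norm h" by (simp add: algebra_simps)
      ultimately have "g * C * norm h \<le> e" using g norm_ge_zero[of h] mult_nonneg_nonneg[of g "norm h"] by linarith
      then have "(g * C * norm h) * (norm h)\<^sup>2 \<le> e * (norm h)\<^sup>2" by (intro mult_right_mono) auto
      then show ?thesis by (simp add: power2_eq_square power3_eq_cube mult_ac)
    qed
    moreover have "g * (1 + \<delta> + \<mu>\<^sup>2 * a\<^sup>2 / 2 - C * (norm h)^3) = g + pert_grad \<iota> \<mu> y \<bullet> h + pert_hess \<iota> \<mu> y h / 2 - g * (C * (norm h)^3)"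
      unfolding pert_grad_def pert_hess_def g_def[symmetric] \<delta>_def inner_scaleR_left embed_inner a_def[symmetric] b_def[symmetric]
      by (simp add: field_simps power2_eq_square)
    ultimately show "pert \<iota> \<mu> y + pert_grad \<iota> \<mu> y \<bullet> h + pert_hess \<iota> \<mu> y h / 2 - e * (norm h)\<^sup>2 \<le> pert \<iota> \<mu> (y + h)"
      unfolding pe g_def[symmetric] by linarith
  qed
qed

lemma pert_jet:
  assumes inj: "inj \<iota>" and mu: "\<mu> \<ge> 0" and eps: "\<epsilon> \<ge> 0" and G: "quad_form G"
    and jet: "upper_jet Z (\<lambda>x. u x + \<epsilon> * (pert \<iota> \<mu> x - c)) y p G"
  shows "upper_jet Z u y (p - \<epsilon> *\<^sub>R pert_grad \<iota> \<mu> y) (\<lambda>h. G h - \<epsilon> * pert_hess \<iota> \<mu> y h)"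
proof (rule upper_jetI_ball)
  fix e :: real assume e: "e > 0"
  obtain d1 where d1: "d1 > 0" "\<And>h. y + h \<in> Z \<Longrightarrow> norm h < d1 \<Longrightarrow>
     u (y + h) + \<epsilon> * (pert \<iota> \<mu> (y + h) - c) \<le> u y + \<epsilon> * (pert \<iota> \<mu> y - c) + p \<bullet> h + G h / 2 + (e / 2) * (norm h)\<^sup>2"
    using upper_jetD_ball[OF jet half_gt_zero[OF e] quad_form_0[OF G]] by blast
  define e2 where "e2 = e / (2 * (\<epsilon> + 1))"
  have e2: "e2 > 0" "\<epsilon> * e2 \<le> e / 2"
  proof -
    show "e2 > 0" unfolding e2_def using e eps by simp
    have "e2 * (2 * (\<epsilon> + 1)) = e" unfolding e2_def using eps by simp
    then show "\<epsilon> * e2 \<le> e / 2" using \<open>e2 > 0\<close> by (simp add: algebra_simps)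
  qed
  obtain d2 where d2: "d2 > 0" "\<And>h. norm h < d2 \<Longrightarrow>
    pert \<iota> \<mu> y + pert_grad \<iota> \<mu> y \<bullet> h + pert_hess \<iota> \<mu> y h / 2 - e2 * (norm h)\<^sup>2 \<le> pert \<iota> \<mu> (y + h)"
    by (rule pert_lower_expansion[OF inj mu e2(1), of y]) (rule that)
  have "u (y + h) \<le> u y + (p - \<epsilon> *\<^sub>R pert_grad \<iota> \<mu> y) \<bullet> h + (G h - \<epsilon> * pert_hess \<iota> \<mu> y h) / 2 + e * (norm h)\<^sup>2"
    if "y + h \<in> Z" "norm h < min d1 d2" for h
  proof -
    have "\<epsilon> * (pert \<iota> \<mu> y + pert_grad \<iota> \<mu> y \<bullet> h + pert_hess \<iota> \<mu> y h / 2 - e2 * (norm h)\<^sup>2) \<le> \<epsilon> * pert \<iota> \<mu> (y + h)"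
      using d2(2)[of h] that eps by (intro mult_left_mono) auto
    moreover have "\<epsilon> * e2 * (norm h)\<^sup>2 \<le> e / 2 * (norm h)\<^sup>2" using e2(2) by (intro mult_right_mono) auto
    ultimately show ?thesis using d1(2)[of h] that by (simp add: inner_diff_left field_simps)
  qed
  then show "\<exists>d>0. \<forall>h. y + h \<in> Z \<longrightarrow> norm h < d \<longrightarrow>
      u (y + h) \<le> u y + (p - \<epsilon> *\<^sub>R pert_grad \<iota> \<mu> y) \<bullet> h + (G h - \<epsilon> * pert_hess \<iota> \<mu> y h) / 2 + e * (norm h)\<^sup>2"
    using d1(1) d2(1) by (intro exI[of _ "min d1 d2"]) auto
qed

text \<open>\<open>det_root_le_trace\<close> for the identity plus \<mu> times the rank-one matrix
  of \<open>a\<close>; its trace excess is \<mu> |a|^2, so its determinant is at least 1 + \<mu>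
  |a|^2. Up to a factor this matrix is the Hessian of \<open>pert\<close> along the fields.\<close>

lemma rank_one_det_sum:
  fixes C :: "real^'m^'m" and a :: "real^'m"
  assumes mu: "\<mu> \<ge> 0" and C: "\<bar>det C\<bar> = 1"
  shows "CARD('m) * root CARD('m) (1 + \<mu> * (norm a)\<^sup>2) \<le> (\<Sum>k\<in>UNIV. (norm (column k C))\<^sup>2 + \<mu> * (a \<bullet> column k C)\<^sup>2)"
proof -
  define S :: "real^'m^'m" where "S = (\<chi> i j. (if i = j then 1 else 0) + \<mu> * (a $ i * a $ j))"
  have sym: "transpose S = S" unfolding S_def transpose_def by (auto simp: vec_eq_iff mult.commute)
  have form: "x \<bullet> (S *v x) = (norm x)\<^sup>2 + \<mu> * (a \<bullet> x)\<^sup>2" for x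
  proof -
    have "S *v x = x + (\<mu> * (a \<bullet> x)) *\<^sub>R a"
    proof (unfold vec_eq_iff, rule allI)
      fix i
      have "(S *v x) $ i = (\<Sum>j\<in>UNIV. (if j = i then x $ j else 0) + (\<mu> * a $ i) * (a $ j * x $ j))"
        unfolding S_def matrix_vector_mult_def vec_lambda_beta by (intro sum.cong) (auto simp: algebra_simps)
      also have "\<dots> = x $ i + (\<mu> * a $ i) * (a \<bullet> x)"
        unfolding sum.distrib sum_distrib_left[symmetric] by (simp add: inner_vec_def)
      finally show "(S *v x) $ i = (x + (\<mu> * (a \<bullet> x)) *\<^sub>R a) $ i" by simp
    qed
    then show ?thesis by (simp add: inner_add_right dot_square_norm inner_commute power2_eq_square)
  qed
  have ge: "x \<bullet> x \<le> x \<bullet> (S *v x)" for x unfolding form using mu by (simp add: power2_norm_eq_inner)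
  have psd: "0 \<le> x \<bullet> (S *v x)" for x using ge[of x] inner_ge_zero[of x] by linarith
  have "trace S = CARD('m) + \<mu> * (norm a)\<^sup>2"
    unfolding trace_def S_def by (simp add: sum.distrib power2_norm_eq_inner inner_vec_def sum_distrib_left)
  then have "1 + \<mu> * (norm a)\<^sup>2 \<le> det S" using det_ge_trace_excess[OF sym ge] by simp
  then have "root CARD('m) (1 + \<mu> * (norm a)\<^sup>2) \<le> root CARD('m) (det S)" by simp
  then have "CARD('m) * root CARD('m) (1 + \<mu> * (norm a)\<^sup>2) \<le> CARD('m) * root CARD('m) (det S)" by (intro mult_left_mono) auto
  also have "\<dots> \<le> (\<Sum>k\<in>UNIV. column k C \<bullet> (S *v column k C))" by (rule det_root_le_trace[OF sym psd C])
  finally show ?thesis unfolding form .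
qed

text \<open>The maxima decrease as \<kappa> doubles and are bounded below by a diagonal value, so
  consecutive differences become small. Such a difference bounds one eighth of the later \<kappa>
  |yh - zh|^2, whence \<eta>/8.\<close>

lemma doubling_parameter:
  fixes U V :: "'a::euclidean_space \<Rightarrow> real"
  assumes Z: "compact Z" "Z \<noteq> {}" and U: "usc_on Z U" and V: "usc_on Z V" and eta: "\<eta> > 0" and k0: "\<kappa>0 > 0"
  obtains \<kappa> yh zh where "\<kappa> \<ge> \<kappa>0" "yh \<in> Z" "zh \<in> Z" "\<kappa> * (norm (yh - zh))\<^sup>2 \<le> \<eta>"
    "\<And>y z. y \<in> Z \<Longrightarrow> z \<in> Z \<Longrightarrow> U y + V z - \<kappa> / 4 * (norm (y - z))\<^sup>2 \<le> U yh + V zh - \<kappa> / 4 * (norm (yh - zh))\<^sup>2"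
proof -
  define kp where "kp n = \<kappa>0 * 2 ^ n" for n :: nat
  define F where "F n q = U (fst q) + V (snd q) - kp n / 4 * (norm (fst q - snd q))\<^sup>2" for n q
  have "\<exists>q\<in>Z \<times> Z. \<forall>q'\<in>Z \<times> Z. F n q' \<le> F n q" for n
  proof -
    have "usc_on (Z \<times> Z) (\<lambda>q. U (fst q) + V (snd q) + (- (kp n / 4 * (norm (fst q - snd q))\<^sup>2)))"
      by (intro usc_on_add usc_on_compose[OF U] usc_on_compose[OF V] continuous_imp_usc_on continuous_intros) auto
    then have "usc_on (Z \<times> Z) (F n)" unfolding F_def by simp
    moreover have "Z \<times> Z \<noteq> {}" using Z(2) by auto
    ultimately obtain q where "q \<in> Z \<times> Z" "\<And>q'. q' \<in> Z \<times> Z \<Longrightarrow> F n q' \<le> F n q"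
      using usc_attains_sup[OF compact_Times[OF Z(1) Z(1)]] by blast
    then show ?thesis by blast
  qed
  then obtain q where q: "\<And>n. q n \<in> Z \<times> Z" "\<And>n q'. q' \<in> Z \<times> Z \<Longrightarrow> F n q' \<le> F n (q n)" by metis
  define m where "m n = F n (q n)" for n
  have kp: "kp n > 0" "kp n \<ge> \<kappa>0" "kp (Suc n) = 2 * kp n" for n unfolding kp_def using k0 by (auto simp: mult_le_cancel_left1)
  have step: "m (Suc n) + kp n / 4 * (norm (fst (q (Suc n)) - snd (q (Suc n))))\<^sup>2 \<le> m n" for n
  proof -
    have "F n (q (Suc n)) \<le> m n" unfolding m_def by (rule q(2)[OF q(1)])
    then show ?thesis unfolding m_def F_def kp(3) by (simp add: field_simps)
  qed
  have dec: "decseq m" by (rule decseq_SucI) (use step kp(1) in \<open>smt (verit) divide_nonneg_pos mult_nonneg_nonneg zero_le_power2\<close>)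
  obtain x0 where x0: "x0 \<in> Z" using Z(2) by blast
  have lb: "U x0 + V x0 \<le> m n" for n using q(2)[of "(x0, x0)" n] x0 unfolding m_def F_def by simp
  have lb': "\<forall>n. U x0 + V x0 \<le> m n" using lb by blast
  obtain l where "m \<longlonglongrightarrow> l" by (rule decseq_convergent[OF dec lb'])
  then have "(\<lambda>n. m n - m (Suc n)) \<longlonglongrightarrow> l - l" by (intro tendsto_diff LIMSEQ_Suc)
  then have T0: "(\<lambda>n. m n - m (Suc n)) \<longlonglongrightarrow> 0" by simp
  have "\<forall>\<^sub>F n in sequentially. m n - m (Suc n) < \<eta> / 8" by (rule order_tendstoD(2)[OF T0]) (use eta in simp)
  then obtain n where n: "m n - m (Suc n) < \<eta> / 8" by (auto simp: eventually_sequentially)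
  show ?thesis
  proof (rule that[of "kp (Suc n)" "fst (q (Suc n))" "snd (q (Suc n))"])
    show "kp (Suc n) * (norm (fst (q (Suc n)) - snd (q (Suc n))))\<^sup>2 \<le> \<eta>" using step[of n] n unfolding kp(3) by simp
    show "U y + V z - kp (Suc n) / 4 * (norm (y - z))\<^sup>2 \<le> U (fst (q (Suc n))) + V (snd (q (Suc n))) - kp (Suc n) / 4 * (norm (fst (q (Suc n)) - snd (q (Suc n))))\<^sup>2"
      if "y \<in> Z" "z \<in> Z" for y z using q(2)[of "(y, z)" "Suc n"] that unfolding F_def by simp
    show "\<kappa>0 \<le> kp (Suc n)" by (rule kp(2))
  qed (use q(1)[of "Suc n"] in \<open>auto simp: mem_Times_iff\<close>)
qed

section \<open>Comparison\<close>

text \<open>Removing the contribution of \<open>pert\<close> leaves a jet of \<open>u\<close>, to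
  which convexity, the gradient bound and the equation apply. Let g =
  \<open>pert \<iota> \<mu> y * \<mu>\<close> and a = \<open>proj_coords \<iota> y\<close>. In the
  last claim the gradient changes by \<epsilon> g |a|, which costs L \<epsilon> g |a| in the root of
  \<open>H\<close>, while the Hessian gains \<epsilon> g times the root of 1 + \<mu> |a|^2. By
  \<open>mu\<close> the net gain is at least \<epsilon> g / 2, and g is at least 1.\<close>

lemma perturbed_jet_inequality:
  fixes X :: "'m::finite \<Rightarrow> real^'n \<Rightarrow> real^'n" and u :: "real^'n \<Rightarrow> real" and H :: "real^'n \<Rightarrow> real \<Rightarrow> real^'m \<Rightarrow> real"
  assumes inj: "inj \<iota>" and form: "\<And>j x. X j x = vf_form \<iota> \<tau> j x" and DX: "\<And>j x. (X j has_derivative DX j x) (at x)"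
    and bd: "bounded \<Omega>" and bu: "bounded (u ` closure \<Omega>)" and conv: "vf_convex X \<Omega> u" and sub: "subsolution X \<Omega> H u"
    and Hmono: "\<And>x r s q. x \<in> closure \<Omega> \<Longrightarrow> r \<le> s \<Longrightarrow> H x r q \<le> H x s q"
    and HL: "\<And>x r q q1. x \<in> closure \<Omega> \<Longrightarrow> \<bar>r\<bar> \<le> R \<Longrightarrow> norm q \<le> R \<Longrightarrow> norm q1 \<le> 1 \<Longrightarrow>
          \<bar>root CARD('m) (H x r (q + q1)) - root CARD('m) (H x r q)\<bar> \<le> L * norm q1"
    and grad: "\<And>y p G. cball y d \<subseteq> \<Omega> \<Longrightarrow> quad_form G \<Longrightarrow> upper_jet (closure \<Omega>) u y p G \<Longrightarrow> norm (\<chi> j. p \<bullet> X j y) \<le> R1"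
    and R: "R1 + 1 \<le> R" and d: "d > 0" and y: "cball y d \<subseteq> \<Omega>"
    and mu: "\<mu> \<ge> 1" "L * norm (proj_coords \<iota> y) + 1 / 2 \<le> root CARD('m) (1 + \<mu> * (norm (proj_coords \<iota> y))\<^sup>2)"
    and L: "L \<ge> 0" and eps: "\<epsilon> \<ge> 0" "\<epsilon> * (pert \<iota> \<mu> y * \<mu> * norm (proj_coords \<iota> y)) \<le> 1"
    and G: "quad_form G" and jet: "upper_jet (closure \<Omega>) (\<lambda>x. u x + \<epsilon> * (pert \<iota> \<mu> x - c)) y q G"
  shows "\<epsilon> * (norm \<xi>)\<^sup>2 \<le> G (vf_comb X y \<xi>) + q \<bullet> vf_acc X DX y \<xi>"
    and "norm (\<chi> j. q \<bullet> X j y) \<le> R1 + 1"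
    and "\<bar>det C\<bar> = 1 \<Longrightarrow> \<bar>r\<bar> \<le> R \<Longrightarrow> r \<le> u y \<Longrightarrow> CARD('m) * (root CARD('m) (H y r (\<chi> j. q \<bullet> X j y)) + \<epsilon> / 2)
       \<le> (\<Sum>k\<in>UNIV. G (vf_comb X y (column k C)) + q \<bullet> vf_acc X DX y (column k C))"
proof -
  define g where "g = pert \<iota> \<mu> y * \<mu>"
  have g: "g \<ge> 1"
  proof -
    have "1 \<le> pert \<iota> \<mu> y" unfolding pert_def using mu(1) by simp
    then have "1 * 1 \<le> pert \<iota> \<mu> y * \<mu>" using mu(1) by (intro mult_mono) auto
    then show ?thesis unfolding g_def by simp
  qed
  let ?a = "proj_coords \<iota> y"
  have yO: "y \<in> \<Omega>" using y d by (auto simp: subset_iff)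
  have yZ: "y \<in> closure \<Omega>" using yO closure_subset by blast
  define q' where "q' = q - \<epsilon> *\<^sub>R pert_grad \<iota> \<mu> y"
  define G' where "G' h = G h - \<epsilon> * pert_hess \<iota> \<mu> y h" for h
  have mu0: "\<mu> \<ge> 0" using mu by simp
  have jet': "upper_jet (closure \<Omega>) u y q' G'" unfolding q'_def G'_def by (rule pert_jet[OF inj mu0 eps(1) G jet])
  have qG': "quad_form G'" unfolding G'_def by (intro quad_form_diff quad_form_cmult quad_form_pert_hess G)
  have pgc: "pert_grad \<iota> \<mu> y \<bullet> vf_comb X y \<xi> = g * (?a \<bullet> \<xi>)" for \<xi>
    unfolding pert_grad_def g_def by (simp add: embed_inner proj_vf_comb[OF inj form])
  \<comment> \<open>The gradient of \<open>pert\<close> is orthogonal to the acceleration, so only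
    its Hessian enters the form.\<close>
  have pga: "pert_grad \<iota> \<mu> y \<bullet> vf_acc X DX y \<xi> = 0" for \<xi>
    unfolding pert_grad_def by (simp add: embed_inner proj_vf_acc[OF inj form DX])
  have ph: "pert_hess \<iota> \<mu> y (vf_comb X y \<xi>) = g * ((norm \<xi>)\<^sup>2 + \<mu> * (?a \<bullet> \<xi>)\<^sup>2)" for \<xi>
    unfolding pert_hess_def g_def proj_vf_comb[OF inj form] ..
  have J: "G' (vf_comb X y \<xi>) + q' \<bullet> vf_acc X DX y \<xi>
     = G (vf_comb X y \<xi>) + q \<bullet> vf_acc X DX y \<xi> - \<epsilon> * (g * ((norm \<xi>)\<^sup>2 + \<mu> * (?a \<bullet> \<xi>)\<^sup>2))" for \<xi>
    unfolding G'_def q'_def ph by (simp add: inner_diff_left pga)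
  have psd: "0 \<le> G' (vf_comb X y \<xi>) + q' \<bullet> vf_acc X DX y \<xi>" for \<xi>
    by (rule vf_convex_jet[where X = X and DX = DX and x = y, OF conv yO bd bu DX qG' jet'])
  show "\<epsilon> * (norm \<xi>)\<^sup>2 \<le> G (vf_comb X y \<xi>) + q \<bullet> vf_acc X DX y \<xi>" for \<xi>
  proof -
    have "1 * ((norm \<xi>)\<^sup>2 + 0) \<le> g * ((norm \<xi>)\<^sup>2 + \<mu> * (?a \<bullet> \<xi>)\<^sup>2)" using g mu0 by (intro mult_mono add_left_mono) auto
    then have "\<epsilon> * (norm \<xi>)\<^sup>2 \<le> \<epsilon> * (g * ((norm \<xi>)\<^sup>2 + \<mu> * (?a \<bullet> \<xi>)\<^sup>2))" using eps(1) by (intro mult_left_mono) auto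
    then show ?thesis using psd[of \<xi>] unfolding J by linarith
  qed
  let ?q = "\<chi> j. q \<bullet> X j y" and ?q' = "\<chi> j. q' \<bullet> X j y" and ?v = "\<chi> j. pert_grad \<iota> \<mu> y \<bullet> X j y"
  have v: "?v = g *\<^sub>R ?a"
  proof -
    have "\<xi> \<bullet> ?v = \<xi> \<bullet> (g *\<^sub>R ?a)" for \<xi> unfolding horizontal_gradient_inner pgc by (simp add: inner_commute)
    then have "\<forall>\<xi>. \<xi> \<bullet> ?v = \<xi> \<bullet> (g *\<^sub>R ?a)" by blast
    then show ?thesis unfolding vector_eq_ldot .
  qed
  have nv: "norm ?v = g * norm ?a" unfolding v using g by simp
  have qq: "?q' = ?q + (- \<epsilon>) *\<^sub>R ?v" unfolding q'_def by (simp add: vec_eq_iff inner_diff_left)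
  have n1: "norm ((- \<epsilon>) *\<^sub>R ?v) \<le> 1" using eps unfolding norm_scaleR nv g_def by simp
  have nq': "norm ?q' \<le> R1" by (rule grad[OF y qG' jet'])
  have "norm ?q \<le> norm ?q' + norm ((- \<epsilon>) *\<^sub>R ?v)" unfolding qq using norm_triangle_ineq4[of "?q + (- \<epsilon>) *\<^sub>R ?v" "(- \<epsilon>) *\<^sub>R ?v"] by simp
  then show nq: "norm ?q \<le> R1 + 1" using nq' n1 by linarith
  assume C: "\<bar>det C\<bar> = 1" and r: "\<bar>r\<bar> \<le> R" "r \<le> u y"
  let ?J = "jet_matrix X DX y q' G'"
  let ?m = "real CARD('m)"
  have "H y r ?q' \<le> det ?J"
    using subsolution_jet[where X = X and DX = DX and x = y, OF sub yO bd bu DX qG' jet'] Hmono[OF yZ r(2), of ?q'] by linarith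
  then have f2: "root CARD('m) (H y r ?q') \<le> root CARD('m) (det ?J)" by simp
  have f1: "root CARD('m) (H y r ?q) - L * (\<epsilon> * (g * norm ?a)) \<le> root CARD('m) (H y r ?q')"
  proof -
    have "norm ?q \<le> R" using nq R by linarith
    from HL[OF yZ r(1) this n1]
    have "\<bar>root CARD('m) (H y r ?q') - root CARD('m) (H y r ?q)\<bar> \<le> L * norm ((- \<epsilon>) *\<^sub>R ?v)" unfolding qq .
    then show ?thesis using eps(1) unfolding norm_scaleR nv by simp
  qed
  have a1: "?m * (root CARD('m) (H y r ?q) - L * (\<epsilon> * (g * norm ?a))) \<le> ?m * root CARD('m) (det ?J)"
    by (rule mult_left_mono[OF order_trans[OF f1 f2]]) simp
  have a2: "?m * root CARD('m) (det ?J) \<le> (\<Sum>k\<in>UNIV. G' (vf_comb X y (column k C)) + q' \<bullet> vf_acc X DX y (column k C))"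
    using det_root_le_trace[OF jet_matrix_symmetric _ C, of X DX y q' G'] psd unfolding jet_matrix_form[OF qG'] by simp
  have "?m * (L * norm ?a + 1 / 2) \<le> ?m * root CARD('m) (1 + \<mu> * (norm ?a)\<^sup>2)" using mu(2) by (intro mult_left_mono) auto
  also have "\<dots> \<le> (\<Sum>k\<in>UNIV. (norm (column k C))\<^sup>2 + \<mu> * (?a \<bullet> column k C)\<^sup>2)" by (rule rank_one_det_sum[OF mu0 C])
  finally have "g * (?m * (L * norm ?a + 1 / 2)) \<le> g * (\<Sum>k\<in>UNIV. (norm (column k C))\<^sup>2 + \<mu> * (?a \<bullet> column k C)\<^sup>2)"
    using g by (intro mult_left_mono) auto
  moreover have "?m * (1 / 2) \<le> g * (?m * (1 / 2))" using g mult_right_mono[of 1 g "?m * (1/2)"] by simp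
  moreover have "g * (?m * (L * norm ?a + 1 / 2)) = ?m * (L * (g * norm ?a)) + g * (?m * (1 / 2))" by (simp add: algebra_simps)
  ultimately have "?m * (L * (g * norm ?a)) + ?m / 2 \<le> g * (\<Sum>k\<in>UNIV. (norm (column k C))\<^sup>2 + \<mu> * (?a \<bullet> column k C)\<^sup>2)"
    by linarith
  from mult_left_mono[OF this eps(1)]
  have a3: "?m * (L * (\<epsilon> * (g * norm ?a))) + ?m * (\<epsilon> / 2) \<le> \<epsilon> * (g * (\<Sum>k\<in>UNIV. (norm (column k C))\<^sup>2 + \<mu> * (?a \<bullet> column k C)\<^sup>2))"
    by (simp add: algebra_simps)
  have a4: "(\<Sum>k\<in>UNIV. G' (vf_comb X y (column k C)) + q' \<bullet> vf_acc X DX y (column k C))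
     = (\<Sum>k\<in>UNIV. G (vf_comb X y (column k C)) + q \<bullet> vf_acc X DX y (column k C))
       - \<epsilon> * (g * (\<Sum>k\<in>UNIV. (norm (column k C))\<^sup>2 + \<mu> * (?a \<bullet> column k C)\<^sup>2))"
    unfolding J by (simp only: sum_subtractf sum_distrib_left)
  have "?m * (root CARD('m) (H y r ?q) + \<epsilon> / 2) = ?m * (root CARD('m) (H y r ?q) - L * (\<epsilon> * (g * norm ?a)))
     + (?m * (L * (\<epsilon> * (g * norm ?a))) + ?m * (\<epsilon> / 2))" by (simp add: algebra_simps)
  then show "CARD('m) * (root CARD('m) (H y r ?q) + \<epsilon> / 2) \<le> (\<Sum>k\<in>UNIV. G (vf_comb X y (column k C)) + q \<bullet> vf_acc X DX y (column k C))"
    using a1 a2 a3 a4 by linarith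
qed

text \<open>For small s the 1 under the root suffices, as L s \<le> 1/2. For s > 1 / (2 (L + 1)) the
  factor 4 (L + 1)^2 makes up for s^2, and the power brings the root to at least L D + 1.\<close>

lemma perturbation_parameter:
  assumes L: "L \<ge> 0" and D: "D \<ge> 0" and m: "m > (0::nat)"
  obtains \<mu> where "\<mu> \<ge> 1" "\<And>s. 0 \<le> s \<Longrightarrow> s \<le> D \<Longrightarrow> L * s + 1 / 2 \<le> root m (1 + \<mu> * s\<^sup>2)"
proof (rule that[of "4 * (L + 1)\<^sup>2 * (L * D + 1) ^ m"])
  have p: "(L * D + 1) ^ m \<ge> 1" using L D by (intro one_le_power) simp
  have l: "(L + 1)\<^sup>2 \<ge> 1" using L by (intro one_le_power) simp
  let ?\<mu> = "4 * (L + 1)\<^sup>2 * (L * D + 1) ^ m"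
  have "1 * 1 \<le> (L + 1)\<^sup>2 * (L * D + 1) ^ m" using p l by (intro mult_mono) auto
  then show mu: "1 \<le> ?\<mu>" by simp
  fix s :: real assume s: "0 \<le> s" "s \<le> D"
  show "L * s + 1 / 2 \<le> root m (1 + ?\<mu> * s\<^sup>2)"
  proof (cases "s * (2 * (L + 1)) \<le> 1")
    case True
    then have "L * s \<le> 1 / 2" using s L by (simp add: algebra_simps)
    moreover have "1 \<le> root m (1 + ?\<mu> * s\<^sup>2)" using m mu s by (simp add: real_root_ge_1_iff)
    ultimately show ?thesis by linarith
  next
    case False
    then have "1\<^sup>2 \<le> (s * (2 * (L + 1)))\<^sup>2" by (intro power_mono) auto
    then have "1 * (L * D + 1) ^ m \<le> (s * (2 * (L + 1)))\<^sup>2 * (L * D + 1) ^ m" using p by (intro mult_right_mono) auto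
    also have "\<dots> = ?\<mu> * s\<^sup>2" by (simp add: power_mult_distrib power2_eq_square algebra_simps)
    finally have "(L * D + 1) ^ m \<le> 1 + ?\<mu> * s\<^sup>2" by simp
    then have "root m ((L * D + 1) ^ m) \<le> root m (1 + ?\<mu> * s\<^sup>2)" using m by simp
    moreover have "root m ((L * D + 1) ^ m) = L * D + 1" using m L D by (simp add: real_root_power_cancel)
    moreover have "L * s \<le> L * D" using s L by (intro mult_left_mono)
    ultimately show ?thesis by linarith
  qed
qed

text \<open>By semicontinuity the pairs with u y - v z \<ge> a form a compact set, disjoint from the
  diagonal over the frontier; \<rho> separates the two. If |y - z| \<le> \<rho>/4, both points are
  farther than \<rho>/4 from the frontier, and a ball that meets \<Omega> but not its frontier lies
  in \<Omega> by connectedness.\<close>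

lemma near_maximal_interior:
  fixes u v :: "real^'n \<Rightarrow> real"
  assumes "open \<Omega>" and bd: "bounded \<Omega>" and u: "usc_on (closure \<Omega>) u" and v: "usc_on (closure \<Omega>) (\<lambda>x. - v x)"
    and less: "\<And>z. z \<in> frontier \<Omega> \<Longrightarrow> u z - v z < a"
  obtains d where "d > 0" "\<And>y z. y \<in> closure \<Omega> \<Longrightarrow> z \<in> closure \<Omega> \<Longrightarrow> a \<le> u y - v z \<Longrightarrow> norm (y - z) \<le> d \<Longrightarrow>
     cball y d \<subseteq> \<Omega> \<and> cball z d \<subseteq> \<Omega>"
proof -
  let ?Z = "closure \<Omega>"
  have cZ: "compact ?Z" using bd by simp
  define P where "P = {q \<in> ?Z \<times> ?Z. a \<le> u (fst q) + (- v (snd q))}"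
  have "usc_on (?Z \<times> ?Z) (\<lambda>q. u (fst q) + (- v (snd q)))"
    by (intro usc_on_add usc_on_compose[OF u] usc_on_compose[OF v] continuous_intros) auto
  then have cP: "compact P" unfolding P_def by (intro usc_superlevel_compact compact_Times cZ)
  define D where "D = (\<lambda>z. (z, z)) ` frontier \<Omega>"
  have cD: "compact D" unfolding D_def
    by (intro compact_continuous_image continuous_intros) (use bd in \<open>simp add: compact_frontier_bounded\<close>)
  have "P \<inter> D = {}" unfolding P_def D_def using less by fastforce
  then obtain \<rho> where rho: "\<rho> > 0" "\<And>p q. p \<in> P \<Longrightarrow> q \<in> D \<Longrightarrow> \<rho> \<le> dist p q"
    using separate_compact_closed[OF cP compact_imp_closed[OF cD]] by metis
  have inside: "cball x (\<rho> / 4) \<subseteq> \<Omega>" if x: "x \<in> ?Z" and far: "\<And>z. z \<in> frontier \<Omega> \<Longrightarrow> \<rho> / 4 < dist x z" for x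
  proof (rule ccontr)
    assume n: "\<not> ?thesis"
    have "x \<in> \<Omega>"
    proof (rule ccontr)
      assume "x \<notin> \<Omega>"
      then have "x \<in> frontier \<Omega>" using x assms(1) unfolding frontier_def by (simp add: interior_open)
      then show False using far[of x] rho by simp
    qed
    then have "x \<in> cball x (\<rho> / 4) \<inter> \<Omega>" using rho by simp
    then have "cball x (\<rho> / 4) \<inter> \<Omega> \<noteq> {}" by blast
    moreover have "cball x (\<rho> / 4) - \<Omega> \<noteq> {}" using n by blast
    ultimately have "cball x (\<rho> / 4) \<inter> frontier \<Omega> \<noteq> {}"
      by (intro connected_Int_frontier convex_connected convex_cball)
    then show False using far by fastforce
  qed
  show ?thesis
  proof (rule that[of "\<rho> / 4"])
    show "\<rho> / 4 > 0" using rho by simp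
    fix y z assume yz: "y \<in> ?Z" "z \<in> ?Z" "a \<le> u y - v z" "norm (y - z) \<le> \<rho> / 4"
    have P: "(y, z) \<in> P" unfolding P_def using yz by simp
    have far: "\<rho> \<le> dist y w + dist z w" if "w \<in> frontier \<Omega>" for w
    proof -
      have "\<rho> \<le> dist (y, z) (w, w)" by (rule rho(2)[OF P]) (use that in \<open>auto simp: D_def\<close>)
      also have "\<dots> \<le> dist y w + dist z w" unfolding dist_Pair_Pair by (rule sqrt_sum_squares_le_sum) auto
      finally show ?thesis .
    qed
    have dyz: "dist y z \<le> \<rho> / 4" using yz(4) by (simp add: dist_norm)
    have "\<rho> / 4 < dist y w" "\<rho> / 4 < dist z w" if "w \<in> frontier \<Omega>" for w
      using far[OF that] dist_triangle[of y w z] dist_triangle[of z w y] dyz rho(1) unfolding dist_commute[of z y] by linarith+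
    then show "cball y (\<rho> / 4) \<subseteq> \<Omega> \<and> cball z (\<rho> / 4) \<subseteq> \<Omega>" using inside yz by blast
  qed
qed

text \<open>The right side is small in the doubling: for p = \<kappa> (yh - zh) / 2 and s close to
  |yh - zh|, both \<kappa> s^2 and |p| s are comparable to \<kappa> |yh - zh|^2, and r is chosen
  last.\<close>

lemma transport_error:
  fixes X :: "'m::finite \<Rightarrow> 'a::euclidean_space \<Rightarrow> 'a"
  assumes B: "B \<ge> 0" and k: "\<kappa> \<ge> 0"
    and a: "\<And>x \<xi>. x \<in> S \<Longrightarrow> norm (vf_acc X DX x \<xi>) \<le> B * (norm \<xi>)\<^sup>2"
    and l: "\<And>x y \<xi>. x \<in> S \<Longrightarrow> y \<in> S \<Longrightarrow> norm (vf_comb X x \<xi> - vf_comb X y \<xi>) \<le> B * norm \<xi> * norm (x - y)"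
    and la: "\<And>x y \<xi>. x \<in> S \<Longrightarrow> y \<in> S \<Longrightarrow> norm (vf_acc X DX x \<xi> - vf_acc X DX y \<xi>) \<le> B * (norm \<xi>)\<^sup>2 * norm (x - y)"
    and x: "x \<in> S" "z \<in> S" "norm (x - z) \<le> s" and q: "norm (q - p) \<le> r"
  shows "\<kappa> * (norm (vf_comb X z \<xi> - vf_comb X x \<xi>))\<^sup>2 + \<bar>q \<bullet> vf_acc X DX x \<xi> - p \<bullet> vf_acc X DX z \<xi>\<bar>
      \<le> (\<kappa> * (B * s)\<^sup>2 + r * B + norm p * B * s) * (norm \<xi>)\<^sup>2"
proof -
  have r: "r \<ge> 0" using q norm_ge_zero order_trans by blast
  have "norm (vf_comb X z \<xi> - vf_comb X x \<xi>) \<le> B * norm \<xi> * norm (x - z)" using l[OF x(2,1), of \<xi>] by (simp add: norm_minus_commute)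
  also have "\<dots> \<le> B * norm \<xi> * s" using x(3) B by (intro mult_left_mono) auto
  finally have "(norm (vf_comb X z \<xi> - vf_comb X x \<xi>))\<^sup>2 \<le> (B * norm \<xi> * s)\<^sup>2" by (intro power_mono) auto
  then have 1: "\<kappa> * (norm (vf_comb X z \<xi> - vf_comb X x \<xi>))\<^sup>2 \<le> \<kappa> * (B * norm \<xi> * s)\<^sup>2" using k by (intro mult_left_mono)
  have 2: "\<bar>(q - p) \<bullet> vf_acc X DX x \<xi>\<bar> \<le> r * (B * (norm \<xi>)\<^sup>2)"
    by (rule order_trans[OF Cauchy_Schwarz_ineq2]) (use a[OF x(1)] q r in \<open>intro mult_mono; simp\<close>)
  have "norm (vf_acc X DX x \<xi> - vf_acc X DX z \<xi>) \<le> B * (norm \<xi>)\<^sup>2 * s"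
    by (rule order_trans[OF la[OF x(1,2)] mult_left_mono[OF x(3)]]) (use B in simp)
  then have "\<bar>p \<bullet> (vf_acc X DX x \<xi> - vf_acc X DX z \<xi>)\<bar> \<le> norm p * (B * (norm \<xi>)\<^sup>2 * s)"
    by (intro order_trans[OF Cauchy_Schwarz_ineq2] mult_left_mono) auto
  moreover have "q \<bullet> vf_acc X DX x \<xi> - p \<bullet> vf_acc X DX z \<xi> = (q - p) \<bullet> vf_acc X DX x \<xi> + p \<bullet> (vf_acc X DX x \<xi> - vf_acc X DX z \<xi>)"
    by (simp add: inner_diff_left inner_diff_right)
  ultimately have "\<bar>q \<bullet> vf_acc X DX x \<xi> - p \<bullet> vf_acc X DX z \<xi>\<bar> \<le> r * (B * (norm \<xi>)\<^sup>2) + norm p * (B * (norm \<xi>)\<^sup>2 * s)"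
    using 2 by linarith
  moreover have "(\<kappa> * (B * s)\<^sup>2 + r * B + norm p * B * s) * (norm \<xi>)\<^sup>2
     = \<kappa> * (B * norm \<xi> * s)\<^sup>2 + (r * (B * (norm \<xi>)\<^sup>2) + norm p * (B * (norm \<xi>)\<^sup>2 * s))"
    by (simp add: power_mult_distrib algebra_simps)
  ultimately show ?thesis using 1 by linarith
qed

text \<open>The difference vector itself is inserted as \<xi>, and one factor of its norm is
  cancelled.\<close>

lemma horizontal_gradient_error:
  fixes X :: "'m::finite \<Rightarrow> 'a::euclidean_space \<Rightarrow> 'a"
  assumes B: "B \<ge> 0"
    and b: "\<And>x \<xi>. x \<in> S \<Longrightarrow> norm (vf_comb X x \<xi>) \<le> B * norm \<xi>"
    and l: "\<And>x y \<xi>. x \<in> S \<Longrightarrow> y \<in> S \<Longrightarrow> norm (vf_comb X x \<xi> - vf_comb X y \<xi>) \<le> B * norm \<xi> * norm (x - y)"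
    and x: "x \<in> S" "z \<in> S" "norm (x - z) \<le> s" and q: "norm (q - p) \<le> r"
  shows "norm ((\<chi> j. q \<bullet> X j x) - (\<chi> j. p \<bullet> X j z)) \<le> r * B + norm p * B * s"
proof -
  let ?w = "(\<chi> j. q \<bullet> X j x) - (\<chi> j. p \<bullet> X j z)"
  have r: "r \<ge> 0" using q norm_ge_zero order_trans by blast
  have 1: "\<bar>(q - p) \<bullet> vf_comb X x ?w\<bar> \<le> r * (B * norm ?w)"
    by (rule order_trans[OF Cauchy_Schwarz_ineq2]) (use b[OF x(1), of ?w] q r in \<open>intro mult_mono; simp\<close>)
  have "norm (vf_comb X x ?w - vf_comb X z ?w) \<le> B * norm ?w * s"
    by (rule order_trans[OF l[OF x(1,2)] mult_left_mono[OF x(3)]]) (use B in simp)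
  then have 2: "\<bar>p \<bullet> (vf_comb X x ?w - vf_comb X z ?w)\<bar> \<le> norm p * (B * norm ?w * s)"
    by (intro order_trans[OF Cauchy_Schwarz_ineq2] mult_left_mono) auto
  have "norm ?w * norm ?w = ?w \<bullet> ?w" by (simp add: dot_square_norm power2_eq_square)
  also have "\<dots> = q \<bullet> vf_comb X x ?w - p \<bullet> vf_comb X z ?w" by (simp only: inner_diff_right horizontal_gradient_inner)
  also have "\<dots> = (q - p) \<bullet> vf_comb X x ?w + p \<bullet> (vf_comb X x ?w - vf_comb X z ?w)" by (simp add: inner_diff_left inner_diff_right)
  also have "\<dots> \<le> (r * B + norm p * B * s) * norm ?w" using 1 2 by (simp add: algebra_simps)
  finally have sq: "norm ?w * norm ?w \<le> (r * B + norm p * B * s) * norm ?w" .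
  show ?thesis
  proof (cases "?w = 0")
    case True
    have "s \<ge> 0" using x(3) norm_ge_zero order_trans by blast
    then show ?thesis unfolding True using r B by simp
  next
    case False
    then show ?thesis using sq by (meson mult_right_le_imp_le zero_less_norm_iff)
  qed
qed

text \<open>The identity corrected by the change of frame. The correction is of order |x - z|, which
  makes the price \<kappa> |T h - h|^2 of the coupling in \<open>sup_conv_jet\<close> quadratic in
  the distance.\<close>

definition transport :: "('m::finite \<Rightarrow> 'n::finite) \<Rightarrow> ('m \<Rightarrow> real^'n \<Rightarrow> real^'n) \<Rightarrow> real^'n \<Rightarrow> real^'n \<Rightarrow> real^'n \<Rightarrow> real^'n" where
  "transport \<iota> X x z h = h + (vf_comb X z (proj_coords \<iota> h) - vf_comb X x (proj_coords \<iota> h))"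

lemma linear_transport: "linear (transport \<iota> X x z)"
proof -
  have "linear (\<lambda>h. vf_comb X y (proj_coords \<iota> h))" for y
    using linear_compose[OF linear_proj_coords linear_vf_comb] by (simp add: o_def)
  then show ?thesis unfolding transport_def by (intro linear_compose_add linear_compose_sub linear_ident)
qed

lemma transport_vf_comb:
  assumes "inj \<iota>" "\<And>j x. X j x = vf_form \<iota> \<tau> j x"
  shows "transport \<iota> X x z (vf_comb X x \<xi>) = vf_comb X z \<xi>"
  unfolding transport_def proj_vf_comb[OF assms] by simp

text \<open>With \<open>\<sigma>\<^sub>x \<xi> = vf_comb X x \<xi>\<close>, the linear map \<open>transport \<iota> X x z\<close> sends \<open>\<sigma>\<^sub>x \<xi>\<close> to \<open>\<sigma>\<^sub>z \<xi>\<close>, so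
  the jets at all the points involved are compared on the common vectors \<open>\<sigma>\<^sub>z \<xi>\<close>, at \<open>z = zh\<close>.\<close>

lemma doubled_maximum_contradiction:
  fixes X :: "'m::finite \<Rightarrow> real^'n \<Rightarrow> real^'n" and u v U :: "real^'n \<Rightarrow> real" and H :: "real^'n \<Rightarrow> real \<Rightarrow> real^'m \<Rightarrow> real"
  assumes U: "U = (\<lambda>x. u x + \<epsilon> * (pert \<iota> \<mu> x - c))" and inj: "inj \<iota>" and form: "\<And>j x. X j x = vf_form \<iota> \<tau> j x" and DX: "\<And>j x. (X j has_derivative DX j x) (at x)"
    and bd: "bounded \<Omega>" and bu: "bounded (u ` closure \<Omega>)" and bv: "bounded (v ` closure \<Omega>)"
    and conv: "vf_convex X \<Omega> u" and sub: "subsolution X \<Omega> H u" and sup: "supersolution X \<Omega> H v"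
    and Hmono: "\<And>x r s q. x \<in> closure \<Omega> \<Longrightarrow> r \<le> s \<Longrightarrow> H x r q \<le> H x s q"
    and HL: "\<And>x r q q1. x \<in> closure \<Omega> \<Longrightarrow> \<bar>r\<bar> \<le> R \<Longrightarrow> norm q \<le> R \<Longrightarrow> norm q1 \<le> 1 \<Longrightarrow>
          \<bar>root CARD('m) (H x r (q + q1)) - root CARD('m) (H x r q)\<bar> \<le> L * norm q1"
    and Hb: "\<And>x r q. x \<in> closure \<Omega> \<Longrightarrow> \<bar>r\<bar> \<le> R \<Longrightarrow> norm q \<le> R \<Longrightarrow> root CARD('m) (H x r q) \<le> Hb"
    and Hc: "\<And>x x' r q q'. x \<in> closure \<Omega> \<Longrightarrow> x' \<in> closure \<Omega> \<Longrightarrow> \<bar>r\<bar> \<le> R \<Longrightarrow> norm q \<le> R \<Longrightarrow> norm q' \<le> R \<Longrightarrow>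
          norm (x - x') \<le> \<delta> \<Longrightarrow> norm (q - q') \<le> \<delta> \<Longrightarrow> root CARD('m) (H x r q) \<le> root CARD('m) (H x' r q') + \<epsilon> / 8"
    and grad: "\<And>y p G. cball y d \<subseteq> \<Omega> \<Longrightarrow> quad_form G \<Longrightarrow> upper_jet (closure \<Omega>) u y p G \<Longrightarrow> norm (\<chi> j. p \<bullet> X j y) \<le> R1"
    and R: "R1 + 2 \<le> R" "\<And>x. x \<in> closure \<Omega> \<Longrightarrow> \<bar>v x\<bar> \<le> R" and d: "d > 0"
    and mu: "\<mu> \<ge> 1" "\<And>y. y \<in> closure \<Omega> \<Longrightarrow> L * norm (proj_coords \<iota> y) + 1 / 2 \<le> root CARD('m) (1 + \<mu> * (norm (proj_coords \<iota> y))\<^sup>2)"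
    and L: "L \<ge> 0" and eps: "\<epsilon> > 0" "\<And>y. y \<in> closure \<Omega> \<Longrightarrow> \<epsilon> * (pert \<iota> \<mu> y * \<mu> * norm (proj_coords \<iota> y)) \<le> 1"
    and uU: "usc_on (closure \<Omega>) (U)" and uV: "usc_on (closure \<Omega>) (\<lambda>x. - v x)"
    and B: "B \<ge> 0" and S: "closure \<Omega> \<subseteq> S"
    and b: "\<And>x \<xi>. x \<in> S \<Longrightarrow> norm (vf_comb X x \<xi>) \<le> B * norm \<xi>"
    and a: "\<And>x \<xi>. x \<in> S \<Longrightarrow> norm (vf_acc X DX x \<xi>) \<le> B * (norm \<xi>)\<^sup>2"
    and l: "\<And>x y \<xi>. x \<in> S \<Longrightarrow> y \<in> S \<Longrightarrow> norm (vf_comb X x \<xi> - vf_comb X y \<xi>) \<le> B * norm \<xi> * norm (x - y)"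
    and la: "\<And>x y \<xi>. x \<in> S \<Longrightarrow> y \<in> S \<Longrightarrow> norm (vf_acc X DX x \<xi> - vf_acc X DX y \<xi>) \<le> B * (norm \<xi>)\<^sup>2 * norm (x - y)"
    and k: "\<kappa> > 0" and yh: "yh \<in> closure \<Omega>" and zh: "zh \<in> closure \<Omega>"
    and max: "\<And>y z. y \<in> closure \<Omega> \<Longrightarrow> z \<in> closure \<Omega> \<Longrightarrow>
       U y + (- v z) - \<kappa> / 4 * (norm (y - z))\<^sup>2 \<le> U yh + (- v zh) - \<kappa> / 4 * (norm (yh - zh))\<^sup>2"
    and r: "r > 0" "norm (yh - zh) + r \<le> s"
    and e: "e = \<kappa> * (B * s)\<^sup>2 + r * B + norm ((\<kappa> / 2) *\<^sub>R (yh - zh)) * B * s"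
    and t: "2 * e + r * B\<^sup>2 \<le> t" "t \<le> \<epsilon> / 2" "t \<le> 1" "t \<le> \<delta>" "s + r \<le> \<delta>" "8 * t * Hb \<le> \<epsilon>\<^sup>2"
    and yad: "\<And>y. y \<in> closure \<Omega> \<Longrightarrow> norm (y - yh) \<le> r \<Longrightarrow> \<bar>U y - U yh\<bar> \<le> r \<Longrightarrow> cball y d \<subseteq> \<Omega>"
    and zad: "\<And>z. z \<in> closure \<Omega> \<Longrightarrow> norm (z - zh) \<le> r \<Longrightarrow> \<bar>v z - v zh\<bar> \<le> r \<Longrightarrow> cball z d \<subseteq> \<Omega>"
    and uv: "\<And>y z. y \<in> closure \<Omega> \<Longrightarrow> z \<in> closure \<Omega> \<Longrightarrow> \<bar>U y - U yh\<bar> \<le> r \<Longrightarrow> \<bar>v z - v zh\<bar> \<le> r \<Longrightarrow> v z \<le> u y"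
  shows False
proof -
  let ?Z = "closure \<Omega>" and ?m = "real CARD('m)" and ?s = "vf_comb X zh"
  define ph where "ph = (\<kappa> / 2) *\<^sub>R (yh - zh)"
  let ?a = "\<lambda>\<xi>. ph \<bullet> vf_acc X DX zh \<xi>"
  have cZ: "compact ?Z" using bd by simp
  have m: "?m > 0" by simp
  have s0: "s > 0" using r norm_ge_zero[of "yh - zh"] by linarith
  have e2: "r * B + norm ph * B * s \<le> e" unfolding e ph_def using k by simp
  have e0: "e \<ge> 0" using e2 r(1) B s0 by (smt (verit) mult_nonneg_nonneg norm_ge_zero)
  have rB: "r * B\<^sup>2 \<ge> 0" using r(1) by simp
  have t0: "t \<ge> 0" using t(1) e0 rB by linarith
  note zS = subsetD[OF S zh]
  have te: "\<kappa> * (norm (?s \<xi> - vf_comb X x \<xi>))\<^sup>2 + \<bar>q \<bullet> vf_acc X DX x \<xi> - ?a \<xi>\<bar> \<le> e * (norm \<xi>)\<^sup>2"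
    if "x \<in> S" "norm (x - zh) \<le> s" "norm (q - ph) \<le> r" for x q \<xi>
    unfolding e[folded ph_def] by (rule transport_error[OF B less_imp_le[OF k] a l la that(1) zS that(2,3)])
  show False
  proof (rule doubling_jets[OF cZ uU uV k yh zh max r(1), where 'm = 'm], goal_cases)
    case (1 y z) then show ?case by blast
  next
    case (2 y z) then show ?case by blast
  next
    case (3 A z p)
    note A = 3(1) and z = 3(2,3) and p = 3(5)[folded ph_def] and jz = 3(6) and key = 3(7)[folded ph_def]
    have vz: "\<bar>v z - v zh\<bar> \<le> r" using 3(4) by simp
    have zO: "cball z d \<subseteq> \<Omega>" by (rule zad[OF z vz])
    then have zin: "z \<in> \<Omega>" using d by (auto simp: subset_iff)
    have zs: "norm (z - zh) \<le> s" using z r norm_ge_zero[of "yh - zh"] by linarith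
    have rv: "\<bar>v z\<bar> \<le> R" by (rule R(2)[OF z(1)])
    define qv where "qv = (\<chi> j. p \<bullet> X j z)"
    \<comment> \<open>The Hessian form seen by \<open>v\<close> at \<open>z\<close>: on the frame at
      \<open>z\<close> it is \<open>A\<close> on the frame at \<open>zh\<close> minus the price of
      the coupling.\<close>
    define Gv where "Gv h = A (transport \<iota> X z zh h) - \<kappa> * (norm (transport \<iota> X z zh h - h))\<^sup>2" for h
    have qGv: "quad_form Gv" unfolding Gv_def
      by (intro quad_form_diff quad_form_cmult quad_form_compose[OF A] quad_form_norm_compose linear_compose_sub linear_transport linear_ident)
    have jv: "upper_jet ?Z (\<lambda>x. - v x) z (- p) (\<lambda>h. - Gv h)" using jz[OF linear_transport] unfolding Gv_def by simp
    have Jv: "A (?s \<xi>) + ?a \<xi> - e * (norm \<xi>)\<^sup>2 \<le> Gv (vf_comb X z \<xi>) + p \<bullet> vf_acc X DX z \<xi>" for \<xi>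
      using te[OF subsetD[OF S z(1)] zs p, of \<xi>]
      unfolding Gv_def transport_vf_comb[OF inj form] by linarith
    \<comment> \<open>What is known of every jet of \<open>U\<close> that \<open>key\<close> may
      present, expressed on the frame at \<open>zh\<close>.\<close>
    have adm: "\<epsilon> * (norm \<xi>)\<^sup>2 \<le> Q (?s \<xi>) + ?a \<xi> + e * (norm \<xi>)\<^sup>2 \<and> norm (\<chi> j. q \<bullet> X j y) \<le> R1 + 1 \<and> norm (qv - (\<chi> j. q \<bullet> X j y)) \<le> t \<and>
       norm (z - y) \<le> \<delta> \<and>
       (\<bar>det C\<bar> = 1 \<longrightarrow> ?m * (root CARD('m) (H y (v z) (\<chi> j. q \<bullet> X j y)) + \<epsilon> / 2) \<le> (\<Sum>k\<in>UNIV. Q (?s (column k C)) + ?a (column k C) + e * (norm (column k C))\<^sup>2))"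
      if y: "y \<in> ?Z" "norm (y - yh) \<le> r" "\<bar>U y - U yh\<bar> \<le> r" and q: "norm (q - ph) \<le> r" and Q: "quad_form Q"
       and jet: "\<And>T. linear T \<Longrightarrow> upper_jet ?Z U y q (\<lambda>h. Q (T h) + \<kappa> * (norm (T h - h))\<^sup>2)" for y q Q \<xi> C
    proof -
      have yO: "cball y d \<subseteq> \<Omega>" by (rule yad[OF y])
      have ys: "norm (y - zh) \<le> s" using norm_triangle_ineq[of "y - yh" "yh - zh"] y(2) r(2) by simp
      define G where "G h = Q (transport \<iota> X y zh h) + \<kappa> * (norm (transport \<iota> X y zh h - h))\<^sup>2" for h
      have qG: "quad_form G" unfolding G_def
        by (intro quad_form_add quad_form_cmult quad_form_compose[OF Q] quad_form_norm_compose linear_compose_sub linear_transport linear_ident)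
      have jG: "upper_jet ?Z (\<lambda>x. u x + \<epsilon> * (pert \<iota> \<mu> x - c)) y q G" using jet[OF linear_transport] unfolding G_def U .
      have J: "G (vf_comb X y \<xi>) + q \<bullet> vf_acc X DX y \<xi> \<le> Q (?s \<xi>) + ?a \<xi> + e * (norm \<xi>)\<^sup>2" for \<xi>
        using te[OF subsetD[OF S y(1)] ys q, of \<xi>]
        unfolding G_def transport_vf_comb[OF inj form] by linarith
      have R': "R1 + 1 \<le> R" using R(1) by simp
      have pj1: "\<epsilon> * (norm \<xi>)\<^sup>2 \<le> G (vf_comb X y \<xi>) + q \<bullet> vf_acc X DX y \<xi>" for \<xi>
        by (rule perturbed_jet_inequality(1)[OF inj form DX bd bu conv sub Hmono HL grad R' d yO mu(1) mu(2)[OF y(1)] L less_imp_le[OF eps(1)] eps(2)[OF y(1)] qG jG])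
      have pj2: "norm (\<chi> j. q \<bullet> X j y) \<le> R1 + 1"
        by (rule perturbed_jet_inequality(2)[OF inj form DX bd bu conv sub Hmono HL grad R' d yO mu(1) mu(2)[OF y(1)] L less_imp_le[OF eps(1)] eps(2)[OF y(1)] qG jG])
      have pj3: "?m * (root CARD('m) (H y (v z) (\<chi> j. q \<bullet> X j y)) + \<epsilon> / 2)
         \<le> (\<Sum>k\<in>UNIV. G (vf_comb X y (column k C)) + q \<bullet> vf_acc X DX y (column k C))" if C: "\<bar>det C\<bar> = 1"
        by (rule perturbed_jet_inequality(3)[OF inj form DX bd bu conv sub Hmono HL grad R' d yO mu(1) mu(2)[OF y(1)] L less_imp_le[OF eps(1)] eps(2)[OF y(1)] qG jG]) (use C rv uv[OF y(1) z(1) y(3) vz] in auto)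
      have "norm (qv - (\<chi> j. ph \<bullet> X j zh)) \<le> e" unfolding qv_def
        by (rule order_trans[OF horizontal_gradient_error[OF B b l subsetD[OF S z(1)] zS zs p] e2])
      moreover have "norm ((\<chi> j. q \<bullet> X j y) - (\<chi> j. ph \<bullet> X j zh)) \<le> e"
        by (rule order_trans[OF horizontal_gradient_error[OF B b l subsetD[OF S y(1)] zS ys q] e2])
      ultimately have qq: "norm (qv - (\<chi> j. q \<bullet> X j y)) \<le> t"
        using norm_triangle_ineq4[of "qv - (\<chi> j. ph \<bullet> X j zh)" "(\<chi> j. q \<bullet> X j y) - (\<chi> j. ph \<bullet> X j zh)"] t(1) rB by simp
      have "norm (z - y) \<le> norm (z - zh) + norm (y - zh)" using norm_triangle_ineq4[of "z - zh" "y - zh"] by simp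
      then have zy: "norm (z - y) \<le> \<delta>" using z(2) ys t(5) by linarith
      have tr: "?m * (root CARD('m) (H y (v z) (\<chi> j. q \<bullet> X j y)) + \<epsilon> / 2) \<le> (\<Sum>k\<in>UNIV. Q (?s (column k C)) + ?a (column k C) + e * (norm (column k C))\<^sup>2)"
        if C: "\<bar>det C\<bar> = 1"
        by (rule order_trans[OF pj3[OF C] sum_mono]) (rule J)
      show ?thesis using order_trans[OF pj1 J] pj2 qq zy tr by blast
    qed
    have nqv: "norm qv \<le> R"
    proof (rule ccontr)
      assume n: "\<not> norm qv \<le> R"
      \<comment> \<open>Zero directions turn \<open>key\<close> into an existence statement: if |qv|
        > R, no admissible jet of \<open>U\<close> exists, so \<open>key\<close> holds with the
        lower bound 1 and yields 1 \<le> 0.\<close>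
      have "(1::real) \<le> (\<Sum>k\<in>(UNIV::'m set). A ((\<lambda>k. 0) k)) + r * (\<Sum>k\<in>(UNIV::'m set). (norm ((\<lambda>k. 0::real^'n) k))\<^sup>2)"
      proof (rule key)
        fix y q Q assume "y \<in> ?Z" "norm (y - yh) \<le> r" "\<bar>U y - U yh\<bar> \<le> r" "norm (q - ph) \<le> r" "quad_form Q"
          "\<And>T. linear T \<Longrightarrow> upper_jet ?Z U y q (\<lambda>h. Q (T h) + \<kappa> * (norm (T h - h))\<^sup>2)"
        then have "norm (\<chi> j. q \<bullet> X j y) \<le> R1 + 1" "norm (qv - (\<chi> j. q \<bullet> X j y)) \<le> t" using adm by blast+
        then have "norm qv \<le> R" using norm_triangle_sub[of qv "\<chi> j. q \<bullet> X j y"] R(1) t(3) by linarith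
        then show "1 \<le> (\<Sum>k\<in>(UNIV::'m set). Q ((\<lambda>k. 0) k))" using n by simp
      qed
      then show False using quad_form_0[OF A] by simp
    qed
    have low: "\<epsilon> / 2 * (norm \<xi>)\<^sup>2 \<le> Gv (vf_comb X z \<xi>) + p \<bullet> vf_acc X DX z \<xi>" for \<xi>
    proof -
      \<comment> \<open>With all directions equal, \<open>key\<close> turns uniform convexity of the
        jets of \<open>U\<close> into coercivity of \<open>A\<close>.\<close>
      have "?m * (\<epsilon> * (norm \<xi>)\<^sup>2 - ?a \<xi> - e * (norm \<xi>)\<^sup>2) \<le> (\<Sum>k\<in>(UNIV::'m set). A ((\<lambda>k. ?s \<xi>) k)) + r * (\<Sum>k\<in>(UNIV::'m set). (norm ((\<lambda>k. ?s \<xi>) k))\<^sup>2)"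
      proof (rule key)
        fix y q Q assume "y \<in> ?Z" "norm (y - yh) \<le> r" "\<bar>U y - U yh\<bar> \<le> r" "norm (q - ph) \<le> r" "quad_form Q"
          "\<And>T. linear T \<Longrightarrow> upper_jet ?Z U y q (\<lambda>h. Q (T h) + \<kappa> * (norm (T h - h))\<^sup>2)"
        then have "\<epsilon> * (norm \<xi>)\<^sup>2 \<le> Q (?s \<xi>) + ?a \<xi> + e * (norm \<xi>)\<^sup>2" using adm by blast
        then have "\<epsilon> * (norm \<xi>)\<^sup>2 - ?a \<xi> - e * (norm \<xi>)\<^sup>2 \<le> Q (?s \<xi>)" by linarith
        then show "?m * (\<epsilon> * (norm \<xi>)\<^sup>2 - ?a \<xi> - e * (norm \<xi>)\<^sup>2) \<le> (\<Sum>k\<in>(UNIV::'m set). Q ((\<lambda>k. ?s \<xi>) k))" by simp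
      qed
      then have "?m * (\<epsilon> * (norm \<xi>)\<^sup>2 - ?a \<xi> - e * (norm \<xi>)\<^sup>2) \<le> ?m * (A (?s \<xi>) + r * (norm (?s \<xi>))\<^sup>2)"
        by (simp add: algebra_simps)
      then have "\<epsilon> * (norm \<xi>)\<^sup>2 - ?a \<xi> - e * (norm \<xi>)\<^sup>2 \<le> A (?s \<xi>) + r * (norm (?s \<xi>))\<^sup>2" using m mult_le_cancel_left_pos by blast
      moreover have "r * (norm (?s \<xi>))\<^sup>2 \<le> r * (B * norm \<xi>)\<^sup>2" using b[OF zS, of \<xi>] r(1) by (intro mult_left_mono power_mono) auto
      moreover have "(2 * e + r * B\<^sup>2) * (norm \<xi>)\<^sup>2 \<le> (\<epsilon> / 2) * (norm \<xi>)\<^sup>2" using t(1,2) by (intro mult_right_mono) auto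
      ultimately show ?thesis using Jv[of \<xi>] by (simp add: power_mult_distrib algebra_simps)
    qed
    let ?J = "jet_matrix X DX z p Gv"
    have e20: "\<epsilon> / 2 > 0" using eps by simp
    have sol: "det ?J \<le> H z (v z) qv" unfolding qv_def
      by (rule supersolution_jet[where X = X and DX = DX and x = z, OF sup zin bd bv DX qGv jv e20 low])
    define h0 where "h0 = root CARD('m) (H z (v z) qv)"
    have rho: "root CARD('m) (det ?J) \<le> h0" unfolding h0_def using sol by simp
    have h0: "h0 \<le> Hb" unfolding h0_def by (rule Hb[OF z(1) rv nqv])
    have pd: "0 < \<xi> \<bullet> (?J *v \<xi>)" if "\<xi> \<noteq> 0" for \<xi>
      unfolding jet_matrix_form[OF qGv] using low[of \<xi>] mult_pos_pos[OF e20, of "(norm \<xi>)\<^sup>2"] that by simp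
    \<comment> \<open>\<open>C\<close> is optimal for the matrix of \<open>v\<close>. The linear
      inequality for the jets of \<open>U\<close> is then used with the same \<open>C\<close>, so
      that both sides contain the same sum of values of \<open>A\<close>.\<close>
    obtain C where C: "\<bar>det C\<bar> = 1" "\<And>k. column k C \<bullet> (?J *v column k C) = root CARD('m) (det ?J)"
      using det_root_attained[OF jet_matrix_symmetric pd] by blast
    define N where "N = (\<Sum>k\<in>UNIV. (norm (column k C))\<^sup>2)"
    \<comment> \<open>Each column contributes at most \<open>Hb\<close>, so coercivity bounds the
      columns; this matters because the transport errors are multiplied by \<open>N\<close>.\<close>
    have N: "\<epsilon> / 2 * N \<le> ?m * Hb"
    proof -
      have "\<epsilon> / 2 * N \<le> (\<Sum>k\<in>(UNIV::'m set). Hb)" unfolding N_def sum_distrib_left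
      proof (rule sum_mono)
        fix k
        show "\<epsilon> / 2 * (norm (column k C))\<^sup>2 \<le> Hb" using low[of "column k C"] C(2)[of k] rho h0 unfolding jet_matrix_form[OF qGv] by linarith
      qed
      then show ?thesis by simp
    qed
    \<comment> \<open>The surplus 3 \<epsilon> / 8 is the strictness \<epsilon>/2 minus the
      \<epsilon>/8 for moving the arguments of \<open>H\<close> from z to y.\<close>
    have "?m * (h0 + 3 * \<epsilon> / 8) - (\<Sum>k\<in>UNIV. ?a (column k C)) - e * N
      \<le> (\<Sum>k\<in>UNIV. A ((\<lambda>k. ?s (column k C)) k)) + r * (\<Sum>k\<in>UNIV. (norm ((\<lambda>k. ?s (column k C)) k))\<^sup>2)"
    proof (rule key)
      fix y q Q assume y: "y \<in> ?Z" "norm (y - yh) \<le> r" "\<bar>U y - U yh\<bar> \<le> r" "norm (q - ph) \<le> r" "quad_form Q"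
          "\<And>T. linear T \<Longrightarrow> upper_jet ?Z U y q (\<lambda>h. Q (T h) + \<kappa> * (norm (T h - h))\<^sup>2)"
      let ?q = "\<chi> j. q \<bullet> X j y"
      have ad: "norm ?q \<le> R1 + 1" "norm (qv - ?q) \<le> t" "norm (z - y) \<le> \<delta>"
        "?m * (root CARD('m) (H y (v z) ?q) + \<epsilon> / 2) \<le> (\<Sum>k\<in>UNIV. Q (?s (column k C)) + ?a (column k C) + e * (norm (column k C))\<^sup>2)"
        using adm[OF y] C(1) by blast+
      have "norm ?q \<le> R" "norm (qv - ?q) \<le> \<delta>" using ad(1,2) R(1) t(4) by linarith+
      from Hc[OF z(1) y(1) rv nqv this(1) ad(3) this(2)]
      have "?m * (h0 + 3 * \<epsilon> / 8) \<le> ?m * (root CARD('m) (H y (v z) ?q) + \<epsilon> / 2)" unfolding h0_def by (intro mult_left_mono) auto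
      also note ad(4)
      also have "(\<Sum>k\<in>UNIV. Q (?s (column k C)) + ?a (column k C) + e * (norm (column k C))\<^sup>2)
         = (\<Sum>k\<in>UNIV. Q (?s (column k C))) + (\<Sum>k\<in>UNIV. ?a (column k C)) + e * N"
        unfolding N_def by (simp only: sum.distrib sum_distrib_left)
      finally show "?m * (h0 + 3 * \<epsilon> / 8) - (\<Sum>k\<in>UNIV. ?a (column k C)) - e * N \<le> (\<Sum>k\<in>UNIV. Q ((\<lambda>k. ?s (column k C)) k))" by simp
    qed
    then have c1: "?m * (h0 + 3 * \<epsilon> / 8) - (\<Sum>k\<in>UNIV. ?a (column k C)) - e * N
      \<le> (\<Sum>k\<in>UNIV. A (?s (column k C))) + r * (\<Sum>k\<in>UNIV. (norm (?s (column k C)))\<^sup>2)" .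
    have "(\<Sum>k\<in>UNIV. (norm (?s (column k C)))\<^sup>2) \<le> (\<Sum>k\<in>UNIV. B\<^sup>2 * (norm (column k C))\<^sup>2)"
      unfolding power_mult_distrib[symmetric] by (intro sum_mono power_mono b[OF zS]) auto
    then have "(\<Sum>k\<in>UNIV. (norm (?s (column k C)))\<^sup>2) \<le> B\<^sup>2 * N" unfolding N_def sum_distrib_left .
    then have c2: "r * (\<Sum>k\<in>UNIV. (norm (?s (column k C)))\<^sup>2) \<le> r * (B\<^sup>2 * N)" using r(1) by (intro mult_left_mono) auto
    have "(\<Sum>k\<in>UNIV. A (?s (column k C)) + ?a (column k C) - e * (norm (column k C))\<^sup>2) \<le> (\<Sum>k\<in>(UNIV::'m set). h0)"
    proof (rule sum_mono)
      fix k
      show "A (?s (column k C)) + ?a (column k C) - e * (norm (column k C))\<^sup>2 \<le> h0"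
        using Jv[of "column k C"] C(2)[of k] rho unfolding jet_matrix_form[OF qGv] by linarith
    qed
    moreover have "(\<Sum>k\<in>UNIV. A (?s (column k C)) + ?a (column k C) - e * (norm (column k C))\<^sup>2)
       = (\<Sum>k\<in>UNIV. A (?s (column k C))) + (\<Sum>k\<in>UNIV. ?a (column k C)) - e * N"
      unfolding N_def by (simp only: sum.distrib sum_subtractf sum_distrib_left)
    ultimately have c3: "(\<Sum>k\<in>UNIV. A (?s (column k C))) + (\<Sum>k\<in>UNIV. ?a (column k C)) - e * N \<le> ?m * h0" by simp
    have N0: "N \<ge> 0" unfolding N_def by (simp add: sum_nonneg)
    have c4: "(2 * e + r * B\<^sup>2) * N \<le> t * N" using t(1) N0 by (rule mult_right_mono)
    have "t * (\<epsilon> / 2 * N) \<le> t * (?m * Hb)" using N t0 by (rule mult_left_mono)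
    moreover have "?m * (8 * t * Hb) \<le> ?m * \<epsilon>\<^sup>2" using t(6) by (intro mult_left_mono) auto
    moreover have "\<epsilon> * (4 * (t * N)) = 8 * (t * (\<epsilon> / 2 * N))" "?m * (8 * t * Hb) = 8 * (t * (?m * Hb))" "?m * \<epsilon>\<^sup>2 = \<epsilon> * (?m * \<epsilon>)"
      by (simp_all add: power2_eq_square)
    ultimately have "\<epsilon> * (4 * (t * N)) \<le> \<epsilon> * (?m * \<epsilon>)" by linarith
    then have c5: "4 * (t * N) \<le> ?m * \<epsilon>" using eps(1) mult_le_cancel_left_pos by blast
    have c1': "?m * h0 + 3 * (?m * \<epsilon>) / 8 - (\<Sum>k\<in>UNIV. ?a (column k C)) - e * N
      \<le> (\<Sum>k\<in>UNIV. A (?s (column k C))) + r * (\<Sum>k\<in>UNIV. (norm (?s (column k C)))\<^sup>2)" using c1 by (simp add: algebra_simps)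
    have c4': "2 * (e * N) + r * (B\<^sup>2 * N) \<le> t * N" using c4 by (simp add: algebra_simps)
    have "?m * \<epsilon> > 0" using m eps(1) by (rule mult_pos_pos)
    \<comment> \<open>Strictness leaves 3/8 of m \<epsilon>, with m = \<open>CARD('m)\<close>, while
      all errors together are at most t N, hence at most m \<epsilon> / 4.\<close>
    then show False using c1' c2 c3 c4' c5 by linarith
  qed
qed

section \<open>Choice of the parameters and conclusion\<close>

lemma usc_on_max_const: "usc_on S f \<Longrightarrow> usc_on S (\<lambda>x. max (f x) c)"
  unfolding usc_on_def by auto

lemma small_multiplier:
  fixes a b \<theta> :: real
  assumes "a \<ge> 0" "b \<ge> 0" "\<theta> > 0"
  obtains \<epsilon> where "\<epsilon> > 0" "\<epsilon> * a \<le> \<theta>" "\<epsilon> * b \<le> 1"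
proof (rule that[of "min 1 \<theta> / (a + b + 1)"])
  have p: "a + b + 1 > 0" "min 1 \<theta> > 0" using assms by auto
  show "0 < min 1 \<theta> / (a + b + 1)" using p by (intro divide_pos_pos)
  have "min 1 \<theta> * a \<le> \<theta> * (a + b + 1)" "min 1 \<theta> * b \<le> 1 * (a + b + 1)" using assms by (intro mult_mono; simp)+
  then show "min 1 \<theta> / (a + b + 1) * a \<le> \<theta>" "min 1 \<theta> / (a + b + 1) * b \<le> 1" using p by (simp_all add: divide_le_eq)
qed

lemma root_uniform_bounds:
  fixes H :: "'a::euclidean_space \<Rightarrow> real \<Rightarrow> 'b::euclidean_space \<Rightarrow> real"
  assumes Z: "compact Z" and H: "continuous_on (Z \<times> UNIV \<times> UNIV) (\<lambda>(x, r, q). H x r q)" and e: "e > 0"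
  obtains C \<delta> where "C \<ge> 0" "\<delta> > 0" "\<And>x r q. x \<in> Z \<Longrightarrow> \<bar>r\<bar> \<le> R \<Longrightarrow> norm q \<le> R \<Longrightarrow> root m (H x r q) \<le> C"
    "\<And>x x' r q q'. x \<in> Z \<Longrightarrow> x' \<in> Z \<Longrightarrow> \<bar>r\<bar> \<le> R \<Longrightarrow> norm q \<le> R \<Longrightarrow> norm q' \<le> R \<Longrightarrow>
       norm (x - x') \<le> \<delta> \<Longrightarrow> norm (q - q') \<le> \<delta> \<Longrightarrow> root m (H x r q) \<le> root m (H x' r q') + e"
proof -
  define F where "F = (\<lambda>w. root m (case w of (x, r, q) \<Rightarrow> H x r q))"
  let ?K = "Z \<times> {-R..R} \<times> (cball 0 R :: 'b set)"
  have cK: "compact ?K" by (intro compact_Times Z) auto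
  have cF: "continuous_on ?K F" unfolding F_def by (intro continuous_on_real_root continuous_on_subset[OF H]) auto
  obtain C where C: "\<And>w. w \<in> ?K \<Longrightarrow> norm (F w) \<le> C"
    using compact_imp_bounded[OF compact_continuous_image[OF cF cK]] unfolding bounded_iff by auto
  obtain \<delta> where d: "\<delta> > 0" "\<And>w w'. w \<in> ?K \<Longrightarrow> w' \<in> ?K \<Longrightarrow> dist w' w < \<delta> \<Longrightarrow> dist (F w') (F w) < e"
    using compact_uniformly_continuous[OF cF cK] e unfolding uniformly_continuous_on_def by metis
  show ?thesis
  proof (rule that[of "max C 0" "\<delta> / 4"])
    show "\<delta> / 4 > 0" using d by simp
    show "root m (H x r q) \<le> max C 0" if "x \<in> Z" "\<bar>r\<bar> \<le> R" "norm q \<le> R" for x r and q :: 'b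
      using C[of "(x, r, q)"] that unfolding F_def by (auto simp: abs_le_iff)
    fix x x' r and q q' :: 'b assume a: "x \<in> Z" "x' \<in> Z" "\<bar>r\<bar> \<le> R" "norm q \<le> R" "norm q' \<le> R" "norm (x - x') \<le> \<delta> / 4" "norm (q - q') \<le> \<delta> / 4"
    have "dist (x, r, q) (x', r, q') \<le> dist x x' + dist q q'"
      unfolding dist_Pair_Pair by (rule order_trans[OF sqrt_sum_squares_le_sum]) auto
    also have "\<dots> < \<delta>" using a(6,7) d(1) by (simp add: dist_norm)
    finally have "dist (F (x, r, q)) (F (x', r, q')) < e" by (intro d(2)) (use a in \<open>auto simp: abs_le_iff\<close>)
    then show "root m (H x r q) \<le> root m (H x' r q') + e" unfolding F_def dist_real_def by simp
  qed simp
qed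

text \<open>At r = 0 both inequalities are the hypotheses, and their left sides are continuous in
  r.\<close>

lemma doubling_radius:
  fixes \<kappa> B l n t :: real
  assumes "2 * (\<kappa> * (B * l)\<^sup>2 + n * B * l) < t" "l < t"
  obtains r where "r > 0" "2 * (\<kappa> * (B * (l + r))\<^sup>2 + r * B + n * B * (l + r)) + r * B\<^sup>2 < t" "l + r + r < t"
proof -
  have "((\<lambda>r. 2 * (\<kappa> * (B * (l + r))\<^sup>2 + r * B + n * B * (l + r)) + r * B\<^sup>2) \<longlongrightarrow> 2 * (\<kappa> * (B * (l + 0))\<^sup>2 + 0 * B + n * B * (l + 0)) + 0 * B\<^sup>2) (at_right 0)"
    by (intro tendsto_intros)
  then have 1: "\<forall>\<^sub>F r in at_right 0. 2 * (\<kappa> * (B * (l + r))\<^sup>2 + r * B + n * B * (l + r)) + r * B\<^sup>2 < t"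
    by (rule order_tendstoD(2)) (use assms in simp)
  have "((\<lambda>r. l + r + r) \<longlongrightarrow> l + 0 + 0) (at_right 0)" by (intro tendsto_intros)
  then have 2: "\<forall>\<^sub>F r in at_right 0. l + r + r < t" by (rule order_tendstoD(2)) (use assms in simp)
  have 3: "\<forall>\<^sub>F r in at_right 0. r > (0::real)" by (rule eventually_at_right_less)
  show ?thesis using eventually_happens'[OF _ eventually_conj[OF 3 eventually_conj[OF 1 2]]] that by auto
qed

theorem theorem1p1:
  fixes \<Omega> :: "(real ^ 'n) set"
    and \<iota> :: "'m::finite \<Rightarrow> 'n"
    and \<tau> :: "'n \<Rightarrow> 'm \<Rightarrow> real ^ 'n \<Rightarrow> real"
    and X :: "'m \<Rightarrow> real ^ 'n \<Rightarrow> real ^ 'n"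
    and H :: "real ^ 'n \<Rightarrow> real \<Rightarrow> real ^ 'm \<Rightarrow> real"
    and u v :: "real ^ 'n \<Rightarrow> real"
  assumes "open \<Omega>" and "bounded \<Omega>" and "\<Omega> \<noteq> {}"
    and H_nonneg: "\<And>x r q. x \<in> closure \<Omega> \<Longrightarrow> 0 \<le> H x r q"
    and H_cont: "continuous_on (closure \<Omega> \<times> UNIV \<times> UNIV) (\<lambda>(x, r, q). H x r q)"
    and H_mono: "\<And>x r s q. x \<in> closure \<Omega> \<Longrightarrow> r \<le> s \<Longrightarrow> H x r q \<le> H x s q"
    and H_Lipschitz: "\<And>R. R > 0 \<Longrightarrow> \<exists>L. \<forall>x\<in>closure \<Omega>. \<forall>r q q1.
          \<bar>r\<bar> \<le> R \<longrightarrow> norm q \<le> R \<longrightarrow> norm q1 \<le> 1 \<longrightarrow>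
          \<bar>root CARD('m) (H x r (q + q1)) - root CARD('m) (H x r q)\<bar> \<le> L * norm q1"
    and "inj \<iota>"
    and X_C2: "\<And>j. C2_on UNIV (X j)"
    and X_form: "\<And>j x. X j x = vf_form \<iota> \<tau> j x"
    and "bounded (u ` closure \<Omega>)" and "vf_convex X \<Omega> u" and "subsolution X \<Omega> H u"
    and "bounded (v ` closure \<Omega>)" and "supersolution X \<Omega> H v"
  shows "\<exists>y\<in>frontier \<Omega>.
           (\<forall>z\<in>frontier \<Omega>. max (u z - v z) 0 \<le> max (u y - v y) 0) \<and>
           (SUP x\<in>\<Omega>. u x - v x) \<le> max (u y - v y) 0"
proof -
  let ?Z = "closure \<Omega>"
  have cZ: "compact ?Z" and Zne: "?Z \<noteq> {}" using assms(2,3) by auto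
  have uu: "usc_on ?Z u" using assms(13) unfolding subsolution_def by blast
  have uV: "usc_on ?Z (\<lambda>x. - v x)" using assms(15) unfolding supersolution_def by (blast intro: lsc_imp_usc_uminus)
  have uuv: "usc_on ?Z (\<lambda>x. u x + - v x)" by (rule usc_on_add[OF uu uV])
  have Fne: "frontier \<Omega> \<noteq> {}" using assms(2,3) frontier_eq_empty[of \<Omega>] not_bounded_UNIV by metis
  have FZ: "frontier \<Omega> \<subseteq> ?Z" unfolding frontier_def by blast
  have "usc_on (frontier \<Omega>) (\<lambda>x. max (u x + - v x) 0)" by (rule usc_on_max_const[OF usc_on_subset[OF uuv FZ]])
  then obtain y0 where y0: "y0 \<in> frontier \<Omega>" and "\<And>z. z \<in> frontier \<Omega> \<Longrightarrow> max (u z + - v z) 0 \<le> max (u y0 + - v y0) 0"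
    by (rule usc_attains_sup[OF compact_frontier_bounded[OF assms(2)] Fne]) blast
  then have y0m: "max (u z - v z) 0 \<le> max (u y0 - v y0) 0" if "z \<in> frontier \<Omega>" for z using that by simp
  define m0 where "m0 = max (u y0 - v y0) 0"
  have "(SUP x\<in>\<Omega>. u x - v x) \<le> m0"
  proof (rule ccontr)
    assume "\<not> ?thesis"
    then obtain x0 where x0: "x0 \<in> \<Omega>" "m0 < u x0 - v x0" using cSUP_least[OF assms(3)] by (meson not_le)
    obtain xm where xm: "xm \<in> ?Z" "\<And>x. x \<in> ?Z \<Longrightarrow> u x + - v x \<le> u xm + - v xm"
      using usc_attains_sup[OF cZ Zne uuv] by blast
    define S where "S = u xm - v xm"
    \<comment> \<open>Of the gap 4 \<theta> above \<open>m0\<close>, one \<theta> pays for replacing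
      \<open>u\<close> by \<open>U\<close> and one each for moving y and z near the doubled
      maximum.\<close>
    define \<theta> where "\<theta> = (S - m0) / 4"
    have th: "\<theta> > 0" using xm(2)[of x0] x0 closure_subset[of \<Omega>] unfolding \<theta>_def S_def by auto
    have m0: "m0 \<ge> 0" unfolding m0_def by simp
    have bl: "u z - v z < S - 2 * \<theta>" if "z \<in> frontier \<Omega>" for z using y0m[OF that] th unfolding m0_def[symmetric] \<theta>_def by (simp add: field_simps)
    obtain d where d: "d > 0" "\<And>y z. y \<in> ?Z \<Longrightarrow> z \<in> ?Z \<Longrightarrow> S - 2 * \<theta> \<le> u y - v z \<Longrightarrow> norm (y - z) \<le> d \<Longrightarrow> cball y d \<subseteq> \<Omega> \<and> cball z d \<subseteq> \<Omega>"
      by (rule near_maximal_interior[OF assms(1,2) uu uV bl]) auto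
    obtain Mu Mv where "\<And>x. x \<in> ?Z \<Longrightarrow> \<bar>u x\<bar> \<le> Mu" "\<And>x. x \<in> ?Z \<Longrightarrow> \<bar>v x\<bar> \<le> Mv"
      using assms(11,14) unfolding bounded_iff by auto
    note M = this
    obtain R0 where R0: "\<And>x. x \<in> ?Z \<Longrightarrow> norm x \<le> R0" using bounded_closure[OF assms(2)] unfolding bounded_iff by auto
    have ZR: "?Z \<subseteq> cball 0 R0" using R0 by auto
    have R00: "R0 \<ge> 0" using R0[OF xm(1)] norm_ge_zero order_trans by blast
    obtain DX B where B: "B \<ge> 0" and DX: "\<And>j x. (X j has_derivative DX j x) (at x)"
      and vb: "\<And>x \<xi>. x \<in> cball 0 R0 \<Longrightarrow> norm (vf_comb X x \<xi>) \<le> B * norm \<xi>"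
      and va: "\<And>x \<xi>. x \<in> cball 0 R0 \<Longrightarrow> norm (vf_acc X DX x \<xi>) \<le> B * (norm \<xi>)\<^sup>2"
      and vl: "\<And>x y \<xi>. x \<in> cball 0 R0 \<Longrightarrow> y \<in> cball 0 R0 \<Longrightarrow> norm (vf_comb X x \<xi> - vf_comb X y \<xi>) \<le> B * norm \<xi> * norm (x - y)"
      and vla: "\<And>x y \<xi>. x \<in> cball 0 R0 \<Longrightarrow> y \<in> cball 0 R0 \<Longrightarrow> norm (vf_acc X DX x \<xi> - vf_acc X DX y \<xi>) \<le> B * (norm \<xi>)\<^sup>2 * norm (x - y)"
    proof (rule vf_bounds[where X = X and R = R0, OF X_C2], goal_cases)
      case (1 DX B)
      show ?case by (rule that[of B DX]) (fact 1)+
    qed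
    obtain R1 where R1: "\<And>y p G. cball y d \<subseteq> \<Omega> \<Longrightarrow> quad_form G \<Longrightarrow> upper_jet ?Z u y p G \<Longrightarrow> norm (\<chi> j. p \<bullet> X j y) \<le> R1"
      by (rule horizontal_gradient_bound[OF assms(8) X_form DX B ZR vb vl vla uu M(1) assms(12) d(1)]) blast+
    define R where "R = max (max (R1 + 2) Mv) 1"
    have R: "R1 + 2 \<le> R" "Mv \<le> R" "R > 0" unfolding R_def by auto
    obtain L0 where L0: "\<forall>x\<in>?Z. \<forall>r q q1. \<bar>r\<bar> \<le> R \<longrightarrow> norm q \<le> R \<longrightarrow> norm q1 \<le> 1 \<longrightarrow>
          \<bar>root CARD('m) (H x r (q + q1)) - root CARD('m) (H x r q)\<bar> \<le> L0 * norm q1" using H_Lipschitz[OF R(3)] by blast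
    define L where "L = max L0 0"
    have L: "L \<ge> 0" "L0 \<le> L" unfolding L_def by auto
    have HL: "\<bar>root CARD('m) (H x r (q + q1)) - root CARD('m) (H x r q)\<bar> \<le> L * norm q1"
      if "x \<in> ?Z" "\<bar>r\<bar> \<le> R" "norm q \<le> R" "norm q1 \<le> 1" for x r q q1
      using L0 that mult_right_mono[OF L(2), of "norm q1"] by (meson norm_ge_zero order_trans)
    obtain \<mu> where mu: "\<mu> \<ge> 1" "\<And>s. 0 \<le> s \<Longrightarrow> s \<le> R0 \<Longrightarrow> L * s + 1 / 2 \<le> root CARD('m) (1 + \<mu> * s\<^sup>2)"
      by (rule perturbation_parameter[OF L(1) R00 zero_less_card_finite]) blast
    have np: "norm (proj_coords \<iota> y) \<le> R0" if "y \<in> ?Z" for y using norm_proj[OF assms(8), of y] R0[OF that] by linarith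
    \<comment> \<open>An upper bound of \<open>pert\<close> on the closure; subtracting it makes the
      perturbation nonpositive, so that U \<le> u.\<close>
    define c where "c = exp (\<mu> * R0\<^sup>2 / 2)"
    have c0: "c > 0" unfolding c_def by simp
    have pc: "pert \<iota> \<mu> y \<le> c" "0 < pert \<iota> \<mu> y" if "y \<in> ?Z" for y
      using np[OF that] mu(1) unfolding pert_def c_def by (auto intro!: mult_left_mono power_mono divide_right_mono)
    have muR: "\<mu> * R0 \<ge> 0" using mu(1) R00 by simp
    have cmu: "c * (\<mu> * R0) \<ge> 0" using c0 muR by simp
    obtain \<epsilon> where eps: "\<epsilon> > 0" "\<epsilon> * c \<le> \<theta>" "\<epsilon> * (c * (\<mu> * R0)) \<le> 1"
      by (rule small_multiplier[OF less_imp_le[OF c0] cmu th])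
    have eps2: "\<epsilon> * (pert \<iota> \<mu> y * \<mu> * norm (proj_coords \<iota> y)) \<le> 1" if y: "y \<in> ?Z" for y
    proof -
      have "pert \<iota> \<mu> y * (\<mu> * norm (proj_coords \<iota> y)) \<le> c * (\<mu> * R0)"
        using pc[OF y] np[OF y] mu(1) c0 by (intro mult_mono) auto
      then have "\<epsilon> * (pert \<iota> \<mu> y * (\<mu> * norm (proj_coords \<iota> y))) \<le> \<epsilon> * (c * (\<mu> * R0))" using eps(1) by (intro mult_left_mono) auto
      then show ?thesis using eps(3) by (simp only: mult.assoc)
    qed
    define U where "U = (\<lambda>x. u x + \<epsilon> * (pert \<iota> \<mu> x - c))"
    have Ub: "U x \<le> u x" "u x - \<theta> \<le> U x" if "x \<in> ?Z" for x
    proof -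
      have "\<epsilon> * (pert \<iota> \<mu> x - c) \<le> 0" using pc(1)[OF that] eps(1) by (simp add: mult_le_0_iff)
      moreover have "0 \<le> \<epsilon> * pert \<iota> \<mu> x" using pc(2)[OF that] eps(1) by simp
      ultimately show "U x \<le> u x" "u x - \<theta> \<le> U x" using eps(2) unfolding U_def by (simp_all add: algebra_simps)
    qed
    have "continuous_on ?Z (\<lambda>x. \<epsilon> * (pert \<iota> \<mu> x - c))" unfolding pert_def
      by (intro continuous_intros linear_continuous_on linear_conv_bounded_linear[THEN iffD1] linear_proj_coords) auto
    then have uU: "usc_on ?Z U" unfolding U_def by (intro usc_on_add[OF uu] continuous_imp_usc_on)
    have e8: "\<epsilon> / 8 > 0" using eps by simp
    obtain Hb \<delta> where Hb0: "Hb \<ge> 0" and del: "\<delta> > 0"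
      and Hb: "\<And>x r q. x \<in> ?Z \<Longrightarrow> \<bar>r\<bar> \<le> R \<Longrightarrow> norm q \<le> R \<Longrightarrow> root CARD('m) (H x r q) \<le> Hb"
      and Hc: "\<And>x x' r q q'. x \<in> ?Z \<Longrightarrow> x' \<in> ?Z \<Longrightarrow> \<bar>r\<bar> \<le> R \<Longrightarrow> norm q \<le> R \<Longrightarrow> norm q' \<le> R \<Longrightarrow>
          norm (x - x') \<le> \<delta> \<Longrightarrow> norm (q - q') \<le> \<delta> \<Longrightarrow> root CARD('m) (H x r q) \<le> root CARD('m) (H x' r q') + \<epsilon> / 8"
      using root_uniform_bounds[OF cZ H_cont e8, of R "CARD('m)"] by metis
    \<comment> \<open>The bound \<epsilon>/2 keeps coercivity, the second entry beats the size of
      the columns of \<open>C\<close>, 1 keeps the gradients below \<open>R\<close>, \<delta> serves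
      uniform continuity of the root of \<open>H\<close>, and d and \<theta> keep points and values
      near the doubled maximum.\<close>
    define t where "t = Min {\<epsilon> / 2, \<epsilon>\<^sup>2 / (8 * (Hb + 1)), 1, \<delta>, d, \<theta>}"
    have t: "t \<le> \<epsilon> / 2" "t \<le> \<epsilon>\<^sup>2 / (8 * (Hb + 1))" "t \<le> 1" "t \<le> \<delta>" "t \<le> d" "t \<le> \<theta>" unfolding t_def by (intro Min.coboundedI; simp)+
    have t0: "t > 0" unfolding t_def using eps(1) Hb0 del d(1) th by simp
    have t6: "8 * t * Hb \<le> \<epsilon>\<^sup>2"
    proof -
      have "t * (8 * (Hb + 1)) \<le> \<epsilon>\<^sup>2" using t(2) Hb0 by (simp add: le_divide_eq)
      then show ?thesis using t0 by (simp add: algebra_simps)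
    qed
    \<comment> \<open>At r = 0 twice the transport error is \<kappa> |yh - zh|^2 times 2 B^2 + B;
      this \<eta> brings it below \<open>t\<close>.\<close>
    define \<eta> where "\<eta> = t / (2 * (2 * B\<^sup>2 + B + 1))"
    have BB: "2 * B\<^sup>2 + B + 1 > 0" using B by (simp add: add_nonneg_pos)
    have eta0: "\<eta> > 0" unfolding \<eta>_def using t0 BB by simp
    have etaB: "\<eta> * (2 * B\<^sup>2 + B) < t"
    proof -
      have "\<eta> * (2 * (2 * B\<^sup>2 + B + 1)) = t" unfolding \<eta>_def using BB by simp
      moreover have "0 \<le> \<eta> * (2 * B\<^sup>2 + B)" using eta0 B by simp
      ultimately show ?thesis using eta0 by (simp add: algebra_simps)
    qed
    \<comment> \<open>The lower bound 4 \<eta> / t^2 for \<kappa> turns \<kappa> |yh - zh|^2 \<le>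
      \<eta> into |yh - zh| < t.\<close>
    have k00: "4 * \<eta> / t\<^sup>2 > 0" using eta0 t0 by simp
    obtain \<kappa> yh zh where k: "4 * \<eta> / t\<^sup>2 \<le> \<kappa>" and yh: "yh \<in> ?Z" and zh: "zh \<in> ?Z" and kl: "\<kappa> * (norm (yh - zh))\<^sup>2 \<le> \<eta>"
      and max: "\<And>y z. y \<in> ?Z \<Longrightarrow> z \<in> ?Z \<Longrightarrow> U y + - v z - \<kappa> / 4 * (norm (y - z))\<^sup>2 \<le> U yh + - v zh - \<kappa> / 4 * (norm (yh - zh))\<^sup>2"
      using doubling_parameter[OF cZ Zne uU uV eta0 k00] by metis
    have k0: "\<kappa> > 0" using k k00 by linarith
    define l where "l = norm (yh - zh)"
    have l0: "l \<ge> 0" unfolding l_def by simp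
    have "l < t"
    proof (rule ccontr)
      assume "\<not> l < t"
      then have "t\<^sup>2 \<le> l\<^sup>2" using t0 by (intro power_mono) auto
      then have "(4 * \<eta> / t\<^sup>2) * t\<^sup>2 \<le> \<kappa> * l\<^sup>2" using k k0 by (intro mult_mono) auto
      then show False using kl eta0 t0 unfolding l_def by simp
    qed
    moreover have "2 * (\<kappa> * (B * l)\<^sup>2 + \<kappa> / 2 * l * B * l) < t"
    proof -
      have "2 * (\<kappa> * (B * l)\<^sup>2 + \<kappa> / 2 * l * B * l) = (\<kappa> * l\<^sup>2) * (2 * B\<^sup>2 + B)" by (simp add: power2_eq_square algebra_simps)
      also have "\<dots> \<le> \<eta> * (2 * B\<^sup>2 + B)" using kl B unfolding l_def by (intro mult_right_mono) auto
      also note etaB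
      finally show ?thesis .
    qed
    ultimately obtain r where r: "r > 0" "2 * (\<kappa> * (B * (l + r))\<^sup>2 + r * B + \<kappa> / 2 * l * B * (l + r)) + r * B\<^sup>2 < t" "l + r + r < t"
      using doubling_radius by metis
    define e where "e = \<kappa> * (B * (l + r))\<^sup>2 + r * B + norm ((\<kappa> / 2) *\<^sub>R (yh - zh)) * B * (l + r)"
    have e: "2 * e + r * B\<^sup>2 \<le> t" using r(2) k0 unfolding e_def l_def by simp
    have rth: "r \<le> \<theta>" using r(1,3) l0 t(6) by linarith
    have top: "S - \<theta> \<le> U yh - v zh"
    proof -
      have "0 \<le> \<kappa> / 4 * (norm (yh - zh))\<^sup>2" using k0 by simp
      then show ?thesis using max[OF xm(1) xm(1)] Ub(2)[OF xm(1)] unfolding S_def by simp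
    qed
    have yad: "cball y d \<subseteq> \<Omega>" if y: "y \<in> ?Z" "norm (y - yh) \<le> r" "\<bar>U y - U yh\<bar> \<le> r" for y
    proof -
      have "S - 2 * \<theta> \<le> u y - v zh" using Ub(1)[OF y(1)] y(3) rth top by linarith
      moreover have "norm (y - zh) \<le> d" using norm_triangle_ineq[of "y - yh" "yh - zh"] y(2) r(1,3) t(5) unfolding l_def by simp
      ultimately show ?thesis using d(2)[OF y(1) zh] by blast
    qed
    have zad: "cball z d \<subseteq> \<Omega>" if z: "z \<in> ?Z" "norm (z - zh) \<le> r" "\<bar>v z - v zh\<bar> \<le> r" for z
    proof -
      have "S - 2 * \<theta> \<le> u yh - v z" using Ub(1)[OF yh] z(3) rth top by linarith
      moreover have "norm (yh - z) \<le> d" using norm_triangle_ineq4[of "yh - zh" "z - zh"] z(2) r(1,3) t(5) unfolding l_def by simp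
      ultimately show ?thesis using d(2)[OF yh z(1)] by blast
    qed
    \<comment> \<open>Here the positive part in the claim enters: m0 \<ge> 0 gives v z \<le> u y, so
      that monotonicity of \<open>H\<close> in its second argument applies.\<close>
    have vu: "v z \<le> u y" if "y \<in> ?Z" "z \<in> ?Z" "\<bar>U y - U yh\<bar> \<le> r" "\<bar>v z - v zh\<bar> \<le> r" for y z
    proof -
      have "S = m0 + 4 * \<theta>" unfolding \<theta>_def by (simp add: field_simps)
      then show ?thesis using Ub(1)[OF that(1)] that(3,4) rth top m0 th by linarith
    qed
    have vR: "\<bar>v x\<bar> \<le> R" if "x \<in> ?Z" for x using M(2)[OF that] R(2) by linarith
    have mu2: "L * norm (proj_coords \<iota> y) + 1 / 2 \<le> root CARD('m) (1 + \<mu> * (norm (proj_coords \<iota> y))\<^sup>2)" if "y \<in> ?Z" for y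
      by (rule mu(2)[OF norm_ge_zero np[OF that]])
    have lr: "norm (yh - zh) + r \<le> l + r" unfolding l_def by simp
    have ld: "(l + r) + r \<le> \<delta>" using r(3) t(4) by linarith
    show False
      by (rule doubled_maximum_contradiction[OF U_def assms(8) X_form DX assms(2,11,14,12,13,15) H_mono HL Hb Hc R1 R(1) vR d(1) mu(1) mu2 L(1) eps(1) eps2
            uU uV B ZR vb va vl vla k0 yh zh max r(1) lr e_def e t(1) t(3) t(4) ld t6 yad zad vu])
  qed
  then show ?thesis using y0 y0m unfolding m0_def by blast
qed

end
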